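(* Let $(E;L)$ be a Courant--Jacobi algebroid, $A\subset E$ a Dirac--Jacobi structure, and fix an almost Dirac--Jacobi structure $B\subset E$ complementary (transverse) to $A$, with associated $LR_\infty[1]$-algebra $(\Omega^\bullet(A;L)[2],\{\mathfrak m_k^B\})$. Then the relation $A'=\mathrm{Gr}(\eta)$ establishes a canonical one-to-one correspondence between: - Dirac--Jacobi structures $A'\subset E$ that are transverse to $B$, i.e. such that $E=A'\oplus B$, and - Maurer--Cartan elements $\eta$ of $(\Omega^\bullet(A;L)[2],\{\mathfrak m_k^B\})$, i.e. those $\eta\in\Omega^2(A;L)$ satisfying $$\mathrm d_{A,L}\eta+\tfrac12\mathfrak m_2^B(\eta,\eta)+\tfrac16\mathfrak m_3^B(\eta,\eta,\eta)=0 .$$ Here $\mathrm{Gr}(\eta):=\{\xi+\iota_\xi\eta\mid\xi\in A\}\subset A\oplus A^\dagger\simeq A\oplus B=E$, where $\iota_\xi\eta=\eta(\xi,-)\in A^\dagger$.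
   Context: **Courant--Jacobi algebroids.** For a line bundle $L\to M$, $DL\to M$ is the gauge (Atiyah) algebroid: its sections are the derivations of $L$, i.e. $\mathbb R$-linear maps $\Delta:\Gamma(L)\to\Gamma(L)$ with $\Delta(f\lambda)=\sigma(\Delta)(f)\lambda+f\Delta\lambda$ for a (unique) vector field $\sigma(\Delta)$. A *Courant--Jacobi algebroid* $(E;L)$ over $M$ is a vector bundle $E\to M$ and a line bundle $L\to M$ with: a non-degenerate symmetric $C^\infty(M)$-bilinear product $\langle\!\langle-,-\rangle\!\rangle:E\otimes E\to L$; an $\mathbb R$-bilinear bracket $[\![-,-]\!]$ on $\Gamma(E)$ with $[\![e_1,[\![e_2,e_3]\!]]\!]=[\![[\![e_1,e_2]\!],e_3]\!]+[\![e_2,[\![e_1,e_3]\!]]\!]$; a vector bundle morphism $\nabla:E\to DL$ over $\mathrm{id}_M$; such that $\langle\!\langle[\![e_1,e_2]\!],e_2\rangle\!\rangle=\langle\!\langle e_1,[\![e_2,e_2]\!]\rangle\!\rangle$ and $\nabla_{e_1}\langle\!\langle e_2,e_2\rangle\!\rangle=2\langle\!\langle[\![e_1,e_2]\!],e_2\rangle\!\rangle$. A subbundle $A\subset E$ is an *almost Dirac--Jacobi structure* if it is Lagrangian ($A=A^\perp$), and a *Dirac--Jacobi structure* if moreover $[\![\Gamma(A),\Gamma(A)]\!]\subset\Gamma(A)$. **Identification.** Put $A^\dagger:=A^\ast\otimes L$. With $E=A\oplus B$, both Lagrangian, $B\to A^\dagger$, $v\mapsto\langle\!\langle v,-\rangle\!\rangle|_A$,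 is an isomorphism; the induced isomorphism $E=A\oplus B\to A\oplus A^\dagger$ transfers the Courant--Jacobi structure of $(E;L)$ to $(A\oplus A^\dagger;L)$, with product $\langle\!\langle\xi+\alpha,\zeta+\beta\rangle\!\rangle=\alpha(\zeta)+\beta(\xi)$. **Almost Jacobi algebroids.** An almost Jacobi algebroid $(A;L)$ is a vector bundle $A$ with a skew-symmetric $\mathbb R$-bilinear bracket on $\Gamma(A)$ and a vector bundle morphism $\nabla:A\to DL$ with $[u,fv]=(\sigma(\nabla_u)f)v+f[u,v]$. Put $\Omega^\bullet(A)=\Gamma(\wedge^\bullet A^\ast)$, $\Omega^\bullet(A;L)=\Gamma(\wedge^\bullet A^\ast\otimes L)$. Its operator $\mathrm d_{A,L}$ is $$(\mathrm d_{A,L}\alpha)(X_0,\dots,X_k)=\sum_i(-1)^i\nabla_{X_i}(\alpha(\dots,\widehat{X_i},\dots))+\sum_{i<j}(-1)^{i+j}\alpha([X_i,X_j],\dots,\widehat{X_i},\dots,\widehat{X_j},\dots).$$ Its almost Gerstenhaber--Jacobi bracket $[-,-]_{A,L}$ is the unique degree $0$ graded skew-symmetric bracket on $\Omega^\bullet(A^\dagger;L)[1]$ which is a graded derivation of the $\Omega^\bullet(A^\dagger)$-module $\Omega^\bullet(A^\dagger;L)[1]$ in each entry and satisfies $[u,v]_{A,L}=[u,v]$, $[u,\lambda]_{A,L}=\nabla_u\lambda$ for $u,v\in\Gamma(A)=\Omega^1(A^\dagger;L)$, $\lambda\in\Gamma(L)$. (A graded derivation $X$ of a graded module is a graded linear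 map for which there is a graded derivation $\underline X$ of the algebra with $X(\omega\alpha)=\underline X(\omega)\alpha+(-1)^{|X||\omega|}\omega X(\alpha)$.) Here $(A;L)$ has $[\xi,\zeta]_A=[\![\xi,\zeta]\!]$, $\nabla^A=\nabla|_A$, and $(A^\dagger;L)$ has $[\alpha,\beta]_{A^\dagger}=\mathrm{pr}_{A^\dagger}[\![\alpha,\beta]\!]$, $\nabla^{A^\dagger}=\nabla|_{A^\dagger}$, computed in the transferred structure. Since $(A^\dagger)^\dagger=A$, the bracket $[-,-]_{A^\dagger,L}$ of $(A^\dagger;L)$ lives on $\Omega^\bullet(A;L)[1]$. $\Upsilon_{A^\dagger}\in\Omega^3(A^\dagger;L)=\Gamma(\wedge^3(A\otimes L^\ast)\otimes L)$ is $\Upsilon_{A^\dagger}(\alpha_1,\alpha_2,\alpha_3)=\langle\!\langle[\![\alpha_1,\alpha_2]\!],\alpha_3\rangle\!\rangle$ (determinant convention for wedges). **The $LR_\infty[1]$-algebra.** For $\alpha\in\Omega^{k+1}(A;L)$, $\alpha^\sharp:A\otimes L^\ast\to\wedge^kA^\ast$ is $\alpha^\sharp(u_0\otimes\nu)(u_1,\dots,u_k)=\nu(\alpha(u_0,\dots,u_k))$ ($\alpha^\sharp=0$ if $k=-1$), and $(\alpha_1^\sharp\wedge\dots\wedge\alpha_n^\sharp)(\tilde u_1\wedge\dots\wedge\tilde u_n)=\sum_{\sigma\in S_n}(-1)^\sigma\alpha_1^\sharp(\tilde u_{\sigma(1)})\wedge\dots\wedge\alpha_n^\sharp(\tilde u_{\sigma(n)})$.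 The $L_\infty[1]$-algebra structure $\{\mathfrak m_k^B\}$ on $\Omega^\bullet(A;L)[2]$ (degree $1$ graded symmetric brackets) has only non-trivial brackets $\mathfrak m_1^B=\mathrm d_{A,L}$, $\mathfrak m_2^B(\alpha,\beta)=(-1)^{|\alpha|}[\alpha,\beta]_{A^\dagger,L}$, $\mathfrak m_3^B(\alpha,\beta,\gamma)=-(-1)^{|\beta|}(\alpha^\sharp\wedge\beta^\sharp\wedge\gamma^\sharp\otimes\mathrm{id}_L)\Upsilon_{A^\dagger}$, where $|\cdot|$ is form degree. *)

theory Defs
  imports "HOL-Analysis.Analysis" "HOL-Library.Function_Algebras"
begin

section \<open>Linear algebra on subspaces of a real vector space\<close>

text \<open>Sections and differential forms are functions, added and scaled pointwise.\<close>

instantiation "fun" :: (type, real_vector) real_vector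
begin

definition "scaleR_fun a f = (\<lambda>i. a *\<^sub>R f i)"

instance
  by standard (auto simp: fun_eq_iff scaleR_fun_def scaleR_add_left scaleR_add_right)

end

lemma scaleR_fun_apply [simp]: "(a *\<^sub>R f) x = a *\<^sub>R f x"
  by (simp add: scaleR_fun_def)

definition lin_on :: "'a::real_vector set \<Rightarrow> ('a \<Rightarrow> 'b::real_vector) \<Rightarrow> bool" where
  "lin_on S f \<longleftrightarrow> (\<forall>a b. \<forall>u\<in>S. \<forall>v\<in>S. f (a *\<^sub>R u + b *\<^sub>R v) = a *\<^sub>R f u + b *\<^sub>R f v)"

definition basis_of :: "nat \<Rightarrow> 'a::real_vector set \<Rightarrow> (nat \<Rightarrow> 'a) \<Rightarrow> bool" where
  "basis_of r S b \<longleftrightarrow> inj_on b {..<r} \<and> independent (b ` {..<r}) \<and> span (b ` {..<r}) = S"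

definition direct_sum :: "'a::real_vector set \<Rightarrow> 'a set \<Rightarrow> 'a set \<Rightarrow> bool" where
  "direct_sum F S T \<longleftrightarrow> F = {a + b | a b. a \<in> S \<and> b \<in> T} \<and> S \<inter> T = {0}"

text \<open>Alternating \<open>k\<close>-linear maps \<open>S \<times> \<dots> \<times> S \<rightarrow> T\<close>, that is, elements of
  \<open>\<Lambda>\<^sup>k S\<^sup>* \<otimes> T\<close>, are functions on lists that vanish on every list other
  than the lists of length \<open>k\<close> in \<open>S\<close>; hence equality of such functions is equality of
  alternating maps. The degree is an integer, and there are only zero elements in negative degree.\<close>

definition alt_maps :: "int \<Rightarrow> 'a::real_vector set \<Rightarrow> 'b::real_vector set \<Rightarrow> ('a list \<Rightarrow> 'b) set" where
  "alt_maps k S T = {w.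
     (\<forall>vs. set vs \<subseteq> S \<and> int (length vs) = k \<longrightarrow> w vs \<in> T) \<and>
     (\<forall>vs. \<not> (set vs \<subseteq> S \<and> int (length vs) = k) \<longrightarrow> w vs = 0) \<and>
     (\<forall>us vs. set us \<union> set vs \<subseteq> S \<longrightarrow> lin_on S (\<lambda>u. w (us @ u # vs))) \<and>
     (\<forall>vs. \<not> distinct vs \<longrightarrow> w vs = 0)}"

text \<open>The wedge product in the determinant convention, as a sum over shuffles. The set \<open>I\<close> holds the
  positions of the arguments passed to \<open>w\<close>; only sets \<open>I\<close> whose size is the degree
  of \<open>w\<close> contribute.\<close>

definition shuffle_sign :: "nat \<Rightarrow> nat set \<Rightarrow> real" where
  "shuffle_sign n I = (-1) ^ card {(i, j). i \<in> I \<and> j \<notin> I \<and> j < i \<and> i < n}"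

definition wedge :: "('a list \<Rightarrow> real) \<Rightarrow> ('a list \<Rightarrow> 'b::real_vector) \<Rightarrow> 'a list \<Rightarrow> 'b" where
  "wedge w z vs = (\<Sum>I \<in> Pow {..<length vs}.
     (shuffle_sign (length vs) I * w (nths vs I)) *\<^sub>R z (nths vs (- I)))"

definition sgn_int :: "int \<Rightarrow> real" where
  "sgn_int n = (if even n then 1 else -1)"


section \<open>Smooth manifolds\<close>

primrec C_diff_on :: "nat \<Rightarrow> 'a::real_normed_vector set \<Rightarrow> ('a \<Rightarrow> 'b::real_normed_vector) \<Rightarrow> bool" where
  "C_diff_on 0 U f \<longleftrightarrow> continuous_on U f"
| "C_diff_on (Suc n) U f \<longleftrightarrow> (\<forall>x\<in>U. f differentiable (at x)) \<and>
     (\<forall>v. C_diff_on n U (\<lambda>x. frechet_derivative f (at x) v))"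

text \<open>Smoothness on a set that need not be open: local extendability to a smooth map
  on an open set.\<close>

definition smooth_map_on :: "'a::euclidean_space set \<Rightarrow> ('a \<Rightarrow> 'b::real_normed_vector) \<Rightarrow> bool" where
  "smooth_map_on S f \<longleftrightarrow>
     (\<forall>x\<in>S. \<exists>U g. open U \<and> x \<in> U \<and> (\<forall>n. C_diff_on n U g) \<and> (\<forall>y\<in>S \<inter> U. f y = g y))"

text \<open>A manifold has all points of the type \<open>'m\<close>, whose topology is Hausdorff and second countable.
  It is modelled on a linear subspace of a Euclidean space, and not
  on the full space, because Euclidean spaces have positive dimension in the library whereas
  manifolds of dimension zero have to be covered.\<close>

record ('m, 'e) manifold =
  model :: "'e set"
  atlas :: "('m set \<times> ('m \<Rightarrow> 'e)) set"

definition smooth_manifold ::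
    "('m::{t2_space,second_countable_topology}, 'e::euclidean_space) manifold \<Rightarrow> bool" where
  "smooth_manifold M \<longleftrightarrow> subspace (model M) \<and> (\<Union>(U, \<phi>)\<in>atlas M. U) = UNIV \<and>
     (\<forall>(U, \<phi>)\<in>atlas M. open U \<and> openin (top_of_set (model M)) (\<phi> ` U) \<and>
        homeomorphism U (\<phi> ` U) \<phi> (inv_into U \<phi>)) \<and>
     (\<forall>(U, \<phi>)\<in>atlas M. \<forall>(W, \<psi>)\<in>atlas M. smooth_map_on (\<phi> ` (U \<inter> W)) (\<psi> \<circ> inv_into U \<phi>))"

definition smooth_fun_on :: "('m, 'e::euclidean_space) manifold \<Rightarrow> 'm set \<Rightarrow> ('m \<Rightarrow> real) \<Rightarrow> bool" where
  "smooth_fun_on M W f \<longleftrightarrow>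
     (\<forall>(U, \<phi>)\<in>atlas M. smooth_map_on (\<phi> ` (U \<inter> W)) (f \<circ> inv_into U \<phi>))"

definition smooth_funs :: "('m, 'e::euclidean_space) manifold \<Rightarrow> ('m \<Rightarrow> real) set" where
  "smooth_funs M = {f. smooth_fun_on M UNIV f}"

definition vector_fields :: "('m, 'e::euclidean_space) manifold \<Rightarrow> (('m \<Rightarrow> real) \<Rightarrow> 'm \<Rightarrow> real) set" where
  "vector_fields M = {X. (\<forall>f\<in>smooth_funs M. X f \<in> smooth_funs M) \<and> lin_on (smooth_funs M) X \<and>
     (\<forall>f\<in>smooth_funs M. \<forall>g\<in>smooth_funs M. X (f * g) = X f * g + f * X g)}"


section \<open>Vector bundles\<close>

text \<open>A vector bundle is a family of vector spaces, realised as linear subspaces of one real vector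
  space type \<open>'v\<close>, with an atlas of local frames. The ambient type carries
  no topology, and subspaces over different points are unrelated, so that every abstract
  bundle is of this form: the smooth structure consists in the frames (equivalently, in the
  local trivialisations they define).\<close>

record ('m, 'v) vbundle =
  fibre :: "'m \<Rightarrow> 'v set"
  bundle_rank :: nat
  frames :: "('m set \<times> (nat \<Rightarrow> 'm \<Rightarrow> 'v)) set"

definition smooth_section_on ::
    "('m, 'e::euclidean_space) manifold \<Rightarrow> ('m, 'v::real_vector) vbundle \<Rightarrow> 'm set \<Rightarrow> ('m \<Rightarrow> 'v) \<Rightarrow> bool" where
  "smooth_section_on M E W s \<longleftrightarrow> (\<forall>x\<in>W. s x \<in> fibre E x) \<and>
     (\<forall>(U, t)\<in>frames E. \<exists>c :: nat \<Rightarrow> 'm \<Rightarrow> real.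
        (\<forall>j<bundle_rank E. smooth_fun_on M (U \<inter> W) (c j)) \<and>
        (\<forall>x\<in>U \<inter> W. s x = (\<Sum>j<bundle_rank E. c j x *\<^sub>R t j x)))"

text \<open>The last condition is the smoothness of the transition functions.\<close>

definition vector_bundle ::
    "('m::topological_space, 'e::euclidean_space) manifold \<Rightarrow> ('m, 'v::real_vector) vbundle \<Rightarrow> bool" where
  "vector_bundle M E \<longleftrightarrow> (\<Union>(U, t)\<in>frames E. U) = UNIV \<and>
     (\<forall>(U, t)\<in>frames E. open U \<and>
        (\<forall>x\<in>U. basis_of (bundle_rank E) (fibre E x) (\<lambda>j. t j x)) \<and>
        (\<forall>j<bundle_rank E. smooth_section_on M E U (t j)))"

definition sections ::
    "('m, 'e::euclidean_space) manifold \<Rightarrow> ('m, 'v::real_vector) vbundle \<Rightarrow> ('m \<Rightarrow> 'v) set" where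
  "sections M E = {s. smooth_section_on M E UNIV s}"

definition trivial_line :: "('m, real) vbundle" where
  "trivial_line = \<lparr>fibre = (\<lambda>x. UNIV), bundle_rank = 1, frames = {(UNIV, \<lambda>j x. 1)}\<rparr>"

definition fmult :: "('m \<Rightarrow> real) \<Rightarrow> ('m \<Rightarrow> 'v::real_vector) \<Rightarrow> 'm \<Rightarrow> 'v"  (infixr "\<odot>" 75) where
  "f \<odot> s = (\<lambda>x. f x *\<^sub>R s x)"

definition subbundle ::
    "('m::topological_space, 'e::euclidean_space) manifold \<Rightarrow> ('m, 'v::real_vector) vbundle \<Rightarrow>
       ('m \<Rightarrow> 'v set) \<Rightarrow> bool" where
  "subbundle M E A \<longleftrightarrow> (\<forall>x. A x \<subseteq> fibre E x) \<and>
     (\<exists>r. \<forall>x. \<exists>U t. open U \<and> x \<in> U \<and>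
        (\<forall>j<r. smooth_section_on M E U (t j)) \<and> (\<forall>y\<in>U. basis_of r (A y) (\<lambda>j. t j y)))"

definition sub_sections ::
    "('m, 'e::euclidean_space) manifold \<Rightarrow> ('m, 'v::real_vector) vbundle \<Rightarrow> ('m \<Rightarrow> 'v set) \<Rightarrow>
       ('m \<Rightarrow> 'v) set" where
  "sub_sections M E A = {s \<in> sections M E. \<forall>x. s x \<in> A x}"

text \<open>The sections \<open>\<Gamma>(DL)\<close> of the gauge algebroid of \<open>L\<close>.\<close>

definition derivations ::
    "('m, 'e::euclidean_space) manifold \<Rightarrow> ('m, 'l::real_vector) vbundle \<Rightarrow>
       (('m \<Rightarrow> 'l) \<Rightarrow> 'm \<Rightarrow> 'l) set" where
  "derivations M L = {\<Delta>. (\<forall>l\<in>sections M L. \<Delta> l \<in> sections M L) \<and> lin_on (sections M L) \<Delta> \<and>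
     (\<exists>X\<in>vector_fields M. \<forall>f\<in>smooth_funs M. \<forall>l\<in>sections M L. \<Delta> (f \<odot> l) = X f \<odot> l + f \<odot> \<Delta> l)}"


section \<open>Courant--Jacobi algebroids\<close>

text \<open>The anchor \<open>\<nabla>\<close> takes a point \<open>x\<close> and a vector \<open>e\<close> of the fibre over \<open>x\<close>, and gives the element
  \<open>\<nabla>\<^sub>e\<close> of the fibre \<open>D\<^sub>x L\<close> as the map \<open>l \<mapsto> \<nabla>\<^sub>e l\<close> from
  \<open>\<Gamma>(L)\<close> to the fibre of \<open>L\<close> over \<open>x\<close>.\<close>

record ('m, 'v, 'l) courant_jacobi =
  bundle_of :: "('m, 'v) vbundle"
  line_of :: "('m, 'l) vbundle"
  pairing :: "'m \<Rightarrow> 'v \<Rightarrow> 'v \<Rightarrow> 'l"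
  bracket :: "('m \<Rightarrow> 'v) \<Rightarrow> ('m \<Rightarrow> 'v) \<Rightarrow> 'm \<Rightarrow> 'v"
  anchor :: "'m \<Rightarrow> 'v \<Rightarrow> ('m \<Rightarrow> 'l) \<Rightarrow> 'l"

definition pair_sec ::
    "('m, 'v, 'l) courant_jacobi \<Rightarrow> ('m \<Rightarrow> 'v) \<Rightarrow> ('m \<Rightarrow> 'v) \<Rightarrow> 'm \<Rightarrow> 'l" where
  "pair_sec C e e' = (\<lambda>x. pairing C x (e x) (e' x))"

definition anchor_sec ::
    "('m, 'v, 'l) courant_jacobi \<Rightarrow> ('m \<Rightarrow> 'v) \<Rightarrow> ('m \<Rightarrow> 'l) \<Rightarrow> 'm \<Rightarrow> 'l" where
  "anchor_sec C e l = (\<lambda>x. anchor C x (e x) l)"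

definition courant_jacobi_algebroid ::
    "('m::topological_space, 'e::euclidean_space) manifold \<Rightarrow>
     ('m, 'v::real_vector, 'l::real_vector) courant_jacobi \<Rightarrow> bool" where
  "courant_jacobi_algebroid M C \<longleftrightarrow>
     (let E = bundle_of C; L = line_of C; \<Gamma> = sections M E in
       vector_bundle M E \<and> vector_bundle M L \<and> bundle_rank L = 1 \<and>
       \<comment> \<open>non-degenerate symmetric product \<open>E \<otimes> E \<rightarrow> L\<close>\<close>
       (\<forall>x. \<forall>e\<in>fibre E x. lin_on (fibre E x) (pairing C x e)) \<and>
       (\<forall>x. \<forall>e\<in>fibre E x. \<forall>e'\<in>fibre E x. pairing C x e e' = pairing C x e' e) \<and>
       (\<forall>x. \<forall>e\<in>fibre E x. (\<forall>e'\<in>fibre E x. pairing C x e e' = 0) \<longrightarrow> e = 0) \<and>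
       (\<forall>e\<in>\<Gamma>. \<forall>e'\<in>\<Gamma>. pair_sec C e e' \<in> sections M L) \<and>
       \<comment> \<open>bracket\<close>
       (\<forall>e\<in>\<Gamma>. \<forall>e'\<in>\<Gamma>. bracket C e e' \<in> \<Gamma>) \<and>
       (\<forall>e\<in>\<Gamma>. lin_on \<Gamma> (bracket C e) \<and> lin_on \<Gamma> (\<lambda>e'. bracket C e' e)) \<and>
       (\<forall>e1\<in>\<Gamma>. \<forall>e2\<in>\<Gamma>. \<forall>e3\<in>\<Gamma>. bracket C e1 (bracket C e2 e3) =
          bracket C (bracket C e1 e2) e3 + bracket C e2 (bracket C e1 e3)) \<and>
       \<comment> \<open>vector bundle morphism \<open>E \<rightarrow> DL\<close>\<close>
       (\<forall>x. lin_on (fibre E x) (\<lambda>e l. if l \<in> sections M L then anchor C x e l else 0)) \<and>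
       (\<forall>e\<in>\<Gamma>. anchor_sec C e \<in> derivations M L) \<and>
       \<comment> \<open>compatibility\<close>
       (\<forall>e1\<in>\<Gamma>. \<forall>e2\<in>\<Gamma>. pair_sec C (bracket C e1 e2) e2 = pair_sec C e1 (bracket C e2 e2)) \<and>
       (\<forall>e1\<in>\<Gamma>. \<forall>e2\<in>\<Gamma>. anchor_sec C e1 (pair_sec C e2 e2) = 2 *\<^sub>R pair_sec C (bracket C e1 e2) e2))"

definition orth ::
    "('m, 'v, 'l::zero) courant_jacobi \<Rightarrow> ('m \<Rightarrow> 'v set) \<Rightarrow> 'm \<Rightarrow> 'v set" where
  "orth C A x = {e \<in> fibre (bundle_of C) x. \<forall>a\<in>A x. pairing C x e a = 0}"

definition almost_dirac_jacobi ::
    "('m::topological_space, 'e::euclidean_space) manifold \<Rightarrow>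
     ('m, 'v::real_vector, 'l::real_vector) courant_jacobi \<Rightarrow> ('m \<Rightarrow> 'v set) \<Rightarrow> bool" where
  "almost_dirac_jacobi M C A \<longleftrightarrow> subbundle M (bundle_of C) A \<and> A = orth C A"

definition dirac_jacobi ::
    "('m::topological_space, 'e::euclidean_space) manifold \<Rightarrow>
     ('m, 'v::real_vector, 'l::real_vector) courant_jacobi \<Rightarrow> ('m \<Rightarrow> 'v set) \<Rightarrow> bool" where
  "dirac_jacobi M C A \<longleftrightarrow> almost_dirac_jacobi M C A \<and>
     (\<forall>a\<in>sub_sections M (bundle_of C) A. \<forall>a'\<in>sub_sections M (bundle_of C) A.
        bracket C a a' \<in> sub_sections M (bundle_of C) A)"

definition transverse ::
    "('m, 'v::real_vector, 'l) courant_jacobi \<Rightarrow> ('m \<Rightarrow> 'v set) \<Rightarrow> ('m \<Rightarrow> 'v set) \<Rightarrow> bool" where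
  "transverse C A B \<longleftrightarrow> (\<forall>x. direct_sum (fibre (bundle_of C) x) (A x) (B x))"


section \<open>Forms on a subbundle\<close>

text \<open>\<open>\<Omega>\<^sup>k(A; L)\<close>; the algebra \<open>\<Omega>\<^sup>\<bullet>(A)\<close> is the case of the trivial line bundle. A form
  takes a point and a list of vectors over that point.\<close>

definition forms ::
    "('m, 'e::euclidean_space) manifold \<Rightarrow> ('m, 'v::real_vector) vbundle \<Rightarrow> ('m \<Rightarrow> 'v set) \<Rightarrow>
     ('m, 'l::real_vector) vbundle \<Rightarrow> int \<Rightarrow> ('m \<Rightarrow> 'v list \<Rightarrow> 'l) set" where
  "forms M E A L k = {\<omega>. (\<forall>x. \<omega> x \<in> alt_maps k (A x) (fibre L x)) \<and>
     (\<forall>Xs. set Xs \<subseteq> sub_sections M E A \<and> int (length Xs) = k \<longrightarrow>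
        (\<lambda>x. \<omega> x (map (\<lambda>X. X x) Xs)) \<in> sections M L)}"

definition form_wedge ::
    "('m \<Rightarrow> 'v list \<Rightarrow> real) \<Rightarrow> ('m \<Rightarrow> 'v list \<Rightarrow> 'l::real_vector) \<Rightarrow> 'm \<Rightarrow> 'v list \<Rightarrow> 'l" where
  "form_wedge \<omega> \<alpha> = (\<lambda>x. wedge (\<omega> x) (\<alpha> x))"

definition zero_form :: "('m \<Rightarrow> 'l::real_vector) \<Rightarrow> 'm \<Rightarrow> 'v list \<Rightarrow> 'l" where
  "zero_form l = (\<lambda>x vs. if vs = [] then l x else 0)"

definition alg_derivation ::
    "('m, 'e::euclidean_space) manifold \<Rightarrow> ('m, 'v::real_vector) vbundle \<Rightarrow> ('m \<Rightarrow> 'v set) \<Rightarrow> int \<Rightarrow>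
     (('m \<Rightarrow> 'v list \<Rightarrow> real) \<Rightarrow> 'm \<Rightarrow> 'v list \<Rightarrow> real) \<Rightarrow> bool" where
  "alg_derivation M E A d D \<longleftrightarrow> (let \<Omega> = forms M E A trivial_line in
     (\<forall>k. \<forall>\<omega>\<in>\<Omega> k. D \<omega> \<in> \<Omega> (k + d)) \<and> (\<forall>k. lin_on (\<Omega> k) D) \<and>
     (\<forall>k l. \<forall>\<omega>\<in>\<Omega> k. \<forall>\<tau>\<in>\<Omega> l.
        D (form_wedge \<omega> \<tau>) = form_wedge (D \<omega>) \<tau> + sgn_int (d * k) *\<^sub>R form_wedge \<omega> (D \<tau>)))"

definition module_derivation ::
    "('m, 'e::euclidean_space) manifold \<Rightarrow> ('m, 'v::real_vector) vbundle \<Rightarrow> ('m \<Rightarrow> 'v set) \<Rightarrow>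
     ('m, 'l::real_vector) vbundle \<Rightarrow> int \<Rightarrow>
     (('m \<Rightarrow> 'v list \<Rightarrow> 'l) \<Rightarrow> 'm \<Rightarrow> 'v list \<Rightarrow> 'l) \<Rightarrow> bool" where
  "module_derivation M E A L d X \<longleftrightarrow>
     (\<forall>k. \<forall>\<alpha>\<in>forms M E A L k. X \<alpha> \<in> forms M E A L (k + d)) \<and> (\<forall>k. lin_on (forms M E A L k) X) \<and>
     (\<exists>D. alg_derivation M E A d D \<and>
        (\<forall>k l. \<forall>\<omega>\<in>forms M E A trivial_line k. \<forall>\<alpha>\<in>forms M E A L l.
           X (form_wedge \<omega> \<alpha>) = form_wedge (D \<omega>) \<alpha> + sgn_int (d * k) *\<^sub>R form_wedge \<omega> (X \<alpha>)))"

text \<open>The almost Gerstenhaber--Jacobi bracket on \<open>\<Omega>\<^sup>\<bullet>(A; L)[1]\<close> that belongs to an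
  almost Jacobi algebroid structure \<open>(lie, nabla)\<close> on \<open>A\<^sup>\<dagger> = A\<^sup>* \<otimes> L\<close>,
  whose sections are the elements of \<open>\<Omega>\<^sup>1(A; L)\<close>. A form of degree \<open>p\<close> has shifted degree \<open>p - 1\<close>.
  The derivation property in the first entry follows from the one in the second
  entry by skew-symmetry.\<close>

definition gerstenhaber_jacobi ::
    "('m, 'e::euclidean_space) manifold \<Rightarrow> ('m, 'v::real_vector) vbundle \<Rightarrow> ('m \<Rightarrow> 'v set) \<Rightarrow>
     ('m, 'l::real_vector) vbundle \<Rightarrow>
     (('m \<Rightarrow> 'v list \<Rightarrow> 'l) \<Rightarrow> ('m \<Rightarrow> 'v list \<Rightarrow> 'l) \<Rightarrow> 'm \<Rightarrow> 'v list \<Rightarrow> 'l) \<Rightarrow>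
     (('m \<Rightarrow> 'v list \<Rightarrow> 'l) \<Rightarrow> ('m \<Rightarrow> 'l) \<Rightarrow> 'm \<Rightarrow> 'l) \<Rightarrow>
     (('m \<Rightarrow> 'v list \<Rightarrow> 'l) \<Rightarrow> ('m \<Rightarrow> 'v list \<Rightarrow> 'l) \<Rightarrow> 'm \<Rightarrow> 'v list \<Rightarrow> 'l) \<Rightarrow> bool" where
  "gerstenhaber_jacobi M E A L lie nabla gj \<longleftrightarrow> (let \<Omega> = forms M E A L in
     (\<forall>p. \<forall>\<alpha>\<in>\<Omega> p. module_derivation M E A L (p - 1) (gj \<alpha>)) \<and>
     (\<forall>p q. \<forall>\<alpha>\<in>\<Omega> p. \<forall>\<beta>\<in>\<Omega> q. gj \<alpha> \<beta> = - (sgn_int ((p - 1) * (q - 1)) *\<^sub>R gj \<beta> \<alpha>)) \<and>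
     (\<forall>\<alpha>\<in>\<Omega> 1. \<forall>\<beta>\<in>\<Omega> 1. gj \<alpha> \<beta> = lie \<alpha> \<beta>) \<and>
     (\<forall>\<alpha>\<in>\<Omega> 1. \<forall>l\<in>sections M L. gj \<alpha> (zero_form l) = zero_form (nabla \<alpha> l)))"


section \<open>The structures induced by a transverse pair\<close>

text \<open>The isomorphism \<open>B \<rightarrow> A\<^sup>\<dagger>\<close> over a point, and its inverse.\<close>

definition flat ::
    "('m, 'v, 'l::zero) courant_jacobi \<Rightarrow> ('m \<Rightarrow> 'v set) \<Rightarrow> 'm \<Rightarrow> 'v \<Rightarrow> 'v list \<Rightarrow> 'l" where
  "flat C A x b vs = (if length vs = 1 \<and> set vs \<subseteq> A x then pairing C x b (hd vs) else 0)"

definition lift ::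
    "('m, 'v, 'l::zero) courant_jacobi \<Rightarrow> ('m \<Rightarrow> 'v set) \<Rightarrow> ('m \<Rightarrow> 'v set) \<Rightarrow> 'm \<Rightarrow> ('v list \<Rightarrow> 'l) \<Rightarrow> 'v" where
  "lift C A B x = inv_into (B x) (flat C A x)"

definition lift_sec ::
    "('m, 'v, 'l::zero) courant_jacobi \<Rightarrow> ('m \<Rightarrow> 'v set) \<Rightarrow> ('m \<Rightarrow> 'v set) \<Rightarrow>
     ('m \<Rightarrow> 'v list \<Rightarrow> 'l) \<Rightarrow> 'm \<Rightarrow> 'v" where
  "lift_sec C A B \<alpha> = (\<lambda>x. lift C A B x (\<alpha> x))"

text \<open>Projection onto \<open>B\<close> along \<open>A\<close>.\<close>

definition proj_along ::
    "('m \<Rightarrow> 'v::real_vector set) \<Rightarrow> ('m \<Rightarrow> 'v set) \<Rightarrow> 'm \<Rightarrow> 'v \<Rightarrow> 'v" where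
  "proj_along A B x e = (THE b. b \<in> B x \<and> (\<exists>a\<in>A x. e = a + b))"

definition dual_bracket ::
    "('m, 'v::real_vector, 'l::real_vector) courant_jacobi \<Rightarrow> ('m \<Rightarrow> 'v set) \<Rightarrow> ('m \<Rightarrow> 'v set) \<Rightarrow>
     ('m \<Rightarrow> 'v list \<Rightarrow> 'l) \<Rightarrow> ('m \<Rightarrow> 'v list \<Rightarrow> 'l) \<Rightarrow> 'm \<Rightarrow> 'v list \<Rightarrow> 'l" where
  "dual_bracket C A B \<alpha> \<beta> =
     (\<lambda>x. flat C A x (proj_along A B x (bracket C (lift_sec C A B \<alpha>) (lift_sec C A B \<beta>) x)))"

definition dual_anchor ::
    "('m, 'v::real_vector, 'l::real_vector) courant_jacobi \<Rightarrow> ('m \<Rightarrow> 'v set) \<Rightarrow> ('m \<Rightarrow> 'v set) \<Rightarrow>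
     ('m \<Rightarrow> 'v list \<Rightarrow> 'l) \<Rightarrow> ('m \<Rightarrow> 'l) \<Rightarrow> 'm \<Rightarrow> 'l" where
  "dual_anchor C A B \<alpha> = anchor_sec C (lift_sec C A B \<alpha>)"

text \<open>\<open>\<Upsilon>\<close> on sections of \<open>A\<^sup>\<dagger>\<close>.\<close>

definition upsilon ::
    "('m, 'v::real_vector, 'l::real_vector) courant_jacobi \<Rightarrow> ('m \<Rightarrow> 'v set) \<Rightarrow> ('m \<Rightarrow> 'v set) \<Rightarrow>
     (nat \<Rightarrow> 'm \<Rightarrow> 'v list \<Rightarrow> 'l) \<Rightarrow> 'm \<Rightarrow> 'l" where
  "upsilon C A B \<alpha> =
     pair_sec C (bracket C (lift_sec C A B (\<alpha> 0)) (lift_sec C A B (\<alpha> 1))) (lift_sec C A B (\<alpha> 2))"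

definition is_gj_bracket ::
    "('m, 'e::euclidean_space) manifold \<Rightarrow>
     ('m, 'v::real_vector, 'l::real_vector) courant_jacobi \<Rightarrow> ('m \<Rightarrow> 'v set) \<Rightarrow> ('m \<Rightarrow> 'v set) \<Rightarrow>
     (('m \<Rightarrow> 'v list \<Rightarrow> 'l) \<Rightarrow> ('m \<Rightarrow> 'v list \<Rightarrow> 'l) \<Rightarrow> 'm \<Rightarrow> 'v list \<Rightarrow> 'l) \<Rightarrow> bool" where
  "is_gj_bracket M C A B gj \<longleftrightarrow>
     gerstenhaber_jacobi M (bundle_of C) A (line_of C) (dual_bracket C A B) (dual_anchor C A B) gj"

abbreviation Omega ::
    "('m, 'e::euclidean_space) manifold \<Rightarrow>
     ('m, 'v::real_vector, 'l::real_vector) courant_jacobi \<Rightarrow> ('m \<Rightarrow> 'v set) \<Rightarrow> int \<Rightarrow>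
     ('m \<Rightarrow> 'v list \<Rightarrow> 'l) set" where
  "Omega M C A \<equiv> forms M (bundle_of C) A (line_of C)"


section \<open>The brackets on \<open>\<Omega>\<^sup>\<bullet>(A; L)[2]\<close>\<close>

text \<open>The value of \<open>d\<^bsub>A,L\<^esub> \<omega>\<close> on sections; \<open>nths Xs (- I)\<close> omits the entries with
  index in \<open>I\<close>.\<close>

definition koszul ::
    "('m, 'v::real_vector, 'l::real_vector) courant_jacobi \<Rightarrow> ('m \<Rightarrow> 'v list \<Rightarrow> 'l) \<Rightarrow>
     ('m \<Rightarrow> 'v) list \<Rightarrow> 'm \<Rightarrow> 'l" where
  "koszul C \<omega> Xs x =
     (\<Sum>i<length Xs. (-1) ^ i *\<^sub>R
        anchor_sec C (Xs ! i) (\<lambda>y. \<omega> y (map (\<lambda>X. X y) (nths Xs (- {i})))) x) +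
     (\<Sum>(i, j) | i < j \<and> j < length Xs. (-1) ^ (i + j) *\<^sub>R
        \<omega> x (bracket C (Xs ! i) (Xs ! j) x # map (\<lambda>X. X x) (nths Xs (- {i, j}))))"

text \<open>For a form \<open>\<omega>\<close>, \<open>koszul\<close> is \<open>C\<^sup>\<infinity>(M)\<close>-multilinear in the sections, so that its value
  at \<open>x\<close> depends only on the values of the sections at \<open>x\<close>: any sections through the given
  vectors may be used.\<close>

definition d_form ::
    "('m, 'e::euclidean_space) manifold \<Rightarrow>
     ('m, 'v::real_vector, 'l::real_vector) courant_jacobi \<Rightarrow> ('m \<Rightarrow> 'v set) \<Rightarrow>
     ('m \<Rightarrow> 'v list \<Rightarrow> 'l) \<Rightarrow> 'm \<Rightarrow> 'v list \<Rightarrow> 'l" where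
  "d_form M C A \<omega> x vs =
     (if set vs \<subseteq> A x
      then koszul C \<omega> (SOME Xs. set Xs \<subseteq> sub_sections M (bundle_of C) A \<and> map (\<lambda>X. X x) Xs = vs) x
      else 0)"

text \<open>Since \<open>L\<close> has rank one, every element of \<open>A \<otimes> L\<^sup>*\<close> over a point is of the form \<open>u \<otimes> \<nu>\<close>; it
  is represented by the pair \<open>(u, \<nu>)\<close>.\<close>

definition sharp :: "('v list \<Rightarrow> 'l) \<Rightarrow> 'v \<times> ('l \<Rightarrow> real) \<Rightarrow> 'v list \<Rightarrow> real" where
  "sharp w = (\<lambda>(u, \<nu>) us. \<nu> (w (u # us)))"

definition sharp_wedge3 ::
    "('v list \<Rightarrow> 'l) \<Rightarrow> ('v list \<Rightarrow> 'l) \<Rightarrow> ('v list \<Rightarrow> 'l) \<Rightarrow> (nat \<Rightarrow> 'v \<times> ('l \<Rightarrow> real)) \<Rightarrow>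
     'v list \<Rightarrow> real" where
  "sharp_wedge3 w1 w2 w3 t = (\<lambda>us. \<Sum>\<sigma> | \<sigma> permutes {..<3}. of_int (sign \<sigma>) *
     wedge (sharp w1 (t (\<sigma> 0))) (wedge (sharp w2 (t (\<sigma> 1))) (sharp w3 (t (\<sigma> 2)))) us)"

text \<open>The value at \<open>x\<close> of an element of \<open>\<Gamma>(\<Lambda>\<^sup>3(A \<otimes> L\<^sup>*) \<otimes> L)\<close>, given
  as a function \<open>\<Upsilon>\<close> on triples of sections of \<open>A\<^sup>\<dagger>\<close>, is the sum over the
  list \<open>ts\<close> of the elements \<open>(t 0 \<and> t 1 \<and> t 2) \<otimes> l\<close>.\<close>

definition decomposes ::
    "('m, 'e::euclidean_space) manifold \<Rightarrow>
     ('m, 'v::real_vector, 'l::real_vector) courant_jacobi \<Rightarrow> ('m \<Rightarrow> 'v set) \<Rightarrow>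
     ((nat \<Rightarrow> 'm \<Rightarrow> 'v list \<Rightarrow> 'l) \<Rightarrow> 'm \<Rightarrow> 'l) \<Rightarrow> 'm \<Rightarrow>
     ((nat \<Rightarrow> 'v \<times> ('l \<Rightarrow> real)) \<times> 'l) list \<Rightarrow> bool" where
  "decomposes M C A \<Upsilon> x ts \<longleftrightarrow>
     (\<forall>(t, l)\<in>set ts. l \<in> fibre (line_of C) x \<and>
        (\<forall>i<3. fst (t i) \<in> A x \<and> lin_on (fibre (line_of C) x) (snd (t i)))) \<and>
     (\<forall>\<alpha>. (\<forall>i<3. \<alpha> i \<in> Omega M C A 1) \<longrightarrow>
        \<Upsilon> \<alpha> x = (\<Sum>(t, l)\<leftarrow>ts.
          (\<Sum>\<sigma> | \<sigma> permutes {..<3}. of_int (sign \<sigma>) *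
             (\<Prod>i<3. snd (t i) (\<alpha> (\<sigma> i) x [fst (t i)]))) *\<^sub>R l))"

text \<open>\<open>(\<alpha>\<^sup>\<sharp> \<and> \<beta>\<^sup>\<sharp> \<and> \<gamma>\<^sup>\<sharp> \<otimes> id) \<Upsilon>\<close>; the
  result does not depend on the chosen decomposition.\<close>

definition sharp_apply ::
    "('m, 'e::euclidean_space) manifold \<Rightarrow>
     ('m, 'v::real_vector, 'l::real_vector) courant_jacobi \<Rightarrow> ('m \<Rightarrow> 'v set) \<Rightarrow>
     ((nat \<Rightarrow> 'm \<Rightarrow> 'v list \<Rightarrow> 'l) \<Rightarrow> 'm \<Rightarrow> 'l) \<Rightarrow>
     ('m \<Rightarrow> 'v list \<Rightarrow> 'l) \<Rightarrow> ('m \<Rightarrow> 'v list \<Rightarrow> 'l) \<Rightarrow> ('m \<Rightarrow> 'v list \<Rightarrow> 'l) \<Rightarrow>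
     'm \<Rightarrow> 'v list \<Rightarrow> 'l" where
  "sharp_apply M C A \<Upsilon> \<alpha> \<beta> \<gamma> x vs =
     (\<Sum>(t, l)\<leftarrow>(SOME ts. decomposes M C A \<Upsilon> x ts).
        sharp_wedge3 (\<alpha> x) (\<beta> x) (\<gamma> x) t vs *\<^sub>R l)"

text \<open>The degrees that enter the signs are explicit arguments: \<open>p\<close> is the degree of
  \<open>\<alpha>\<close> in \<open>m2\<close>, and \<open>q\<close> is the degree of \<open>\<beta>\<close> in \<open>m3\<close>.\<close>

definition m1 ::
    "('m, 'e::euclidean_space) manifold \<Rightarrow>
     ('m, 'v::real_vector, 'l::real_vector) courant_jacobi \<Rightarrow> ('m \<Rightarrow> 'v set) \<Rightarrow>
     ('m \<Rightarrow> 'v list \<Rightarrow> 'l) \<Rightarrow> 'm \<Rightarrow> 'v list \<Rightarrow> 'l" where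
  "m1 M C A = d_form M C A"

definition m2 ::
    "(('m \<Rightarrow> 'v list \<Rightarrow> 'l::real_vector) \<Rightarrow> ('m \<Rightarrow> 'v list \<Rightarrow> 'l) \<Rightarrow> 'm \<Rightarrow> 'v list \<Rightarrow> 'l) \<Rightarrow> int \<Rightarrow>
     ('m \<Rightarrow> 'v list \<Rightarrow> 'l) \<Rightarrow> ('m \<Rightarrow> 'v list \<Rightarrow> 'l) \<Rightarrow> 'm \<Rightarrow> 'v list \<Rightarrow> 'l" where
  "m2 gj p \<alpha> \<beta> = sgn_int p *\<^sub>R gj \<alpha> \<beta>"

definition m3 ::
    "('m, 'e::euclidean_space) manifold \<Rightarrow>
     ('m, 'v::real_vector, 'l::real_vector) courant_jacobi \<Rightarrow> ('m \<Rightarrow> 'v set) \<Rightarrow> ('m \<Rightarrow> 'v set) \<Rightarrow> int \<Rightarrow>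
     ('m \<Rightarrow> 'v list \<Rightarrow> 'l) \<Rightarrow> ('m \<Rightarrow> 'v list \<Rightarrow> 'l) \<Rightarrow> ('m \<Rightarrow> 'v list \<Rightarrow> 'l) \<Rightarrow>
     'm \<Rightarrow> 'v list \<Rightarrow> 'l" where
  "m3 M C A B q \<alpha> \<beta> \<gamma> = - (sgn_int q *\<^sub>R sharp_apply M C A (upsilon C A B) \<alpha> \<beta> \<gamma>)"

definition maurer_cartan ::
    "('m, 'e::euclidean_space) manifold \<Rightarrow>
     ('m, 'v::real_vector, 'l::real_vector) courant_jacobi \<Rightarrow> ('m \<Rightarrow> 'v set) \<Rightarrow> ('m \<Rightarrow> 'v set) \<Rightarrow>
     (('m \<Rightarrow> 'v list \<Rightarrow> 'l) \<Rightarrow> ('m \<Rightarrow> 'v list \<Rightarrow> 'l) \<Rightarrow> 'm \<Rightarrow> 'v list \<Rightarrow> 'l) \<Rightarrow>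
     ('m \<Rightarrow> 'v list \<Rightarrow> 'l) set" where
  "maurer_cartan M C A B gj = {\<eta> \<in> Omega M C A 2.
     m1 M C A \<eta> + (1/2) *\<^sub>R m2 gj 2 \<eta> \<eta> + (1/6) *\<^sub>R m3 M C A B 2 \<eta> \<eta> \<eta> = 0}"

text \<open>\<open>\<iota>\<^sub>\<xi> \<eta>\<close> is \<open>\<lambda>us. \<eta> x (\<xi> # us)\<close>.\<close>

definition graph ::
    "('m, 'v::real_vector, 'l::real_vector) courant_jacobi \<Rightarrow> ('m \<Rightarrow> 'v set) \<Rightarrow> ('m \<Rightarrow> 'v set) \<Rightarrow>
     ('m \<Rightarrow> 'v list \<Rightarrow> 'l) \<Rightarrow> 'm \<Rightarrow> 'v set" where
  "graph C A B \<eta> x = {\<xi> + lift C A B x (\<lambda>us. \<eta> x (\<xi> # us)) | \<xi>. \<xi> \<in> A x}"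

end

theory Submission
  imports Defs
begin

text \<open>
  For sections \<open>a, b, c\<close> of a Lagrangian subbundle \<open>D\<close>, the expression \<open>T3 a b c = \<langle>[a, b], c\<rangle>\<close> is
  skew and tensorial, and \<open>D\<close> is involutive if and only if it vanishes. For \<open>D = Gr(\<eta>)\<close> it is
  evaluated on \<open>X + \<eta> X\<close>, where \<open>\<eta> X \<in> \<Gamma>(B)\<close> corresponds to \<open>\<iota>\<^sub>X \<eta>\<close> (\<open>hat \<eta> X\<close> below), and expanded
  by the number of entries from \<open>B\<close>. The term of order \<open>0\<close> vanishes because \<open>A\<close> is
  involutive, the terms of order \<open>1\<close> give \<open>d \<eta>\<close>, those of order \<open>2\<close> give half of \<open>[\<eta>, \<eta>]\<close>, and the
  term of order \<open>3\<close> is \<open>\<Upsilon>(\<eta> X, \<eta> Y, \<eta> Z)\<close>, where the sign in \<open>m3\<close> is absorbed by the three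
  transpositions in \<open>\<eta>(u, X) = - \<eta>(X, u)\<close>. Hence the Maurer--Cartan equation is the vanishing of \<open>T3\<close>
  on the graph.

  The bracket \<open>[\<eta>, \<eta>]\<close> is known only through its derivation properties. Multiplying \<open>\<eta>\<close> by a
  cutoff function with value \<open>1\<close> and differential \<open>0\<close> at a point does not change the bracket there and
  turns \<open>\<eta>\<close> into a finite sum of products \<open>\<omega> \<and> \<beta>\<close> of global one-forms, for which the Leibniz rule
  gives an explicit formula.
\<close>

section \<open>Iterated differentiability\<close>

text \<open>All operators act on global objects, and the bracket is an arbitrary map with prescribed
  behaviour on global forms, so its locality is not given. Local frames have to be cut off to global
  sections and forms; one bump function around each point suffices, because every identity is
  verified at a single point. The value 1 alone would not do: the bracket is of first order in each
  entry, so the differential of the cutoff would survive.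

  The Leibniz rule for the bracket contains a derivation D of the algebra of which only the
  existence is known. It is eliminated by applying the same rule to \<omega> \<otimes> l with a
  section l of L, a one-form whose bracket belongs to a stage already settled. Thus a two-form is
  bracketed with sections, with one-forms and with two-forms, in this order.

  The bracket on E comes without a Leibniz rule. After pairing with a third section such rules
  follow by polarising the two compatibility axioms, and this is why T3 rather than the bracket is
  the basic object. The identification of B with the twisted dual of A is a pointwise inverse; its
  smoothness comes from solving linear systems with smooth coefficients.\<close>

lemma C_diff_on_cong:
  assumes "open U" "\<And>x. x \<in> U \<Longrightarrow> f x = g x"
  shows "C_diff_on n U f \<longleftrightarrow> C_diff_on n U g"
  using assms(2)
proof (induction n arbitrary: f g)
  case 0
  then show ?case by (auto intro: continuous_on_eq)
next
  case (Suc n)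
  have ev: "\<forall>\<^sub>F y in nhds x. f y = g y" if "x \<in> U" for x
    using assms(1) Suc.prems that eventually_nhds by blast
  have fd: "(f has_derivative D) (at x) \<longleftrightarrow> (g has_derivative D) (at x)" if "x \<in> U" for x D
    using assms(1) Suc.prems has_derivative_transform_within_open[of _ D x UNIV U] that
    by (metis (no_types, lifting))
  then have dif: "f differentiable (at x) \<longleftrightarrow> g differentiable (at x)"
    and fr: "frechet_derivative f (at x) = frechet_derivative g (at x)" if "x \<in> U" for x
    using that by (auto simp: differentiable_def frechet_derivative_def)
  have "C_diff_on n U (\<lambda>x. frechet_derivative f (at x) v) =
        C_diff_on n U (\<lambda>x. frechet_derivative g (at x) v)" for v
    by (rule Suc.IH) (simp add: fr)
  with dif show ?case by auto
qed

lemma C_diff_on_subset: "C_diff_on n U f \<Longrightarrow> V \<subseteq> U \<Longrightarrow> C_diff_on n V f"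
  by (induction n arbitrary: f) (auto intro: continuous_on_subset)

lemma C_diff_on_Suc_D: "C_diff_on (Suc n) U f \<Longrightarrow> C_diff_on n U f"
proof (induction n arbitrary: f)
  case 0
  then show ?case
    by (auto intro!: continuous_at_imp_continuous_on differentiable_imp_continuous_within)
next
  case (Suc n)
  then show ?case by simp
qed

text \<open>Any explicitly known derivative may replace the canonical
  \<open>frechet_derivative\<close> of the definition. With the converse rule
  \<open>C_diff_on_SucE\<close>, the inductions below never mention that operator.\<close>

lemma C_diff_on_SucI:
  assumes "open U" "\<And>x. x \<in> U \<Longrightarrow> (f has_derivative D x) (at x)"
    "\<And>v. C_diff_on n U (\<lambda>x. D x v)"
  shows "C_diff_on (Suc n) U f"
proof -
  have "frechet_derivative f (at x) = D x" if "x \<in> U" for x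
    using assms(2)[OF that] frechet_derivative_at by metis
  then have "C_diff_on n U (\<lambda>x. frechet_derivative f (at x) v)" for v
    using assms(3)[of v] C_diff_on_cong[OF assms(1), of "\<lambda>x. frechet_derivative f (at x) v" "\<lambda>x. D x v"]
    by simp
  then show ?thesis using assms(2) by (auto simp: differentiable_def)
qed

lemma C_diff_on_SucE:
  assumes "C_diff_on (Suc n) U f"
  obtains D where "\<And>x. x \<in> U \<Longrightarrow> (f has_derivative D x) (at x)" "\<And>v. C_diff_on n U (\<lambda>x. D x v)"
  using assms that[of "\<lambda>x. frechet_derivative f (at x)"] frechet_derivative_works by auto

lemma C_diff_on_const: "open U \<Longrightarrow> C_diff_on n U (\<lambda>x. c)"
proof (induction n arbitrary: c)
  case (Suc n)
  show ?case by (rule C_diff_on_SucI[of _ _ "\<lambda>_ _. 0"]) (auto intro: Suc)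
qed auto

lemma C_diff_on_add:
  assumes "open U" shows "C_diff_on n U f \<Longrightarrow> C_diff_on n U g \<Longrightarrow> C_diff_on n U (\<lambda>x. f x + g x)"
proof (induction n arbitrary: f g)
  case 0 then show ?case by (simp add: continuous_on_add continuous_on_mult continuous_on_scaleR)
next
  case (Suc n)
  obtain D where D: "\<And>x. x \<in> U \<Longrightarrow> (f has_derivative D x) (at x)" "\<And>v. C_diff_on n U (\<lambda>x. D x v)"
    using Suc.prems(1) C_diff_on_SucE by metis
  obtain D' where D': "\<And>x. x \<in> U \<Longrightarrow> (g has_derivative D' x) (at x)" "\<And>v. C_diff_on n U (\<lambda>x. D' x v)"
    using Suc.prems(2) C_diff_on_SucE by metis
  show ?case
    by (rule C_diff_on_SucI[of _ _ "\<lambda>x v. D x v + D' x v"])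
       (auto intro!: assms Suc.IH D D' derivative_eq_intros)
qed

lemma C_diff_on_mult:
  fixes f g :: "'a::real_normed_vector \<Rightarrow> real"
  assumes "open U" shows "C_diff_on n U f \<Longrightarrow> C_diff_on n U g \<Longrightarrow> C_diff_on n U (\<lambda>x. f x * g x)"
proof (induction n arbitrary: f g)
  case 0 then show ?case by (simp add: continuous_on_add continuous_on_mult continuous_on_scaleR)
next
  case (Suc n)
  obtain D where D: "\<And>x. x \<in> U \<Longrightarrow> (f has_derivative D x) (at x)" "\<And>v. C_diff_on n U (\<lambda>x. D x v)"
    using Suc.prems(1) C_diff_on_SucE by metis
  obtain D' where D': "\<And>x. x \<in> U \<Longrightarrow> (g has_derivative D' x) (at x)" "\<And>v. C_diff_on n U (\<lambda>x. D' x v)"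
    using Suc.prems(2) C_diff_on_SucE by metis
  show ?case
    by (rule C_diff_on_SucI[of _ _ "\<lambda>x v. f x * D' x v + D x v * g x"])
       (use Suc.prems[THEN C_diff_on_Suc_D] in \<open>auto intro!: assms Suc.IH D D' has_derivative_mult C_diff_on_add\<close>)
qed

lemma C_diff_on_sum:
  assumes "open U" "finite I" "\<And>i. i \<in> I \<Longrightarrow> C_diff_on n U (f i)"
  shows "C_diff_on n U (\<lambda>x. \<Sum>i\<in>I. f i x)"
  using assms(2,3) by (induction I rule: finite_induct) (auto intro: C_diff_on_add C_diff_on_const assms(1))

lemma C_diff_on_linear:
  assumes "open U" "bounded_linear l"
  shows "C_diff_on n U f \<Longrightarrow> C_diff_on n U (\<lambda>x. l (f x))"
proof (induction n arbitrary: f)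
  case 0 then show ?case using bounded_linear.continuous_on[OF assms(2)] by simp
next
  case (Suc n)
  obtain D where D: "\<And>x. x \<in> U \<Longrightarrow> (f has_derivative D x) (at x)" "\<And>v. C_diff_on n U (\<lambda>x. D x v)"
    using Suc.prems(1) C_diff_on_SucE by metis
  show ?case
    by (rule C_diff_on_SucI[of _ _ "\<lambda>x v. l (D x v)"])
       (use assms Suc.IH D bounded_linear.has_derivative[OF assms(2) D(1)] in auto)
qed

lemma C_diff_on_scaleR:
  fixes f :: "'a::real_normed_vector \<Rightarrow> real"
  assumes "open U" shows "C_diff_on n U f \<Longrightarrow> C_diff_on n U g \<Longrightarrow> C_diff_on n U (\<lambda>x. f x *\<^sub>R g x)"
proof (induction n arbitrary: f g)
  case 0 then show ?case by (simp add: continuous_on_add continuous_on_mult continuous_on_scaleR)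
next
  case (Suc n)
  obtain D where D: "\<And>x. x \<in> U \<Longrightarrow> (f has_derivative D x) (at x)" "\<And>v. C_diff_on n U (\<lambda>x. D x v)"
    using Suc.prems(1) C_diff_on_SucE by metis
  obtain D' where D': "\<And>x. x \<in> U \<Longrightarrow> (g has_derivative D' x) (at x)" "\<And>v. C_diff_on n U (\<lambda>x. D' x v)"
    using Suc.prems(2) C_diff_on_SucE by metis
  show ?case
    by (rule C_diff_on_SucI[of _ _ "\<lambda>x v. f x *\<^sub>R D' x v + D x v *\<^sub>R g x"])
       (use Suc.prems[THEN C_diff_on_Suc_D] in \<open>auto intro!: assms Suc.IH D D' has_derivative_scaleR C_diff_on_add\<close>)
qed

lemma C_diff_on_ident: "open U \<Longrightarrow> C_diff_on n U (\<lambda>x. x)"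
proof (cases n)
  case (Suc m)
  assume "open U"
  then show ?thesis unfolding Suc
    by (intro C_diff_on_SucI[of _ _ "\<lambda>x v. v"]) (auto intro: C_diff_on_const)
qed auto

lemma C_diff_on_compose:
  fixes f :: "'a::real_normed_vector \<Rightarrow> 'b::euclidean_space" and g :: "'b \<Rightarrow> 'c::real_normed_vector"
  assumes "open U" "open V" "f ` U \<subseteq> V"
  shows "C_diff_on n U f \<Longrightarrow> C_diff_on n V g \<Longrightarrow> C_diff_on n U (\<lambda>x. g (f x))"
  using assms(3)
proof (induction n arbitrary: f g)
  case 0 then show ?case by (auto intro: continuous_on_compose2)
next
  case (Suc n)
  obtain D where D: "\<And>x. x \<in> U \<Longrightarrow> (f has_derivative D x) (at x)" "\<And>v. C_diff_on n U (\<lambda>x. D x v)"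
    using Suc.prems(1) C_diff_on_SucE by metis
  obtain D' where D': "\<And>x. x \<in> V \<Longrightarrow> (g has_derivative D' x) (at x)" "\<And>v. C_diff_on n V (\<lambda>x. D' x v)"
    using Suc.prems(2) C_diff_on_SucE by metis
  \<comment> \<open>The direction \<open>D x v\<close> moves with x, while the induction hypothesis
    controls the derivative of g in fixed directions only; expanding in the standard basis separates
    the two dependences.\<close>
  have "((\<lambda>x. g (f x)) has_derivative (\<lambda>v. \<Sum>b\<in>Basis. (D x v \<bullet> b) *\<^sub>R D' (f x) b)) (at x)" if x: "x \<in> U" for x
  proof -
    have fx: "f x \<in> V" using x Suc.prems by auto
    have "D' (f x) w = (\<Sum>b\<in>Basis. (w \<bullet> b) *\<^sub>R D' (f x) b)" for w
    proof -
      have l: "linear (D' (f x))" using D'(1)[OF fx] has_derivative_linear by blast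
      have "D' (f x) w = D' (f x) (\<Sum>b\<in>Basis. (w \<bullet> b) *\<^sub>R b)" by (simp add: euclidean_representation)
      also have "\<dots> = (\<Sum>b\<in>Basis. (w \<bullet> b) *\<^sub>R D' (f x) b)"
        by (simp add: linear_sum[OF l] linear_cmul[OF l])
      finally show ?thesis .
    qed
    then have "(\<lambda>v. \<Sum>b\<in>Basis. (D x v \<bullet> b) *\<^sub>R D' (f x) b) = (\<lambda>v. D' (f x) (D x v))" by metis
    then show ?thesis using has_derivative_compose[OF D(1)[OF x] D'(1)[OF fx]] by simp
  qed
  moreover have "C_diff_on n U (\<lambda>x. \<Sum>b\<in>Basis. (D x v \<bullet> b) *\<^sub>R D' (f x) b)" for v
  proof (intro C_diff_on_sum C_diff_on_scaleR assms)
    fix b :: 'b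
    show "C_diff_on n U (\<lambda>x. D x v \<bullet> b)"
      by (rule C_diff_on_linear[OF assms(1) bounded_linear_inner_left D(2)])
    show "C_diff_on n U (\<lambda>x. D' (f x) b)"
      by (rule Suc.IH[OF C_diff_on_Suc_D[OF Suc.prems(1)] D'(2) Suc.prems(3)])
  qed auto
  ultimately show ?case by (intro C_diff_on_SucI[OF assms(1)])
qed

text \<open>The derivative is a polynomial in \<open>inverse\<close> itself, so that the induction
  hypothesis applies to it directly.\<close>

lemma C_diff_on_inverse: "C_diff_on n (- {0}) (inverse :: real \<Rightarrow> real)"
proof (induction n)
  case 0 show ?case by (auto intro!: continuous_intros)
next
  case (Suc n)
  show ?case
  proof (rule C_diff_on_SucI[of _ _ "\<lambda>x v. (- 1 * (inverse x * inverse x)) * v"])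
    show "(inverse has_derivative (\<lambda>v. (- 1 * (inverse x * inverse x)) * v)) (at x)" if "x \<in> - {0}" for x :: real
      using that by (auto intro!: derivative_eq_intros)
    show "C_diff_on n (- {0}) (\<lambda>x. (- 1 * (inverse x * inverse x)) * v)" for v :: real
      by (intro C_diff_on_mult C_diff_on_const Suc) auto
  qed auto
qed

section \<open>A smooth function that vanishes on a half-line\<close>

text \<open>The family is closed under differentiation: the derivative of member k is a combination
  of the members k + 1 and k + 2. Member 0 is the classical \<open>exp (-1/t)\<close>, extended by
  0.\<close>

definition flat_exp :: "nat \<Rightarrow> real \<Rightarrow> real" where
  "flat_exp k t = (if t > 0 then inverse t ^ k * exp (- inverse t) else 0)"

text \<open>With s = 1/t the limit from the right is the decay of s^k e^(-s); from the left the
  function is 0.\<close>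

lemma flat_exp_tendsto: "((\<lambda>t. flat_exp k t) \<longlongrightarrow> 0) (at 0)"
proof -
  have "((\<lambda>s::real. s ^ k / exp s) \<longlongrightarrow> 0) at_top" by (rule tendsto_power_div_exp_0)
  then have "((\<lambda>t::real. inverse t ^ k / exp (inverse t)) \<longlongrightarrow> 0) (at_right 0)"
    by (rule filterlim_compose) (rule filterlim_inverse_at_top_right)
  then have "(flat_exp k \<longlongrightarrow> 0) (at_right 0)"
    by (rule Lim_transform_eventually)
       (auto simp: eventually_at_right_field flat_exp_def exp_minus field_simps intro!: exI[of _ 1])
  moreover have "(flat_exp k \<longlongrightarrow> 0) (at_left 0)"
    by (rule Lim_transform_eventually[OF tendsto_const])
       (auto simp: eventually_at_left_field flat_exp_def intro!: exI[of _ "-1"])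
  ultimately show ?thesis using filterlim_split_at by (metis (full_types))
qed

lemma flat_exp_deriv:
  "(flat_exp k has_real_derivative (flat_exp (k + 2) t - real k * flat_exp (k + 1) t)) (at t)"
proof -
  consider "t > 0" | "t < 0" | "t = 0" by linarith
  then show ?thesis
  proof cases
    case 1
    have "((\<lambda>t. inverse t ^ k * exp (- inverse t)) has_real_derivative
        real k * inverse t ^ (k - 1) * (- (inverse t * inverse t)) * exp (- inverse t) +
        inverse t ^ k * (exp (- inverse t) * (inverse t * inverse t))) (at t)"
      using 1 by (auto intro!: derivative_eq_intros simp: power2_eq_square)
    also have "real k * inverse t ^ (k - 1) * (- (inverse t * inverse t)) * exp (- inverse t) +
        inverse t ^ k * (exp (- inverse t) * (inverse t * inverse t)) =
        flat_exp (k + 2) t - real k * flat_exp (k + 1) t"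
      using 1 by (cases k) (simp_all add: flat_exp_def algebra_simps)
    finally have "((\<lambda>t. inverse t ^ k * exp (- inverse t)) has_real_derivative
            (flat_exp (k + 2) t - real k * flat_exp (k + 1) t)) (at t)" .
    then show ?thesis
      by (rule has_field_derivative_transform_within_open[of _ _ _ "{0<..}"]) (use 1 in \<open>auto simp: flat_exp_def\<close>)
  next
    case 2
    have "((\<lambda>t. 0) has_real_derivative (flat_exp (k + 2) t - real k * flat_exp (k + 1) t)) (at t)"
      using 2 by (auto simp: flat_exp_def)
    then show ?thesis
      by (rule has_field_derivative_transform_within_open[of _ _ _ "{..<0}"]) (use 2 in \<open>auto simp: flat_exp_def\<close>)
  next
    case 3
    \<comment> \<open>At 0 the difference quotient of one member is the next member, so the
      derivative there is the limit already computed.\<close>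
    have "flat_exp (k + 1) h = (flat_exp k (0 + h) - flat_exp k 0) / h" for h
      by (auto simp: flat_exp_def field_simps)
    then have "(\<lambda>h. (flat_exp k (0 + h) - flat_exp k 0) / h) = flat_exp (k + 1)" by auto
    moreover have "flat_exp (k + 2) 0 - real k * flat_exp (k + 1) 0 = 0" by (simp add: flat_exp_def)
    ultimately show ?thesis using flat_exp_tendsto[of "k+1"] 3 unfolding DERIV_def by metis
  qed
qed

lemma C_diff_on_flat_exp: "C_diff_on n UNIV (flat_exp k)"
proof (induction n arbitrary: k)
  case 0 then show ?case
    by (simp add: continuous_at_imp_continuous_on DERIV_isCont[OF flat_exp_deriv])
next
  case (Suc n)
  have "C_diff_on n UNIV (\<lambda>t. (flat_exp (k + 2) t + (- real k) * flat_exp (k + 1) t) * v)" for v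
    by (intro C_diff_on_mult C_diff_on_add C_diff_on_const Suc) auto
  moreover have "(flat_exp k has_derivative (\<lambda>v. (flat_exp (k + 2) t + (- real k) * flat_exp (k + 1) t) * v)) (at t)" for t
    using flat_exp_deriv[of k t] unfolding has_field_derivative_def by simp
  ultimately show ?case by (intro C_diff_on_SucI) auto
qed

section \<open>Smooth functions on manifolds\<close>

lemma smooth_map_onE:
  assumes "smooth_map_on S f" "x \<in> S"
  obtains U g where "open U" "x \<in> U" "\<And>n. C_diff_on n U g" "\<And>y. y \<in> S \<Longrightarrow> y \<in> U \<Longrightarrow> f y = g y"
  using assms unfolding smooth_map_on_def by (metis IntI)

lemma smooth_map_onI:
  assumes "\<And>x. x \<in> S \<Longrightarrow> \<exists>U g. open U \<and> x \<in> U \<and> (\<forall>n. C_diff_on n U g) \<and> (\<forall>y. y \<in> S \<longrightarrow> y \<in> U \<longrightarrow> f y = g y)"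
  shows "smooth_map_on S f"
  using assms unfolding smooth_map_on_def Ball_def Int_iff imp_conjL by blast

lemma smooth_map_on_cong_subset:
  assumes "smooth_map_on T f" "S \<subseteq> T" "\<And>x. x \<in> S \<Longrightarrow> f x = g x"
  shows "smooth_map_on S g"
proof (rule smooth_map_onI)
  fix x assume "x \<in> S"
  then obtain U h where "open U" "x \<in> U" "\<And>n. C_diff_on n U h" "\<And>y. y \<in> T \<Longrightarrow> y \<in> U \<Longrightarrow> f y = h y"
    using smooth_map_onE[OF assms(1), of x] assms(2) by blast
  then show "\<exists>U h. open U \<and> x \<in> U \<and> (\<forall>n. C_diff_on n U h) \<and> (\<forall>y. y \<in> S \<longrightarrow> y \<in> U \<longrightarrow> g y = h y)"
    using assms(2,3) by (intro exI[of _ U] exI[of _ h]) (metis subsetD)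
qed

lemma smooth_map_on_subset: "smooth_map_on T f \<Longrightarrow> S \<subseteq> T \<Longrightarrow> smooth_map_on S f"
  by (rule smooth_map_on_cong_subset) auto

lemma smooth_map_on_cong: "smooth_map_on S f \<Longrightarrow> (\<And>x. x \<in> S \<Longrightarrow> f x = g x) \<Longrightarrow> smooth_map_on S g"
  by (rule smooth_map_on_cong_subset[OF _ subset_refl])

lemma smooth_map_on_local:
  assumes "\<And>x. x \<in> S \<Longrightarrow> \<exists>V. open V \<and> x \<in> V \<and> smooth_map_on (S \<inter> V) f"
  shows "smooth_map_on S f"
proof (rule smooth_map_onI)
  fix x assume x: "x \<in> S"
  obtain V where V: "open V" "x \<in> V" "smooth_map_on (S \<inter> V) f" using assms[OF x] by blast
  obtain U g where U: "open U" "x \<in> U" "\<And>n. C_diff_on n U g" "\<And>y. y \<in> S \<inter> V \<Longrightarrow> y \<in> U \<Longrightarrow> f y = g y"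
    using smooth_map_onE[OF V(3), of x] x V(2) by blast
  have "C_diff_on n (U \<inter> V) g" for n by (rule C_diff_on_subset[OF U(3)]) simp
  then show "\<exists>U g. open U \<and> x \<in> U \<and> (\<forall>n. C_diff_on n U g) \<and> (\<forall>y. y \<in> S \<longrightarrow> y \<in> U \<longrightarrow> f y = g y)"
    using U V by (intro exI[of _ "U \<inter> V"] exI[of _ g]) (simp add: open_Int)
qed

lemma smooth_map_on_const: "smooth_map_on S (\<lambda>x. c)"
  unfolding smooth_map_on_def using C_diff_on_const[OF open_UNIV] by blast

text \<open>One argument for sums and products: local extensions of both maps are restricted to a
  common open set, where \<open>op\<close> preserves iterated differentiability.\<close>

lemma smooth_map_on_binary:
  fixes f g :: "'a::euclidean_space \<Rightarrow> real" and op :: "real \<Rightarrow> real \<Rightarrow> real"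
  assumes op: "\<And>U n (f :: 'a \<Rightarrow> real) (g :: 'a \<Rightarrow> real). open U \<Longrightarrow> C_diff_on n U f \<Longrightarrow> C_diff_on n U g \<Longrightarrow>
      C_diff_on n U (\<lambda>x. op (f x) (g x))"
    and f: "smooth_map_on S f" and g: "smooth_map_on S g"
  shows "smooth_map_on S (\<lambda>x. op (f x) (g x))"
proof (rule smooth_map_onI)
  fix x assume x: "x \<in> S"
  obtain U f' where U: "open U" "x \<in> U" "\<And>n. C_diff_on n U f'" "\<And>y. y \<in> S \<Longrightarrow> y \<in> U \<Longrightarrow> f y = f' y"
    using smooth_map_onE[OF f x] by blast
  obtain V g' where V: "open V" "x \<in> V" "\<And>n. C_diff_on n V g'" "\<And>y. y \<in> S \<Longrightarrow> y \<in> V \<Longrightarrow> g y = g' y"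
    using smooth_map_onE[OF g x] by blast
  have "C_diff_on n (U \<inter> V) (\<lambda>x. op (f' x) (g' x))" for n
    by (rule op) (use U V C_diff_on_subset[OF U(3), of "U \<inter> V"] C_diff_on_subset[OF V(3), of "U \<inter> V"] in auto)
  then show "\<exists>W h. open W \<and> x \<in> W \<and> (\<forall>n. C_diff_on n W h) \<and> (\<forall>y. y \<in> S \<longrightarrow> y \<in> W \<longrightarrow> op (f y) (g y) = h y)"
    using U V by (intro exI[of _ "U \<inter> V"] exI[of _ "\<lambda>x. op (f' x) (g' x)"]) (simp add: open_Int)
qed

lemma smooth_map_on_compose:
  fixes f :: "'a::euclidean_space \<Rightarrow> 'b::euclidean_space" and h :: "'b \<Rightarrow> 'c::real_normed_vector"
  assumes f: "smooth_map_on S f" and V: "open V" "f ` S \<subseteq> V" and h: "\<And>n. C_diff_on n V h"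
  shows "smooth_map_on S (\<lambda>x. h (f x))"
proof (rule smooth_map_onI)
  fix x assume x: "x \<in> S"
  obtain U f' where U: "open U" "x \<in> U" "\<And>n. C_diff_on n U f'" "\<And>y. y \<in> S \<Longrightarrow> y \<in> U \<Longrightarrow> f y = f' y"
    using smooth_map_onE[OF f x] by blast
  have "continuous_on U f'" using U(3)[of 0] by simp
  then have o: "open (f' -` V \<inter> U)" using U(1) V(1) continuous_on_open_vimage by blast
  have "f' x \<in> V" using U x V(2) by force
  moreover have "C_diff_on n (f' -` V \<inter> U) (\<lambda>x. h (f' x))" for n
    by (rule C_diff_on_compose[OF o V(1) _ _ h]) (use C_diff_on_subset[OF U(3)] in auto)
  ultimately show "\<exists>W g. open W \<and> x \<in> W \<and> (\<forall>n. C_diff_on n W g) \<and> (\<forall>y. y \<in> S \<longrightarrow> y \<in> W \<longrightarrow> h (f y) = g y)"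
    using U o by (intro exI[of _ "f' -` V \<inter> U"] exI[of _ "\<lambda>x. h (f' x)"]) simp
qed

lemma smooth_fun_on_subset: "smooth_fun_on M W f \<Longrightarrow> W' \<subseteq> W \<Longrightarrow> smooth_fun_on M W' f"
  unfolding smooth_fun_on_def by (fastforce intro: smooth_map_on_subset)

lemma inv_into_chart:
  assumes "smooth_manifold M" "(U, \<phi>) \<in> atlas M"
  shows "inj_on \<phi> U" "x \<in> U \<Longrightarrow> inv_into U \<phi> (\<phi> x) = x" "open U"
    "homeomorphism U (\<phi> ` U) \<phi> (inv_into U \<phi>)"
proof -
  show h: "homeomorphism U (\<phi> ` U) \<phi> (inv_into U \<phi>)" "open U"
    using assms unfolding smooth_manifold_def by auto
  then show "x \<in> U \<Longrightarrow> inv_into U \<phi> (\<phi> x) = x" unfolding homeomorphism_def by auto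
  show "inj_on \<phi> U" using h unfolding homeomorphism_def by (auto intro: inj_on_inverseI)
qed

lemma smooth_fun_on_cong:
  assumes "smooth_manifold M" "smooth_fun_on M W f" "\<And>x. x \<in> W \<Longrightarrow> f x = g x"
  shows "smooth_fun_on M W g"
  unfolding smooth_fun_on_def
proof clarify
  fix U \<phi> assume c: "(U, \<phi>) \<in> atlas M"
  have "smooth_map_on (\<phi> ` (U \<inter> W)) (f \<circ> inv_into U \<phi>)"
    using assms(2) c unfolding smooth_fun_on_def by auto
  then show "smooth_map_on (\<phi> ` (U \<inter> W)) (g \<circ> inv_into U \<phi>)"
    by (rule smooth_map_on_cong) (use assms(3) inv_into_chart(2)[OF assms(1) c] in auto)
qed

lemma smooth_fun_on_local:
  assumes M: "smooth_manifold M"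
    and loc: "\<And>x. x \<in> W \<Longrightarrow> \<exists>N. open N \<and> x \<in> N \<and> smooth_fun_on M (W \<inter> N) f"
  shows "smooth_fun_on M W f"
  unfolding smooth_fun_on_def
proof clarify
  fix U \<phi> assume c: "(U, \<phi>) \<in> atlas M"
  note ch = inv_into_chart[OF M c]
  show "smooth_map_on (\<phi> ` (U \<inter> W)) (f \<circ> inv_into U \<phi>)"
  proof (rule smooth_map_on_local)
    fix p assume "p \<in> \<phi> ` (U \<inter> W)"
    then obtain x where x: "x \<in> U" "x \<in> W" "p = \<phi> x" by blast
    obtain N where N: "open N" "x \<in> N" "smooth_fun_on M (W \<inter> N) f" using loc[OF x(2)] by blast
    \<comment> \<open>Chart images are open in the model subspace only, not in the Euclidean space.
      The homeomorphism turns N into the trace on the chart image of an honest open set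
      \<open>Ob\<close>.\<close>
    have "openin (top_of_set (\<phi> ` U)) (\<phi> ` (U \<inter> N))"
      using homeomorphism_imp_open_map[OF ch(4)] N(1) by (simp add: openin_open_Int)
    then obtain Ob where Ob: "open Ob" "\<phi> ` (U \<inter> N) = \<phi> ` U \<inter> Ob" using openin_open by metis
    have "\<phi> ` (U \<inter> W) \<inter> Ob \<subseteq> \<phi> ` (U \<inter> (W \<inter> N))"
    proof
      fix q assume q: "q \<in> \<phi> ` (U \<inter> W) \<inter> Ob"
      then obtain y where y: "y \<in> U" "y \<in> W" "q = \<phi> y" by blast
      then have "q \<in> \<phi> ` (U \<inter> N)" using q Ob by auto
      then have "y \<in> N" using y ch(1) by (auto dest: inj_onD)
      then show "q \<in> \<phi> ` (U \<inter> (W \<inter> N))" using y by auto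
    qed
    then have "smooth_map_on (\<phi> ` (U \<inter> W) \<inter> Ob) (f \<circ> inv_into U \<phi>)"
      using N(3) c unfolding smooth_fun_on_def by (auto intro: smooth_map_on_subset)
    then show "\<exists>Ob. open Ob \<and> p \<in> Ob \<and> smooth_map_on (\<phi> ` (U \<inter> W) \<inter> Ob) (f \<circ> inv_into U \<phi>)"
      using Ob x N by blast
  qed
qed

section \<open>Germs of smooth functions\<close>

definition smooth_at :: "('m::topological_space, 'e::euclidean_space) manifold \<Rightarrow> 'm \<Rightarrow> ('m \<Rightarrow> real) \<Rightarrow> bool" where
  "smooth_at M x f \<longleftrightarrow> (\<exists>N. open N \<and> x \<in> N \<and> smooth_fun_on M N f)"

lemma smooth_at_of_on: "smooth_fun_on M W f \<Longrightarrow> open W \<Longrightarrow> x \<in> W \<Longrightarrow> smooth_at M x f"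
  unfolding smooth_at_def by (rule exI[of _ W]) simp

lemma smooth_atE:
  assumes "smooth_at M x f"
  obtains N where "open N" "x \<in> N" "smooth_fun_on M N f"
  using assms unfolding smooth_at_def by (elim exE conjE)

lemma smooth_fun_onI:
  assumes "smooth_manifold M" "\<And>x. x \<in> W \<Longrightarrow> smooth_at M x f"
  shows "smooth_fun_on M W f"
proof (rule smooth_fun_on_local[OF assms(1)])
  fix x assume "x \<in> W"
  then obtain N where "open N" "x \<in> N" "smooth_fun_on M N f" using smooth_atE[OF assms(2)] by blast
  then show "\<exists>N. open N \<and> x \<in> N \<and> smooth_fun_on M (W \<inter> N) f"
    using smooth_fun_on_subset[of M N f "W \<inter> N"] by auto
qed

lemma smooth_at_cong:
  assumes "smooth_manifold M" "smooth_at M x f" "open N" "x \<in> N" "\<And>y. y \<in> N \<Longrightarrow> f y = g y"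
  shows "smooth_at M x g"
proof -
  obtain N' where N': "open N'" "x \<in> N'" "smooth_fun_on M N' f" by (rule smooth_atE[OF assms(2)])
  have "smooth_fun_on M (N \<inter> N') f" by (rule smooth_fun_on_subset[OF N'(3)]) simp
  then have "smooth_fun_on M (N \<inter> N') g"
    by (rule smooth_fun_on_cong[OF assms(1)]) (simp add: assms(5))
  then show ?thesis by (rule smooth_at_of_on) (simp_all add: open_Int assms N')
qed

lemma smooth_at_const: "smooth_at M x (\<lambda>y. c)"
  unfolding smooth_at_def smooth_fun_on_def using smooth_map_on_const[of _ c] by (auto simp: comp_def)

lemma smooth_at_binary:
  fixes f g :: "'m::topological_space \<Rightarrow> real" and M :: "('m, 'e::euclidean_space) manifold"
    and op :: "real \<Rightarrow> real \<Rightarrow> real"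
  assumes op: "\<And>U n (f :: 'e \<Rightarrow> real) (g :: 'e \<Rightarrow> real). open U \<Longrightarrow> C_diff_on n U f \<Longrightarrow> C_diff_on n U g \<Longrightarrow>
      C_diff_on n U (\<lambda>x. op (f x) (g x))"
    and f: "smooth_at M x f" and g: "smooth_at M x g"
  shows "smooth_at M x (\<lambda>y. op (f y) (g y))"
proof -
  obtain N where N: "open N" "x \<in> N" "smooth_fun_on M N f" by (rule smooth_atE[OF f])
  obtain N' where N': "open N'" "x \<in> N'" "smooth_fun_on M N' g" by (rule smooth_atE[OF g])
  have "smooth_fun_on M (N \<inter> N') f" by (rule smooth_fun_on_subset[OF N(3)]) simp
  moreover have "smooth_fun_on M (N \<inter> N') g" by (rule smooth_fun_on_subset[OF N'(3)]) simp
  ultimately have "smooth_fun_on M (N \<inter> N') (\<lambda>y. op (f y) (g y))"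
    unfolding smooth_fun_on_def comp_def
    using smooth_map_on_binary[OF op] by fast
  then show ?thesis by (rule smooth_at_of_on) (simp_all add: open_Int N N')
qed

lemma smooth_at_add: "smooth_at M x f \<Longrightarrow> smooth_at M x g \<Longrightarrow> smooth_at M x (\<lambda>y. f y + g y)"
  by (rule smooth_at_binary) (rule C_diff_on_add)

lemma smooth_at_mult: "smooth_at M x f \<Longrightarrow> smooth_at M x g \<Longrightarrow> smooth_at M x (\<lambda>y. f y * g y)"
  by (rule smooth_at_binary) (rule C_diff_on_mult)

lemma smooth_at_diff: "smooth_at M x f \<Longrightarrow> smooth_at M x g \<Longrightarrow> smooth_at M x (\<lambda>y. f y - g y)"
  using smooth_at_add[of M x f "\<lambda>y. -1 * g y"] smooth_at_mult[OF smooth_at_const[of M x "-1"], of g] by simp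

lemma smooth_at_sum:
  "finite I \<Longrightarrow> (\<And>i. i \<in> I \<Longrightarrow> smooth_at M x (f i)) \<Longrightarrow> smooth_at M x (\<lambda>y. \<Sum>i\<in>I. f i y)"
  by (induction I rule: finite_induct) (auto intro: smooth_at_add smooth_at_const)

text \<open>Continuity of f is not part of the definition of smoothness; it is read off from a local
  extension in a chart and pulled back along that chart.\<close>

lemma smooth_at_nonzero:
  assumes M: "smooth_manifold M" and f: "smooth_at M x f" and "f x \<noteq> 0"
  obtains N where "open N" "x \<in> N" "\<And>y. y \<in> N \<Longrightarrow> f y \<noteq> 0" "smooth_fun_on M N f"
proof -
  obtain N where N: "open N" "x \<in> N" "smooth_fun_on M N f" by (rule smooth_atE[OF f])
  obtain U \<phi> where c: "(U, \<phi>) \<in> atlas M" and x: "x \<in> U"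
    using M unfolding smooth_manifold_def by fast
  note ch = inv_into_chart[OF M c]
  have "smooth_map_on (\<phi> ` (U \<inter> N)) (f \<circ> inv_into U \<phi>)" using N c unfolding smooth_fun_on_def by auto
  moreover have "\<phi> x \<in> \<phi> ` (U \<inter> N)" using x N by blast
  ultimately obtain Ob g where Ob: "open Ob" "\<phi> x \<in> Ob" "\<And>n. C_diff_on n Ob g"
    "\<And>p. p \<in> \<phi> ` (U \<inter> N) \<Longrightarrow> p \<in> Ob \<Longrightarrow> (f \<circ> inv_into U \<phi>) p = g p"
    using smooth_map_onE by blast
  have "continuous_on Ob g" using Ob(3)[of 0] by simp
  then have o: "open (g -` (- {0}) \<inter> Ob)" using Ob(1) continuous_on_open_vimage open_Compl by blast
  have cont: "continuous_on U \<phi>" using ch(4) unfolding homeomorphism_def by blast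
  define N' where "N' = \<phi> -` (g -` (- {0}) \<inter> Ob) \<inter> U \<inter> N"
  have "open (\<phi> -` (g -` (- {0}) \<inter> Ob) \<inter> U)" using cont o ch(3) continuous_on_open_vimage by blast
  then have "open N'" unfolding N'_def using N by blast
  moreover have "f y = g (\<phi> y)" if "y \<in> U" "y \<in> N" "\<phi> y \<in> Ob" for y
    using Ob(4)[of "\<phi> y"] that ch(2) by auto
  then have "x \<in> N'" "y \<in> N' \<Longrightarrow> f y \<noteq> 0" for y
    unfolding N'_def using x N Ob assms(3) by auto
  moreover have "smooth_fun_on M N' f" using N(3) by (rule smooth_fun_on_subset) (auto simp: N'_def)
  ultimately show ?thesis using that by blast
qed

lemma smooth_at_inverse:
  assumes "smooth_manifold M" "smooth_at M x f" "f x \<noteq> 0"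
  shows "smooth_at M x (\<lambda>y. inverse (f y))"
proof -
  obtain N where N: "open N" "x \<in> N" "\<And>y. y \<in> N \<Longrightarrow> f y \<noteq> 0" "smooth_fun_on M N f"
    using smooth_at_nonzero[OF assms] by blast
  have "smooth_fun_on M N (\<lambda>y. inverse (f y))"
    unfolding smooth_fun_on_def
  proof clarify
    fix U \<phi> assume c: "(U, \<phi>) \<in> atlas M"
    have "smooth_map_on (\<phi> ` (U \<inter> N)) (f \<circ> inv_into U \<phi>)" using N c unfolding smooth_fun_on_def by auto
    then have "smooth_map_on (\<phi> ` (U \<inter> N)) (\<lambda>x. inverse ((f \<circ> inv_into U \<phi>) x))"
      by (rule smooth_map_on_compose[of _ _ "- {0}"])
         (use N(3) C_diff_on_inverse inv_into_chart(2)[OF assms(1) c] in auto)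
    then show "smooth_map_on (\<phi> ` (U \<inter> N)) ((\<lambda>y. inverse (f y)) \<circ> inv_into U \<phi>)" by (simp add: comp_def)
  qed
  then show ?thesis by (rule smooth_at_of_on[OF _ N(1,2)])
qed

lemma smooth_at_divide:
  "smooth_manifold M \<Longrightarrow> smooth_at M x f \<Longrightarrow> smooth_at M x g \<Longrightarrow> g x \<noteq> 0 \<Longrightarrow> smooth_at M x (\<lambda>y. f y / g y)"
  unfolding divide_inverse by (intro smooth_at_mult smooth_at_inverse)

lemma smooth_funs_iff: "smooth_manifold M \<Longrightarrow> f \<in> smooth_funs M \<longleftrightarrow> (\<forall>x. smooth_at M x f)"
  unfolding smooth_funs_def using smooth_fun_onI[of M UNIV f] smooth_at_of_on[of M UNIV f] by auto

section \<open>Bump functions\<close>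

lemma C_diff_on_dist_bump: "C_diff_on n UNIV (\<lambda>z::'e::euclidean_space. flat_exp 0 (c - (z - p) \<bullet> (z - p)))"
proof (rule C_diff_on_compose[of UNIV UNIV "\<lambda>z. c - (z - p) \<bullet> (z - p)" n "flat_exp 0"])
  have "C_diff_on n UNIV (\<lambda>z::'e. z + - p)"
    by (rule C_diff_on_add[OF open_UNIV C_diff_on_ident[OF open_UNIV] C_diff_on_const[OF open_UNIV]])
  then have 1: "C_diff_on n UNIV (\<lambda>z::'e. (z - p) \<bullet> b)" for b
    using C_diff_on_linear[OF open_UNIV bounded_linear_inner_left] by fastforce
  have "C_diff_on n UNIV (\<lambda>z::'e. c + -1 * (\<Sum>b\<in>Basis. ((z - p) \<bullet> b) * ((z - p) \<bullet> b)))"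
    by (rule C_diff_on_add[OF open_UNIV C_diff_on_const[OF open_UNIV]
          C_diff_on_mult[OF open_UNIV C_diff_on_const[OF open_UNIV]
            C_diff_on_sum[OF open_UNIV finite_Basis C_diff_on_mult[OF open_UNIV 1 1]]]])
  moreover have "(\<lambda>z::'e. c + -1 * (\<Sum>b\<in>Basis. ((z - p) \<bullet> b) * ((z - p) \<bullet> b))) = (\<lambda>z. c - (z - p) \<bullet> (z - p))"
    using euclidean_inner[of "z - p" "z - p" for z] by (simp add: fun_eq_iff)
  ultimately show "C_diff_on n UNIV (\<lambda>z::'e. c - (z - p) \<bullet> (z - p))" by (simp only:)
qed (simp_all add: C_diff_on_flat_exp)

text \<open>The set K is the image of a closed ball of the model subspace under the inverse chart.
  It is compact, hence closed because M is Hausdorff, so its complement is an open set on which the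
  extension by zero is constant.\<close>

lemma exists_bump:
  fixes M :: "('m::{t2_space,second_countable_topology}, 'e::euclidean_space) manifold"
  assumes M: "smooth_manifold M" and W: "open W" "x \<in> W"
  obtains h K where "h \<in> smooth_funs M" "h x = 1" "closed K" "K \<subseteq> W" "\<And>y. y \<notin> K \<Longrightarrow> h y = 0"
proof -
  obtain U \<phi> where c: "(U, \<phi>) \<in> atlas M" and x: "x \<in> U"
    using M unfolding smooth_manifold_def by fast
  note ch = inv_into_chart[OF M c]
  have ss: "subspace (model M)" "openin (top_of_set (model M)) (\<phi> ` U)"
    using M c unfolding smooth_manifold_def by fast+
  have "openin (top_of_set (\<phi> ` U)) (\<phi> ` (U \<inter> W))"
    by (rule homeomorphism_imp_open_map[OF ch(4)]) (simp add: W(1) openin_open_Int)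
  then have "openin (top_of_set (model M)) (\<phi> ` (U \<inter> W))" by (rule openin_trans[OF _ ss(2)])
  moreover have "\<phi> x \<in> \<phi> ` (U \<inter> W)" using x W by blast
  ultimately obtain r where r: "r > 0" "ball (\<phi> x) r \<inter> model M \<subseteq> \<phi> ` (U \<inter> W)"
    unfolding openin_contains_ball by meson
  \<comment> \<open>Half the radius, so that the closed ball still lies over the chart
    image.\<close>
  define r' where "r' = r / 2"
  have r': "r' > 0" "r' < r" using r r'_def by auto
  define Q where "Q = cball (\<phi> x) r' \<inter> model M"
  have Q1: "compact Q"
    unfolding Q_def using closed_subspace[OF ss(1)] by (simp add: compact_Int_closed)
  have "cball (\<phi> x) r' \<subseteq> ball (\<phi> x) r" using r' by auto
  then have Q2: "Q \<subseteq> \<phi> ` (U \<inter> W)" unfolding Q_def using r(2) by blast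
  define K where "K = inv_into U \<phi> ` Q"
  have "continuous_on (\<phi> ` U) (inv_into U \<phi>)" using ch(4) unfolding homeomorphism_def by (elim conjE)
  then have "continuous_on Q (inv_into U \<phi>)" by (rule continuous_on_subset) (use Q2 in blast)
  then have "compact K" unfolding K_def using Q1 by (rule compact_continuous_image)
  then have K1: "closed K" by (rule compact_imp_closed)
  have K2: "K \<subseteq> U \<inter> W"
  proof
    fix y assume "y \<in> K"
    then obtain q where "q \<in> Q" "y = inv_into U \<phi> q" unfolding K_def by blast
    moreover then obtain z where "z \<in> U \<inter> W" "q = \<phi> z" using Q2 by blast
    ultimately show "y \<in> U \<inter> W" using ch(2) by simp
  qed
  define g where "g = (\<lambda>z. flat_exp 0 (r'\<^sup>2 - (z - \<phi> x) \<bullet> (z - \<phi> x)))"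
  have gx: "g (\<phi> x) \<noteq> 0" unfolding g_def flat_exp_def using r' by auto
  have g0: "g z = 0" if "z \<notin> cball (\<phi> x) r'" for z
  proof -
    have "r' < norm (z - \<phi> x)" using that by (auto simp: dist_norm norm_minus_commute)
    then have "r'\<^sup>2 < (norm (z - \<phi> x))\<^sup>2" using r' by (intro power_strict_mono) auto
    then show ?thesis unfolding g_def flat_exp_def by (simp add: power2_norm_eq_inner)
  qed
  have gs: "C_diff_on n UNIV g" for n unfolding g_def by (rule C_diff_on_dist_bump)
  define h where "h = (\<lambda>y. if y \<in> U then g (\<phi> y) / g (\<phi> x) else 0)"
  have h0: "h y = 0" if "y \<notin> K" for y
  proof (cases "y \<in> U")
    case True
    have "\<phi> y \<in> model M" using openin_imp_subset[OF ss(2)] True by blast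
    moreover have "\<phi> y \<notin> Q"
    proof
      assume "\<phi> y \<in> Q"
      then have "inv_into U \<phi> (\<phi> y) \<in> K" unfolding K_def by (rule imageI)
      then show False using that ch(2)[OF True] by simp
    qed
    ultimately have "\<phi> y \<notin> cball (\<phi> x) r'" unfolding Q_def by blast
    then show ?thesis unfolding h_def by (simp add: g0)
  qed (simp add: h_def)
  have "smooth_at M y h" for y
  proof (cases "y \<in> K")
    case True
    have "smooth_fun_on M U h" unfolding smooth_fun_on_def
    proof clarify
      fix V \<psi> assume d: "(V, \<psi>) \<in> atlas M"
      have "smooth_map_on (\<psi> ` (V \<inter> U)) (\<phi> \<circ> inv_into V \<psi>)"
        using M c d unfolding smooth_manifold_def by fast
      then have "smooth_map_on (\<psi> ` (V \<inter> U)) (\<lambda>p. g ((\<phi> \<circ> inv_into V \<psi>) p) * inverse (g (\<phi> x)))"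
        by (intro smooth_map_on_binary[of "(*)", OF C_diff_on_mult _ smooth_map_on_const]
              smooth_map_on_compose[of _ _ UNIV g] gs) (simp_all add: comp_def)
      then show "smooth_map_on (\<psi> ` (V \<inter> U)) (h \<circ> inv_into V \<psi>)"
        by (rule smooth_map_on_cong) (use inv_into_chart(2)[OF M d] in \<open>auto simp: h_def divide_inverse\<close>)
    qed
    then show ?thesis by (rule smooth_at_of_on[OF _ ch(3)]) (use True K2 in blast)
  next
    case False
    show ?thesis
      by (rule smooth_at_cong[OF M smooth_at_const[of M y 0], of "- K"]) (use K1 False h0 in auto)
  qed
  then have "h \<in> smooth_funs M" by (simp add: smooth_funs_iff[OF M])
  moreover have "h x = 1" unfolding h_def using x gx by simp
  ultimately show ?thesis using K1 K2 h0 by (intro that[of h K]) simp_all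
qed

section \<open>Linear systems\<close>

text \<open>Gaussian elimination of the last unknown: the reduced row is the original row with the
  last unknown solved from the homogeneous pivot equation.\<close>

lemma pivot_elimination:
  fixes G :: "'i \<Rightarrow> nat \<Rightarrow> real"
  assumes "G i0 n \<noteq> 0"
  shows "(\<Sum>j<n. (G i j - G i n * (G i0 j / G i0 n)) * k j) =
    (\<Sum>j<n. G i j * k j) + G i n * (- (\<Sum>j<n. G i0 j * k j) / G i0 n)"
  by (simp add: sum_subtractf algebra_simps sum_distrib_left sum_divide_distrib)

text \<open>Injectivity for an arbitrary set of rows, so that overdetermined systems are covered.
  They arise when a family of sections is expanded in a frame of a larger bundle.\<close>

definition trivial_kernel :: "'i set \<Rightarrow> nat \<Rightarrow> ('i \<Rightarrow> nat \<Rightarrow> real) \<Rightarrow> bool" where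
  "trivial_kernel I n G \<longleftrightarrow> (\<forall>k. (\<forall>i\<in>I. (\<Sum>j<n. G i j * k j) = 0) \<longrightarrow> (\<forall>j<n. k j = 0))"

lemma trivial_kernelD:
  "trivial_kernel I n G \<Longrightarrow> (\<And>i. i \<in> I \<Longrightarrow> (\<Sum>j<n. G i j * k j) = 0) \<Longrightarrow> j < n \<Longrightarrow> k j = 0"
  unfolding trivial_kernel_def by simp

text \<open>If the last column vanished, the last unit vector would lie in the kernel; so there is a
  pivot. A kernel vector of the reduced system extends to one of the full system by solving the
  pivot equation.\<close>

lemma trivial_kernel_pivot:
  assumes "trivial_kernel I (Suc n) G"
  obtains i0 where "i0 \<in> I" "G i0 n \<noteq> 0"
    "trivial_kernel I n (\<lambda>i j. G i j - G i n * (G i0 j / G i0 n))"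
proof -
  have "\<exists>i0\<in>I. G i0 n \<noteq> 0"
  proof (rule ccontr)
    assume "\<not> (\<exists>i0\<in>I. G i0 n \<noteq> 0)"
    then have "(\<Sum>j<Suc n. G i j * (if j = n then 1 else 0)) = 0" if "i \<in> I" for i using that by simp
    then show False using trivial_kernelD[OF assms, of "\<lambda>j. if j = n then 1 else 0" n] by simp
  qed
  then obtain i0 where i0: "i0 \<in> I" "G i0 n \<noteq> 0" by blast
  have "trivial_kernel I n (\<lambda>i j. G i j - G i n * (G i0 j / G i0 n))"
    unfolding trivial_kernel_def
  proof (intro allI impI)
    fix k j
    assume k: "\<forall>i\<in>I. (\<Sum>j<n. (G i j - G i n * (G i0 j / G i0 n)) * k j) = 0" and j: "j < n"
    define k' where "k' = k(n := - (\<Sum>j<n. G i0 j * k j) / G i0 n)"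
    have "(\<Sum>j<Suc n. G i j * k' j) = 0" if "i \<in> I" for i
    proof -
      have "(\<Sum>j<n. G i j * k' j) = (\<Sum>j<n. G i j * k j)" by (rule sum.cong) (auto simp: k'_def)
      then show ?thesis using k that pivot_elimination[of G i0 n i k, OF i0(2)] by (simp add: k'_def)
    qed
    then have "k' j = 0" using trivial_kernelD[OF assms, of k' j] j by simp
    then show "k j = 0" using j by (simp add: k'_def)
  qed
  then show ?thesis using that i0 by blast
qed

lemma square_system_solvable:
  assumes "finite I" "card I = n" "trivial_kernel I n G"
  shows "\<exists>c. \<forall>i\<in>I. (\<Sum>j<n. G i j * c j) = v i"
  using assms
proof (induction n arbitrary: I G v)
  case 0
  then show ?case by simp
next
  case (Suc n)
  obtain i0 where i0: "i0 \<in> I" "G i0 n \<noteq> 0"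
    "trivial_kernel I n (\<lambda>i j. G i j - G i n * (G i0 j / G i0 n))"
    using trivial_kernel_pivot[OF Suc.prems(3)] by blast
  let ?G = "\<lambda>i j. G i j - G i n * (G i0 j / G i0 n)"
  \<comment> \<open>The reduced pivot row is identically zero; dropping it leaves the kernel trivial
    and the system square.\<close>
  have "trivial_kernel (I - {i0}) n ?G"
    unfolding trivial_kernel_def
  proof (intro allI impI)
    fix k j assume k: "\<forall>i\<in>I - {i0}. (\<Sum>j<n. ?G i j * k j) = 0" and j: "j < n"
    have "(\<Sum>j<n. ?G i0 j * k j) = 0" using i0(2) by simp
    then have "(\<Sum>j<n. ?G i j * k j) = 0" if "i \<in> I" for i using k that by (cases "i = i0") auto
    then show "k j = 0" by (rule trivial_kernelD[OF i0(3)]) (simp_all add: j)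
  qed
  then obtain c where c: "\<forall>i\<in>I - {i0}. (\<Sum>j<n. ?G i j * c j) = v i - G i n * (v i0 / G i0 n)"
    using Suc.IH[of "I - {i0}" ?G "\<lambda>i. v i - G i n * (v i0 / G i0 n)"] Suc.prems i0 by auto
  define c' where "c' = c(n := (v i0 - (\<Sum>j<n. G i0 j * c j)) / G i0 n)"
  have s: "(\<Sum>j<Suc n. G i j * c' j) = (\<Sum>j<n. G i j * c j) + G i n * c' n" for i
  proof -
    have "(\<Sum>j<n. G i j * c' j) = (\<Sum>j<n. G i j * c j)" by (rule sum.cong) (auto simp: c'_def)
    then show ?thesis by simp
  qed
  have "(\<Sum>j<Suc n. G i j * c' j) = v i" if "i \<in> I" for i
  proof (cases "i = i0")
    case True
    then show ?thesis unfolding s using i0(2) by (simp add: c'_def)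
  next
    case False
    then have "(\<Sum>j<n. G i j * c j) + G i n * (- (\<Sum>j<n. G i0 j * c j) / G i0 n) = v i - G i n * (v i0 / G i0 n)"
      using c that pivot_elimination[of G i0 n i c, OF i0(2)] by simp
    then show ?thesis unfolding s by (simp add: c'_def diff_divide_distrib algebra_simps)
  qed
  then show ?case by blast
qed

text \<open>Elimination divides only by pivots that are nonzero at x and hence near x. The solution
  is given and only its smoothness is at stake, so the system may have more equations than
  unknowns.\<close>

lemma smooth_solution:
  fixes M :: "('m::{t2_space,second_countable_topology}, 'e::euclidean_space) manifold"
  assumes M: "smooth_manifold M" and "trivial_kernel I n (\<lambda>i j. G i j x)"
    and "\<And>i j. i \<in> I \<Longrightarrow> j < n \<Longrightarrow> smooth_at M x (G i j)" "\<And>i. i \<in> I \<Longrightarrow> smooth_at M x (v i)"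
    and "open N" "x \<in> N" "\<And>y i. y \<in> N \<Longrightarrow> i \<in> I \<Longrightarrow> (\<Sum>j<n. G i j y * c j y) = v i y"
    and "j < n"
  shows "smooth_at M x (c j)"
  using assms(2-)
proof (induction n arbitrary: G v N j)
  case 0
  then show ?case by simp
next
  case (Suc n)
  obtain i0 where i0: "i0 \<in> I" "G i0 n x \<noteq> 0"
    "trivial_kernel I n (\<lambda>i j. G i j x - G i n x * (G i0 j x / G i0 n x))"
    by (rule trivial_kernel_pivot[OF Suc.prems(1)])
  have g0: "smooth_at M x (G i0 n)" by (rule Suc.prems(2)) (simp_all add: i0)
  obtain N' where N': "open N'" "x \<in> N'" "\<And>y. y \<in> N' \<Longrightarrow> G i0 n y \<noteq> 0"
    by (rule smooth_at_nonzero[OF M g0 i0(2)]) (rule that)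
  have IH: "smooth_at M x (c j)" if "j < n" for j
  proof (rule Suc.IH[of "\<lambda>i j y. G i j y - G i n y * (G i0 j y / G i0 n y)"
        "\<lambda>i y. v i y - G i n y * (v i0 y / G i0 n y)" "N \<inter> N'"])
    show "trivial_kernel I n (\<lambda>i j. G i j x - G i n x * (G i0 j x / G i0 n x))" by (rule i0(3))
    show "smooth_at M x (\<lambda>y. G i j y - G i n y * (G i0 j y / G i0 n y))" if "i \<in> I" "j < n" for i j
      by (rule smooth_at_diff[OF Suc.prems(2) smooth_at_mult[OF Suc.prems(2)
            smooth_at_divide[OF M Suc.prems(2) g0 i0(2)]]]) (use i0 that in simp_all)
    show "smooth_at M x (\<lambda>y. v i y - G i n y * (v i0 y / G i0 n y))" if "i \<in> I" for i
      by (rule smooth_at_diff[OF Suc.prems(3) smooth_at_mult[OF Suc.prems(2)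
            smooth_at_divide[OF M Suc.prems(3) g0 i0(2)]]]) (use i0 that in simp_all)
    show "open (N \<inter> N')" using Suc.prems(4) N'(1) by (rule open_Int)
    show "x \<in> N \<inter> N'" using Suc.prems(5) N'(2) by simp
    show "(\<Sum>j<n. (G i j y - G i n y * (G i0 j y / G i0 n y)) * c j y) = v i y - G i n y * (v i0 y / G i0 n y)"
      if "y \<in> N \<inter> N'" "i \<in> I" for y i
    proof -
      have e: "(\<Sum>j<n. G i j y * c j y) = v i y - G i n y * c n y"
        "(\<Sum>j<n. G i0 j y * c j y) = v i0 y - G i0 n y * c n y"
        using Suc.prems(6)[of y i] Suc.prems(6)[of y i0] that i0(1) by simp_all
      have nz: "G i0 n y \<noteq> 0" using N'(3) that by simp
      then show ?thesis
        unfolding pivot_elimination[of "\<lambda>i j. G i j y" i0 n i "\<lambda>j. c j y", OF nz] e by (simp add: field_simps)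
    qed
    show "j < n" by (rule that)
  qed
  show ?case
  proof (cases "j = n")
    case True
    have "smooth_at M x (\<lambda>y. (v i0 y - (\<Sum>j<n. G i0 j y * c j y)) / G i0 n y)"
    proof (rule smooth_at_divide[OF M smooth_at_diff[OF Suc.prems(3) smooth_at_sum] g0 i0(2)])
      show "smooth_at M x (\<lambda>y. G i0 j y * c j y)" if "j \<in> {..<n}" for j
        by (rule smooth_at_mult[OF Suc.prems(2) IH]) (use that i0(1) in simp_all)
    qed (simp_all add: i0)
    then show ?thesis unfolding True
    proof (rule smooth_at_cong[OF M])
      show "open (N \<inter> N')" using Suc.prems(4) N'(1) by (rule open_Int)
      show "x \<in> N \<inter> N'" using Suc.prems(5) N'(2) by simp
      show "(v i0 y - (\<Sum>j<n. G i0 j y * c j y)) / G i0 n y = c n y" if "y \<in> N \<inter> N'" for y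
        using Suc.prems(6)[of y i0] N'(3)[of y] that i0(1) by (simp add: field_simps)
    qed
  next
    case False
    then show ?thesis using IH Suc.prems(7) by simp
  qed
qed

section \<open>Bases as coordinate systems\<close>

lemma basis_of_iff:
  "basis_of r S b \<longleftrightarrow> S = range (\<lambda>c. \<Sum>j<r. c j *\<^sub>R b j) \<and>
     (\<forall>k. (\<Sum>j<r. k j *\<^sub>R b j) = 0 \<longrightarrow> (\<forall>j<r. k j = 0))"
proof -
  have span: "span (b ` {..<r}) = range (\<lambda>c. \<Sum>j<r. c j *\<^sub>R b j)" if i: "inj_on b {..<r}"
  proof -
    have "(\<Sum>v\<in>b ` {..<r}. u v *\<^sub>R v) = (\<Sum>j<r. u (b j) *\<^sub>R b j)" for u
      by (simp add: sum.reindex[OF i])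
    moreover have "\<exists>u. (\<Sum>j<r. c j *\<^sub>R b j) = (\<Sum>j<r. u (b j) *\<^sub>R b j)" for c :: "nat \<Rightarrow> real"
      by (rule exI[of _ "\<lambda>v. c (inv_into {..<r} b v)"]) (simp add: inv_into_f_f[OF i])
    ultimately have "range (\<lambda>u. \<Sum>v\<in>b ` {..<r}. u v *\<^sub>R v) = range (\<lambda>c. \<Sum>j<r. c j *\<^sub>R b j)"
      by (simp add: set_eq_iff image_iff) metis
    then show ?thesis by (simp add: span_finite)
  qed
  have ind: "independent (b ` {..<r}) \<longleftrightarrow> (\<forall>k. (\<Sum>j<r. k j *\<^sub>R b j) = 0 \<longrightarrow> (\<forall>j<r. k j = 0))"
    if i: "inj_on b {..<r}"
  proof -
    have e: "(\<Sum>v\<in>b ` {..<r}. u v *\<^sub>R v) = (\<Sum>j<r. u (b j) *\<^sub>R b j)" for u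
      by (simp add: sum.reindex[OF i])
    show ?thesis
    proof
      assume I: "independent (b ` {..<r})"
      show "\<forall>k. (\<Sum>j<r. k j *\<^sub>R b j) = 0 \<longrightarrow> (\<forall>j<r. k j = 0)"
      proof (intro allI impI)
        fix k j assume k: "(\<Sum>j<r. k j *\<^sub>R b j) = 0" and j: "j < r"
        let ?u = "\<lambda>v. k (inv_into {..<r} b v)"
        have "(\<Sum>v\<in>b ` {..<r}. ?u v *\<^sub>R v) = 0"
          unfolding e using k by (simp add: inv_into_f_f[OF i])
        then have "\<forall>v\<in>b ` {..<r}. ?u v = 0" using I dependent_finite[of "b ` {..<r}"] by auto
        then show "k j = 0" using j by (simp add: inv_into_f_f[OF i])
      qed
    next
      assume H: "\<forall>k. (\<Sum>j<r. k j *\<^sub>R b j) = 0 \<longrightarrow> (\<forall>j<r. k j = 0)"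
      show "independent (b ` {..<r})"
      proof
        assume "dependent (b ` {..<r})"
        then obtain u where u: "\<exists>v\<in>b ` {..<r}. u v \<noteq> 0" "(\<Sum>v\<in>b ` {..<r}. u v *\<^sub>R v) = 0"
          using dependent_finite[of "b ` {..<r}"] by auto
        then have "\<forall>j<r. u (b j) = 0" using H e by metis
        then show False using u(1) by auto
      qed
    qed
  qed
  have inj: "inj_on b {..<r}" if H: "\<forall>k. (\<Sum>j<r. k j *\<^sub>R b j) = 0 \<longrightarrow> (\<forall>j<r. k j = 0)"
  proof (rule inj_onI, rule ccontr)
    fix i j assume ij: "i \<in> {..<r}" "j \<in> {..<r}" "b i = b j" "i \<noteq> j"
    \<comment> \<open>Two equal members would give the nontrivial relation
      \<open>b i - b j = 0\<close>; injectivity of the family is thus a consequence of its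
      independence.\<close>
    let ?k = "\<lambda>l. (if l = i then 1 else 0) - (if l = j then 1 else 0 :: real)"
    have "(\<Sum>l<r. ?k l *\<^sub>R b l) = 0"
      using ij by (simp add: scaleR_left_diff_distrib sum_subtractf if_distrib[of "\<lambda>z. z *\<^sub>R _"] cong: if_cong)
    then have "?k i = 0" using H[rule_format, of ?k i] ij(1) by blast
    then show False using ij(4) by simp
  qed
  show ?thesis unfolding basis_of_def using span ind inj by auto
qed

lemma basis_of_independent:
  assumes "basis_of r S b" "(\<Sum>j<r. k j *\<^sub>R b j) = 0" "j < r"
  shows "k j = 0"
  using assms unfolding basis_of_iff by simp

lemma basis_of_unique:
  assumes "basis_of r S b" "(\<Sum>j<r. c j *\<^sub>R b j) = (\<Sum>j<r. d j *\<^sub>R b j)" "j < r"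
  shows "c j = d j"
proof -
  have "(\<Sum>j<r. (c j - d j) *\<^sub>R b j) = 0" using assms(2) by (simp add: scaleR_left_diff_distrib sum_subtractf)
  then show ?thesis using basis_of_independent[OF assms(1), of "\<lambda>j. c j - d j" j] assms(3) by simp
qed

lemma basis_of_subspace: "basis_of r S b \<Longrightarrow> subspace S"
  unfolding basis_of_def using subspace_span by metis

lemma basis_of_coeffs:
  assumes "basis_of r S b" "v \<in> S" obtains c where "v = (\<Sum>j<r. c j *\<^sub>R b j)"
proof -
  have "v \<in> range (\<lambda>c. \<Sum>j<r. c j *\<^sub>R b j)" using assms unfolding basis_of_iff by simp
  then show ?thesis using that by (rule imageE)
qed

lemma basis_of_mem: "basis_of r S b \<Longrightarrow> j < r \<Longrightarrow> b j \<in> S"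
  using span_base[of "b j" "b ` {..<r}"] unfolding basis_of_def by simp

lemma basis_of_combination_mem:
  assumes "basis_of r S b" shows "(\<Sum>j<r. c j *\<^sub>R b j) \<in> S"
proof -
  have "S = range (\<lambda>c. \<Sum>j<r. c j *\<^sub>R b j)" using assms unfolding basis_of_iff by (rule conjunct1)
  then show ?thesis using rangeI[of "\<lambda>c. \<Sum>j<r. c j *\<^sub>R b j" c] by simp
qed

section \<open>Germs of smooth sections\<close>

lemma smooth_at_common_nbhd:
  fixes n :: nat
  assumes "\<And>k. k < n \<Longrightarrow> smooth_at M x (c k)"
  obtains N where "open N" "x \<in> N" "\<And>k y. k < n \<Longrightarrow> y \<in> N \<Longrightarrow> smooth_at M y (c k)"
proof -
  have "\<forall>k. \<exists>N. k < n \<longrightarrow> open N \<and> x \<in> N \<and> smooth_fun_on M N (c k)"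
    using assms unfolding smooth_at_def by simp
  then obtain N where N: "\<And>k. k < n \<Longrightarrow> open (N k) \<and> x \<in> N k \<and> smooth_fun_on M (N k) (c k)" by metis
  show ?thesis
  proof (rule that[of "\<Inter>k<n. N k"])
    show "open (\<Inter>k<n. N k)" by (intro open_INT finite_lessThan ballI) (simp add: N)
    show "x \<in> (\<Inter>k<n. N k)" by (simp add: N)
    show "smooth_at M y (c k)" if "k < n" "y \<in> (\<Inter>k<n. N k)" for k y
      by (rule smooth_at_of_on[of _ "N k"]) (use N[OF that(1)] that in auto)
  qed
qed

definition smooth_sec_at ::
    "('m::topological_space, 'e::euclidean_space) manifold \<Rightarrow> ('m, 'v::real_vector) vbundle \<Rightarrow> 'm \<Rightarrow> ('m \<Rightarrow> 'v) \<Rightarrow> bool" where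
  "smooth_sec_at M E x s \<longleftrightarrow> (\<exists>N. open N \<and> x \<in> N \<and> smooth_section_on M E N s)"

lemma smooth_sec_atE:
  assumes "smooth_sec_at M E x s" obtains N where "open N" "x \<in> N" "smooth_section_on M E N s"
  using assms unfolding smooth_sec_at_def by (elim exE conjE)

lemma smooth_sec_at_of_on: "smooth_section_on M E W s \<Longrightarrow> open W \<Longrightarrow> x \<in> W \<Longrightarrow> smooth_sec_at M E x s"
  unfolding smooth_sec_at_def by (rule exI[of _ W]) simp

locale smooth_bundle =
  fixes M :: "('m::{t2_space,second_countable_topology}, 'e::euclidean_space) manifold"
    and E :: "('m, 'v::real_vector) vbundle"
  assumes M: "smooth_manifold M" and E: "vector_bundle M E"
begin

abbreviation "rk \<equiv> bundle_rank E"

lemma frame_props: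
  assumes "(U, t) \<in> frames E"
  shows "open U" "x \<in> U \<Longrightarrow> basis_of rk (fibre E x) (\<lambda>j. t j x)"
    "j < rk \<Longrightarrow> smooth_section_on M E U (t j)"
proof -
  have "\<forall>(U, t)\<in>frames E. open U \<and> (\<forall>x\<in>U. basis_of rk (fibre E x) (\<lambda>j. t j x)) \<and>
        (\<forall>j<rk. smooth_section_on M E U (t j))"
    using E unfolding vector_bundle_def by (rule conjunct2)
  from bspec[OF this assms] show "open U" "x \<in> U \<Longrightarrow> basis_of rk (fibre E x) (\<lambda>j. t j x)"
    "j < rk \<Longrightarrow> smooth_section_on M E U (t j)" by simp_all
qed

lemma frame_at: obtains U t where "(U, t) \<in> frames E" "x \<in> U"
proof -
  have "(\<Union>(U, t)\<in>frames E. U) = UNIV" using E unfolding vector_bundle_def by (rule conjunct1)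
  then have "x \<in> (\<Union>(U, t)\<in>frames E. U)" by simp
  then obtain p where p: "p \<in> frames E" "x \<in> (case p of (U, t) \<Rightarrow> U)" by (rule UN_E)
  then show ?thesis by (cases p) (simp add: that)
qed

lemma subspace_fibre: "subspace (fibre E x)"
proof -
  obtain U t where "(U, t) \<in> frames E" "x \<in> U" by (rule frame_at)
  then show ?thesis using basis_of_subspace[OF frame_props(2)] by simp
qed

lemma section_on_coeffs:
  assumes "smooth_section_on M E W s" "(U, t) \<in> frames E"
  obtains c where "\<And>j. j < rk \<Longrightarrow> smooth_fun_on M (U \<inter> W) (c j)"
    "\<And>x. x \<in> U \<Longrightarrow> x \<in> W \<Longrightarrow> s x = (\<Sum>j<rk. c j x *\<^sub>R t j x)"
proof -
  have "\<forall>(U, t)\<in>frames E. \<exists>c. (\<forall>j<rk. smooth_fun_on M (U \<inter> W) (c j)) \<and>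
        (\<forall>x\<in>U \<inter> W. s x = (\<Sum>j<rk. c j x *\<^sub>R t j x))"
    using assms(1) unfolding smooth_section_on_def by (rule conjunct2)
  from bspec[OF this assms(2)] obtain c where "\<forall>j<rk. smooth_fun_on M (U \<inter> W) (c j)"
    "\<forall>x\<in>U \<inter> W. s x = (\<Sum>j<rk. c j x *\<^sub>R t j x)" by auto
  then show ?thesis by (intro that[of c]) simp_all
qed

lemma section_on_mem: "smooth_section_on M E W s \<Longrightarrow> x \<in> W \<Longrightarrow> s x \<in> fibre E x"
  unfolding smooth_section_on_def by simp

lemma smooth_section_on_subset: "smooth_section_on M E W s \<Longrightarrow> V \<subseteq> W \<Longrightarrow> smooth_section_on M E V s"
proof -
  assume a: "smooth_section_on M E W s" "V \<subseteq> W"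
  show ?thesis unfolding smooth_section_on_def
  proof (intro conjI ballI, goal_cases)
    case (1 x) then show ?case using a section_on_mem by blast
  next
    case (2 p)
    obtain U t where p: "p = (U, t)" by (cases p)
    obtain c where c: "\<And>j. j < rk \<Longrightarrow> smooth_fun_on M (U \<inter> W) (c j)"
      "\<And>x. x \<in> U \<Longrightarrow> x \<in> W \<Longrightarrow> s x = (\<Sum>j<rk. c j x *\<^sub>R t j x)"
      using section_on_coeffs[OF a(1) 2[unfolded p]] by metis
    have "smooth_fun_on M (U \<inter> V) (c j)" if "j < rk" for j
      by (rule smooth_fun_on_subset[OF c(1)[OF that]]) (use a(2) in blast)
    then show ?case unfolding p using c(2) a(2) by (auto intro!: exI[of _ c])
  qed
qed

text \<open>Coefficients are chosen pointwise. By uniqueness of coordinates they agree near each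
  point with the smooth coefficients of the germ, so the local data glue.\<close>

lemma smooth_section_onI:
  assumes "\<And>x. x \<in> W \<Longrightarrow> smooth_sec_at M E x s"
  shows "smooth_section_on M E W s"
  unfolding smooth_section_on_def
proof (intro conjI ballI, goal_cases)
  case (1 x)
  obtain N where "x \<in> N" "smooth_section_on M E N s" using smooth_sec_atE[OF assms[OF 1]] by metis
  then show ?case by (simp add: section_on_mem)
next
  case (2 p)
  obtain U t where p: "p = (U, t)" by (cases p)
  have f: "(U, t) \<in> frames E" using 2 p by simp
  define c where "c = (\<lambda>j x. (SOME d. s x = (\<Sum>j<rk. d j *\<^sub>R t j x)) j)"
  have c: "s x = (\<Sum>j<rk. c j x *\<^sub>R t j x)" if xU: "x \<in> U" and sx: "s x \<in> fibre E x" for x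
  proof -
    obtain d where "s x = (\<Sum>j<rk. d j *\<^sub>R t j x)"
      by (rule basis_of_coeffs[OF frame_props(2)[OF f xU] sx])
    then show ?thesis unfolding c_def by (rule someI[of "\<lambda>d. s x = (\<Sum>j<rk. d j *\<^sub>R t j x)" d])
  qed
  have "smooth_fun_on M (U \<inter> W) (c j)" if j: "j < rk" for j
  proof (rule smooth_fun_onI[OF M])
    fix x assume x: "x \<in> U \<inter> W"
    then obtain N where N: "open N" "x \<in> N" "smooth_section_on M E N s" using smooth_sec_atE[OF assms] by blast
    obtain c' where c': "\<And>j. j < rk \<Longrightarrow> smooth_fun_on M (U \<inter> N) (c' j)"
      "\<And>x. x \<in> U \<Longrightarrow> x \<in> N \<Longrightarrow> s x = (\<Sum>j<rk. c' j x *\<^sub>R t j x)"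
      using section_on_coeffs[OF N(3) f] by metis
    have o: "open (U \<inter> N)" "x \<in> U \<inter> N" using frame_props(1)[OF f] N x by auto
    show "smooth_at M x (c j)"
    proof (rule smooth_at_cong[OF M smooth_at_of_on[OF c'(1)[OF j] o] o])
      fix y assume y: "y \<in> U \<inter> N"
      have "s y \<in> fibre E y" using section_on_mem[OF N(3)] y by blast
      then show "c' j y = c j y"
        by (intro basis_of_unique[OF frame_props(2)[OF f, of y] _ j, of "\<lambda>j. c' j y" "\<lambda>j. c j y"])
           (use c[of y] c'(2)[of y] y in auto)
    qed
  qed
  moreover have "s x = (\<Sum>j<rk. c j x *\<^sub>R t j x)" if x: "x \<in> U \<inter> W" for x
  proof -
    obtain N where "x \<in> N" "smooth_section_on M E N s" using smooth_sec_atE[OF assms] x by blast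
    then show ?thesis using c[of x] x by (simp add: section_on_mem)
  qed
  ultimately show ?case unfolding p by blast
qed

lemma sections_iff: "s \<in> sections M E \<longleftrightarrow> (\<forall>x. smooth_sec_at M E x s)"
  unfolding sections_def using smooth_section_onI[of UNIV s] smooth_sec_at_of_on[of M E UNIV s] by auto

lemma section_mem: "s \<in> sections M E \<Longrightarrow> s x \<in> fibre E x"
  unfolding sections_def using section_on_mem[of UNIV s x] by auto

lemma smooth_sec_at_coeffs:
  assumes "smooth_sec_at M E x s" "(U, t) \<in> frames E" "x \<in> U"
  obtains c N where "open N" "x \<in> N" "\<And>j. j < rk \<Longrightarrow> smooth_at M x (c j)"
    "\<And>y. y \<in> N \<Longrightarrow> s y = (\<Sum>j<rk. c j y *\<^sub>R t j y)" "N \<subseteq> U"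
proof -
  obtain N where N: "open N" "x \<in> N" "smooth_section_on M E N s" by (rule smooth_sec_atE[OF assms(1)])
  obtain c where c: "\<And>j. j < rk \<Longrightarrow> smooth_fun_on M (U \<inter> N) (c j)"
    "\<And>x. x \<in> U \<Longrightarrow> x \<in> N \<Longrightarrow> s x = (\<Sum>j<rk. c j x *\<^sub>R t j x)"
    using section_on_coeffs[OF N(3) assms(2)] by metis
  have o: "open (U \<inter> N)" "x \<in> U \<inter> N" using frame_props(1)[OF assms(2)] N assms(3) by auto
  show ?thesis by (rule that[OF o smooth_at_of_on[OF c(1) o]]) (use c(2) in auto)
qed

text \<open>Smoothness is demanded in every frame of the atlas. The members of one frame are smooth
  sections, and their coefficients \<open>d\<close> in another frame are the transition functions
  that carry the given coefficients over.\<close>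

lemma smooth_sec_at_frameI:
  assumes f: "(U, t) \<in> frames E" "x \<in> U" and c: "\<And>j. j < rk \<Longrightarrow> smooth_at M x (c j)"
    and N: "open N" "x \<in> N" "\<And>y. y \<in> N \<Longrightarrow> s y = (\<Sum>j<rk. c j y *\<^sub>R t j y)"
  shows "smooth_sec_at M E x s"
proof -
  obtain N1 where N1: "open N1" "x \<in> N1" "\<And>k y. k < rk \<Longrightarrow> y \<in> N1 \<Longrightarrow> smooth_at M y (c k)"
    by (rule smooth_at_common_nbhd[of rk M x c]) (rule c, assumption, rule that)
  define W where "W = U \<inter> N \<inter> N1"
  have W: "open W" "x \<in> W" using frame_props(1)[OF f(1)] f N N1 unfolding W_def by auto
  have "smooth_section_on M E W s" unfolding smooth_section_on_def
  proof (intro conjI ballI, goal_cases)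
    case (1 y)
    have b: "basis_of rk (fibre E y) (\<lambda>j. t j y)" by (rule frame_props(2)[OF f(1)]) (use 1 W_def in simp)
    have "s y = (\<Sum>j<rk. c j y *\<^sub>R t j y)" by (rule N(3)) (use 1 W_def in simp)
    then show ?case using basis_of_combination_mem[OF b, of "\<lambda>j. c j y"] by simp
  next
    case (2 p)
    obtain U' t' where p: "p = (U', t')" by (cases p)
    have f': "(U', t') \<in> frames E" using 2 p by simp
    have "\<forall>k. \<exists>d. k < rk \<longrightarrow> (\<forall>j<rk. smooth_fun_on M (U' \<inter> U) (d j)) \<and>
        (\<forall>y\<in>U' \<inter> U. t k y = (\<Sum>j<rk. d j y *\<^sub>R t' j y))"
    proof
      fix k
      show "\<exists>d. k < rk \<longrightarrow> (\<forall>j<rk. smooth_fun_on M (U' \<inter> U) (d j)) \<and>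
        (\<forall>y\<in>U' \<inter> U. t k y = (\<Sum>j<rk. d j y *\<^sub>R t' j y))"
      proof (cases "k < rk")
        case True
        obtain d where "\<And>j. j < rk \<Longrightarrow> smooth_fun_on M (U' \<inter> U) (d j)"
          "\<And>x. x \<in> U' \<Longrightarrow> x \<in> U \<Longrightarrow> t k x = (\<Sum>j<rk. d j x *\<^sub>R t' j x)"
          using section_on_coeffs[OF frame_props(3)[OF f(1) True] f'] by metis
        then show ?thesis by (intro exI[of _ d]) simp
      qed simp
    qed
    from choice[OF this] obtain d where d': "\<forall>k. k < rk \<longrightarrow> (\<forall>j<rk. smooth_fun_on M (U' \<inter> U) (d k j)) \<and>
        (\<forall>y\<in>U' \<inter> U. t k y = (\<Sum>j<rk. d k j y *\<^sub>R t' j y))"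
      by (rule exE)
    have d: "\<And>k j. k < rk \<Longrightarrow> j < rk \<Longrightarrow> smooth_fun_on M (U' \<inter> U) (d k j)"
      "\<And>k y. k < rk \<Longrightarrow> y \<in> U' \<Longrightarrow> y \<in> U \<Longrightarrow> t k y = (\<Sum>j<rk. d k j y *\<^sub>R t' j y)"
      using d' by simp_all
    have o: "open (U' \<inter> U)" using frame_props(1)[OF f(1)] frame_props(1)[OF f'] by auto
    have "smooth_fun_on M (U' \<inter> W) (\<lambda>y. \<Sum>k<rk. c k y * d k j y)" if "j < rk" for j
    proof (rule smooth_fun_onI[OF M], rule smooth_at_sum)
      show "smooth_at M y (\<lambda>y. c k y * d k j y)" if "y \<in> U' \<inter> W" "k \<in> {..<rk}" for k y
        by (rule smooth_at_mult[OF N1(3) smooth_at_of_on[OF d(1) o]])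
           (use that \<open>j < rk\<close> W_def in auto)
    qed simp
    moreover have "s y = (\<Sum>j<rk. (\<Sum>k<rk. c k y * d k j y) *\<^sub>R t' j y)" if y: "y \<in> U' \<inter> W" for y
    proof -
      have "s y = (\<Sum>k<rk. c k y *\<^sub>R (\<Sum>j<rk. d k j y *\<^sub>R t' j y))"
        using N(3)[of y] d(2)[of _ y] y W_def by simp
      also have "\<dots> = (\<Sum>j<rk. (\<Sum>k<rk. c k y * d k j y) *\<^sub>R t' j y)"
        unfolding scaleR_sum_right scaleR_sum_left scaleR_scaleR by (rule sum.swap)
      finally show ?thesis .
    qed
    ultimately show ?case unfolding p by (auto intro!: exI[of _ "\<lambda>j y. \<Sum>k<rk. c k y * d k j y"])
  qed
  then show ?thesis by (rule smooth_sec_at_of_on[OF _ W])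
qed

lemma smooth_sec_at_family_coeffs:
  fixes n :: nat
  assumes t: "\<And>i. i < n \<Longrightarrow> smooth_sec_at M E x (t i)" and f: "(U, \<tau>) \<in> frames E" "x \<in> U"
  obtains d N where "open N" "x \<in> N" "N \<subseteq> U" "\<And>i j. i < n \<Longrightarrow> j < rk \<Longrightarrow> smooth_at M x (d i j)"
    "\<And>i y. i < n \<Longrightarrow> y \<in> N \<Longrightarrow> t i y = (\<Sum>j<rk. d i j y *\<^sub>R \<tau> j y)"
proof -
  have "\<forall>i. \<exists>N d. i < n \<longrightarrow> open N \<and> x \<in> N \<and> (\<forall>j<rk. smooth_at M x (d j)) \<and>
      (\<forall>y\<in>N. t i y = (\<Sum>j<rk. d j y *\<^sub>R \<tau> j y))"
  proof
    fix i
    show "\<exists>N d. i < n \<longrightarrow> open N \<and> x \<in> N \<and> (\<forall>j<rk. smooth_at M x (d j)) \<and>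
      (\<forall>y\<in>N. t i y = (\<Sum>j<rk. d j y *\<^sub>R \<tau> j y))"
    proof (cases "i < n")
      case True
      obtain d N where "open N" "x \<in> N" "\<And>j. j < rk \<Longrightarrow> smooth_at M x (d j)"
        "\<And>y. y \<in> N \<Longrightarrow> t i y = (\<Sum>j<rk. d j y *\<^sub>R \<tau> j y)"
        by (rule smooth_sec_at_coeffs[OF t[OF True] f]) (rule that)
      then show ?thesis by (intro exI[of _ N] exI[of _ d]) simp
    qed simp
  qed
  then obtain N d where N: "\<And>i. i < n \<Longrightarrow> open (N i) \<and> x \<in> N i \<and> (\<forall>j<rk. smooth_at M x (d i j)) \<and>
      (\<forall>y\<in>N i. t i y = (\<Sum>j<rk. d i j y *\<^sub>R \<tau> j y))"
    by metis
  show ?thesis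
  proof (rule that[of "U \<inter> (\<Inter>i<n. N i)" d])
    show "open (U \<inter> (\<Inter>i<n. N i))"
      by (intro open_Int open_INT finite_lessThan ballI frame_props(1)[OF f(1)]) (simp add: N)
    show "x \<in> U \<inter> (\<Inter>i<n. N i)" by (simp add: N f(2))
    show "smooth_at M x (d i j)" if "i < n" "j < rk" for i j using N[OF that(1)] that(2) by simp
    show "t i y = (\<Sum>j<rk. d i j y *\<^sub>R \<tau> j y)" if "i < n" "y \<in> U \<inter> (\<Inter>i<n. N i)" for i y
      using N[OF that(1)] that by simp
  qed simp
qed

text \<open>The zero section, a change away from the point, multiples and linear combinations are
  the instances below, with 0, 1 and 2 summands.\<close>

lemma smooth_sec_at_combination:
  fixes n :: nat
  assumes c: "\<And>i. i < n \<Longrightarrow> smooth_at M x (c i)" and t: "\<And>i. i < n \<Longrightarrow> smooth_sec_at M E x (t i)"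
    and N: "open N" "x \<in> N" "\<And>y. y \<in> N \<Longrightarrow> s y = (\<Sum>i<n. c i y *\<^sub>R t i y)"
  shows "smooth_sec_at M E x s"
proof -
  obtain U \<tau> where f: "(U, \<tau>) \<in> frames E" "x \<in> U" by (rule frame_at)
  obtain d N' where d: "open N'" "x \<in> N'" "N' \<subseteq> U" "\<And>i j. i < n \<Longrightarrow> j < rk \<Longrightarrow> smooth_at M x (d i j)"
    "\<And>i y. i < n \<Longrightarrow> y \<in> N' \<Longrightarrow> t i y = (\<Sum>j<rk. d i j y *\<^sub>R \<tau> j y)"
    by (rule smooth_sec_at_family_coeffs[of n x t, OF _ f]) (rule t, assumption, rule that)
  show ?thesis
  proof (rule smooth_sec_at_frameI[OF f])
    show "smooth_at M x (\<lambda>y. \<Sum>i<n. c i y * d i j y)" if "j < rk" for j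
      by (rule smooth_at_sum) (simp_all add: smooth_at_mult c d(4) that)
    show "open (N \<inter> N')" "x \<in> N \<inter> N'" using N d by auto
    show "s y = (\<Sum>j<rk. (\<Sum>i<n. c i y * d i j y) *\<^sub>R \<tau> j y)" if "y \<in> N \<inter> N'" for y
    proof -
      have "s y = (\<Sum>i<n. c i y *\<^sub>R (\<Sum>j<rk. d i j y *\<^sub>R \<tau> j y))" using N(3)[of y] d(5)[of _ y] that by simp
      also have "\<dots> = (\<Sum>i<n. \<Sum>j<rk. (c i y * d i j y) *\<^sub>R \<tau> j y)" by (simp add: scaleR_sum_right)
      also have "\<dots> = (\<Sum>j<rk. \<Sum>i<n. (c i y * d i j y) *\<^sub>R \<tau> j y)" by (rule sum.swap)
      finally show ?thesis by (simp add: scaleR_sum_left)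
    qed
  qed
qed

text \<open>The family only has to be independent at x and may span less than the fibre. Comparing
  coordinates in an ambient frame gives an overdetermined system for the coefficients, to which
  \<open>smooth_solution\<close> applies.\<close>

lemma smooth_at_coefficients:
  fixes n :: nat
  assumes t: "\<And>j. j < n \<Longrightarrow> smooth_sec_at M E x (t j)" and s: "smooth_sec_at M E x s"
    and ind: "\<And>k. (\<Sum>j<n. k j *\<^sub>R t j x) = 0 \<Longrightarrow> (\<forall>j<n. k j = 0)"
    and N: "open N" "x \<in> N" "\<And>y. y \<in> N \<Longrightarrow> s y = (\<Sum>j<n. c j y *\<^sub>R t j y)" and "j < n"
  shows "smooth_at M x (c j)"
proof -
  obtain U \<tau> where f: "(U, \<tau>) \<in> frames E" "x \<in> U" by (rule frame_at)
  obtain d N' where d: "open N'" "x \<in> N'" "N' \<subseteq> U" "\<And>i j. i < n \<Longrightarrow> j < rk \<Longrightarrow> smooth_at M x (d i j)"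
    "\<And>i y. i < n \<Longrightarrow> y \<in> N' \<Longrightarrow> t i y = (\<Sum>j<rk. d i j y *\<^sub>R \<tau> j y)"
    by (rule smooth_sec_at_family_coeffs[of n x t, OF _ f]) (rule t, assumption, rule that)
  obtain v N'' where v: "open N''" "x \<in> N''" "\<And>j. j < rk \<Longrightarrow> smooth_at M x (v j)"
    "\<And>y. y \<in> N'' \<Longrightarrow> s y = (\<Sum>j<rk. v j y *\<^sub>R \<tau> j y)" "N'' \<subseteq> U"
    by (rule smooth_sec_at_coeffs[OF s f]) (rule that)
  have comb: "(\<Sum>j<n. k j *\<^sub>R t j y) = (\<Sum>l<rk. (\<Sum>j<n. d j l y * k j) *\<^sub>R \<tau> l y)" if "y \<in> N'" for y k
  proof -
    have "(\<Sum>j<n. k j *\<^sub>R t j y) = (\<Sum>j<n. k j *\<^sub>R (\<Sum>l<rk. d j l y *\<^sub>R \<tau> l y))" using d(5) that by simp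
    also have "\<dots> = (\<Sum>j<n. \<Sum>l<rk. (d j l y * k j) *\<^sub>R \<tau> l y)" by (simp add: scaleR_sum_right mult.commute)
    also have "\<dots> = (\<Sum>l<rk. \<Sum>j<n. (d j l y * k j) *\<^sub>R \<tau> l y)" by (rule sum.swap)
    finally show ?thesis by (simp add: scaleR_sum_left)
  qed
  show ?thesis
  proof (rule smooth_solution[OF M, of "{..<rk}" n "\<lambda>l j. d j l" x v "N \<inter> N' \<inter> N''" c])
    show "trivial_kernel {..<rk} n (\<lambda>l j. d j l x)"
      unfolding trivial_kernel_def
    proof (intro allI impI)
      fix k j assume k: "\<forall>l\<in>{..<rk}. (\<Sum>j<n. d j l x * k j) = 0" and j: "j < n"
      have "(\<Sum>j<n. k j *\<^sub>R t j x) = 0" unfolding comb[OF d(2)] using k by simp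
      then show "k j = 0" using ind j by simp
    qed
    show "open (N \<inter> N' \<inter> N'')" "x \<in> N \<inter> N' \<inter> N''" using N d v by auto
    show "(\<Sum>j<n. d j l y * c j y) = v l y" if y: "y \<in> N \<inter> N' \<inter> N''" and l: "l \<in> {..<rk}" for y l
    proof -
      have b: "basis_of rk (fibre E y) (\<lambda>j. \<tau> j y)" by (rule frame_props(2)[OF f(1)]) (use d(3) y in blast)
      have "(\<Sum>l<rk. (\<Sum>j<n. d j l y * c j y) *\<^sub>R \<tau> l y) = (\<Sum>l<rk. v l y *\<^sub>R \<tau> l y)"
        using comb[of y "\<lambda>j. c j y"] N(3)[of y] v(4)[of y] y by simp
      from basis_of_unique[OF b this] show ?thesis using l by simp
    qed
  qed (use d(4) v(3) \<open>j < n\<close> in simp_all)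
qed

lemma smooth_sec_at_zero: "smooth_sec_at M E x (\<lambda>y. 0)"
  by (rule smooth_sec_at_combination[of 0 x "\<lambda>_ _. 0" "\<lambda>_ _. 0" UNIV]) simp_all

lemma smooth_sec_at_cong:
  assumes "smooth_sec_at M E x s" "open N" "x \<in> N" "\<And>y. y \<in> N \<Longrightarrow> s' y = s y"
  shows "smooth_sec_at M E x s'"
  by (rule smooth_sec_at_combination[of 1 x "\<lambda>_ _. 1" "\<lambda>_. s" N]) (simp_all add: assms smooth_at_const)

lemma smooth_sec_at_scale:
  assumes "smooth_at M x f" "smooth_sec_at M E x s"
  shows "smooth_sec_at M E x (\<lambda>y. f y *\<^sub>R s y)"
  by (rule smooth_sec_at_combination[of 1 x "\<lambda>_. f" "\<lambda>_. s" UNIV]) (simp_all add: assms)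

lemma smooth_sec_at_lin:
  assumes "smooth_sec_at M E x s" "smooth_sec_at M E x s'"
  shows "smooth_sec_at M E x (\<lambda>y. a *\<^sub>R s y + b *\<^sub>R s' y)"
  by (rule smooth_sec_at_combination[of 2 x "\<lambda>i _. if i = 0 then a else b" "\<lambda>i. if i = 0 then s else s'" UNIV])
     (simp_all add: assms smooth_at_const lessThan_Suc numeral_2_eq_2)

text \<open>Every point lies in the open set W or in the open complement of K; on the first the
  section is a smooth multiple of t, on the second it is zero.\<close>

lemma cutoff_section:
  assumes t: "smooth_section_on M E W t" and W: "open W" and h: "h \<in> smooth_funs M"
    and K: "closed K" "K \<subseteq> W" "\<And>y. y \<notin> K \<Longrightarrow> h y = 0"
  shows "(\<lambda>y. if y \<in> W then h y *\<^sub>R t y else 0) \<in> sections M E"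
  unfolding sections_iff
proof
  fix x
  show "smooth_sec_at M E x (\<lambda>y. if y \<in> W then h y *\<^sub>R t y else 0)"
  proof (cases "x \<in> K")
    case True
    then have x: "x \<in> W" using K by blast
    have "smooth_at M x h" using h smooth_funs_iff[OF M] by blast
    then have "smooth_sec_at M E x (\<lambda>y. h y *\<^sub>R t y)"
      by (rule smooth_sec_at_scale[OF _ smooth_sec_at_of_on[OF t W x]])
    then show ?thesis by (rule smooth_sec_at_cong[OF _ W x]) simp
  next
    case False
    show ?thesis by (rule smooth_sec_at_cong[OF smooth_sec_at_zero, of "- K"]) (use False K in auto)
  qed
qed

end

section \<open>Forms of low degree\<close>

definition form1 :: "('m \<Rightarrow> 'v set) \<Rightarrow> ('m \<Rightarrow> 'v \<Rightarrow> 'l::zero) \<Rightarrow> 'm \<Rightarrow> 'v list \<Rightarrow> 'l" where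
  "form1 A f x vs = (if length vs = 1 \<and> set vs \<subseteq> A x then f x (hd vs) else 0)"

definition form2 :: "('m \<Rightarrow> 'v set) \<Rightarrow> ('m \<Rightarrow> 'v \<Rightarrow> 'v \<Rightarrow> 'l::zero) \<Rightarrow> 'm \<Rightarrow> 'v list \<Rightarrow> 'l" where
  "form2 A f x vs = (if length vs = 2 \<and> set vs \<subseteq> A x then f x (vs ! 0) (vs ! 1) else 0)"

lemma form1_apply: "u \<in> A x \<Longrightarrow> form1 A f x [u] = f x u"
  by (simp add: form1_def)

lemma form2_apply: "u \<in> A x \<Longrightarrow> v \<in> A x \<Longrightarrow> form2 A f x [u, v] = f x u v"
  by (simp add: form2_def)

lemma formsI:
  assumes "\<And>x vs. set vs \<subseteq> A x \<Longrightarrow> int (length vs) = k \<Longrightarrow> w x vs \<in> fibre L x"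
    "\<And>x vs. \<not> (set vs \<subseteq> A x \<and> int (length vs) = k) \<Longrightarrow> w x vs = 0"
    "\<And>x us vs. set us \<subseteq> A x \<Longrightarrow> set vs \<subseteq> A x \<Longrightarrow> lin_on (A x) (\<lambda>u. w x (us @ u # vs))"
    "\<And>x vs. \<not> distinct vs \<Longrightarrow> w x vs = 0"
    "\<And>Xs. set Xs \<subseteq> sub_sections M E A \<Longrightarrow> int (length Xs) = k \<Longrightarrow> (\<lambda>x. w x (map (\<lambda>X. X x) Xs)) \<in> sections M L"
  shows "w \<in> forms M E A L k"
  unfolding forms_def alt_maps_def using assms by simp

lemma
  assumes "w \<in> forms M E A L k"
  shows form_mem: "set vs \<subseteq> A x \<Longrightarrow> int (length vs) = k \<Longrightarrow> w x vs \<in> fibre L x"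
    and form_zero: "\<not> (set vs \<subseteq> A x \<and> int (length vs) = k) \<Longrightarrow> w x vs = 0"
    and form_lin: "set us \<subseteq> A x \<Longrightarrow> set vs \<subseteq> A x \<Longrightarrow> lin_on (A x) (\<lambda>u. w x (us @ u # vs))"
    and form_distinct: "\<not> distinct vs \<Longrightarrow> w x vs = 0"
    and form_smooth: "set Xs \<subseteq> sub_sections M E A \<Longrightarrow> int (length Xs) = k \<Longrightarrow>
      (\<lambda>x. w x (map (\<lambda>X. X x) Xs)) \<in> sections M L"
proof -
  have 1: "\<forall>x. w x \<in> alt_maps k (A x) (fibre L x)" and
    2: "\<forall>Xs. set Xs \<subseteq> sub_sections M E A \<and> int (length Xs) = k \<longrightarrow> (\<lambda>x. w x (map (\<lambda>X. X x) Xs)) \<in> sections M L"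
    using assms unfolding forms_def mem_Collect_eq by (rule conjunct1, rule conjunct2)
  from spec[OF 1, of x] have a: "(\<forall>vs. set vs \<subseteq> A x \<and> int (length vs) = k \<longrightarrow> w x vs \<in> fibre L x) \<and>
    (\<forall>vs. \<not> (set vs \<subseteq> A x \<and> int (length vs) = k) \<longrightarrow> w x vs = 0) \<and>
    (\<forall>us vs. set us \<union> set vs \<subseteq> A x \<longrightarrow> lin_on (A x) (\<lambda>u. w x (us @ u # vs))) \<and>
    (\<forall>vs. \<not> distinct vs \<longrightarrow> w x vs = 0)"
    unfolding alt_maps_def mem_Collect_eq .
  note b = conjunct2[OF a]
  note c = conjunct2[OF b]
  show "set vs \<subseteq> A x \<Longrightarrow> int (length vs) = k \<Longrightarrow> w x vs \<in> fibre L x" using conjunct1[OF a] by simp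
  show "\<not> (set vs \<subseteq> A x \<and> int (length vs) = k) \<Longrightarrow> w x vs = 0" using conjunct1[OF b] by simp
  show "set us \<subseteq> A x \<Longrightarrow> set vs \<subseteq> A x \<Longrightarrow> lin_on (A x) (\<lambda>u. w x (us @ u # vs))" using conjunct1[OF c] by simp
  show "\<not> distinct vs \<Longrightarrow> w x vs = 0" using conjunct2[OF c] by simp
  show "set Xs \<subseteq> sub_sections M E A \<Longrightarrow> int (length Xs) = k \<Longrightarrow>
      (\<lambda>x. w x (map (\<lambda>X. X x) Xs)) \<in> sections M L" using 2 by simp
qed

lemma form_eqI:
  assumes "w \<in> forms M E A L k" "w' \<in> forms M E A L k"
    "\<And>x vs. set vs \<subseteq> A x \<Longrightarrow> int (length vs) = k \<Longrightarrow> w x vs = w' x vs"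
  shows "w = w'"
proof (intro ext)
  fix x vs show "w x vs = w' x vs"
    using assms(3)[of vs x] form_zero[OF assms(1), of vs x] form_zero[OF assms(2), of vs x]
    by (cases "set vs \<subseteq> A x \<and> int (length vs) = k") simp_all
qed

lemma lin_onD: "lin_on S f \<Longrightarrow> u \<in> S \<Longrightarrow> v \<in> S \<Longrightarrow> f (a *\<^sub>R u + b *\<^sub>R v) = a *\<^sub>R f u + b *\<^sub>R f v"
  unfolding lin_on_def by simp

lemma lin_on_add: "lin_on S f \<Longrightarrow> u \<in> S \<Longrightarrow> v \<in> S \<Longrightarrow> f (u + v) = f u + f v"
  using lin_onD[of S f u v 1 1] by simp

lemma lin_on_scale: "lin_on S f \<Longrightarrow> u \<in> S \<Longrightarrow> f (a *\<^sub>R u) = a *\<^sub>R f u"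
  using lin_onD[of S f u u a 0] by simp

lemma lin_on_zero: "lin_on S f \<Longrightarrow> u \<in> S \<Longrightarrow> f 0 = 0"
  using lin_on_scale[of S f u 0] by simp

lemma lin_on_diff: "lin_on S f \<Longrightarrow> u \<in> S \<Longrightarrow> v \<in> S \<Longrightarrow> f (u - v) = f u - f v"
  using lin_onD[of S f u v 1 "-1"] by simp

lemma lin_on_sum:
  assumes "lin_on S f" "subspace S" "finite I" "\<And>i. i \<in> I \<Longrightarrow> u i \<in> S"
  shows "f (\<Sum>i\<in>I. c i *\<^sub>R u i) = (\<Sum>i\<in>I. c i *\<^sub>R f (u i))"
  using assms(3,4)
proof (induction I rule: finite_induct)
  case empty
  then show ?case using lin_on_zero[OF assms(1) subspace_0[OF assms(2)]] by simp
next
  case (insert i I)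
  have "(\<Sum>i\<in>I. c i *\<^sub>R u i) \<in> S" by (rule subspace_sum[OF assms(2)]) (simp add: insert subspace_scale[OF assms(2)])
  then show ?case using insert lin_onD[OF assms(1), of "u i" "\<Sum>i\<in>I. c i *\<^sub>R u i" "c i" 1] by simp
qed

lemma form1_in_forms:
  assumes A: "\<And>x. subspace (A x)" and lin: "\<And>x. lin_on (A x) (f x)"
    and L: "\<And>x u. u \<in> A x \<Longrightarrow> f x u \<in> fibre L x"
    and sm: "\<And>X. X \<in> sub_sections M E A \<Longrightarrow> (\<lambda>x. f x (X x)) \<in> sections M L"
  shows "form1 A f \<in> forms M E A L 1"
proof (rule formsI)
  show "form1 A f x vs \<in> fibre L x" if "set vs \<subseteq> A x" "int (length vs) = 1" for x vs
    using that L[of "hd vs" x] by (cases vs) (auto simp: form1_def)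
  show "form1 A f x vs = 0" if "\<not> (set vs \<subseteq> A x \<and> int (length vs) = 1)" for x vs
    using that unfolding form1_def by auto
  show "lin_on (A x) (\<lambda>u. form1 A f x (us @ u # vs))" if "set us \<subseteq> A x" "set vs \<subseteq> A x" for x us vs
  proof (cases "us = [] \<and> vs = []")
    case True
    have "a *\<^sub>R u + b *\<^sub>R v \<in> A x" if "u \<in> A x" "v \<in> A x" for a b u v
      using A[of x] that by (simp add: subspace_add subspace_scale)
    then show ?thesis unfolding lin_on_def using True lin_onD[OF lin] by (simp add: form1_apply)
  next
    case False
    then have "form1 A f x (us @ u # vs) = 0" for u unfolding form1_def by (cases us) auto
    then show ?thesis unfolding lin_on_def by simp
  qed
  show "form1 A f x vs = 0" if "\<not> distinct vs" for x vs
    using that unfolding form1_def by (cases vs) auto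
  show "(\<lambda>x. form1 A f x (map (\<lambda>X. X x) Xs)) \<in> sections M L"
    if Xs: "set Xs \<subseteq> sub_sections M E A" "int (length Xs) = 1" for Xs
  proof -
    obtain X where X: "Xs = [X]" using Xs(2) by (cases Xs) auto
    then have XA: "X \<in> sub_sections M E A" using Xs(1) by simp
    then have "X x \<in> A x" for x unfolding sub_sections_def by simp
    then show ?thesis using sm[OF XA] X by (simp add: form1_apply)
  qed
qed

text \<open>Linearity in the first entry is inherited from the second through skewness, and skewness
  makes the diagonal vanish because the scalars are real.\<close>

lemma form2_in_forms:
  assumes A: "\<And>x. subspace (A x)" and lin: "\<And>x u. u \<in> A x \<Longrightarrow> lin_on (A x) (f x u)"
    and skew: "\<And>x u v. u \<in> A x \<Longrightarrow> v \<in> A x \<Longrightarrow> f x v u = - f x u v"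
    and L: "\<And>x u v. u \<in> A x \<Longrightarrow> v \<in> A x \<Longrightarrow> f x u v \<in> fibre L x"
    and sm: "\<And>X Y. X \<in> sub_sections M E A \<Longrightarrow> Y \<in> sub_sections M E A \<Longrightarrow> (\<lambda>x. f x (X x) (Y x)) \<in> sections M L"
  shows "form2 A f \<in> forms M E A L 2"
proof (rule formsI)
  have two: "\<exists>u v. vs = [u, v]" if "length vs = 2" for vs :: "'z list"
    using that by (auto simp: numeral_2_eq_2 length_Suc_conv)
  show "form2 A f x vs \<in> fibre L x" if "set vs \<subseteq> A x" "int (length vs) = 2" for x vs
    using that L two[of vs] by (auto simp: form2_def)
  show "form2 A f x vs = 0" if "\<not> (set vs \<subseteq> A x \<and> int (length vs) = 2)" for x vs
    using that unfolding form2_def by auto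
  have comb: "a *\<^sub>R u + b *\<^sub>R v \<in> A x" if "u \<in> A x" "v \<in> A x" for a b u v x
    using A[of x] that by (simp add: subspace_add subspace_scale)
  show "lin_on (A x) (\<lambda>u. form2 A f x (us @ u # vs))" if us: "set us \<subseteq> A x" "set vs \<subseteq> A x" for x us vs
  proof -
    consider w where "us = [w]" "vs = []" | w where "us = []" "vs = [w]" | "length us + length vs \<noteq> 1"
      by (cases us; cases vs) auto
    then show ?thesis
    proof cases
      case 1
      then show ?thesis unfolding lin_on_def using us comb lin_onD[OF lin] by (simp add: form2_apply)
    next
      case 2
      have w: "w \<in> A x" using 2 us by simp
      have "f x (a *\<^sub>R u + b *\<^sub>R v) w = a *\<^sub>R f x u w + b *\<^sub>R f x v w" if "u \<in> A x" "v \<in> A x" for a b u v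
        using skew[OF w comb[OF that], of a b] skew[OF w that(1)] skew[OF w that(2)] lin_onD[OF lin[OF w] that, of a b]
        by simp
      then show ?thesis unfolding lin_on_def using w comb 2 by (simp add: form2_apply)
    next
      case 3
      then have "form2 A f x (us @ u # vs) = 0" for u unfolding form2_def by simp
      then show ?thesis unfolding lin_on_def by simp
    qed
  qed
  show "form2 A f x vs = 0" if "\<not> distinct vs" for x vs
  proof (cases "length vs = 2 \<and> set vs \<subseteq> A x")
    case True
    then obtain u v where uv: "vs = [u, v]" using two by blast
    then have "u = v" using that by auto
    then have "form2 A f x vs = f x u u" "u \<in> A x" using uv True by (simp_all add: form2_apply)
    then show ?thesis using skew[of u x u] by (simp add: eq_neg_iff_add_eq_0 scaleR_2[symmetric])
  next
    case False
    then show ?thesis unfolding form2_def by auto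
  qed
  show "(\<lambda>x. form2 A f x (map (\<lambda>X. X x) Xs)) \<in> sections M L"
    if Xs: "set Xs \<subseteq> sub_sections M E A" "int (length Xs) = 2" for Xs
  proof -
    obtain X Y where X: "Xs = [X, Y]" using Xs(2) by (auto simp: numeral_2_eq_2 length_Suc_conv)
    then have XA: "X \<in> sub_sections M E A" "Y \<in> sub_sections M E A" using Xs(1) by simp_all
    then have "X x \<in> A x" "Y x \<in> A x" for x unfolding sub_sections_def by simp_all
    then show ?thesis using sm[OF XA] X by (simp add: form2_apply)
  qed
qed

lemma form1_props:
  assumes "w \<in> forms M E A L 1"
  shows "lin_on (A x) (\<lambda>u. w x [u])" "u \<in> A x \<Longrightarrow> w x [u] \<in> fibre L x"
    "X \<in> sub_sections M E A \<Longrightarrow> (\<lambda>x. w x [X x]) \<in> sections M L"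
    "length vs \<noteq> 1 \<Longrightarrow> w x vs = 0" "\<not> set vs \<subseteq> A x \<Longrightarrow> w x vs = 0"
  using form_lin[OF assms, of "[]" x "[]"] form_mem[OF assms, of "[u]" x] form_smooth[OF assms, of "[X]"]
    form_zero[OF assms, of vs x] by simp_all

lemma form2_props:
  assumes "w \<in> forms M E A L 2"
  shows "u \<in> A x \<Longrightarrow> lin_on (A x) (\<lambda>v. w x [u, v])" "v \<in> A x \<Longrightarrow> lin_on (A x) (\<lambda>u. w x [u, v])"
    "u \<in> A x \<Longrightarrow> v \<in> A x \<Longrightarrow> w x [u, v] \<in> fibre L x"
    "X \<in> sub_sections M E A \<Longrightarrow> Y \<in> sub_sections M E A \<Longrightarrow> (\<lambda>x. w x [X x, Y x]) \<in> sections M L"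
    "length vs \<noteq> 2 \<Longrightarrow> w x vs = 0" "\<not> set vs \<subseteq> A x \<Longrightarrow> w x vs = 0"
  using form_lin[OF assms, of "[u]" x "[]"] form_lin[OF assms, of "[]" x "[v]"]
    form_mem[OF assms, of "[u, v]" x] form_smooth[OF assms, of "[X, Y]"]
    form_zero[OF assms, of vs x] by simp_all

text \<open>Polarisation of the vanishing on repeated entries.\<close>

lemma form2_skew:
  assumes w: "w \<in> forms M E A L 2" and A: "subspace (A x)" and u: "u \<in> A x" "v \<in> A x"
  shows "w x [v, u] = - w x [u, v]"
proof -
  have uv: "u + v \<in> A x" using A u by (rule subspace_add)
  have "0 = w x [u + v, u + v]" using form_distinct[OF w, of "[u + v, u + v]" x] by simp
  also have "\<dots> = w x [u, u + v] + w x [v, u + v]" by (rule lin_on_add[OF form2_props(2)[OF w uv] u])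
  also have "w x [u, u + v] = w x [u, u] + w x [u, v]" by (rule lin_on_add[OF form2_props(1)[OF w u(1)] u])
  also have "w x [v, u + v] = w x [v, u] + w x [v, v]" by (rule lin_on_add[OF form2_props(1)[OF w u(2)] u])
  also have "w x [u, u] = 0" using form_distinct[OF w, of "[u, u]" x] by simp
  also have "w x [v, v] = 0" using form_distinct[OF w, of "[v, v]" x] by simp
  finally show ?thesis by (simp add: eq_neg_iff_add_eq_0 add.commute)
qed

lemma sections_trivial_line: "sections M trivial_line = smooth_funs M"
proof (intro set_eqI iffI)
  fix s assume "s \<in> sections M trivial_line"
  then obtain c :: "nat \<Rightarrow> 'a \<Rightarrow> real" where "smooth_fun_on M UNIV (c 0)" "\<And>x. s x = c 0 x"
    unfolding sections_def smooth_section_on_def trivial_line_def by auto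
  moreover then have "s = c 0" by auto
  ultimately show "s \<in> smooth_funs M" unfolding smooth_funs_def by simp
next
  fix s assume "s \<in> smooth_funs M"
  then show "s \<in> sections M trivial_line"
    unfolding sections_def smooth_section_on_def trivial_line_def smooth_funs_def
    by (auto intro!: exI[of _ "\<lambda>_. s"])
qed

lemma fibre_trivial_line: "fibre trivial_line x = UNIV"
  unfolding trivial_line_def by simp

lemma sum_lessThan_add: "(\<Sum>j<r + (n::nat). f j) = (\<Sum>j<r. f j) + (\<Sum>j<n. f (r + j))"
  by (induction n) (simp_all add: add.assoc)

section \<open>Subbundles\<close>

text \<open>A partition of unity with one member: \<open>h\<close> times the identity of \<open>A\<close> is the sum of the
  globally defined \<open>\<omega> i \<otimes> s i\<close>. It gives global sections through given vectors, shows that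
  \<open>C\<^sup>\<infinity>(M)\<close>-linear expressions in global sections are pointwise, and decomposes \<open>h \<eta>\<close>.\<close>

definition partial_frame_at ::
    "('m::topological_space, 'e::euclidean_space) manifold \<Rightarrow> ('m, 'v::real_vector) vbundle \<Rightarrow> ('m \<Rightarrow> 'v set) \<Rightarrow>
      nat \<Rightarrow> 'm \<Rightarrow> 'm set \<Rightarrow> (nat \<Rightarrow> 'm \<Rightarrow> 'v) \<Rightarrow> (nat \<Rightarrow> 'm \<Rightarrow> 'v list \<Rightarrow> real) \<Rightarrow> ('m \<Rightarrow> real) \<Rightarrow> bool" where
  "partial_frame_at M E A r x U s \<omega> h \<longleftrightarrow> open U \<and> x \<in> U \<and> h \<in> smooth_funs M \<and> h x = 1 \<and>
     (\<forall>i<r. s i \<in> sub_sections M E A) \<and> (\<forall>i<r. \<omega> i \<in> forms M E A trivial_line 1) \<and>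
     (\<forall>y. \<forall>v\<in>A y. h y *\<^sub>R v = (\<Sum>i<r. \<omega> i y [v] *\<^sub>R s i y)) \<and>
     (\<forall>y\<in>U. basis_of r (A y) (\<lambda>i. s i y))"

lemma sub_sections_iff: "s \<in> sub_sections M E A \<longleftrightarrow> s \<in> sections M E \<and> (\<forall>x. s x \<in> A x)"
  unfolding sub_sections_def by simp

context smooth_bundle begin

lemma subbundleE:
  assumes "subbundle M E A"
  obtains r where "\<And>x. \<exists>U t. open U \<and> x \<in> U \<and>
        (\<forall>j<r. smooth_section_on M E U (t j)) \<and> (\<forall>y\<in>U. basis_of r (A y) (\<lambda>j. t j y))"
proof -
  have "\<exists>r. \<forall>x. \<exists>U t. open U \<and> x \<in> U \<and>
        (\<forall>j<r. smooth_section_on M E U (t j)) \<and> (\<forall>y\<in>U. basis_of r (A y) (\<lambda>j. t j y))"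
    using assms unfolding subbundle_def by (rule conjunct2)
  then obtain r where "\<forall>x. \<exists>U t. open U \<and> x \<in> U \<and>
        (\<forall>j<r. smooth_section_on M E U (t j)) \<and> (\<forall>y\<in>U. basis_of r (A y) (\<lambda>j. t j y))" by (rule exE)
  then show ?thesis by (intro that[of r]) simp
qed

lemma subbundle_subspace: assumes "subbundle M E A" shows "subspace (A x)"
proof -
  obtain r where "\<And>x. \<exists>U t. open U \<and> x \<in> U \<and>
        (\<forall>j<r. smooth_section_on M E U (t j)) \<and> (\<forall>y\<in>U. basis_of r (A y) (\<lambda>j. t j y))"
    using subbundleE[OF assms] by metis
  then obtain U t where "x \<in> U" "\<forall>y\<in>U. basis_of r (A y) (\<lambda>j. t j y)" by metis
  then have "basis_of r (A x) (\<lambda>j. t j x)" by simp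
  then show ?thesis by (rule basis_of_subspace)
qed

lemma subbundle_fibre: "subbundle M E (fibre E)"
  unfolding subbundle_def
proof (intro conjI exI[of _ rk] allI)
  fix x
  obtain U t where f: "(U, t) \<in> frames E" "x \<in> U" by (rule frame_at)
  show "\<exists>U t. open U \<and> x \<in> U \<and> (\<forall>j<rk. smooth_section_on M E U (t j)) \<and>
      (\<forall>y\<in>U. basis_of rk (fibre E y) (\<lambda>j. t j y))"
    using frame_props[OF f(1)] f(2) by (intro exI[of _ U] exI[of _ t]) simp
qed simp

text \<open>The members of a local frame and the coordinate functions in it both have to be cut off
  to become global. The cut-off members still form a basis where the bump function is nonzero, and
  the neighbourhood is shrunk accordingly.\<close>

lemma partial_frame_exists:
  assumes A: "subbundle M E A"
  shows "\<exists>r. \<forall>x. \<exists>U s \<omega> h. partial_frame_at M E A r x U s \<omega> h"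
proof -
  obtain r where r: "\<And>x. \<exists>U t. open U \<and> x \<in> U \<and>
        (\<forall>j<r. smooth_section_on M E U (t j)) \<and> (\<forall>y\<in>U. basis_of r (A y) (\<lambda>j. t j y))"
    using subbundleE[OF A] by metis
  note sub = subbundle_subspace[OF A]
  have "\<exists>U s \<omega> h. partial_frame_at M E A r x U s \<omega> h" for x
  proof -
    obtain W t where W: "open W" "x \<in> W" and t': "\<forall>j<r. smooth_section_on M E W (t j)"
      and b': "\<forall>y\<in>W. basis_of r (A y) (\<lambda>j. t j y)" using r by metis
    have t: "smooth_section_on M E W (t j)" if "j < r" for j using t' that by simp
    have b: "basis_of r (A y) (\<lambda>j. t j y)" if "y \<in> W" for y using b' that by simp
    obtain h K where h: "h \<in> smooth_funs M" "h x = 1" and K: "closed K" "K \<subseteq> W" "\<And>y. y \<notin> K \<Longrightarrow> h y = 0"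
      by (rule exists_bump[OF M W]) (rule that)
    have h_at: "smooth_at M y h" for y using h(1) smooth_funs_iff[OF M] by blast
    define s where "s = (\<lambda>j y. if y \<in> W then h y *\<^sub>R t j y else 0)"
    define cf where "cf = (\<lambda>y v. SOME d. v = (\<Sum>j<r. d j *\<^sub>R t j y))"
    have cf: "v = (\<Sum>j<r. cf y v j *\<^sub>R t j y)" if y: "y \<in> W" and v: "v \<in> A y" for y v
    proof -
      obtain d where "v = (\<Sum>j<r. d j *\<^sub>R t j y)" by (rule basis_of_coeffs[OF b[OF y] v])
      then show ?thesis unfolding cf_def by (rule someI[of "\<lambda>d. v = (\<Sum>j<r. d j *\<^sub>R t j y)" d])
    qed
    define g where "g = (\<lambda>i y v. if y \<in> W then h y * cf y v i else 0)"
    define \<omega> where "\<omega> = (\<lambda>i. form1 A (g i))"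
    have s_sec: "s j \<in> sub_sections M E A" if "j < r" for j
    proof -
      have "s j \<in> sections M E" unfolding s_def by (rule cutoff_section[OF t[OF that] W(1) h(1) K])
      moreover have "s j y \<in> A y" for y
        unfolding s_def using basis_of_mem[OF b that, of y] sub[of y] by (simp add: subspace_scale subspace_0)
      ultimately show ?thesis unfolding sub_sections_iff by simp
    qed
    have \<omega>: "\<omega> i \<in> forms M E A trivial_line 1" if i: "i < r" for i
      unfolding \<omega>_def
    proof (rule form1_in_forms[OF sub])
      show "lin_on (A y) (g i y)" for y
        unfolding lin_on_def
      proof (intro allI ballI)
        fix a b u v assume u: "u \<in> A y" and v: "v \<in> A y"
        show "g i y (a *\<^sub>R u + b *\<^sub>R v) = a *\<^sub>R g i y u + b *\<^sub>R g i y v"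
        proof (cases "y \<in> W")
          case True
          have uv: "a *\<^sub>R u + b *\<^sub>R v \<in> A y" using sub[of y] u v by (simp add: subspace_add subspace_scale)
          have "(\<Sum>j<r. cf y (a *\<^sub>R u + b *\<^sub>R v) j *\<^sub>R t j y) = a *\<^sub>R u + b *\<^sub>R v"
            using cf[OF True uv] by (rule sym)
          also have "\<dots> = a *\<^sub>R (\<Sum>j<r. cf y u j *\<^sub>R t j y) + b *\<^sub>R (\<Sum>j<r. cf y v j *\<^sub>R t j y)"
            using cf[OF True u] cf[OF True v] by simp
          also have "\<dots> = (\<Sum>j<r. (a * cf y u j + b * cf y v j) *\<^sub>R t j y)"
            by (simp add: scaleR_sum_right sum.distrib scaleR_left_distrib)
          finally have "cf y (a *\<^sub>R u + b *\<^sub>R v) i = a * cf y u i + b * cf y v i"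
            by (rule basis_of_unique[OF \<open>\<And>y. y \<in> W \<Longrightarrow> basis_of r (A y) (\<lambda>j. t j y)\<close>[OF True] _ i])
          then show ?thesis using True unfolding g_def by (simp add: algebra_simps)
        qed (simp add: g_def)
      qed
      show "g i y u \<in> fibre trivial_line y" for y u unfolding fibre_trivial_line by simp
      fix X assume X: "X \<in> sub_sections M E A"
      then have XE: "X \<in> sections M E" and XA: "\<And>y. X y \<in> A y" unfolding sub_sections_iff by simp_all
      have "smooth_at M y (\<lambda>y. g i y (X y))" for y
      proof (cases "y \<in> K")
        case True
        then have y: "y \<in> W" using K(2) by blast
        have "smooth_at M y (\<lambda>y. cf y (X y) i)"
        proof (rule smooth_at_coefficients[of r y t X])
          show "smooth_sec_at M E y (t j)" if "j < r" for j by (rule smooth_sec_at_of_on[OF t[OF that] W(1) y])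
          show "smooth_sec_at M E y X" using XE sections_iff by simp
          show "\<forall>j<r. k j = 0" if "(\<Sum>j<r. k j *\<^sub>R t j y) = 0" for k
            using basis_of_independent[OF b[OF y] that] by simp
          show "open W" "y \<in> W" by (rule W(1), rule y)
          show "X z = (\<Sum>j<r. cf z (X z) j *\<^sub>R t j z)" if "z \<in> W" for z by (rule cf[OF that XA])
        qed (rule i)
        then have "smooth_at M y (\<lambda>y. h y * cf y (X y) i)" by (rule smooth_at_mult[OF h_at])
        then show ?thesis by (rule smooth_at_cong[OF M _ W(1) y]) (simp add: g_def)
      next
        case False
        show ?thesis
          by (rule smooth_at_cong[OF M smooth_at_const[of M y 0], of "- K"]) (use False K in \<open>auto simp: g_def\<close>)
      qed
      then show "(\<lambda>y. g i y (X y)) \<in> sections M trivial_line"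
        unfolding sections_trivial_line smooth_funs_iff[OF M] by simp
    qed
    \<comment> \<open>One factor h comes from the sections and one from the coordinate forms; their
      product is the cutoff of the resulting partial frame.\<close>
    define H where "H = (\<lambda>y. h y * h y)"
    have H: "H \<in> smooth_funs M" unfolding smooth_funs_iff[OF M] H_def using smooth_at_mult[OF h_at h_at] by simp
    obtain N where N: "open N" "x \<in> N" "\<And>y. y \<in> N \<Longrightarrow> h y \<noteq> 0"
      by (rule smooth_at_nonzero[OF M h_at, of x]) (simp add: h(2), rule that)
    have fr: "H y *\<^sub>R v = (\<Sum>i<r. \<omega> i y [v] *\<^sub>R s i y)" if v: "v \<in> A y" for y v
    proof (cases "y \<in> W")
      case True
      have "H y *\<^sub>R v = H y *\<^sub>R (\<Sum>j<r. cf y v j *\<^sub>R t j y)" using cf[OF True v] by simp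
      also have "\<dots> = (\<Sum>i<r. \<omega> i y [v] *\<^sub>R s i y)"
        unfolding \<omega>_def form1_apply[of v A y, OF v] using True by (simp add: g_def s_def H_def scaleR_sum_right ac_simps)
      finally show ?thesis .
    next
      case False
      then have "h y = 0" using K by blast
      then show ?thesis using False by (simp add: H_def s_def)
    qed
    have bas: "basis_of r (A y) (\<lambda>i. s i y)" if y: "y \<in> W \<inter> N" for y
    proof -
      have hy: "h y \<noteq> 0" and yW: "y \<in> W" using y N(3) by auto
      have e: "(\<Sum>j<r. c j *\<^sub>R s j y) = (\<Sum>j<r. (c j * h y) *\<^sub>R t j y)" for c using yW by (simp add: s_def)
      have ran: "A y = range (\<lambda>c. \<Sum>j<r. c j *\<^sub>R t j y)" using b[OF yW] unfolding basis_of_iff by (rule conjunct1)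
      show ?thesis unfolding basis_of_iff
      proof (intro conjI allI impI set_eqI iffI)
        fix v assume "v \<in> A y"
        then have "v = (\<Sum>j<r. (cf y v j / h y) *\<^sub>R s j y)" unfolding e using hy cf[OF yW] by simp
        then show "v \<in> range (\<lambda>c. \<Sum>j<r. c j *\<^sub>R s j y)"
          by (rule image_eqI[of v _ "\<lambda>j. cf y v j / h y"]) simp
      next
        fix v assume "v \<in> range (\<lambda>c. \<Sum>j<r. c j *\<^sub>R s j y)"
        then obtain c where "v = (\<Sum>j<r. c j *\<^sub>R s j y)" by (rule imageE)
        then show "v \<in> A y" unfolding e using basis_of_combination_mem[OF b[OF yW], of "\<lambda>j. c j * h y"] by simp
      next
        fix k j assume "(\<Sum>j<r. k j *\<^sub>R s j y) = 0" "j < r"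
        then have "k j * h y = 0" unfolding e by (rule basis_of_independent[OF b[OF yW]])
        then show "k j = 0" using hy by simp
      qed
    qed
    have "partial_frame_at M E A r x (W \<inter> N) s \<omega> H"
      unfolding partial_frame_at_def
      using W N(1,2) H h(2) s_sec \<omega> fr bas by (simp add: open_Int H_def)
    then show ?thesis by (intro exI)
  qed
  then show ?thesis by (intro exI[of _ r]) simp
qed

text \<open>Local frames of A and B are joined into one family, independent because the fibres meet
  in zero. The coefficients of s in this family are smooth, and those on the part from A are the
  coefficients of a.\<close>

lemma projection_smooth:
  assumes A: "subbundle M E A" and B: "subbundle M E B" and AB: "\<And>x. A x \<inter> B x = {0}"
    and s: "s \<in> sections M E" and a: "\<And>x. a x \<in> A x" "\<And>x. s x - a x \<in> B x"
  shows "a \<in> sub_sections M E A"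
proof -
  obtain r where r: "\<And>x. \<exists>U t. open U \<and> x \<in> U \<and>
        (\<forall>j<r. smooth_section_on M E U (t j)) \<and> (\<forall>y\<in>U. basis_of r (A y) (\<lambda>j. t j y))"
    using subbundleE[OF A] by metis
  obtain n where n: "\<And>x. \<exists>U t. open U \<and> x \<in> U \<and>
        (\<forall>j<n. smooth_section_on M E U (t j)) \<and> (\<forall>y\<in>U. basis_of n (B y) (\<lambda>j. t j y))"
    using subbundleE[OF B] by metis
  have "smooth_sec_at M E x a" for x
  proof -
    obtain U t where U: "open U" "x \<in> U" and t: "\<forall>j<r. smooth_section_on M E U (t j)"
      and tb: "\<forall>y\<in>U. basis_of r (A y) (\<lambda>j. t j y)" using r by metis
    obtain V u where V: "open V" "x \<in> V" and u: "\<forall>j<n. smooth_section_on M E V (u j)"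
      and ub: "\<forall>y\<in>V. basis_of n (B y) (\<lambda>j. u j y)" using n by metis
    define W where "W = U \<inter> V"
    have W: "open W" "x \<in> W" using U V unfolding W_def by auto
    have "\<forall>y. \<exists>c. y \<in> W \<longrightarrow> a y = (\<Sum>j<r. c j *\<^sub>R t j y)"
    proof
      fix y show "\<exists>c. y \<in> W \<longrightarrow> a y = (\<Sum>j<r. c j *\<^sub>R t j y)"
        using basis_of_coeffs[of r "A y" "\<lambda>j. t j y" "a y"] tb a(1) unfolding W_def by (metis IntD1)
    qed
    from choice[OF this] obtain c where c: "\<And>y. y \<in> W \<Longrightarrow> a y = (\<Sum>j<r. c y j *\<^sub>R t j y)" by metis
    have "\<forall>y. \<exists>d. y \<in> W \<longrightarrow> s y - a y = (\<Sum>j<n. d j *\<^sub>R u j y)"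
    proof
      fix y show "\<exists>d. y \<in> W \<longrightarrow> s y - a y = (\<Sum>j<n. d j *\<^sub>R u j y)"
        using basis_of_coeffs[of n "B y" "\<lambda>j. u j y" "s y - a y"] ub a(2) unfolding W_def by (metis IntD2)
    qed
    from choice[OF this] obtain d where d: "\<And>y. y \<in> W \<Longrightarrow> s y - a y = (\<Sum>j<n. d y j *\<^sub>R u j y)" by metis
    define f where "f = (\<lambda>j. if j < r then t j else u (j - r))"
    define e where "e = (\<lambda>j y. if j < r then c y j else d y (j - r))"
    have f_sm: "smooth_sec_at M E x (f j)" if "j < r + n" for j
    proof (cases "j < r")
      case True
      then show ?thesis using smooth_sec_at_of_on[OF _ U, of M E "t j"] t unfolding f_def by simp
    next
      case False
      then show ?thesis using smooth_sec_at_of_on[OF _ V, of M E "u (j - r)"] u that unfolding f_def by simp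
    qed
    have sums: "(\<Sum>j<r + n. k j *\<^sub>R f j y) = (\<Sum>j<r. k j *\<^sub>R t j y) + (\<Sum>j<n. k (r + j) *\<^sub>R u j y)" for k y
      unfolding sum_lessThan_add by (simp add: f_def)
    have "smooth_at M x (\<lambda>y. e j y)" if j: "j < r" for j
    proof (rule smooth_at_coefficients[of "r + n" x f s W e j])
      show "smooth_sec_at M E x s" using s sections_iff by simp
      show "\<forall>j<r + n. k j = 0" if k: "(\<Sum>j<r + n. k j *\<^sub>R f j x) = 0" for k
      proof -
        have bA: "basis_of r (A x) (\<lambda>j. t j x)" using tb U(2) by simp
        have bB: "basis_of n (B x) (\<lambda>j. u j x)" using ub V(2) by simp
        have eq: "(\<Sum>j<r. k j *\<^sub>R t j x) = - (\<Sum>j<n. k (r + j) *\<^sub>R u j x)"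
          using k unfolding sums by (simp add: eq_neg_iff_add_eq_0)
        have "(\<Sum>j<r. k j *\<^sub>R t j x) \<in> A x" by (rule basis_of_combination_mem[OF bA])
        moreover have "(\<Sum>j<r. k j *\<^sub>R t j x) \<in> B x"
          unfolding eq by (rule subspace_neg[OF subbundle_subspace[OF B] basis_of_combination_mem[OF bB]])
        ultimately have "(\<Sum>j<r. k j *\<^sub>R t j x) \<in> A x \<inter> B x" by (rule IntI)
        then have z: "(\<Sum>j<r. k j *\<^sub>R t j x) = 0" unfolding AB by simp
        then have z': "(\<Sum>j<n. k (r + j) *\<^sub>R u j x) = 0" using eq by simp
        show ?thesis
        proof (intro allI impI)
          fix j assume j: "j < r + n"
          show "k j = 0"
          proof (cases "j < r")
            case True then show ?thesis using basis_of_independent[OF bA z] by simp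
          next
            case False
            then show ?thesis using basis_of_independent[OF bB z', of "j - r"] j by simp
          qed
        qed
      qed
      show "s y = (\<Sum>j<r + n. e j y *\<^sub>R f j y)" if "y \<in> W" for y
        using c[OF that] d[OF that] unfolding sums by (simp add: e_def algebra_simps)
    qed (use f_sm W j in simp_all)
    then have c_sm: "smooth_at M x (\<lambda>y. c y j)" if "j < r" for j using that unfolding e_def by simp
    show ?thesis
    proof (rule smooth_sec_at_combination[of r x "\<lambda>j y. c y j" t W a])
      show "smooth_sec_at M E x (t j)" if "j < r" for j
        using smooth_sec_at_of_on[OF _ U, of M E "t j"] t that by simp
    qed (use c_sm W c in simp_all)
  qed
  then show ?thesis unfolding sub_sections_iff sections_iff using a(1) by simp
qed

end

section \<open>The module of global sections\<close>

lemma fmult_apply: "fmult f s x = f x *\<^sub>R s x"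
  by (simp add: fmult_def)

lemma sum_fun_apply: "(\<Sum>i\<in>I. f i) x = (\<Sum>i\<in>I. f i x)"
  by (induction I rule: infinite_finite_induct) simp_all

context smooth_bundle begin

lemma section_lin: "s \<in> sections M E \<Longrightarrow> t \<in> sections M E \<Longrightarrow> a *\<^sub>R s + b *\<^sub>R t \<in> sections M E"
  unfolding sections_iff using smooth_sec_at_lin[of _ s t a b] by (simp add: plus_fun_def scaleR_fun_def)

lemma section_add: "s \<in> sections M E \<Longrightarrow> t \<in> sections M E \<Longrightarrow> s + t \<in> sections M E"
  using section_lin[of s t 1 1] by simp

lemma section_zero: "0 \<in> sections M E"
  unfolding sections_iff zero_fun_def using smooth_sec_at_zero by simp

lemma section_scale: "s \<in> sections M E \<Longrightarrow> a *\<^sub>R s \<in> sections M E"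
  using section_lin[of s s a 0] by simp

lemma section_diff: "s \<in> sections M E \<Longrightarrow> t \<in> sections M E \<Longrightarrow> s - t \<in> sections M E"
  using section_lin[of s t 1 "-1"] by simp

lemma section_minus: "s \<in> sections M E \<Longrightarrow> - s \<in> sections M E"
  using section_scale[of s "-1"] by simp

lemma section_fmult: "f \<in> smooth_funs M \<Longrightarrow> s \<in> sections M E \<Longrightarrow> fmult f s \<in> sections M E"
  unfolding sections_iff smooth_funs_iff[OF M] fmult_def using smooth_sec_at_scale by simp

lemma sub_section_mem: "s \<in> sub_sections M E A \<Longrightarrow> s x \<in> A x"
  unfolding sub_sections_iff by simp

lemma sub_section_section: "s \<in> sub_sections M E A \<Longrightarrow> s \<in> sections M E"
  unfolding sub_sections_iff by simp

lemma sub_section_fmult: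
  assumes A: "subbundle M E A" and "f \<in> smooth_funs M" "s \<in> sub_sections M E A"
  shows "fmult f s \<in> sub_sections M E A"
  using assms(2,3) unfolding sub_sections_iff
  by (simp add: section_fmult fmult_apply subspace_scale[OF subbundle_subspace[OF A]])

lemma sub_section_add:
  assumes A: "subbundle M E A" and "s \<in> sub_sections M E A" "t \<in> sub_sections M E A"
  shows "s + t \<in> sub_sections M E A"
  using assms(2,3) unfolding sub_sections_iff
  by (simp add: section_add subspace_add[OF subbundle_subspace[OF A]])

lemma sub_section_minus:
  assumes A: "subbundle M E A" and "s \<in> sub_sections M E A"
  shows "- s \<in> sub_sections M E A"
  using assms(2) unfolding sub_sections_iff
  by (simp add: section_minus subspace_neg[OF subbundle_subspace[OF A]])

lemma sub_section_zero: assumes A: "subbundle M E A" shows "0 \<in> sub_sections M E A"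
  unfolding sub_sections_iff by (simp add: section_zero subspace_0[OF subbundle_subspace[OF A]])

lemma sub_section_sum:
  assumes A: "subbundle M E A" and "finite I" "\<And>i. i \<in> I \<Longrightarrow> s i \<in> sub_sections M E A"
  shows "(\<Sum>i\<in>I. s i) \<in> sub_sections M E A"
  using assms(2,3) by (induction I rule: finite_induct) (simp_all add: sub_section_zero[OF A] sub_section_add[OF A])

lemma partial_frameD:
  assumes "partial_frame_at M E A r x U s \<omega> h"
  shows "open U" "x \<in> U" "h \<in> smooth_funs M" "h x = 1" "i < r \<Longrightarrow> s i \<in> sub_sections M E A"
    "i < r \<Longrightarrow> \<omega> i \<in> forms M E A trivial_line 1"
    "v \<in> A y \<Longrightarrow> h y *\<^sub>R v = (\<Sum>i<r. \<omega> i y [v] *\<^sub>R s i y)"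
    "y \<in> U \<Longrightarrow> basis_of r (A y) (\<lambda>i. s i y)"
  using assms unfolding partial_frame_at_def by simp_all

lemma form1_fun: "\<omega> \<in> forms M E A trivial_line 1 \<Longrightarrow> X \<in> sub_sections M E A \<Longrightarrow> (\<lambda>x. \<omega> x [X x]) \<in> smooth_funs M"
  using form1_props(3)[of \<omega> M E A trivial_line X] unfolding sections_trivial_line by simp

text \<open>The expansion of v in a partial frame at x, with its coefficients frozen to
  constants.\<close>

lemma section_through:
  assumes A: "subbundle M E A" and v: "v \<in> A x"
  obtains X where "X \<in> sub_sections M E A" "X x = v"
proof -
  obtain r where "\<forall>x. \<exists>U s \<omega> h. partial_frame_at M E A r x U s \<omega> h" using partial_frame_exists[OF A] by (rule exE)
  then obtain U s \<omega> h where F: "partial_frame_at M E A r x U s \<omega> h" by metis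
  define X where "X = (\<Sum>i<r. fmult (\<lambda>_. \<omega> i x [v]) (s i))"
  have c: "(\<lambda>_. a) \<in> smooth_funs M" for a unfolding smooth_funs_iff[OF M] by (simp add: smooth_at_const)
  have "X \<in> sub_sections M E A"
    unfolding X_def by (rule sub_section_sum[OF A]) (simp_all add: sub_section_fmult[OF A c] partial_frameD(5)[OF F])
  moreover have "X x = v"
    using partial_frameD(7)[OF F v] partial_frameD(4)[OF F] by (simp add: X_def fmult_apply sum_fun_apply)
  ultimately show ?thesis by (rule that)
qed

lemma sections_through_list:
  assumes A: "subbundle M E A" and "set vs \<subseteq> A x"
  shows "\<exists>Xs. set Xs \<subseteq> sub_sections M E A \<and> map (\<lambda>X. X x) Xs = vs"
  using assms(2)
proof (induction vs)
  case (Cons v vs)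
  obtain Xs where Xs: "set Xs \<subseteq> sub_sections M E A" "map (\<lambda>X. X x) Xs = vs" using Cons by auto
  have "v \<in> A x" using Cons by simp
  then obtain X where "X \<in> sub_sections M E A" "X x = v" by (rule section_through[OF A])
  then show ?case using Xs by (intro exI[of _ "X # Xs"]) simp
qed simp

end

lemma smooth_fun_const: "smooth_manifold M \<Longrightarrow> (\<lambda>_. a) \<in> smooth_funs M"
  by (simp add: smooth_funs_iff smooth_at_const)

lemma smooth_fun_mult: "smooth_manifold M \<Longrightarrow> f \<in> smooth_funs M \<Longrightarrow> g \<in> smooth_funs M \<Longrightarrow> f * g \<in> smooth_funs M"
  by (simp add: smooth_funs_iff times_fun_def smooth_at_mult)

lemma smooth_fun_diff: "smooth_manifold M \<Longrightarrow> f \<in> smooth_funs M \<Longrightarrow> g \<in> smooth_funs M \<Longrightarrow> f - g \<in> smooth_funs M"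
  by (simp add: smooth_funs_iff fun_diff_def smooth_at_diff)

section \<open>The calculus of a Courant--Jacobi algebroid\<close>

locale courant =
  fixes M :: "('m::{t2_space,second_countable_topology}, 'e::euclidean_space) manifold"
    and C :: "('m, 'v::real_vector, 'l::real_vector) courant_jacobi"
  assumes M: "smooth_manifold M" and C: "courant_jacobi_algebroid M C"
begin

abbreviation "E \<equiv> bundle_of C"
abbreviation "L \<equiv> line_of C"
abbreviation "\<Gamma> \<equiv> sections M E"
abbreviation "\<Gamma>L \<equiv> sections M L"
abbreviation "pr \<equiv> pair_sec C"
abbreviation "br \<equiv> bracket C"
abbreviation "nb \<equiv> anchor_sec C"
definition "T3 e1 e2 e3 = pr (br e1 e2) e3"

lemma bundle_axioms: "vector_bundle M E" "vector_bundle M L" "bundle_rank L = 1"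
  using C unfolding courant_jacobi_algebroid_def Let_def by simp_all

lemma pairing_lin: "e \<in> fibre E x \<Longrightarrow> lin_on (fibre E x) (pairing C x e)"
  and pairing_sym: "e \<in> fibre E x \<Longrightarrow> e' \<in> fibre E x \<Longrightarrow> pairing C x e e' = pairing C x e' e"
  and nondegenerate: "e \<in> fibre E x \<Longrightarrow> (\<And>e'. e' \<in> fibre E x \<Longrightarrow> pairing C x e e' = 0) \<Longrightarrow> e = 0"
  and anchor_lin: "lin_on (fibre E x) (\<lambda>e l. if l \<in> \<Gamma>L then anchor C x e l else 0)"
  using C unfolding courant_jacobi_algebroid_def Let_def by simp_all

lemma pair_sec_section: "e \<in> \<Gamma> \<Longrightarrow> e' \<in> \<Gamma> \<Longrightarrow> pr e e' \<in> \<Gamma>L"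
  and bracket_section: "e \<in> \<Gamma> \<Longrightarrow> e' \<in> \<Gamma> \<Longrightarrow> br e e' \<in> \<Gamma>"
  and bracket_lin2: "e \<in> \<Gamma> \<Longrightarrow> lin_on \<Gamma> (br e)"
  and bracket_lin1: "e \<in> \<Gamma> \<Longrightarrow> lin_on \<Gamma> (\<lambda>e'. br e' e)"
  and anchor_derivation: "e \<in> \<Gamma> \<Longrightarrow> nb e \<in> derivations M L"
  and compat1: "e \<in> \<Gamma> \<Longrightarrow> e' \<in> \<Gamma> \<Longrightarrow> pr (br e e') e' = pr e (br e' e')"
  and compat2: "e \<in> \<Gamma> \<Longrightarrow> e' \<in> \<Gamma> \<Longrightarrow> nb e (pr e' e') = 2 *\<^sub>R pr (br e e') e'"
  using C unfolding courant_jacobi_algebroid_def Let_def by simp_all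

sublocale E: smooth_bundle M E by unfold_locales (rule M, rule bundle_axioms)
sublocale L: smooth_bundle M L by unfold_locales (rule M, rule bundle_axioms)

lemma pairing_lin': "e \<in> fibre E x \<Longrightarrow> lin_on (fibre E x) (\<lambda>e'. pairing C x e' e)"
  using pairing_lin[of e x] pairing_sym[of _ x e] E.subspace_fibre[of x]
  unfolding lin_on_def by (simp add: subspace_add subspace_scale)

lemma pr_apply: "pr e e' x = pairing C x (e x) (e' x)"
  by (simp add: pair_sec_def)

lemma pr_sym: "e \<in> \<Gamma> \<Longrightarrow> e' \<in> \<Gamma> \<Longrightarrow> pr e e' = pr e' e"
  by (rule ext) (simp add: pr_apply pairing_sym E.section_mem)

lemma pr_add: "e \<in> \<Gamma> \<Longrightarrow> e' \<in> \<Gamma> \<Longrightarrow> e'' \<in> \<Gamma> \<Longrightarrow> pr (e + e') e'' = pr e e'' + pr e' e''"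
  "e \<in> \<Gamma> \<Longrightarrow> e' \<in> \<Gamma> \<Longrightarrow> e'' \<in> \<Gamma> \<Longrightarrow> pr e'' (e + e') = pr e'' e + pr e'' e'"
  by (rule ext, simp add: pr_apply lin_on_add[OF pairing_lin'] lin_on_add[OF pairing_lin] E.section_mem)+

lemma pr_fmult: "e \<in> \<Gamma> \<Longrightarrow> e' \<in> \<Gamma> \<Longrightarrow> pr (fmult f e) e' = fmult f (pr e e')"
  "e \<in> \<Gamma> \<Longrightarrow> e' \<in> \<Gamma> \<Longrightarrow> pr e (fmult f e') = fmult f (pr e e')"
  by (rule ext, simp add: pr_apply fmult_apply lin_on_scale[OF pairing_lin'] lin_on_scale[OF pairing_lin] E.section_mem)+

lemma br_add: "e \<in> \<Gamma> \<Longrightarrow> e' \<in> \<Gamma> \<Longrightarrow> e'' \<in> \<Gamma> \<Longrightarrow> br (e + e') e'' = br e e'' + br e' e''"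
  "e \<in> \<Gamma> \<Longrightarrow> e' \<in> \<Gamma> \<Longrightarrow> e'' \<in> \<Gamma> \<Longrightarrow> br e'' (e + e') = br e'' e + br e'' e'"
  using lin_on_add[OF bracket_lin1, of e'' e e'] lin_on_add[OF bracket_lin2, of e'' e e'] by simp_all

lemma nb_lin: "e \<in> \<Gamma> \<Longrightarrow> lin_on \<Gamma>L (nb e)"
  and nb_symbol: "e \<in> \<Gamma> \<Longrightarrow> \<exists>X\<in>vector_fields M. \<forall>f\<in>smooth_funs M. \<forall>l\<in>\<Gamma>L.
      nb e (fmult f l) = fmult (X f) l + fmult f (nb e l)"
  using anchor_derivation[of e] unfolding derivations_def by simp_all

lemma nb_add: "e \<in> \<Gamma> \<Longrightarrow> l \<in> \<Gamma>L \<Longrightarrow> l' \<in> \<Gamma>L \<Longrightarrow> nb e (l + l') = nb e l + nb e l'"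
  by (rule lin_on_add[OF nb_lin])

lemma nb_diff: "e \<in> \<Gamma> \<Longrightarrow> l \<in> \<Gamma>L \<Longrightarrow> l' \<in> \<Gamma>L \<Longrightarrow> nb e (l - l') = nb e l - nb e l'"
  by (rule lin_on_diff[OF nb_lin])

lemma nb_zero: "e \<in> \<Gamma> \<Longrightarrow> nb e 0 = 0"
  by (rule lin_on_zero[OF nb_lin L.section_zero])

lemma nb_minus: "e \<in> \<Gamma> \<Longrightarrow> l \<in> \<Gamma>L \<Longrightarrow> nb e (- l) = - nb e l"
  using lin_on_scale[OF nb_lin, of e l "-1"] by simp

lemma anchor_comb:
  assumes "l \<in> \<Gamma>L" "u \<in> fibre E x" "v \<in> fibre E x"
  shows "anchor C x (a *\<^sub>R u + b *\<^sub>R v) l = a *\<^sub>R anchor C x u l + b *\<^sub>R anchor C x v l"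
  using fun_cong[OF lin_onD[OF anchor_lin[of x] assms(2,3), of a b], of l] assms(1) by simp

lemma nb_apply: "nb e l x = anchor C x (e x) l"
  by (simp add: anchor_sec_def)

lemma nb_add1: "e \<in> \<Gamma> \<Longrightarrow> e' \<in> \<Gamma> \<Longrightarrow> l \<in> \<Gamma>L \<Longrightarrow> nb (e + e') l = nb e l + nb e' l"
  using anchor_comb[of l _ _ _ 1 1] by (intro ext) (simp add: nb_apply E.section_mem)

lemma nb_diff1: "e \<in> \<Gamma> \<Longrightarrow> e' \<in> \<Gamma> \<Longrightarrow> l \<in> \<Gamma>L \<Longrightarrow> nb (e - e') l = nb e l - nb e' l"
  using anchor_comb[of l _ _ _ 1 "-1"] by (intro ext) (simp add: nb_apply E.section_mem)

lemma nb_fmult1: "e \<in> \<Gamma> \<Longrightarrow> l \<in> \<Gamma>L \<Longrightarrow> nb (fmult f e) l = fmult f (nb e l)"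
  using anchor_comb[of l "e x" x "e x" "f x" 0 for x] by (intro ext) (simp add: nb_apply fmult_apply E.section_mem)

text \<open>The symbol \<sigma>(\<nabla>) of the derivation belonging to e;
  \<open>derivations\<close> asserts the existence of such a vector field, and one is fixed by
  choice.\<close>

definition sg :: "('m \<Rightarrow> 'v) \<Rightarrow> ('m \<Rightarrow> real) \<Rightarrow> 'm \<Rightarrow> real" where
  "sg e = (SOME X. X \<in> vector_fields M \<and> (\<forall>f\<in>smooth_funs M. \<forall>l\<in>\<Gamma>L.
      nb e (fmult f l) = fmult (X f) l + fmult f (nb e l)))"

lemma sg_props:
  assumes "e \<in> \<Gamma>"
  shows "sg e \<in> vector_fields M"
    "f \<in> smooth_funs M \<Longrightarrow> l \<in> \<Gamma>L \<Longrightarrow> nb e (fmult f l) = fmult (sg e f) l + fmult f (nb e l)"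
proof -
  have "\<exists>X. X \<in> vector_fields M \<and> (\<forall>f\<in>smooth_funs M. \<forall>l\<in>\<Gamma>L.
      nb e (fmult f l) = fmult (X f) l + fmult f (nb e l))"
    using nb_symbol[OF assms] by (simp add: Bex_def)
  from someI_ex[OF this] show "sg e \<in> vector_fields M"
    "f \<in> smooth_funs M \<Longrightarrow> l \<in> \<Gamma>L \<Longrightarrow> nb e (fmult f l) = fmult (sg e f) l + fmult f (nb e l)"
    unfolding sg_def[symmetric] by simp_all
qed

section \<open>Symmetries and Leibniz rules of T3\<close>

lemma T3_section: "e1 \<in> \<Gamma> \<Longrightarrow> e2 \<in> \<Gamma> \<Longrightarrow> e3 \<in> \<Gamma> \<Longrightarrow> T3 e1 e2 e3 \<in> \<Gamma>L"
  unfolding T3_def by (simp add: pair_sec_section bracket_section)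

lemma T3_add:
  assumes "e \<in> \<Gamma>" "e' \<in> \<Gamma>" "a \<in> \<Gamma>" "b \<in> \<Gamma>"
  shows "T3 (e + e') a b = T3 e a b + T3 e' a b" "T3 a (e + e') b = T3 a e b + T3 a e' b"
    "T3 a b (e + e') = T3 a b e + T3 a b e'"
  unfolding T3_def using assms by (simp_all add: br_add pr_add bracket_section)

text \<open>Polarisation of the second compatibility axiom in its repeated entry.\<close>

lemma T3_swap23:
  assumes e: "e1 \<in> \<Gamma>" "e2 \<in> \<Gamma>" "e3 \<in> \<Gamma>"
  shows "T3 e1 e2 e3 + T3 e1 e3 e2 = nb e1 (pr e2 e3)"
proof -
  have s: "e2 + e3 \<in> \<Gamma>" using e by (simp add: E.section_add)
  have p: "pr e2 e2 \<in> \<Gamma>L" "pr e2 e3 \<in> \<Gamma>L" "pr e3 e3 \<in> \<Gamma>L" using e by (simp_all add: pair_sec_section)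
  have "nb e1 (pr (e2 + e3) (e2 + e3)) = 2 *\<^sub>R T3 e1 (e2 + e3) (e2 + e3)"
    unfolding T3_def by (rule compat2[OF e(1) s])
  also have "T3 e1 (e2 + e3) (e2 + e3) = T3 e1 e2 e2 + T3 e1 e3 e2 + (T3 e1 e2 e3 + T3 e1 e3 e3)"
    using e s by (simp add: T3_add)
  also have "pr (e2 + e3) (e2 + e3) = pr e2 e2 + pr e2 e3 + (pr e2 e3 + pr e3 e3)"
    using e s by (simp add: pr_add pr_sym[of e3 e2])
  also have "nb e1 (pr e2 e2 + pr e2 e3 + (pr e2 e3 + pr e3 e3)) =
      nb e1 (pr e2 e2) + nb e1 (pr e2 e3) + (nb e1 (pr e2 e3) + nb e1 (pr e3 e3))"
    using e p by (simp add: nb_add L.section_add)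
  also have "nb e1 (pr e2 e2) = 2 *\<^sub>R T3 e1 e2 e2" unfolding T3_def by (rule compat2[OF e(1,2)])
  also have "nb e1 (pr e3 e3) = 2 *\<^sub>R T3 e1 e3 e3" unfolding T3_def by (rule compat2[OF e(1,3)])
  finally have *: "2 *\<^sub>R T3 e1 e2 e2 + nb e1 (pr e2 e3) + (nb e1 (pr e2 e3) + 2 *\<^sub>R T3 e1 e3 e3) =
      2 *\<^sub>R (T3 e1 e2 e2 + T3 e1 e3 e2 + (T3 e1 e2 e3 + T3 e1 e3 e3))" .
  show ?thesis
  proof
    fix x
    have "2 *\<^sub>R (T3 e1 e2 e3 + T3 e1 e3 e2) x = 2 *\<^sub>R nb e1 (pr e2 e3) x"
      using fun_cong[OF *, of x] by (simp add: scaleR_2 algebra_simps)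
    then show "(T3 e1 e2 e3 + T3 e1 e3 e2) x = nb e1 (pr e2 e3) x" by simp
  qed
qed

text \<open>The two axioms together express \<nabla> along e3 of the square of e as twice the
  pairing of [e, e] with e3; this is polarised in e. The symmetric part of the bracket is thus
  governed by derivatives of the pairing.\<close>

lemma T3_swap12:
  assumes e: "e1 \<in> \<Gamma>" "e2 \<in> \<Gamma>" "e3 \<in> \<Gamma>"
  shows "T3 e1 e2 e3 + T3 e2 e1 e3 = nb e3 (pr e1 e2)"
proof -
  have c: "nb e3 (pr e e) = 2 *\<^sub>R T3 e e e3" if "e \<in> \<Gamma>" for e
    using compat2[OF e(3) that] compat1[OF e(3) that] pr_sym[OF e(3) bracket_section[OF that that]]
    unfolding T3_def by simp
  have s: "e1 + e2 \<in> \<Gamma>" using e by (simp add: E.section_add)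
  have p: "pr e1 e1 \<in> \<Gamma>L" "pr e1 e2 \<in> \<Gamma>L" "pr e2 e2 \<in> \<Gamma>L" using e by (simp_all add: pair_sec_section)
  have "nb e3 (pr (e1 + e2) (e1 + e2)) = 2 *\<^sub>R T3 (e1 + e2) (e1 + e2) e3" by (rule c[OF s])
  also have "T3 (e1 + e2) (e1 + e2) e3 = T3 e1 e1 e3 + T3 e1 e2 e3 + (T3 e2 e1 e3 + T3 e2 e2 e3)"
    using e s by (simp add: T3_add algebra_simps)
  also have "pr (e1 + e2) (e1 + e2) = pr e1 e1 + pr e1 e2 + (pr e1 e2 + pr e2 e2)"
    using e s by (simp add: pr_add pr_sym[of e2 e1])
  also have "nb e3 (pr e1 e1 + pr e1 e2 + (pr e1 e2 + pr e2 e2)) =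
      nb e3 (pr e1 e1) + nb e3 (pr e1 e2) + (nb e3 (pr e1 e2) + nb e3 (pr e2 e2))"
    using e p by (simp add: nb_add L.section_add)
  also have "nb e3 (pr e1 e1) = 2 *\<^sub>R T3 e1 e1 e3" by (rule c[OF e(1)])
  also have "nb e3 (pr e2 e2) = 2 *\<^sub>R T3 e2 e2 e3" by (rule c[OF e(2)])
  finally have *: "2 *\<^sub>R T3 e1 e1 e3 + nb e3 (pr e1 e2) + (nb e3 (pr e1 e2) + 2 *\<^sub>R T3 e2 e2 e3) =
      2 *\<^sub>R (T3 e1 e1 e3 + T3 e1 e2 e3 + (T3 e2 e1 e3 + T3 e2 e2 e3))" .
  show ?thesis
  proof
    fix x
    have "2 *\<^sub>R (T3 e1 e2 e3 + T3 e2 e1 e3) x = 2 *\<^sub>R nb e3 (pr e1 e2) x"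
      using fun_cong[OF *, of x] by (simp add: scaleR_2 algebra_simps)
    then show "(T3 e1 e2 e3 + T3 e2 e1 e3) x = nb e3 (pr e1 e2) x" by simp
  qed
qed

lemma T3_fmult3: "e1 \<in> \<Gamma> \<Longrightarrow> e2 \<in> \<Gamma> \<Longrightarrow> e3 \<in> \<Gamma> \<Longrightarrow> T3 e1 e2 (fmult f e3) = fmult f (T3 e1 e2 e3)"
  unfolding T3_def by (simp add: pr_fmult bracket_section)

text \<open>The third entry enters through the pairing alone and is linear over functions.
  Exchanging it with the second by \<open>T3_swap23\<close> costs one application of \<nabla>, whose
  product rule yields the symbol term.\<close>

lemma T3_fmult2:
  assumes e: "e1 \<in> \<Gamma>" "e2 \<in> \<Gamma>" "e3 \<in> \<Gamma>" and f: "f \<in> smooth_funs M"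
  shows "T3 e1 (fmult f e2) e3 = fmult f (T3 e1 e2 e3) + fmult (sg e1 f) (pr e2 e3)"
proof -
  have "T3 e1 (fmult f e2) e3 + T3 e1 e3 (fmult f e2) = nb e1 (fmult f (pr e2 e3))"
    using T3_swap23[OF e(1) E.section_fmult[OF f e(2)] e(3)] e by (simp add: pr_fmult)
  also have "\<dots> = fmult (sg e1 f) (pr e2 e3) + fmult f (nb e1 (pr e2 e3))"
    by (rule sg_props(2)[OF e(1) f pair_sec_section[OF e(2,3)]])
  also have "nb e1 (pr e2 e3) = T3 e1 e2 e3 + T3 e1 e3 e2" by (rule T3_swap23[OF e, symmetric])
  finally have *: "T3 e1 (fmult f e2) e3 + fmult f (T3 e1 e3 e2) =
      fmult (sg e1 f) (pr e2 e3) + fmult f (T3 e1 e2 e3 + T3 e1 e3 e2)"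
    unfolding T3_fmult3[OF e(1,3,2)] .
  show ?thesis
  proof
    fix x show "T3 e1 (fmult f e2) e3 x = (fmult f (T3 e1 e2 e3) + fmult (sg e1 f) (pr e2 e3)) x"
      using fun_cong[OF *, of x] by (simp add: fmult_apply algebra_simps)
  qed
qed

text \<open>Exchanging the first two entries reduces the claim to the rule for the second entry. One
  symbol term is inherited from there, the other comes from the product rule for \<nabla> along
  e3.\<close>

lemma T3_fmult1:
  assumes e: "e1 \<in> \<Gamma>" "e2 \<in> \<Gamma>" "e3 \<in> \<Gamma>" and f: "f \<in> smooth_funs M"
  shows "T3 (fmult f e1) e2 e3 =
    fmult f (T3 e1 e2 e3) - fmult (sg e2 f) (pr e1 e3) + fmult (sg e3 f) (pr e1 e2)"
proof -
  have "T3 (fmult f e1) e2 e3 + T3 e2 (fmult f e1) e3 = nb e3 (fmult f (pr e1 e2))"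
    using T3_swap12[OF E.section_fmult[OF f e(1)] e(2,3)] e by (simp add: pr_fmult)
  also have "\<dots> = fmult (sg e3 f) (pr e1 e2) + fmult f (nb e3 (pr e1 e2))"
    by (rule sg_props(2)[OF e(3) f pair_sec_section[OF e(1,2)]])
  also have "nb e3 (pr e1 e2) = T3 e1 e2 e3 + T3 e2 e1 e3" by (rule T3_swap12[OF e, symmetric])
  finally have *: "T3 (fmult f e1) e2 e3 + (fmult f (T3 e2 e1 e3) + fmult (sg e2 f) (pr e1 e3)) =
      fmult (sg e3 f) (pr e1 e2) + fmult f (T3 e1 e2 e3 + T3 e2 e1 e3)"
    unfolding T3_fmult2[OF e(2,1,3) f] .
  show ?thesis
  proof
    fix x show "T3 (fmult f e1) e2 e3 x =
        (fmult f (T3 e1 e2 e3) - fmult (sg e2 f) (pr e1 e3) + fmult (sg e3 f) (pr e1 e2)) x"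
      using fun_cong[OF *, of x] by (simp add: fmult_apply algebra_simps)
  qed
qed

text \<open>The axiom places the pairing in L only for global sections; sections through u and v
  carry this over to single vectors.\<close>

lemma pairing_fibre:
  assumes "u \<in> fibre E x" "v \<in> fibre E x" shows "pairing C x u v \<in> fibre L x"
proof -
  obtain e where e: "e \<in> sub_sections M E (fibre E)" "e x = u"
    by (rule E.section_through[OF E.subbundle_fibre assms(1)])
  obtain e' where e': "e' \<in> sub_sections M E (fibre E)" "e' x = v"
    by (rule E.section_through[OF E.subbundle_fibre assms(2)])
  show ?thesis
    using L.section_mem[OF pair_sec_section[OF E.sub_section_section[OF e(1)] E.sub_section_section[OF e'(1)]], of x]
    by (simp add: pr_apply e(2) e'(2))
qed

text \<open>A cutoff function with value \<open>1\<close> and vanishing differential at the given point: if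
  \<open>h x = 1\<close>, then \<open>1 - (1 - h)\<^sup>2\<close> is one.\<close>

definition flatten :: "('m \<Rightarrow> real) \<Rightarrow> 'm \<Rightarrow> real" where
  "flatten h = h * ((\<lambda>_. 2) - h)"

lemma flatten_smooth: "h \<in> smooth_funs M \<Longrightarrow> flatten h \<in> smooth_funs M"
  unfolding flatten_def by (simp add: smooth_fun_mult smooth_fun_diff smooth_fun_const M)

lemma flatten_at: "h x = 1 \<Longrightarrow> flatten h x = 1"
  unfolding flatten_def by simp

text \<open>The differential of h (2 - h) is 2 (1 - h) dh, which vanishes where h = 1. That X kills
  constants follows from the product rule for 1 = 1 * 1.\<close>

lemma vector_field_flatten:
  assumes X: "X \<in> vector_fields M" and h: "h \<in> smooth_funs M" "h x = 1"
  shows "X (flatten h) x = 0"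
proof -
  have lin: "lin_on (smooth_funs M) X"
    and leib: "\<And>f g. f \<in> smooth_funs M \<Longrightarrow> g \<in> smooth_funs M \<Longrightarrow> X (f * g) = X f * g + f * X g"
    using X unfolding vector_fields_def by simp_all
  have c: "(\<lambda>_. a) \<in> smooth_funs M" for a by (rule smooth_fun_const[OF M])
  have "X (\<lambda>_. 1) = X (\<lambda>_. 1) + X (\<lambda>_. 1)"
    using leib[OF c c, of 1 1] by (simp add: times_fun_def plus_fun_def)
  then have "X (\<lambda>_. 1) = 0" by simp
  then have 2: "X (\<lambda>_. 2) = 0" using lin_on_scale[OF lin c, of 2 1] by (simp add: scaleR_fun_def zero_fun_def)
  have "X ((\<lambda>_. 2) - h) = - X h" using lin_on_diff[OF lin c h(1), of 2] 2 by simp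
  then show ?thesis
    unfolding flatten_def leib[OF h(1) smooth_fun_diff[OF M c h(1)]] using h(2) by simp
qed

lemma sg_flatten: "e \<in> \<Gamma> \<Longrightarrow> h \<in> smooth_funs M \<Longrightarrow> h x = 1 \<Longrightarrow> sg e (flatten h) x = 0"
  by (rule vector_field_flatten[OF sg_props(1)])

lemma nb_flatten:
  assumes e: "e \<in> \<Gamma>" and l: "l \<in> \<Gamma>L" and h: "h \<in> smooth_funs M" "h x = 1"
  shows "nb e (fmult (flatten h) l) x = nb e l x"
  unfolding sg_props(2)[OF e flatten_smooth[OF h(1)] l]
  by (simp add: fmult_apply sg_flatten[OF e h] flatten_at[of h x] h)

lemma T3_flatten:
  assumes e: "e1 \<in> \<Gamma>" "e2 \<in> \<Gamma>" "e3 \<in> \<Gamma>" and h: "h \<in> smooth_funs M" "h x = 1"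
  shows "T3 e1 (fmult (flatten h) e2) e3 x = T3 e1 e2 e3 x" "T3 (fmult (flatten h) e1) e2 e3 x = T3 e1 e2 e3 x"
  unfolding T3_fmult2[OF e flatten_smooth[OF h(1)]] T3_fmult1[OF e flatten_smooth[OF h(1)]]
  by (simp_all add: fmult_apply sg_flatten e h flatten_at[of h x])

text \<open>The Gram matrix of the pairing in a local frame is a smooth system with trivial kernel.\<close>

lemma smooth_by_pairing:
  assumes e: "\<And>x. e x \<in> fibre E x" and pe: "\<And>s. s \<in> \<Gamma> \<Longrightarrow> pr e s \<in> \<Gamma>L"
  shows "e \<in> \<Gamma>"
proof -
  obtain r where "\<forall>x. \<exists>U s \<omega> h. partial_frame_at M E (fibre E) r x U s \<omega> h"
    using E.partial_frame_exists[OF E.subbundle_fibre] by (rule exE)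
  note r = this[rule_format]
  have "smooth_sec_at M E x e" for x
  proof -
    obtain U s \<omega> h where F: "partial_frame_at M E (fibre E) r x U s \<omega> h" using r[of x] by (elim exE)
    note Fs = E.partial_frameD(5)[OF F, THEN E.sub_section_section]
    note Fb = E.partial_frameD(8)[OF F]
    obtain V l where V: "(V, l) \<in> frames L" "x \<in> V" by (rule L.frame_at)
    have pp: "pr (s i) (s j) \<in> \<Gamma>L" if "i < r" "j < r" for i j using Fs that by (simp add: pair_sec_section)
    have "\<forall>y. \<exists>c. y \<in> U \<longrightarrow> e y = (\<Sum>j<r. c j *\<^sub>R s j y)"
    proof
      fix y show "\<exists>c. y \<in> U \<longrightarrow> e y = (\<Sum>j<r. c j *\<^sub>R s j y)"
        using basis_of_coeffs[OF Fb e, of y] by metis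
    qed
    from choice[OF this] obtain c where c: "\<And>y. y \<in> U \<Longrightarrow> e y = (\<Sum>j<r. c y j *\<^sub>R s j y)" by metis
    let ?P = "\<lambda>i j. pr (s i) (s j)"
    have "\<forall>i. \<exists>d N. i < r \<longrightarrow> open N \<and> x \<in> N \<and> N \<subseteq> V \<and> (\<forall>j<r. \<forall>k<L.rk. smooth_at M x (d j k)) \<and>
        (\<forall>j<r. \<forall>y\<in>N. ?P i j y = (\<Sum>k<L.rk. d j k y *\<^sub>R l k y))"
    proof
      fix i
      show "\<exists>d N. i < r \<longrightarrow> open N \<and> x \<in> N \<and> N \<subseteq> V \<and> (\<forall>j<r. \<forall>k<L.rk. smooth_at M x (d j k)) \<and>
        (\<forall>j<r. \<forall>y\<in>N. ?P i j y = (\<Sum>k<L.rk. d j k y *\<^sub>R l k y))"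
      proof (cases "i < r")
        case True
        have sm: "smooth_sec_at M L x (?P i j)" if "j < r" for j using pp[OF True that] L.sections_iff by simp
        obtain d N where "open N" "x \<in> N" "N \<subseteq> V" "\<And>j k. j < r \<Longrightarrow> k < L.rk \<Longrightarrow> smooth_at M x (d j k)"
          "\<And>j y. j < r \<Longrightarrow> y \<in> N \<Longrightarrow> ?P i j y = (\<Sum>k<L.rk. d j k y *\<^sub>R l k y)"
          by (rule L.smooth_sec_at_family_coeffs[of r x "?P i", OF _ V]) (rule sm, assumption, rule that)
        then show ?thesis by (intro exI[of _ d] exI[of _ N]) simp
      qed simp
    qed
    from choice[OF this] obtain d where "\<forall>i. \<exists>N. i < r \<longrightarrow> open N \<and> x \<in> N \<and> N \<subseteq> V \<and>
        (\<forall>j<r. \<forall>k<L.rk. smooth_at M x (d i j k)) \<and> (\<forall>j<r. \<forall>y\<in>N. ?P i j y = (\<Sum>k<L.rk. d i j k y *\<^sub>R l k y))"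
      by (rule exE)
    from choice[OF this] obtain N where N: "\<forall>i. i < r \<longrightarrow> open (N i) \<and> x \<in> N i \<and> N i \<subseteq> V \<and>
        (\<forall>j<r. \<forall>k<L.rk. smooth_at M x (d i j k)) \<and> (\<forall>j<r. \<forall>y\<in>N i. ?P i j y = (\<Sum>k<L.rk. d i j k y *\<^sub>R l k y))"
      by (rule exE)
    have sme: "smooth_sec_at M L x (pr (s i) e)" if "i < r" for i
    proof -
      have "pr (s i) e = pr e (s i)"
        by (rule ext) (simp add: pr_apply pairing_sym e E.section_mem[OF Fs[OF that]])
      then show ?thesis using pe[OF Fs[OF that]] L.sections_iff by simp
    qed
    obtain v N' where v: "open N'" "x \<in> N'" "N' \<subseteq> V" "\<And>i k. i < r \<Longrightarrow> k < L.rk \<Longrightarrow> smooth_at M x (v i k)"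
      "\<And>i y. i < r \<Longrightarrow> y \<in> N' \<Longrightarrow> pr (s i) e y = (\<Sum>k<L.rk. v i k y *\<^sub>R l k y)"
      by (rule L.smooth_sec_at_family_coeffs[of r x "\<lambda>i. pr (s i) e", OF _ V]) (rule sme, assumption, rule that)
    define W where "W = U \<inter> N' \<inter> (\<Inter>i<r. N i)"
    have W: "open W" "x \<in> W" unfolding W_def using N E.partial_frameD(1,2)[OF F] v(1,2)
      by (auto intro!: open_Int open_INT)
    have sp: "(\<Sum>k<L.rk. (\<Sum>j<r. d i j k y * \<kappa> j) *\<^sub>R l k y) = pairing C y (s i y) (\<Sum>j<r. \<kappa> j *\<^sub>R s j y)"
      if "i < r" "y \<in> W" for i y \<kappa>
    proof -
      have m: "s j y \<in> fibre E y" if "j < r" for j by (rule E.section_mem[OF Fs[OF that]])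
      have "pairing C y (s i y) (\<Sum>j<r. \<kappa> j *\<^sub>R s j y) = (\<Sum>j<r. \<kappa> j *\<^sub>R ?P i j y)"
        unfolding pr_apply by (rule lin_on_sum[OF pairing_lin[OF m[OF that(1)]] E.subspace_fibre]) (simp_all add: m)
      also have "\<dots> = (\<Sum>j<r. \<Sum>k<L.rk. (d i j k y * \<kappa> j) *\<^sub>R l k y)"
        using N that W_def by (simp add: scaleR_sum_right mult.commute)
      also have "\<dots> = (\<Sum>k<L.rk. \<Sum>j<r. (d i j k y * \<kappa> j) *\<^sub>R l k y)" by (rule sum.swap)
      finally show ?thesis by (simp add: scaleR_sum_left)
    qed
    \<comment> \<open>There is one equation for each frame member \<open>s i\<close> and each
      coordinate of the line bundle. A combination in the kernel at x is orthogonal to the whole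
      fibre, hence zero by nondegeneracy.\<close>
    have "smooth_at M x (\<lambda>y. c y j)" if j: "j < r" for j
    proof (rule smooth_solution[OF M, of "{..<r} \<times> {..<L.rk}" r "\<lambda>(i, k) j. d i j k" x "\<lambda>(i, k). v i k" W "\<lambda>j y. c y j"])
      show "trivial_kernel ({..<r} \<times> {..<L.rk}) r (\<lambda>p j. (case p of (i, k) \<Rightarrow> \<lambda>j. d i j k) j x)"
        unfolding trivial_kernel_def
      proof (intro allI impI)
        fix \<kappa> j assume \<kappa>: "\<forall>p\<in>{..<r} \<times> {..<L.rk}. (\<Sum>j<r. (case p of (i, k) \<Rightarrow> \<lambda>j. d i j k) j x * \<kappa> j) = 0"
          and j: "j < r"
        let ?w = "\<Sum>j<r. \<kappa> j *\<^sub>R s j x"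
        have b: "basis_of r (fibre E x) (\<lambda>i. s i x)" by (rule Fb[OF E.partial_frameD(2)[OF F]])
        have w: "?w \<in> fibre E x" by (rule basis_of_combination_mem[OF b])
        have z: "pairing C x (s i x) ?w = 0" if "i < r" for i
          unfolding sp[OF that W(2), symmetric] using \<kappa> that by (simp add: sum.neutral)
        have "?w = 0"
        proof (rule nondegenerate[OF w])
          fix e' assume e': "e' \<in> fibre E x"
          obtain q where q: "e' = (\<Sum>j<r. q j *\<^sub>R s j x)" by (rule basis_of_coeffs[OF b e'])
          have "pairing C x ?w e' = (\<Sum>j<r. q j *\<^sub>R pairing C x ?w (s j x))"
            unfolding q by (rule lin_on_sum[OF pairing_lin[OF w] E.subspace_fibre]) (simp_all add: basis_of_mem[OF b])
          also have "\<dots> = 0" using z pairing_sym[OF w basis_of_mem[OF b]] by simp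
          finally show "pairing C x ?w e' = 0" .
        qed
        then show "\<kappa> j = 0" by (rule basis_of_independent[OF b _ j])
      qed
      show "(\<Sum>j<r. (case p of (i, k) \<Rightarrow> \<lambda>j. d i j k) j y * c y j) = (case p of (i, k) \<Rightarrow> v i k) y"
        if y: "y \<in> W" and p: "p \<in> {..<r} \<times> {..<L.rk}" for y p
      proof -
        obtain i k where ik: "p = (i, k)" "i < r" "k < L.rk" using p by (cases p) simp
        have "basis_of L.rk (fibre L y) (\<lambda>j. l j y)"
          by (rule L.frame_props(2)[OF V(1)]) (use y v(3) W_def in blast)
        moreover have "(\<Sum>k<L.rk. (\<Sum>j<r. d i j k y * c y j) *\<^sub>R l k y) = (\<Sum>k<L.rk. v i k y *\<^sub>R l k y)"
          using sp[OF ik(2) y, of "c y"] c[of y] v(5)[OF ik(2), of y] y W_def by (simp add: pr_apply)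
        ultimately have "(\<Sum>j<r. d i j k y * c y j) = v i k y" using ik(3) by (rule basis_of_unique)
        then show ?thesis using ik(1) by simp
      qed
    qed (use N v(4) W j in auto)
    then show ?thesis
      by (intro E.smooth_sec_at_combination[of r x "\<lambda>j y. c y j" s U e])
         (use c Fs E.sections_iff E.partial_frameD(1,2)[OF F] in auto)
  qed
  then show ?thesis unfolding E.sections_iff by simp
qed

end

section \<open>Lagrangian subbundles\<close>

context courant begin

lemma almost_dirac:
  assumes D: "almost_dirac_jacobi M C D"
  shows almost_dirac_subbundle: "subbundle M E D"
    and almost_dirac_isotropic: "u \<in> D x \<Longrightarrow> v \<in> D x \<Longrightarrow> pairing C x u v = 0"
    and almost_dirac_memI: "e \<in> fibre E x \<Longrightarrow> (\<And>a. a \<in> D x \<Longrightarrow> pairing C x e a = 0) \<Longrightarrow> e \<in> D x"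
    and almost_dirac_fibre: "u \<in> D x \<Longrightarrow> u \<in> fibre E x"
proof -
  show s: "subbundle M E D" using D unfolding almost_dirac_jacobi_def by (rule conjunct1)
  have o: "D = orth C D" using D unfolding almost_dirac_jacobi_def by (rule conjunct2)
  have m: "e \<in> D x \<longleftrightarrow> e \<in> fibre E x \<and> (\<forall>a\<in>D x. pairing C x e a = 0)" for e
    by (subst o) (simp add: orth_def)
  show "u \<in> D x \<Longrightarrow> v \<in> D x \<Longrightarrow> pairing C x u v = 0" unfolding m[of u] by simp
  show "e \<in> fibre E x \<Longrightarrow> (\<And>a. a \<in> D x \<Longrightarrow> pairing C x e a = 0) \<Longrightarrow> e \<in> D x" unfolding m[of e] by simp
  show "u \<in> D x \<Longrightarrow> u \<in> fibre E x" unfolding m[of u] by simp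
qed

lemma pr_isotropic:
  assumes D: "almost_dirac_jacobi M C D" and "a \<in> sub_sections M E D" "b \<in> sub_sections M E D"
  shows "pr a b = 0"
  by (rule ext) (simp add: pr_apply almost_dirac_isotropic[OF D] E.sub_section_mem[OF assms(2)] E.sub_section_mem[OF assms(3)])

context
  fixes D assumes D: "almost_dirac_jacobi M C D"
begin

text \<open>The exchange identities have a derivative of a pairing on the right, and on D all
  pairings are zero.\<close>

lemma T3_lagrangian_skew:
  assumes "a \<in> sub_sections M E D" "b \<in> sub_sections M E D" "c \<in> sub_sections M E D"
  shows "T3 b a c = - T3 a b c" "T3 a c b = - T3 a b c"
proof -
  note s = assms[THEN E.sub_section_section]
  have "T3 a b c + T3 b a c = 0"
    unfolding T3_swap12[OF s] pr_isotropic[OF D assms(1,2)] by (rule nb_zero[OF s(3)])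
  then show "T3 b a c = - T3 a b c" by (simp add: eq_neg_iff_add_eq_0 add.commute)
  have "T3 a b c + T3 a c b = 0"
    unfolding T3_swap23[OF s] pr_isotropic[OF D assms(2,3)] by (rule nb_zero[OF s(1)])
  then show "T3 a c b = - T3 a b c" by (simp add: eq_neg_iff_add_eq_0 add.commute)
qed

lemma T3_zero_at3:
  assumes "a \<in> \<Gamma>" "b \<in> \<Gamma>" "c \<in> \<Gamma>" "c x = 0"
  shows "T3 a b c x = 0"
  unfolding T3_def pr_apply assms(4)
  by (rule lin_on_zero[OF pairing_lin[OF E.section_mem[OF bracket_section[OF assms(1,2)]]]
        subspace_0[OF E.subspace_fibre]])

text \<open>A zero in the third entry kills the pairing; skewness brings a zero in any other entry
  there.\<close>

lemma T3_lagrangian_zero: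
  assumes s: "a \<in> sub_sections M E D" "b \<in> sub_sections M E D" "c \<in> sub_sections M E D"
    and z: "a x = 0 \<or> b x = 0 \<or> c x = 0"
  shows "T3 a b c x = 0"
proof -
  note t = s[THEN E.sub_section_section]
  have 1: "T3 a b c x = T3 b c a x"
    unfolding T3_lagrangian_skew(2)[OF s(2,1,3)] T3_lagrangian_skew(1)[OF s] by simp
  have 2: "T3 a b c x = - T3 a c b x"
    unfolding T3_lagrangian_skew(2)[OF s] by simp
  show ?thesis
    using z T3_zero_at3[OF t(2,3,1)] T3_zero_at3[OF t(1,3,2)] T3_zero_at3[OF t] 1 2
    by auto
qed

lemma T3_lagrangian_cong:
  assumes s: "a \<in> sub_sections M E D" "b \<in> sub_sections M E D" "c \<in> sub_sections M E D"
    and s': "a' \<in> sub_sections M E D" "b' \<in> sub_sections M E D" "c' \<in> sub_sections M E D"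
    and e: "a x = a' x" "b x = b' x" "c x = c' x"
  shows "T3 a b c x = T3 a' b' c' x"
proof -
  note sub = almost_dirac_subbundle[OF D]
  note t = s[THEN E.sub_section_section] s'[THEN E.sub_section_section]
  have m: "u + - v \<in> sub_sections M E D" if "u \<in> sub_sections M E D" "v \<in> sub_sections M E D" for u v
    by (rule E.sub_section_add[OF sub that(1) E.sub_section_minus[OF sub that(2)]])
  note mt = m[THEN E.sub_section_section]
  have "T3 (a' + (a + - a')) b c x = T3 a' b c x"
    unfolding T3_add(1)[OF t(4) mt[OF s(1) s'(1)] t(2,3)]
    using T3_lagrangian_zero[OF m[OF s(1) s'(1)] s(2,3), of x] e by simp
  moreover have "T3 a' (b' + (b + - b')) c x = T3 a' b' c x"
    unfolding T3_add(2)[OF t(5) mt[OF s(2) s'(2)] t(4,3)]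
    using T3_lagrangian_zero[OF s'(1) m[OF s(2) s'(2)] s(3), of x] e by simp
  moreover have "T3 a' b' (c' + (c + - c')) x = T3 a' b' c' x"
    unfolding T3_add(3)[OF t(6) mt[OF s(3) s'(3)] t(4,5)]
    using T3_lagrangian_zero[OF s'(1,2) m[OF s(3) s'(3)], of x] e by simp
  ultimately show ?thesis by simp
qed

text \<open>Since D is its own orthogonal, a bracket lies in D exactly if it is orthogonal to D, and
  every vector of D is the value of a global section of D.\<close>

lemma involutive_iff:
  "dirac_jacobi M C D \<longleftrightarrow> (\<forall>a\<in>sub_sections M E D. \<forall>b\<in>sub_sections M E D. \<forall>c\<in>sub_sections M E D. T3 a b c = 0)"
proof
  assume d: "dirac_jacobi M C D"
  show "\<forall>a\<in>sub_sections M E D. \<forall>b\<in>sub_sections M E D. \<forall>c\<in>sub_sections M E D. T3 a b c = 0"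
  proof (intro ballI)
    fix a b c assume a: "a \<in> sub_sections M E D" and b: "b \<in> sub_sections M E D" and c: "c \<in> sub_sections M E D"
    have "br a b \<in> sub_sections M E D" using d a b unfolding dirac_jacobi_def by simp
    from pr_isotropic[OF D this c] show "T3 a b c = 0" unfolding T3_def .
  qed
next
  assume T: "\<forall>a\<in>sub_sections M E D. \<forall>b\<in>sub_sections M E D. \<forall>c\<in>sub_sections M E D. T3 a b c = 0"
  have "br a b \<in> sub_sections M E D" if a: "a \<in> sub_sections M E D" and b: "b \<in> sub_sections M E D" for a b
  proof -
    have g: "br a b \<in> \<Gamma>" by (rule bracket_section[OF a[THEN E.sub_section_section] b[THEN E.sub_section_section]])
    have "br a b x \<in> D x" for x
    proof (rule almost_dirac_memI[OF D E.section_mem[OF g]])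
      fix v assume v: "v \<in> D x"
      obtain c where c: "c \<in> sub_sections M E D" "c x = v" by (rule E.section_through[OF almost_dirac_subbundle[OF D] v])
      have "T3 a b c = 0" using T a b c(1) by simp
      from fun_cong[OF this, of x] show "pairing C x (br a b x) v = 0" using c(2) by (simp add: T3_def pr_apply)
    qed
    then show ?thesis using g unfolding sub_sections_iff by simp
  qed
  then show "dirac_jacobi M C D" using D unfolding dirac_jacobi_def by simp
qed

end

end

section \<open>Transverse Lagrangian pairs\<close>

lemma proj_along_eq:
  assumes "subspace (A x)" "subspace (B x)" "A x \<inter> B x = {0}" "a \<in> A x" "b \<in> B x"
  shows "proj_along A B x (a + b) = b"
  unfolding proj_along_def
proof (rule the_equality)
  show "b \<in> B x \<and> (\<exists>a'\<in>A x. a + b = a' + b)" using assms by blast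
  fix c assume c: "c \<in> B x \<and> (\<exists>a'\<in>A x. a + b = a' + c)"
  then obtain a' where a': "a' \<in> A x" "a + b = a' + c" by blast
  have e: "a - a' = c - b" using a'(2) by (simp add: algebra_simps)
  have "a - a' \<in> A x" using assms(1,4) a'(1) by (simp add: subspace_diff)
  moreover have "a - a' \<in> B x" unfolding e using assms(2,5) c by (simp add: subspace_diff)
  ultimately have "a - a' \<in> A x \<inter> B x" by (rule IntI)
  then have "a - a' = 0" unfolding assms(3) by simp
  then show "c = b" using e by simp
qed

text \<open>The first subbundle is only Lagrangian here, with involutivity a separate hypothesis
  where it enters; \<open>graph_surj\<close> interprets the locale a second time for another
  complement of B.\<close>

locale lagrangian_pair = courant M C
  for M :: "('m::{t2_space,second_countable_topology}, 'e::euclidean_space) manifold"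
    and C :: "('m, 'v::real_vector, 'l::real_vector) courant_jacobi" +
  fixes A B :: "'m \<Rightarrow> 'v set"
  assumes A: "almost_dirac_jacobi M C A" and B: "almost_dirac_jacobi M C B" and AB: "transverse C A B"
begin

lemmas subA = almost_dirac_subbundle[OF A]
lemmas subB = almost_dirac_subbundle[OF B]
lemmas subspaceA = E.subbundle_subspace[OF subA]
lemmas subspaceB = E.subbundle_subspace[OF subB]
abbreviation "\<Gamma>A \<equiv> sub_sections M E A"
abbreviation "\<Gamma>B \<equiv> sub_sections M E B"
abbreviation "pA \<equiv> proj_along B A"
abbreviation "pB \<equiv> proj_along A B"
lemmas \<Gamma>A_sec = E.sub_section_section[of _ A]
lemmas \<Gamma>B_sec = E.sub_section_section[of _ B]
lemmas \<Gamma>A_mem = E.sub_section_mem[of _ A]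
lemmas \<Gamma>B_mem = E.sub_section_mem[of _ B]
lemmas isoA = almost_dirac_isotropic[OF A]
lemmas isoB = almost_dirac_isotropic[OF B]
lemmas fibA = almost_dirac_fibre[OF A]
lemmas fibB = almost_dirac_fibre[OF B]

lemma AB_int: "A x \<inter> B x = {0}"
  using AB unfolding transverse_def direct_sum_def by simp

lemma BA_int: "B x \<inter> A x = {0}"
  using AB_int by blast

lemma decompose:
  assumes "e \<in> fibre E x" obtains a b where "a \<in> A x" "b \<in> B x" "e = a + b"
proof -
  have "fibre E x = {a + b | a b. a \<in> A x \<and> b \<in> B x}" using AB unfolding transverse_def direct_sum_def by simp
  then show ?thesis using assms that by auto
qed

lemma pA_eq: "a \<in> A x \<Longrightarrow> b \<in> B x \<Longrightarrow> pA x (a + b) = a"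
  using proj_along_eq[of B x A b a] subspaceA subspaceB BA_int by (simp add: add.commute)

lemma pB_eq: "a \<in> A x \<Longrightarrow> b \<in> B x \<Longrightarrow> pB x (a + b) = b"
  using proj_along_eq[of A x B a b] subspaceA subspaceB AB_int by simp

lemma proj_props:
  assumes "e \<in> fibre E x"
  shows "pA x e \<in> A x" "pB x e \<in> B x" "e = pA x e + pB x e"
proof -
  obtain a b where ab: "a \<in> A x" "b \<in> B x" "e = a + b" by (rule decompose[OF assms])
  show "pA x e \<in> A x" "pB x e \<in> B x" "e = pA x e + pB x e" using ab by (simp_all add: pA_eq pB_eq)
qed

lemma pA_lin: "lin_on (fibre E x) (pA x)"
  unfolding lin_on_def
proof (intro allI ballI)
  fix a b u v assume u: "u \<in> fibre E x" and v: "v \<in> fibre E x"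
  have "a *\<^sub>R u + b *\<^sub>R v = a *\<^sub>R (pA x u + pB x u) + b *\<^sub>R (pA x v + pB x v)"
    using proj_props(3)[OF u] proj_props(3)[OF v] by simp
  also have "\<dots> = (a *\<^sub>R pA x u + b *\<^sub>R pA x v) + (a *\<^sub>R pB x u + b *\<^sub>R pB x v)"
    by (simp add: algebra_simps)
  finally have "a *\<^sub>R u + b *\<^sub>R v = (a *\<^sub>R pA x u + b *\<^sub>R pA x v) + (a *\<^sub>R pB x u + b *\<^sub>R pB x v)" .
  moreover have "a *\<^sub>R pA x u + b *\<^sub>R pA x v \<in> A x" "a *\<^sub>R pB x u + b *\<^sub>R pB x v \<in> B x"
    using proj_props[OF u] proj_props[OF v] by (simp_all add: subspace_add subspace_scale subspaceA subspaceB)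
  ultimately show "pA x (a *\<^sub>R u + b *\<^sub>R v) = a *\<^sub>R pA x u + b *\<^sub>R pA x v" by (simp only: pA_eq)
qed

lemma pA_section: assumes "s \<in> \<Gamma>" shows "(\<lambda>x. pA x (s x)) \<in> \<Gamma>A"
proof (rule E.projection_smooth[OF subA subB AB_int assms])
  fix x
  note p = proj_props[OF E.section_mem[OF assms, of x]]
  show "pA x (s x) \<in> A x" by (rule p(1))
  have "s x - pA x (s x) = pB x (s x)" using p(3) by (simp add: algebra_simps)
  then show "s x - pA x (s x) \<in> B x" using p(2) by simp
qed

lemma pB_section: assumes "s \<in> \<Gamma>" shows "(\<lambda>x. pB x (s x)) \<in> \<Gamma>B"
proof (rule E.projection_smooth[OF subB subA BA_int assms])
  fix x
  note p = proj_props[OF E.section_mem[OF assms, of x]]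
  show "pB x (s x) \<in> B x" by (rule p(2))
  have "s x - pB x (s x) = pA x (s x)" using p(3) by (simp add: algebra_simps)
  then show "s x - pB x (s x) \<in> A x" using p(1) by simp
qed

text \<open>B is isotropic, so an element of B sees only the component along A.\<close>

lemma pairing_B:
  assumes "b \<in> B x" "e \<in> fibre E x" shows "pairing C x b e = pairing C x b (pA x e)"
proof -
  note p = proj_props[OF assms(2)]
  have "pairing C x b (pA x e + pB x e) = pairing C x b (pA x e) + pairing C x b (pB x e)"
    by (rule lin_on_add[OF pairing_lin[OF fibB[OF assms(1)]] fibA[OF p(1)] fibB[OF p(2)]])
  then show ?thesis using p(3) isoB[OF assms(1) p(2)] by simp
qed

text \<open>The difference is orthogonal to A by assumption and to B by isotropy, hence to
  everything. This is the injectivity of the map from B to the twisted dual of A, in the form in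
  which elements of B are compared throughout.\<close>

lemma B_eqI:
  assumes b: "b \<in> B x" "b' \<in> B x" and e: "\<And>u. u \<in> A x \<Longrightarrow> pairing C x b u = pairing C x b' u"
  shows "b = b'"
proof -
  have f: "b \<in> fibre E x" "b' \<in> fibre E x" using b fibB by simp_all
  have "b - b' = 0"
  proof (rule nondegenerate)
    show "b - b' \<in> fibre E x" using f by (simp add: subspace_diff E.subspace_fibre)
    fix u assume u: "u \<in> fibre E x"
    have "pairing C x (b - b') u = pairing C x b u - pairing C x b' u" by (rule lin_on_diff[OF pairing_lin'[OF u] f])
    also have "\<dots> = 0" unfolding pairing_B[OF b(1) u] pairing_B[OF b(2) u] using e[OF proj_props(1)[OF u]] by simp
    finally show "pairing C x (b - b') u = 0" .
  qed
  then show ?thesis by simp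
qed

section \<open>The identification of B with \<open>A\<^sup>\<dagger>\<close>\<close>

lemma line_basis:
  obtains l where "l \<in> fibre L x" "l \<noteq> 0" "\<And>m. m \<in> fibre L x \<Longrightarrow> \<exists>c. m = c *\<^sub>R l"
proof -
  obtain V t where V: "(V, t) \<in> frames L" "x \<in> V" by (rule L.frame_at)
  have b: "basis_of 1 (fibre L x) (\<lambda>j. t j x)" using L.frame_props(2)[OF V] bundle_axioms(3) by simp
  show ?thesis
  proof (rule that[of "t 0 x"])
    show "t 0 x \<in> fibre L x" using basis_of_mem[OF b, of 0] by simp
    show "t 0 x \<noteq> 0" using basis_of_independent[OF b, of "\<lambda>_. 1" 0] by auto
    fix m assume m: "m \<in> fibre L x"
    obtain c where "m = (\<Sum>j<1. c j *\<^sub>R t j x)" by (rule basis_of_coeffs[OF b m])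
    then show "\<exists>c. m = c *\<^sub>R t 0 x" by (intro exI[of _ "c 0"]) simp
  qed
qed

text \<open>Surjectivity of that identification. The functional is extended to the whole fibre by
  composing with the projection to A, and represented by a vector through the Gram matrix, which is
  square with trivial kernel. The extension vanishes on B, so the vector is orthogonal to B and
  therefore lies in B.\<close>

lemma exists_dual_vector:
  assumes lin: "lin_on (A x) \<phi>" and L: "\<And>u. u \<in> A x \<Longrightarrow> \<phi> u \<in> fibre L x"
  shows "\<exists>b\<in>B x. \<forall>u\<in>A x. pairing C x b u = \<phi> u"
proof -
  obtain U s where U: "(U, s) \<in> frames E" "x \<in> U" by (rule E.frame_at)
  note b = E.frame_props(2)[OF U]
  note m = basis_of_mem[OF b]
  obtain l where l: "l \<in> fibre L x" "l \<noteq> 0" "\<And>m. m \<in> fibre L x \<Longrightarrow> \<exists>c. m = c *\<^sub>R l"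
    by (rule line_basis) (rule that)
  have "\<forall>i j. \<exists>c. i < E.rk \<longrightarrow> j < E.rk \<longrightarrow> pairing C x (s i x) (s j x) = c *\<^sub>R l"
    using l(3) pairing_fibre m by simp
  then obtain G where G: "\<And>i j. i < E.rk \<Longrightarrow> j < E.rk \<Longrightarrow> pairing C x (s i x) (s j x) = G i j *\<^sub>R l" by metis
  have "\<forall>i. \<exists>c. i < E.rk \<longrightarrow> \<phi> (pA x (s i x)) = c *\<^sub>R l"
    using l(3) L proj_props(1) m by simp
  then obtain v where v: "\<And>i. i < E.rk \<Longrightarrow> \<phi> (pA x (s i x)) = v i *\<^sub>R l" by metis
  have sp: "pairing C x (s i x) (\<Sum>j<E.rk. \<kappa> j *\<^sub>R s j x) = (\<Sum>j<E.rk. G i j * \<kappa> j) *\<^sub>R l" if "i < E.rk" for i \<kappa>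
  proof -
    have "pairing C x (s i x) (\<Sum>j<E.rk. \<kappa> j *\<^sub>R s j x) = (\<Sum>j<E.rk. \<kappa> j *\<^sub>R pairing C x (s i x) (s j x))"
      by (rule lin_on_sum[OF pairing_lin[OF m[OF that]] E.subspace_fibre]) (simp_all add: m)
    then show ?thesis using G that by (simp add: scaleR_sum_left mult.commute)
  qed
  have ext: "pairing C x w e' = (\<Sum>j<E.rk. q j *\<^sub>R pairing C x (s j x) w)"
    if w: "w \<in> fibre E x" and q: "e' = (\<Sum>j<E.rk. q j *\<^sub>R s j x)" for w e' q
  proof -
    have "pairing C x w e' = (\<Sum>j<E.rk. q j *\<^sub>R pairing C x w (s j x))"
      unfolding q by (rule lin_on_sum[OF pairing_lin[OF w] E.subspace_fibre]) (simp_all add: m)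
    then show ?thesis using pairing_sym[OF w m] by simp
  qed
  have "trivial_kernel {..<E.rk} E.rk G"
    unfolding trivial_kernel_def
  proof (intro allI impI)
    fix \<kappa> j assume \<kappa>: "\<forall>i\<in>{..<E.rk}. (\<Sum>j<E.rk. G i j * \<kappa> j) = 0" and j: "j < E.rk"
    let ?w = "\<Sum>j<E.rk. \<kappa> j *\<^sub>R s j x"
    have w: "?w \<in> fibre E x" by (rule basis_of_combination_mem[OF b])
    have "?w = 0"
    proof (rule nondegenerate[OF w])
      fix e' assume e': "e' \<in> fibre E x"
      obtain q where "e' = (\<Sum>j<E.rk. q j *\<^sub>R s j x)" by (rule basis_of_coeffs[OF b e'])
      from ext[OF w this] show "pairing C x ?w e' = 0" using \<kappa> by (simp add: sp)
    qed
    then show "\<kappa> j = 0" by (rule basis_of_independent[OF b _ j])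
  qed
  from square_system_solvable[OF finite_lessThan card_lessThan this, of v]
  obtain c where c: "\<forall>i\<in>{..<E.rk}. (\<Sum>j<E.rk. G i j * c j) = v i" by (rule exE)
  define e where "e = (\<Sum>j<E.rk. c j *\<^sub>R s j x)"
  have eE: "e \<in> fibre E x" unfolding e_def by (rule basis_of_combination_mem[OF b])
  have e: "pairing C x e u = \<phi> (pA x u)" if u: "u \<in> fibre E x" for u
  proof -
    obtain q where q: "u = (\<Sum>j<E.rk. q j *\<^sub>R s j x)" by (rule basis_of_coeffs[OF b u])
    have "pairing C x e u = (\<Sum>j<E.rk. q j *\<^sub>R v j *\<^sub>R l)"
      unfolding ext[OF eE q] using c unfolding e_def by (simp add: sp)
    also have "\<dots> = (\<Sum>j<E.rk. q j *\<^sub>R \<phi> (pA x (s j x)))" using v by simp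
    also have "\<dots> = \<phi> (\<Sum>j<E.rk. q j *\<^sub>R pA x (s j x))"
      by (rule lin_on_sum[OF lin subspaceA, symmetric]) (simp_all add: proj_props(1) m)
    also have "(\<Sum>j<E.rk. q j *\<^sub>R pA x (s j x)) = pA x u"
      unfolding q by (rule lin_on_sum[OF pA_lin E.subspace_fibre, symmetric]) (simp_all add: m)
    finally show ?thesis .
  qed
  have p0: "pA x u = 0" if "u \<in> B x" for u using pA_eq[OF subspace_0[OF subspaceA] that] by simp
  have p1: "pA x u = u" if "u \<in> A x" for u using pA_eq[OF that subspace_0[OF subspaceB]] by simp
  have "e \<in> B x"
    by (rule almost_dirac_memI[OF B eE])
       (simp add: e fibB p0 lin_on_zero[OF lin subspace_0[OF subspaceA]])
  moreover have "\<forall>u\<in>A x. pairing C x e u = \<phi> u" by (simp add: e fibA p1)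
  ultimately show ?thesis by blast
qed

text \<open>Membership in the fibre of \<open>A\<^sup>\<dagger>\<close> over x, in the encoding by
  functions on lists.\<close>

definition dual_at :: "'m \<Rightarrow> ('v list \<Rightarrow> 'l) \<Rightarrow> bool" where
  "dual_at x \<alpha> \<longleftrightarrow> lin_on (A x) (\<lambda>u. \<alpha> [u]) \<and> (\<forall>u\<in>A x. \<alpha> [u] \<in> fibre L x) \<and>
    (\<forall>vs. \<not> (length vs = 1 \<and> set vs \<subseteq> A x) \<longrightarrow> \<alpha> vs = 0)"

lemma flat_eqI:
  assumes "dual_at x \<alpha>" "\<And>u. u \<in> A x \<Longrightarrow> pairing C x b u = \<alpha> [u]"
  shows "flat C A x b = \<alpha>"
proof
  fix vs show "flat C A x b vs = \<alpha> vs"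
  proof (cases "length vs = 1 \<and> set vs \<subseteq> A x")
    case True
    then obtain u where "vs = [u]" by (cases vs) auto
    then show ?thesis using True assms(2) by (simp add: flat_def)
  next
    case False
    then have "\<alpha> vs = 0" using assms(1) unfolding dual_at_def by simp
    then show ?thesis using False unfolding flat_def by auto
  qed
qed

lemma flat_inj: "inj_on (flat C A x) (B x)"
proof (rule inj_onI, rule B_eqI)
  fix b b' u assume e: "flat C A x b = flat C A x b'" and u: "u \<in> A x"
  show "pairing C x b u = pairing C x b' u" using fun_cong[OF e, of "[u]"] u by (simp add: flat_def)
qed

lemma lift_eqI:
  assumes "dual_at x \<alpha>" "b \<in> B x" "\<And>u. u \<in> A x \<Longrightarrow> pairing C x b u = \<alpha> [u]"
  shows "lift C A B x \<alpha> = b"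
  using inv_into_f_f[OF flat_inj assms(2)] flat_eqI[OF assms(1,3)] unfolding lift_def by simp

lemma lift_props:
  assumes "dual_at x \<alpha>"
  shows "lift C A B x \<alpha> \<in> B x" "u \<in> A x \<Longrightarrow> pairing C x (lift C A B x \<alpha>) u = \<alpha> [u]"
proof -
  have "\<exists>b\<in>B x. \<forall>u\<in>A x. pairing C x b u = \<alpha> [u]"
    by (rule exists_dual_vector) (use assms in \<open>simp_all add: dual_at_def\<close>)
  then obtain b where b: "b \<in> B x" "\<And>u. u \<in> A x \<Longrightarrow> pairing C x b u = \<alpha> [u]" by blast
  have "lift C A B x \<alpha> = b" by (rule lift_eqI[OF assms b])
  then show "lift C A B x \<alpha> \<in> B x" "u \<in> A x \<Longrightarrow> pairing C x (lift C A B x \<alpha>) u = \<alpha> [u]" using b by simp_all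
qed

abbreviation "\<Omega> \<equiv> forms M E A L"
abbreviation "\<Omega>R \<equiv> forms M E A trivial_line"
abbreviation "\<Lambda> \<equiv> lift_sec C A B"

lemma form1_dual_at: "\<alpha> \<in> \<Omega> 1 \<Longrightarrow> dual_at x (\<alpha> x)"
  unfolding dual_at_def de_Morgan_conj using form1_props[of \<alpha> M E A L] by blast

lemma lift_sec_pair: "\<alpha> \<in> \<Omega> 1 \<Longrightarrow> u \<in> A x \<Longrightarrow> pairing C x (\<Lambda> \<alpha> x) u = \<alpha> x [u]"
  unfolding lift_sec_def by (rule lift_props(2)[OF form1_dual_at])

text \<open>The lift is an inverse taken point by point. Its pairing with an arbitrary section s is
  \<alpha> evaluated on the projection of s to A, which is smooth, and
  \<open>smooth_by_pairing\<close> turns this into smoothness of the lift.\<close>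

lemma lift_sec_section: assumes "\<alpha> \<in> \<Omega> 1" shows "\<Lambda> \<alpha> \<in> \<Gamma>B"
proof -
  have m: "\<Lambda> \<alpha> x \<in> B x" for x unfolding lift_sec_def by (rule lift_props(1)[OF form1_dual_at[OF assms]])
  have "\<Lambda> \<alpha> \<in> \<Gamma>"
  proof (rule smooth_by_pairing)
    show "\<Lambda> \<alpha> x \<in> fibre E x" for x by (rule fibB[OF m])
    fix s assume s: "s \<in> \<Gamma>"
    have "pr (\<Lambda> \<alpha>) s = (\<lambda>x. \<alpha> x [pA x (s x)])"
    proof
      fix x
      note sx = E.section_mem[OF s, of x]
      show "pr (\<Lambda> \<alpha>) s x = \<alpha> x [pA x (s x)]"
        unfolding pr_apply pairing_B[OF m sx] by (rule lift_sec_pair[OF assms proj_props(1)[OF sx]])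
    qed
    then show "pr (\<Lambda> \<alpha>) s \<in> \<Gamma>L" using form1_props(3)[OF assms pA_section[OF s]] by simp
  qed
  then show ?thesis using m unfolding sub_sections_iff by simp
qed

lemma lift_sec_eqI:
  assumes "\<alpha> \<in> \<Omega> 1" "\<And>x. b x \<in> B x" "\<And>x u. u \<in> A x \<Longrightarrow> pairing C x (b x) u = \<alpha> x [u]"
  shows "\<Lambda> \<alpha> = b"
  unfolding lift_sec_def by (rule ext) (rule lift_eqI[OF form1_dual_at[OF assms(1)] assms(2,3)])

lemma pr_lift: "\<alpha> \<in> \<Omega> 1 \<Longrightarrow> X \<in> \<Gamma>A \<Longrightarrow> pr (\<Lambda> \<alpha>) X = (\<lambda>x. \<alpha> x [X x])"
  by (rule ext) (simp add: pr_apply lift_sec_pair \<Gamma>A_mem)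

section \<open>Contractions of two-forms and their lifts to B\<close>

definition contract :: "('m \<Rightarrow> 'v) \<Rightarrow> ('m \<Rightarrow> 'v list \<Rightarrow> 'l) \<Rightarrow> 'm \<Rightarrow> 'v list \<Rightarrow> 'l" where
  "contract X \<eta> = (\<lambda>x us. \<eta> x (X x # us))"

lemma contract_apply: "contract X \<eta> x [u] = \<eta> x [X x, u]"
  by (simp add: contract_def)

lemma contract_form:
  assumes \<eta>: "\<eta> \<in> \<Omega> 2" and X: "X \<in> \<Gamma>A"
  shows "contract X \<eta> \<in> \<Omega> 1"
proof -
  have "contract X \<eta> = form1 A (\<lambda>x v. \<eta> x [X x, v])"
  proof (intro ext)
    fix x us show "contract X \<eta> x us = form1 A (\<lambda>x v. \<eta> x [X x, v]) x us"
    proof (cases "length us = 1 \<and> set us \<subseteq> A x")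
      case True
      then obtain u where "us = [u]" by (cases us) auto
      then show ?thesis using True by (simp add: contract_def form1_def)
    next
      case False
      then have "\<eta> x (X x # us) = 0" using form_zero[OF \<eta>, of "X x # us" x] by auto
      then show ?thesis using False by (auto simp: contract_def form1_def)
    qed
  qed
  moreover have "form1 A (\<lambda>x v. \<eta> x [X x, v]) \<in> \<Omega> 1"
    by (rule form1_in_forms[OF subspaceA])
       (simp_all add: form2_props[OF \<eta>] \<Gamma>A_mem[OF X] X)
  ultimately show ?thesis by simp
qed

definition hat :: "('m \<Rightarrow> 'v list \<Rightarrow> 'l) \<Rightarrow> ('m \<Rightarrow> 'v) \<Rightarrow> 'm \<Rightarrow> 'v" where
  "hat \<eta> X = \<Lambda> (contract X \<eta>)"

lemma hat_section: "\<eta> \<in> \<Omega> 2 \<Longrightarrow> X \<in> \<Gamma>A \<Longrightarrow> hat \<eta> X \<in> \<Gamma>B"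
  unfolding hat_def by (rule lift_sec_section[OF contract_form])

definition ev2 :: "('m \<Rightarrow> 'v list \<Rightarrow> 'l) \<Rightarrow> ('m \<Rightarrow> 'v) \<Rightarrow> ('m \<Rightarrow> 'v) \<Rightarrow> 'm \<Rightarrow> 'l" where
  "ev2 \<eta> X Y = (\<lambda>x. \<eta> x [X x, Y x])"

lemma ev2_section: "\<eta> \<in> \<Omega> 2 \<Longrightarrow> X \<in> \<Gamma>A \<Longrightarrow> Y \<in> \<Gamma>A \<Longrightarrow> ev2 \<eta> X Y \<in> \<Gamma>L"
  unfolding ev2_def by (rule form2_props(4))

lemma ev2_skew: "\<eta> \<in> \<Omega> 2 \<Longrightarrow> X \<in> \<Gamma>A \<Longrightarrow> Y \<in> \<Gamma>A \<Longrightarrow> ev2 \<eta> Y X = - ev2 \<eta> X Y"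
  using form2_skew[of \<eta> M E A L _ "X _" "Y _"] subspaceA by (intro ext) (simp add: ev2_def \<Gamma>A_mem)

lemma pr_hat: "\<eta> \<in> \<Omega> 2 \<Longrightarrow> X \<in> \<Gamma>A \<Longrightarrow> Y \<in> \<Gamma>A \<Longrightarrow> pr (hat \<eta> X) Y = ev2 \<eta> X Y"
  unfolding hat_def ev2_def by (simp add: pr_lift contract_form contract_apply)

lemma pr_hat': "\<eta> \<in> \<Omega> 2 \<Longrightarrow> X \<in> \<Gamma>A \<Longrightarrow> Y \<in> \<Gamma>A \<Longrightarrow> pr Y (hat \<eta> X) = ev2 \<eta> X Y"
  using pr_hat[of \<eta> X Y] pr_sym[OF \<Gamma>A_sec \<Gamma>B_sec[OF hat_section], of Y \<eta> X] by simp

end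

section \<open>Wedge products of low degree\<close>

text \<open>A product over pairs of positions can be unfolded for a numeral n, whereas the
  cardinality of the set of inversions cannot.\<close>

lemma shuffle_sign_prod:
  "shuffle_sign n I = (\<Prod>i<n. \<Prod>j<i. if i \<in> I \<and> j \<notin> I then - 1 else 1)"
proof -
  let ?S = "SIGMA i:{..<n}. {..<i}"
  have "{(i, j). i \<in> I \<and> j \<notin> I \<and> j < i \<and> i < n} = {p \<in> ?S. fst p \<in> I \<and> snd p \<notin> I}" by auto
  then have "shuffle_sign n I = (\<Prod>p\<in>{p \<in> ?S. fst p \<in> I \<and> snd p \<notin> I}. - 1)"
    unfolding shuffle_sign_def by simp
  also have "\<dots> = (\<Prod>p\<in>?S. if fst p \<in> I \<and> snd p \<notin> I then - 1 else 1)"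
    by (rule prod.inter_filter) simp
  also have "\<dots> = (\<Prod>i<n. \<Prod>j<i. if i \<in> I \<and> j \<notin> I then - 1 else 1)"
    by (simp add: prod.Sigma split_def)
  finally show ?thesis .
qed

text \<open>Recursion on the largest position; with the product form of the sign it makes the wedge
  of a short explicit list computable by rewriting.\<close>

lemma sum_Pow_Suc:
  "(\<Sum>I\<in>Pow {..<Suc n}. f I) = (\<Sum>I\<in>Pow {..<n}. f I) + (\<Sum>I\<in>Pow {..<n}. f (insert n I))"
proof -
  have inj: "inj_on (insert n) (Pow {..<n})"
  proof (rule inj_onI)
    fix I J assume "I \<in> Pow {..<n}" "J \<in> Pow {..<n}" "insert n I = insert n J"
    then show "I = J" by (metis Pow_iff insert_ident lessThan_iff less_irrefl subsetD)
  qed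
  have "Pow {..<Suc n} = Pow {..<n} \<union> insert n ` Pow {..<n}" unfolding lessThan_Suc by (rule Pow_insert)
  moreover have "Pow {..<n} \<inter> insert n ` Pow {..<n} = {}" by auto
  ultimately show ?thesis by (simp add: sum.union_disjoint sum.reindex[OF inj])
qed

lemma wedge_Nil: "wedge w z [] = w [] *\<^sub>R z []"
  by (simp add: wedge_def shuffle_sign_prod)

lemma wedge_1: "wedge w z [a] = w [] *\<^sub>R z [a] + w [a] *\<^sub>R z []"
  by (simp add: wedge_def sum_Pow_Suc shuffle_sign_prod nths_Cons)

lemma wedge_2:
  "wedge w z [a, b] = w [] *\<^sub>R z [a, b] + w [a] *\<^sub>R z [b] - w [b] *\<^sub>R z [a] + w [a, b] *\<^sub>R z []"
  by (simp add: wedge_def sum_Pow_Suc shuffle_sign_prod nths_Cons numeral_2_eq_2)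

lemma wedge_3:
  "wedge w z [a, b, c] = w [] *\<^sub>R z [a, b, c] + w [a] *\<^sub>R z [b, c] - w [b] *\<^sub>R z [a, c] + w [c] *\<^sub>R z [a, b] +
    w [a, b] *\<^sub>R z [c] - w [a, c] *\<^sub>R z [b] + w [b, c] *\<^sub>R z [a] + w [a, b, c] *\<^sub>R z []"
  by (simp add: wedge_def sum_Pow_Suc shuffle_sign_prod nths_Cons numeral_2_eq_2 numeral_3_eq_3 del: lessThan_Suc)

lemma length_nths_compl: "length (nths xs I) + length (nths xs (- I)) = length xs"
proof -
  have "{i. i < length xs \<and> i \<in> I} \<union> {i. i < length xs \<and> i \<in> - I} = {..<length xs}" by auto
  moreover have "card ({i. i < length xs \<and> i \<in> I} \<union> {i. i < length xs \<and> i \<in> - I}) =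
      card {i. i < length xs \<and> i \<in> I} + card {i. i < length xs \<and> i \<in> - I}"
    by (rule card_Un_disjoint) auto
  ultimately show ?thesis by (simp add: length_nths)
qed

lemma set_nths_compl: "set xs \<subseteq> set (nths xs I) \<union> set (nths xs (- I))"
proof
  fix a assume "a \<in> set xs"
  then obtain i where "i < length xs" "a = xs ! i" by (auto simp: in_set_conv_nth)
  then show "a \<in> set (nths xs I) \<union> set (nths xs (- I))" by (cases "i \<in> I") (auto simp: set_nths)
qed

text \<open>A shuffle distributes all entries among the two factors, so degrees add and every entry
  has to lie in S for a term to survive.\<close>

lemma wedge_vanish:
  assumes w: "\<And>vs. w vs \<noteq> 0 \<Longrightarrow> length vs = p \<and> set vs \<subseteq> S" and z: "\<And>vs. z vs \<noteq> 0 \<Longrightarrow> length vs = q \<and> set vs \<subseteq> S"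
    and vs: "\<not> (length vs = p + q \<and> set vs \<subseteq> S)"
  shows "wedge w z vs = 0"
  unfolding wedge_def
proof (rule sum.neutral, rule ballI)
  fix I
  show "(shuffle_sign (length vs) I * w (nths vs I)) *\<^sub>R z (nths vs (- I)) = 0"
  proof (rule ccontr)
    assume "(shuffle_sign (length vs) I * w (nths vs I)) *\<^sub>R z (nths vs (- I)) \<noteq> 0"
    then have "w (nths vs I) \<noteq> 0" "z (nths vs (- I)) \<noteq> 0" by auto
    then have "length (nths vs I) = p" "set (nths vs I) \<subseteq> S" "length (nths vs (- I)) = q" "set (nths vs (- I)) \<subseteq> S"
      using w z by simp_all
    then show False using vs length_nths_compl[of vs I] set_nths_compl[of vs I] by auto
  qed
qed

lemma nths_Nil_index: "nths vs I = [] \<Longrightarrow> I \<subseteq> {..<length vs} \<Longrightarrow> I = {}"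
  using length_nths[of vs I] by (auto simp: card_eq_0_iff)

lemma wedge_zero_left:
  assumes "\<And>vs. vs \<noteq> [] \<Longrightarrow> w vs = 0" shows "wedge w z vs = w [] *\<^sub>R z vs"
proof -
  have "wedge w z vs = (\<Sum>I\<in>Pow {..<length vs}. if I = {} then w [] *\<^sub>R z vs else 0)"
    unfolding wedge_def
  proof (rule sum.cong[OF refl])
    fix I assume I: "I \<in> Pow {..<length vs}"
    show "(shuffle_sign (length vs) I * w (nths vs I)) *\<^sub>R z (nths vs (- I)) = (if I = {} then w [] *\<^sub>R z vs else 0)"
    proof (cases "I = {}")
      case True
      then show ?thesis by (simp add: shuffle_sign_def nths_all)
    next
      case False
      then have "nths vs I \<noteq> []" using nths_Nil_index[of vs I] I by auto
      then show ?thesis using assms False by simp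
    qed
  qed
  then show ?thesis by simp
qed

lemma form_wedge_zero_form: "form_wedge (zero_form f) \<alpha> = (\<lambda>x vs. f x *\<^sub>R \<alpha> x vs)"
  unfolding form_wedge_def by (intro ext, subst wedge_zero_left) (simp_all add: zero_form_def)

section \<open>Module operations on forms\<close>

context smooth_bundle begin

lemma zero_form_in_forms:
  assumes "l \<in> sections M L" "\<And>x. l x \<in> fibre L x"
  shows "zero_form l \<in> forms M E' A L 0"
proof (rule formsI)
  show "zero_form l x vs \<in> fibre L x" if "int (length vs) = 0" for x vs using assms(2) that by (simp add: zero_form_def)
  show "zero_form l x vs = 0" if "\<not> (set vs \<subseteq> A x \<and> int (length vs) = 0)" for x vs
    using that by (auto simp: zero_form_def)
  show "(\<lambda>x. zero_form l x (map (\<lambda>X. X x) Xs)) \<in> sections M L" if "int (length Xs) = 0" for Xs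
    using assms(1) that by (simp add: zero_form_def)
qed (auto simp: zero_form_def lin_on_def)

lemma scale_form_real:
  assumes "f \<in> smooth_funs M" shows "zero_form f \<in> forms M E' A trivial_line 0"
proof -
  have "f \<in> sections M trivial_line" using assms unfolding sections_trivial_line .
  then show ?thesis by (rule zero_form_in_forms) (simp add: fibre_trivial_line)
qed

lemma fmult_form:
  assumes f: "f \<in> smooth_funs M" and \<alpha>: "\<alpha> \<in> forms M E' A E k"
  shows "(\<lambda>x vs. f x *\<^sub>R \<alpha> x vs) \<in> forms M E' A E k"
proof (rule formsI)
  show "f x *\<^sub>R \<alpha> x vs \<in> fibre E x" if "set vs \<subseteq> A x" "int (length vs) = k" for x vs
    using form_mem[OF \<alpha> that] by (simp add: subspace_scale subspace_fibre)
  show "f x *\<^sub>R \<alpha> x vs = 0" if "\<not> (set vs \<subseteq> A x \<and> int (length vs) = k)" for x vs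
    using form_zero[OF \<alpha> that] by simp
  show "lin_on (A x) (\<lambda>u. f x *\<^sub>R \<alpha> x (us @ u # vs))" if "set us \<subseteq> A x" "set vs \<subseteq> A x" for x us vs
    using form_lin[OF \<alpha> that] by (simp add: lin_on_def scaleR_add_right mult.commute)
  show "f x *\<^sub>R \<alpha> x vs = 0" if "\<not> distinct vs" for x vs using form_distinct[OF \<alpha> that] by simp
  show "(\<lambda>x. f x *\<^sub>R \<alpha> x (map (\<lambda>X. X x) Xs)) \<in> sections M E"
    if "set Xs \<subseteq> sub_sections M E' A" "int (length Xs) = k" for Xs
    using section_fmult[OF f form_smooth[OF \<alpha> that]] by (simp add: fmult_def)
qed

lemma form_add:
  assumes \<alpha>: "\<alpha> \<in> forms M E' A E k" and \<beta>: "\<beta> \<in> forms M E' A E k"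
  shows "\<alpha> + \<beta> \<in> forms M E' A E k"
proof (rule formsI)
  show "(\<alpha> + \<beta>) x vs \<in> fibre E x" if "set vs \<subseteq> A x" "int (length vs) = k" for x vs
    using form_mem[OF \<alpha> that] form_mem[OF \<beta> that] by (simp add: subspace_add subspace_fibre)
  show "(\<alpha> + \<beta>) x vs = 0" if "\<not> (set vs \<subseteq> A x \<and> int (length vs) = k)" for x vs
    using form_zero[OF \<alpha> that] form_zero[OF \<beta> that] by simp
  show "lin_on (A x) (\<lambda>u. (\<alpha> + \<beta>) x (us @ u # vs))" if "set us \<subseteq> A x" "set vs \<subseteq> A x" for x us vs
    using form_lin[OF \<alpha> that] form_lin[OF \<beta> that] by (simp add: lin_on_def scaleR_add_right)
  show "(\<alpha> + \<beta>) x vs = 0" if "\<not> distinct vs" for x vs using form_distinct[OF \<alpha> that] form_distinct[OF \<beta> that] by simp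
  show "(\<lambda>x. (\<alpha> + \<beta>) x (map (\<lambda>X. X x) Xs)) \<in> sections M E"
    if "set Xs \<subseteq> sub_sections M E' A" "int (length Xs) = k" for Xs
    using section_add[OF form_smooth[OF \<alpha> that] form_smooth[OF \<beta> that]] by (simp add: plus_fun_def)
qed

lemma form_zero_form: "0 \<in> forms M E' A E k"
  by (rule formsI) (use section_zero in \<open>simp_all add: lin_on_def subspace_0 subspace_fibre zero_fun_def\<close>)

end

context lagrangian_pair begin

text \<open>The one-forms \<omega> \<otimes> l. They are the test objects on which the unknown
  derivation of a bracket operator is read off, and they give the coframe that decomposes
  \<Upsilon>.\<close>

lemma ol_form:
  assumes \<omega>: "\<omega> \<in> \<Omega>R 1" and l: "l \<in> \<Gamma>L"
  shows "form_wedge \<omega> (zero_form l) \<in> \<Omega> 1"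
    and "u \<in> A x \<Longrightarrow> form_wedge \<omega> (zero_form l) x [u] = \<omega> x [u] *\<^sub>R l x"
proof -
  have "form_wedge \<omega> (zero_form l) = form1 A (\<lambda>x u. \<omega> x [u] *\<^sub>R l x)"
  proof (intro ext)
    fix x vs show "form_wedge \<omega> (zero_form l) x vs = form1 A (\<lambda>x u. \<omega> x [u] *\<^sub>R l x) x vs"
    proof (cases "length vs = 1 \<and> set vs \<subseteq> A x")
      case True
      then obtain u where "vs = [u]" by (cases vs) auto
      then show ?thesis using True by (simp add: form_wedge_def wedge_1 form1_def zero_form_def)
    next
      case False
      then have "form1 A (\<lambda>x u. \<omega> x [u] *\<^sub>R l x) x vs = 0" unfolding form1_def by auto
      moreover have "wedge (\<omega> x) (zero_form l x) vs = 0"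
      proof (rule wedge_vanish[of _ 1 "A x" _ 0])
        show "length vs = 1 \<and> set vs \<subseteq> A x" if "\<omega> x vs \<noteq> 0" for vs
          using that form1_props(4,5)[OF \<omega>, of vs x] by blast
        show "length vs = 0 \<and> set vs \<subseteq> A x" if "zero_form l x vs \<noteq> 0" for vs
          using that by (cases vs) (simp_all add: zero_form_def)
      qed (use False in simp)
      ultimately show ?thesis by (simp add: form_wedge_def)
    qed
  qed
  moreover have "form1 A (\<lambda>x u. \<omega> x [u] *\<^sub>R l x) \<in> \<Omega> 1"
  proof (rule form1_in_forms[OF subspaceA])
    show "lin_on (A x) (\<lambda>u. \<omega> x [u] *\<^sub>R l x)" for x
      using form1_props(1)[OF \<omega>, of x] by (simp add: lin_on_def scaleR_left_distrib)
    show "\<omega> x [u] *\<^sub>R l x \<in> fibre L x" for x u using L.section_mem[OF l] by (simp add: subspace_scale L.subspace_fibre)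
    show "(\<lambda>x. \<omega> x [X x] *\<^sub>R l x) \<in> \<Gamma>L" if "X \<in> \<Gamma>A" for X
      using L.section_fmult[OF E.form1_fun[OF \<omega> that] l] by (simp add: fmult_def)
  qed
  ultimately show "form_wedge \<omega> (zero_form l) \<in> \<Omega> 1"
    and "u \<in> A x \<Longrightarrow> form_wedge \<omega> (zero_form l) x [u] = \<omega> x [u] *\<^sub>R l x" by (simp_all add: form1_apply)
qed

lemma wedge11_form:
  assumes \<omega>: "\<omega> \<in> \<Omega>R 1" and \<beta>: "\<beta> \<in> \<Omega> 1"
  shows "form_wedge \<omega> \<beta> \<in> \<Omega> 2"
    and "u \<in> A x \<Longrightarrow> v \<in> A x \<Longrightarrow> form_wedge \<omega> \<beta> x [u, v] = \<omega> x [u] *\<^sub>R \<beta> x [v] - \<omega> x [v] *\<^sub>R \<beta> x [u]"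
proof -
  let ?f = "\<lambda>x u v. \<omega> x [u] *\<^sub>R \<beta> x [v] - \<omega> x [v] *\<^sub>R \<beta> x [u]"
  have "form_wedge \<omega> \<beta> = form2 A ?f"
  proof (intro ext)
    fix x vs show "form_wedge \<omega> \<beta> x vs = form2 A ?f x vs"
    proof (cases "length vs = 2 \<and> set vs \<subseteq> A x")
      case True
      then obtain u v where "vs = [u, v]" by (auto simp: numeral_2_eq_2 length_Suc_conv)
      then show ?thesis using True form1_props(4)[OF \<omega>] form1_props(4)[OF \<beta>] by (simp add: form_wedge_def wedge_2 form2_def)
    next
      case False
      then have "form2 A ?f x vs = 0" unfolding form2_def by auto
      moreover have "wedge (\<omega> x) (\<beta> x) vs = 0"
      proof (rule wedge_vanish[of _ 1 "A x" _ 1])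
        show "length vs = 1 \<and> set vs \<subseteq> A x" if "\<omega> x vs \<noteq> 0" for vs
          using that form1_props(4,5)[OF \<omega>, of vs x] by blast
        show "length vs = 1 \<and> set vs \<subseteq> A x" if "\<beta> x vs \<noteq> 0" for vs
          using that form1_props(4,5)[OF \<beta>, of vs x] by blast
      qed (use False in simp)
      ultimately show ?thesis by (simp add: form_wedge_def)
    qed
  qed
  moreover have "form2 A ?f \<in> \<Omega> 2"
  proof (rule form2_in_forms[OF subspaceA])
    show "lin_on (A x) (?f x u)" for x u
      using form1_props(1)[OF \<omega>, of x] form1_props(1)[OF \<beta>, of x] by (simp add: lin_on_def algebra_simps)
    show "?f x u v \<in> fibre L x" if "u \<in> A x" "v \<in> A x" for x u v
      using form1_props(2)[OF \<beta>] that by (simp add: subspace_scale subspace_diff L.subspace_fibre)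
    show "(\<lambda>x. ?f x (X x) (Y x)) \<in> \<Gamma>L" if "X \<in> \<Gamma>A" "Y \<in> \<Gamma>A" for X Y
      using L.section_diff[OF L.section_fmult[OF E.form1_fun[OF \<omega> that(1)] form1_props(3)[OF \<beta> that(2)]]
          L.section_fmult[OF E.form1_fun[OF \<omega> that(2)] form1_props(3)[OF \<beta> that(1)]]]
      by (simp add: fmult_def fun_diff_def)
  qed simp
  ultimately show "form_wedge \<omega> \<beta> \<in> \<Omega> 2"
    and "u \<in> A x \<Longrightarrow> v \<in> A x \<Longrightarrow> form_wedge \<omega> \<beta> x [u, v] = \<omega> x [u] *\<^sub>R \<beta> x [v] - \<omega> x [v] *\<^sub>R \<beta> x [u]"
    by (simp_all add: form2_apply)
qed

lemma hat_eqI: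
  assumes "\<eta> \<in> \<Omega> 2" "X \<in> \<Gamma>A" "\<And>x. b x \<in> B x" "\<And>x u. u \<in> A x \<Longrightarrow> pairing C x (b x) u = \<eta> x [X x, u]"
  shows "hat \<eta> X = b"
  unfolding hat_def by (rule lift_sec_eqI[OF contract_form[OF assms(1,2)] assms(3)]) (simp add: contract_apply assms(4))

lemma hat_pair: "\<eta> \<in> \<Omega> 2 \<Longrightarrow> X \<in> \<Gamma>A \<Longrightarrow> u \<in> A x \<Longrightarrow> pairing C x (hat \<eta> X x) u = \<eta> x [X x, u]"
  unfolding hat_def by (simp add: lift_sec_pair contract_form contract_apply)

lemma hat_add:
  assumes \<eta>: "\<eta> \<in> \<Omega> 2" "\<eta>' \<in> \<Omega> 2" and X: "X \<in> \<Gamma>A"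
  shows "hat (\<eta> + \<eta>') X = hat \<eta> X + hat \<eta>' X"
proof (rule hat_eqI[OF L.form_add[OF \<eta>] X])
  note m = \<Gamma>B_mem[OF hat_section[OF \<eta>(1) X]] \<Gamma>B_mem[OF hat_section[OF \<eta>(2) X]]
  show "(hat \<eta> X + hat \<eta>' X) x \<in> B x" for x using m by (simp add: subspace_add subspaceB)
  show "pairing C x ((hat \<eta> X + hat \<eta>' X) x) u = (\<eta> + \<eta>') x [X x, u]" if "u \<in> A x" for x u
    using lin_on_add[OF pairing_lin'[OF fibA[OF that]] fibB[OF m(1)] fibB[OF m(2)]]
    by (simp add: hat_pair \<eta> X that)
qed

lemma hat_fmult:
  assumes f: "f \<in> smooth_funs M" and \<eta>: "\<eta> \<in> \<Omega> 2" and X: "X \<in> \<Gamma>A"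
  shows "hat (\<lambda>x vs. f x *\<^sub>R \<eta> x vs) X = fmult f (hat \<eta> X)"
proof (rule hat_eqI[OF L.fmult_form[OF f \<eta>] X])
  note m = \<Gamma>B_mem[OF hat_section[OF \<eta> X]]
  show "fmult f (hat \<eta> X) x \<in> B x" for x using m by (simp add: subspace_scale subspaceB fmult_apply)
  show "pairing C x (fmult f (hat \<eta> X) x) u = f x *\<^sub>R \<eta> x [X x, u]" if "u \<in> A x" for x u
    using lin_on_scale[OF pairing_lin'[OF fibA[OF that]] fibB[OF m]]
    by (simp add: hat_pair \<eta> X that fmult_apply)
qed

text \<open>The contraction \<omega>(X) \<beta> - \<beta>(X) \<omega>, transported to B. In the
  second term \<beta>(X) has values in L and is no function, so that term is lifted as a whole and
  not as a multiple of a lift.\<close>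

lemma hat_wedge:
  assumes \<omega>: "\<omega> \<in> \<Omega>R 1" and \<beta>: "\<beta> \<in> \<Omega> 1" and X: "X \<in> \<Gamma>A"
  shows "hat (form_wedge \<omega> \<beta>) X =
    fmult (\<lambda>x. \<omega> x [X x]) (\<Lambda> \<beta>) - \<Lambda> (form_wedge \<omega> (zero_form (\<lambda>x. \<beta> x [X x])))"
proof (rule hat_eqI[OF wedge11_form(1)[OF \<omega> \<beta>] X])
  let ?l = "\<lambda>x. \<beta> x [X x]"
  have l: "?l \<in> \<Gamma>L" by (rule form1_props(3)[OF \<beta> X])
  note o = ol_form[OF \<omega> l]
  have m: "fmult (\<lambda>x. \<omega> x [X x]) (\<Lambda> \<beta>) x \<in> B x" for x
    using \<Gamma>B_mem[OF lift_sec_section[OF \<beta>]] by (simp add: subspace_scale subspaceB fmult_apply)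
  note m' = \<Gamma>B_mem[OF lift_sec_section[OF o(1)]]
  show "(fmult (\<lambda>x. \<omega> x [X x]) (\<Lambda> \<beta>) - \<Lambda> (form_wedge \<omega> (zero_form ?l))) x \<in> B x" for x
    using m m' by (simp add: subspace_diff subspaceB)
  show "pairing C x ((fmult (\<lambda>x. \<omega> x [X x]) (\<Lambda> \<beta>) - \<Lambda> (form_wedge \<omega> (zero_form ?l))) x) u =
      form_wedge \<omega> \<beta> x [X x, u]" if u: "u \<in> A x" for x u
    using lin_on_diff[OF pairing_lin'[OF fibA[OF u]] fibB[OF m] fibB[OF m']]
      lin_on_scale[OF pairing_lin'[OF fibA[OF u]] fibB[OF \<Gamma>B_mem[OF lift_sec_section[OF \<beta>]]], of "\<omega> x [X x]"]
    by (simp add: fmult_apply lift_sec_pair \<beta> o u wedge11_form(2)[OF \<omega> \<beta>] \<Gamma>A_mem[OF X])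
qed

lemma ev2_wedge:
  assumes "\<omega> \<in> \<Omega>R 1" "\<beta> \<in> \<Omega> 1" "X \<in> \<Gamma>A" "Y \<in> \<Gamma>A"
  shows "ev2 (form_wedge \<omega> \<beta>) X Y =
    fmult (\<lambda>x. \<omega> x [X x]) (\<lambda>x. \<beta> x [Y x]) - fmult (\<lambda>x. \<omega> x [Y x]) (\<lambda>x. \<beta> x [X x])"
  by (rule ext) (simp add: ev2_def wedge11_form(2)[OF assms(1,2)] \<Gamma>A_mem assms fmult_apply)

lemma ev2_add: "ev2 (\<eta> + \<eta>') X Y = ev2 \<eta> X Y + ev2 \<eta>' X Y"
  by (rule ext) (simp add: ev2_def)

lemma ev2_fmult: "ev2 (\<lambda>x vs. f x *\<^sub>R \<eta> x vs) X Y = fmult f (ev2 \<eta> X Y)"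
  by (rule ext) (simp add: ev2_def fmult_apply)

end

section \<open>The Gerstenhaber--Jacobi bracket on two-forms\<close>

locale gj_pair = lagrangian_pair M C A B
  for M :: "('m::{t2_space,second_countable_topology}, 'e::euclidean_space) manifold"
    and C :: "('m, 'v::real_vector, 'l::real_vector) courant_jacobi" and A B :: "'m \<Rightarrow> 'v set" +
  fixes gj :: "('m \<Rightarrow> 'v list \<Rightarrow> 'l) \<Rightarrow> ('m \<Rightarrow> 'v list \<Rightarrow> 'l) \<Rightarrow> 'm \<Rightarrow> 'v list \<Rightarrow> 'l"
  assumes gj: "is_gj_bracket M C A B gj"
begin

lemma gj_module: "\<alpha> \<in> \<Omega> p \<Longrightarrow> module_derivation M E A L (p - 1) (gj \<alpha>)"
  and gj_skew: "\<alpha> \<in> \<Omega> p \<Longrightarrow> \<beta> \<in> \<Omega> q \<Longrightarrow> gj \<alpha> \<beta> = - (sgn_int ((p - 1) * (q - 1)) *\<^sub>R gj \<beta> \<alpha>)"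
  and gj_11: "\<alpha> \<in> \<Omega> 1 \<Longrightarrow> \<beta> \<in> \<Omega> 1 \<Longrightarrow> gj \<alpha> \<beta> = dual_bracket C A B \<alpha> \<beta>"
  and gj_10: "\<alpha> \<in> \<Omega> 1 \<Longrightarrow> l \<in> \<Gamma>L \<Longrightarrow> gj \<alpha> (zero_form l) = zero_form (nb (\<Lambda> \<alpha>) l)"
proof -
  note g = gj[unfolded is_gj_bracket_def gerstenhaber_jacobi_def Let_def dual_anchor_def]
  note g1 = conjunct1[OF g] and g2 = conjunct1[OF conjunct2[OF g]]
    and g3 = conjunct1[OF conjunct2[OF conjunct2[OF g]]] and g4 = conjunct2[OF conjunct2[OF conjunct2[OF g]]]
  show "\<alpha> \<in> \<Omega> p \<Longrightarrow> module_derivation M E A L (p - 1) (gj \<alpha>)" using g1 by simp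
  show "\<alpha> \<in> \<Omega> p \<Longrightarrow> \<beta> \<in> \<Omega> q \<Longrightarrow> gj \<alpha> \<beta> = - (sgn_int ((p - 1) * (q - 1)) *\<^sub>R gj \<beta> \<alpha>)"
    by (rule g2[rule_format])
  show "\<alpha> \<in> \<Omega> 1 \<Longrightarrow> \<beta> \<in> \<Omega> 1 \<Longrightarrow> gj \<alpha> \<beta> = dual_bracket C A B \<alpha> \<beta>" by (rule g3[rule_format])
  show "\<alpha> \<in> \<Omega> 1 \<Longrightarrow> l \<in> \<Gamma>L \<Longrightarrow> gj \<alpha> (zero_form l) = zero_form (nb (\<Lambda> \<alpha>) l)" by (rule g4[rule_format])
qed

lemma gj_form: "\<alpha> \<in> \<Omega> p \<Longrightarrow> \<beta> \<in> \<Omega> q \<Longrightarrow> gj \<alpha> \<beta> \<in> \<Omega> (q + (p - 1))"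
  and gj_lin: "\<alpha> \<in> \<Omega> p \<Longrightarrow> lin_on (\<Omega> q) (gj \<alpha>)"
  using gj_module[of \<alpha> p] unfolding module_derivation_def by simp_all

lemma gj_derivation:
  assumes "\<alpha> \<in> \<Omega> p"
  obtains D where "\<And>k \<omega>. \<omega> \<in> \<Omega>R k \<Longrightarrow> D \<omega> \<in> \<Omega>R (k + (p - 1))" "\<And>k. lin_on (\<Omega>R k) D"
    "\<And>k l \<omega> \<tau>. \<omega> \<in> \<Omega>R k \<Longrightarrow> \<tau> \<in> \<Omega>R l \<Longrightarrow>
      D (form_wedge \<omega> \<tau>) = form_wedge (D \<omega>) \<tau> + sgn_int ((p - 1) * k) *\<^sub>R form_wedge \<omega> (D \<tau>)"
    "\<And>k l \<omega> \<beta>. \<omega> \<in> \<Omega>R k \<Longrightarrow> \<beta> \<in> \<Omega> l \<Longrightarrow>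
      gj \<alpha> (form_wedge \<omega> \<beta>) = form_wedge (D \<omega>) \<beta> + sgn_int ((p - 1) * k) *\<^sub>R form_wedge \<omega> (gj \<alpha> \<beta>)"
proof -
  note m = gj_module[OF assms, unfolded module_derivation_def]
  obtain D where D: "alg_derivation M E A (p - 1) D" and
    X: "\<forall>k l. \<forall>\<omega>\<in>\<Omega>R k. \<forall>\<beta>\<in>\<Omega> l.
      gj \<alpha> (form_wedge \<omega> \<beta>) = form_wedge (D \<omega>) \<beta> + sgn_int ((p - 1) * k) *\<^sub>R form_wedge \<omega> (gj \<alpha> \<beta>)"
    using conjunct2[OF conjunct2[OF m]] by (elim exE conjE)
  note d = D[unfolded alg_derivation_def Let_def]
  show ?thesis
  proof (rule that[of D])
    show "\<omega> \<in> \<Omega>R k \<Longrightarrow> D \<omega> \<in> \<Omega>R (k + (p - 1))" for k \<omega> using conjunct1[OF d] by simp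
    show "lin_on (\<Omega>R k) D" for k using conjunct1[OF conjunct2[OF d]] by simp
    show "\<omega> \<in> \<Omega>R k \<Longrightarrow> \<tau> \<in> \<Omega>R l \<Longrightarrow>
      D (form_wedge \<omega> \<tau>) = form_wedge (D \<omega>) \<tau> + sgn_int ((p - 1) * k) *\<^sub>R form_wedge \<omega> (D \<tau>)" for k l \<omega> \<tau>
      by (rule conjunct2[OF conjunct2[OF d], rule_format])
    show "\<omega> \<in> \<Omega>R k \<Longrightarrow> \<beta> \<in> \<Omega> l \<Longrightarrow>
      gj \<alpha> (form_wedge \<omega> \<beta>) = form_wedge (D \<omega>) \<beta> + sgn_int ((p - 1) * k) *\<^sub>R form_wedge \<omega> (gj \<alpha> \<beta>)" for k l \<omega> \<beta>
      by (rule X[rule_format])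
  qed
qed

lemma zf: "l \<in> \<Gamma>L \<Longrightarrow> zero_form l \<in> \<Omega> 0"
  by (rule L.zero_form_in_forms) (simp_all add: L.section_mem)

text \<open>The projection of the bracket to B disappears on evaluation, because its component in A
  pairs to zero with X.\<close>

lemma dual_bracket_eval:
  assumes "\<beta> \<in> \<Omega> 1" "\<gamma> \<in> \<Omega> 1" "X \<in> \<Gamma>A"
  shows "dual_bracket C A B \<beta> \<gamma> x [X x] = T3 (\<Lambda> \<beta>) (\<Lambda> \<gamma>) X x"
proof -
  let ?e = "br (\<Lambda> \<beta>) (\<Lambda> \<gamma>) x"
  have e: "?e \<in> fibre E x"
    by (rule E.section_mem[OF bracket_section[OF \<Gamma>B_sec[OF lift_sec_section[OF assms(1)]]
          \<Gamma>B_sec[OF lift_sec_section[OF assms(2)]]]])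
  note p = proj_props[OF e]
  have X: "X x \<in> A x" by (rule \<Gamma>A_mem[OF assms(3)])
  have "pairing C x (pA x ?e + pB x ?e) (X x) = pairing C x (pA x ?e) (X x) + pairing C x (pB x ?e) (X x)"
    by (rule lin_on_add[OF pairing_lin'[OF fibA[OF X]] fibA[OF p(1)] fibB[OF p(2)]])
  then show ?thesis using p(3) isoA[OF p(1) X] X by (simp add: dual_bracket_def flat_def T3_def pr_apply)
qed

lemma gj_11_eval: "\<beta> \<in> \<Omega> 1 \<Longrightarrow> \<gamma> \<in> \<Omega> 1 \<Longrightarrow> X \<in> \<Gamma>A \<Longrightarrow> gj \<beta> \<gamma> x [X x] = T3 (\<Lambda> \<beta>) (\<Lambda> \<gamma>) X x"
  by (simp add: gj_11 dual_bracket_eval)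

lemma gj_01: "l \<in> \<Gamma>L \<Longrightarrow> \<beta> \<in> \<Omega> 1 \<Longrightarrow> gj (zero_form l) \<beta> = - zero_form (nb (\<Lambda> \<beta>) l)"
  using gj_skew[OF zf, of l \<beta> 1] by (simp add: gj_10 sgn_int_def)

text \<open>The bracket lands in degree -1, where all forms are zero.\<close>

lemma gj_00: "l \<in> \<Gamma>L \<Longrightarrow> m \<in> \<Gamma>L \<Longrightarrow> gj (zero_form l) (zero_form m) = 0"
  using form_zero[OF gj_form[OF zf zf, of l m]] by (intro ext) simp

text \<open>The bracket with \<open>\<eta>\<close> on forms of degree \<open>0\<close> and \<open>1\<close>. These two properties are additive in \<open>\<eta>\<close>,
  and by the Leibniz rule they determine the bracket of \<open>\<eta>\<close> with every \<open>\<omega> \<and> \<gamma>\<close>.\<close>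

definition gj_on_sections :: "('m \<Rightarrow> 'v list \<Rightarrow> 'l) \<Rightarrow> bool" where
  "gj_on_sections \<eta> \<longleftrightarrow> (\<forall>l\<in>\<Gamma>L. \<forall>u\<in>\<Gamma>A. \<forall>x. gj \<eta> (zero_form l) x [u x] = nb (hat \<eta> u) l x)"

definition gj_on_one_forms :: "('m \<Rightarrow> 'v list \<Rightarrow> 'l) \<Rightarrow> bool" where
  "gj_on_one_forms \<eta> \<longleftrightarrow> (\<forall>\<beta>\<in>\<Omega> 1. \<forall>u\<in>\<Gamma>A. \<forall>v\<in>\<Gamma>A. \<forall>x. gj \<eta> \<beta> x [u x, v x] =
     nb (\<Lambda> \<beta>) (ev2 \<eta> u v) x + T3 (\<Lambda> \<beta>) (hat \<eta> v) u x - T3 (\<Lambda> \<beta>) (hat \<eta> u) v x)"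

lemma gj_20: "\<eta> \<in> \<Omega> 2 \<Longrightarrow> l \<in> \<Gamma>L \<Longrightarrow> gj \<eta> (zero_form l) = gj (zero_form l) \<eta>"
  using gj_skew[OF _ zf, of \<eta> 2 l] by (simp add: sgn_int_def)

lemma gj_21: "\<eta> \<in> \<Omega> 2 \<Longrightarrow> \<beta> \<in> \<Omega> 1 \<Longrightarrow> gj \<eta> \<beta> = - gj \<beta> \<eta>"
  using gj_skew[of \<eta> 2 \<beta> 1] by (simp add: sgn_int_def)

text \<open>A two-form has shifted degree 1, and graded skewness of odd elements is
  symmetry.\<close>

lemma gj_22: "\<eta> \<in> \<Omega> 2 \<Longrightarrow> \<eta>' \<in> \<Omega> 2 \<Longrightarrow> gj \<eta> \<eta>' = gj \<eta>' \<eta>"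
  using gj_skew[of \<eta> 2 \<eta>' 2] by (simp add: sgn_int_def)

lemma T3_diff2:
  assumes "e \<in> \<Gamma>" "e' \<in> \<Gamma>" "a \<in> \<Gamma>" "b \<in> \<Gamma>"
  shows "T3 a (e - e') b = T3 a e b - T3 a e' b"
  using T3_add(2)[OF E.section_diff[OF assms(1,2)] assms(2-4)] by simp

lemma lift_sec_sec: "\<alpha> \<in> \<Omega> 1 \<Longrightarrow> \<Lambda> \<alpha> \<in> \<Gamma>"
  by (rule \<Gamma>B_sec[OF lift_sec_section])

lemma hat_sec: "\<eta> \<in> \<Omega> 2 \<Longrightarrow> X \<in> \<Gamma>A \<Longrightarrow> hat \<eta> X \<in> \<Gamma>"
  by (rule \<Gamma>B_sec[OF hat_section])

section \<open>Brackets with a single product \<omega> \<and> \<gamma>\<close>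

context
  fixes \<omega> \<gamma> assumes \<omega>: "\<omega> \<in> \<Omega>R 1" and \<gamma>: "\<gamma> \<in> \<Omega> 1"
begin

abbreviation "om_at u \<equiv> (\<lambda>x. \<omega> x [u x])"
abbreviation "ga_at u \<equiv> (\<lambda>x. \<gamma> x [u x])"
abbreviation "om_lift l \<equiv> \<Lambda> (form_wedge \<omega> (zero_form l))"

lemma om_at_smooth: "u \<in> \<Gamma>A \<Longrightarrow> om_at u \<in> smooth_funs M"
  by (rule E.form1_fun[OF \<omega>])

lemma ga_at_section: "u \<in> \<Gamma>A \<Longrightarrow> ga_at u \<in> \<Gamma>L"
  by (rule form1_props(3)[OF \<gamma>])

lemma om_lift_section: "l \<in> \<Gamma>L \<Longrightarrow> om_lift l \<in> \<Gamma>"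
  by (rule lift_sec_sec[OF ol_form(1)[OF \<omega>]])

lemma nb_hat_wedge:
  assumes u: "u \<in> \<Gamma>A" and l: "l \<in> \<Gamma>L"
  shows "nb (hat (form_wedge \<omega> \<gamma>) u) l = fmult (om_at u) (nb (\<Lambda> \<gamma>) l) - nb (om_lift (ga_at u)) l"
  unfolding hat_wedge[OF \<omega> \<gamma> u]
  by (simp add: nb_diff1 nb_fmult1 l om_lift_section ga_at_section u lift_sec_sec[OF \<gamma>] E.section_fmult om_at_smooth)

lemma T3_hat_wedge:
  assumes e: "e \<in> \<Gamma>" and u: "u \<in> \<Gamma>A" and v: "v \<in> \<Gamma>A"
  shows "T3 e (hat (form_wedge \<omega> \<gamma>) u) v =
    fmult (om_at u) (T3 e (\<Lambda> \<gamma>) v) + fmult (sg e (om_at u)) (ga_at v) - T3 e (om_lift (ga_at u)) v"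
proof -
  note s = lift_sec_sec[OF \<gamma>] om_lift_section[OF ga_at_section[OF u]] \<Gamma>A_sec[OF v]
  have "T3 e (hat (form_wedge \<omega> \<gamma>) u) v = T3 e (fmult (om_at u) (\<Lambda> \<gamma>)) v - T3 e (om_lift (ga_at u)) v"
    unfolding hat_wedge[OF \<omega> \<gamma> u] by (rule T3_diff2[OF E.section_fmult[OF om_at_smooth[OF u] s(1)] s(2) e s(3)])
  then show ?thesis unfolding T3_fmult2[OF e s(1,3) om_at_smooth[OF u]] pr_lift[OF \<gamma> v] .
qed

lemma nb_ev2_wedge:
  assumes e: "e \<in> \<Gamma>" and u: "u \<in> \<Gamma>A" and v: "v \<in> \<Gamma>A"
  shows "nb e (ev2 (form_wedge \<omega> \<gamma>) u v) =
    fmult (sg e (om_at u)) (ga_at v) + fmult (om_at u) (nb e (ga_at v)) - (fmult (sg e (om_at v)) (ga_at u) + fmult (om_at v) (nb e (ga_at u)))"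
  unfolding ev2_wedge[OF \<omega> \<gamma> u v]
  by (simp add: nb_diff e L.section_fmult om_at_smooth ga_at_section u v sg_props(2))

text \<open>The derivation attached to the bracket with l lowers the degree, so D \<omega> is a
  function. The bracket of l with the one-form \<omega> \<otimes> \<gamma>(u) is prescribed, and the
  Leibniz rule there yields D \<omega> times \<gamma>(u), which is the product needed for \<omega>
  \<and> \<gamma>.\<close>

lemma gj_on_sections_wedge: "gj_on_sections (form_wedge \<omega> \<gamma>)"
  unfolding gj_on_sections_def
proof (intro ballI allI)
  fix l u x assume l: "l \<in> \<Gamma>L" and u: "u \<in> \<Gamma>A"
  note \<theta> = wedge11_form(1)[OF \<omega> \<gamma>]
  obtain D where D: "\<And>k m \<omega> \<beta>. \<omega> \<in> \<Omega>R k \<Longrightarrow> \<beta> \<in> \<Omega> m \<Longrightarrow> gj (zero_form l) (form_wedge \<omega> \<beta>) =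
      form_wedge (D \<omega>) \<beta> + sgn_int ((0 - 1) * k) *\<^sub>R form_wedge \<omega> (gj (zero_form l) \<beta>)"
    using gj_derivation[OF zf[OF l]] by metis
  have z: "\<omega> x [] = 0" "\<gamma> x [] = 0" using form1_props(4)[OF \<omega>] form1_props(4)[OF \<gamma>] by simp_all
  have "gj (zero_form l) (form_wedge \<omega> (zero_form (ga_at u))) = form_wedge (D \<omega>) (zero_form (ga_at u)) +
      sgn_int ((0 - 1) * 1) *\<^sub>R form_wedge \<omega> 0"
    using D[OF \<omega> zf[OF ga_at_section[OF u]]] unfolding gj_00[OF l ga_at_section[OF u]] .
  from fun_cong[OF fun_cong[OF this, of x], of "[]"]
  have 1: "D \<omega> x [] *\<^sub>R ga_at u x = - nb (om_lift (ga_at u)) l x"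
    unfolding gj_01[OF l ol_form(1)[OF \<omega> ga_at_section[OF u]]]
    by (simp add: form_wedge_def wedge_Nil zero_form_def)
  have "gj (form_wedge \<omega> \<gamma>) (zero_form l) = form_wedge (D \<omega>) \<gamma> +
      sgn_int ((0 - 1) * 1) *\<^sub>R form_wedge \<omega> (- zero_form (nb (\<Lambda> \<gamma>) l))"
    using D[OF \<omega> \<gamma>] unfolding gj_01[OF l \<gamma>] gj_20[OF \<theta> l] .
  from fun_cong[OF fun_cong[OF this, of x], of "[u x]"]
  have "gj (form_wedge \<omega> \<gamma>) (zero_form l) x [u x] = D \<omega> x [] *\<^sub>R ga_at u x + om_at u x *\<^sub>R nb (\<Lambda> \<gamma>) l x"
    by (simp add: form_wedge_def wedge_1 z sgn_int_def zero_form_def)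
  then show "gj (form_wedge \<omega> \<gamma>) (zero_form l) x [u x] = nb (hat (form_wedge \<omega> \<gamma>) u) l x"
    unfolding 1 nb_hat_wedge[OF u l] by (simp add: fmult_apply)
qed

text \<open>The derivation attached to \<open>gj \<beta>\<close> has degree 0 and is read off from
  \<omega> \<otimes> l, whose bracket with \<beta> is that of \<open>A\<^sup>\<dagger>\<close>.
  Taking l = \<gamma>(v) and l = \<gamma>(u) gives the two products with D \<omega> that occur; the
  symbol terms from T3 and from \<open>ev2\<close> cancel.\<close>

lemma gj_on_one_forms_wedge: "gj_on_one_forms (form_wedge \<omega> \<gamma>)"
  unfolding gj_on_one_forms_def
proof (intro ballI allI)
  fix \<beta> u v x assume \<beta>: "\<beta> \<in> \<Omega> 1" and u: "u \<in> \<Gamma>A" and v: "v \<in> \<Gamma>A"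
  note \<theta> = wedge11_form(1)[OF \<omega> \<gamma>]
  obtain D where D: "\<And>k m \<omega> \<beta>'. \<omega> \<in> \<Omega>R k \<Longrightarrow> \<beta>' \<in> \<Omega> m \<Longrightarrow> gj \<beta> (form_wedge \<omega> \<beta>') =
      form_wedge (D \<omega>) \<beta>' + sgn_int ((1 - 1) * k) *\<^sub>R form_wedge \<omega> (gj \<beta> \<beta>')"
    using gj_derivation[OF \<beta>] by metis
  note z = form1_props(4)[OF \<omega>] form1_props(4)[OF \<gamma>]
  have 1: "D \<omega> x [w x] *\<^sub>R l x = T3 (\<Lambda> \<beta>) (om_lift l) w x - om_at w x *\<^sub>R nb (\<Lambda> \<beta>) l x"
    if l: "l \<in> \<Gamma>L" and w: "w \<in> \<Gamma>A" for l w
  proof -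
    have "gj \<beta> (form_wedge \<omega> (zero_form l)) = form_wedge (D \<omega>) (zero_form l) +
      sgn_int ((1 - 1) * 1) *\<^sub>R form_wedge \<omega> (zero_form (nb (\<Lambda> \<beta>) l))"
      using D[OF \<omega> zf[OF l]] unfolding gj_10[OF \<beta> l] .
    from fun_cong[OF fun_cong[OF this, of x], of "[w x]"] show ?thesis
      unfolding gj_11_eval[OF \<beta> ol_form(1)[OF \<omega> l] w]
      by (simp add: form_wedge_def wedge_1 zero_form_def z sgn_int_def)
  qed
  have "gj \<beta> (form_wedge \<omega> \<gamma>) = form_wedge (D \<omega>) \<gamma> + sgn_int ((1 - 1) * 1) *\<^sub>R form_wedge \<omega> (gj \<beta> \<gamma>)"
    by (rule D[OF \<omega> \<gamma>])
  from fun_cong[OF fun_cong[OF this, of x], of "[u x, v x]"]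
  have "gj \<beta> (form_wedge \<omega> \<gamma>) x [u x, v x] = D \<omega> x [u x] *\<^sub>R ga_at v x - D \<omega> x [v x] *\<^sub>R ga_at u x +
      (om_at u x *\<^sub>R T3 (\<Lambda> \<beta>) (\<Lambda> \<gamma>) v x - om_at v x *\<^sub>R T3 (\<Lambda> \<beta>) (\<Lambda> \<gamma>) u x)"
    by (simp add: form_wedge_def wedge_2 z sgn_int_def gj_11_eval[OF \<beta> \<gamma>] u v)
  then show "gj (form_wedge \<omega> \<gamma>) \<beta> x [u x, v x] = nb (\<Lambda> \<beta>) (ev2 (form_wedge \<omega> \<gamma>) u v) x +
      T3 (\<Lambda> \<beta>) (hat (form_wedge \<omega> \<gamma>) v) u x - T3 (\<Lambda> \<beta>) (hat (form_wedge \<omega> \<gamma>) u) v x"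
    unfolding gj_21[OF \<theta> \<beta>] nb_ev2_wedge[OF lift_sec_sec[OF \<beta>] u v]
      T3_hat_wedge[OF lift_sec_sec[OF \<beta>] u v] T3_hat_wedge[OF lift_sec_sec[OF \<beta>] v u]
      1[OF ga_at_section[OF v] u] 1[OF ga_at_section[OF u] v]
    by (simp add: fmult_apply algebra_simps)
qed

end

text \<open>The polarisation of one summand of \<open>second_order\<close> below. Splitting \<eta>
  from \<eta>' makes the expression additive in \<eta>', so that a sum of products can be treated
  term by term while \<eta> stays fixed.\<close>

definition cyc_term :: "('m \<Rightarrow> 'v list \<Rightarrow> 'l) \<Rightarrow> ('m \<Rightarrow> 'v list \<Rightarrow> 'l) \<Rightarrow> ('m \<Rightarrow> 'v) \<Rightarrow> ('m \<Rightarrow> 'v) \<Rightarrow> ('m \<Rightarrow> 'v) \<Rightarrow> 'm \<Rightarrow> 'l" where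
  "cyc_term \<eta> \<eta>' a b c = T3 (hat \<eta> a) (hat \<eta>' b) c + T3 (hat \<eta>' a) (hat \<eta> b) c -
     nb (hat \<eta> a) (ev2 \<eta>' b c) - nb (hat \<eta>' a) (ev2 \<eta> b c)"

definition polar :: "('m \<Rightarrow> 'v list \<Rightarrow> 'l) \<Rightarrow> ('m \<Rightarrow> 'v list \<Rightarrow> 'l) \<Rightarrow> ('m \<Rightarrow> 'v) \<Rightarrow> ('m \<Rightarrow> 'v) \<Rightarrow> ('m \<Rightarrow> 'v) \<Rightarrow> 'm \<Rightarrow> 'l" where
  "polar \<eta> \<eta>' a b c = cyc_term \<eta> \<eta>' a b c + cyc_term \<eta> \<eta>' b c a + cyc_term \<eta> \<eta>' c a b"

text \<open>What is known about \<eta> enters through F1 and F2. The derivation of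
  \<open>gj \<eta>\<close> sends \<omega> to a two-form; the Leibniz rule on \<omega> \<otimes> l
  determines it, with the bracket of the product given by F2 and that of l by F1. In the cyclic sum
  the symbol terms cancel in pairs.\<close>

lemma gj_on_two_forms_wedge:
  assumes \<eta>: "\<eta> \<in> \<Omega> 2" and F1: "gj_on_sections \<eta>" and F2: "gj_on_one_forms \<eta>"
    and \<omega>: "\<omega> \<in> \<Omega>R 1" and \<gamma>: "\<gamma> \<in> \<Omega> 1" and u: "a \<in> \<Gamma>A" "b \<in> \<Gamma>A" "c \<in> \<Gamma>A"
  shows "gj \<eta> (form_wedge \<omega> \<gamma>) x [a x, b x, c x] = polar \<eta> (form_wedge \<omega> \<gamma>) a b c x"
proof -
  obtain D where D0: "\<And>k \<omega>. \<omega> \<in> \<Omega>R k \<Longrightarrow> D \<omega> \<in> \<Omega>R (k + (2 - 1))" and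
    D: "\<And>k m \<omega> \<beta>. \<omega> \<in> \<Omega>R k \<Longrightarrow> \<beta> \<in> \<Omega> m \<Longrightarrow> gj \<eta> (form_wedge \<omega> \<beta>) =
      form_wedge (D \<omega>) \<beta> + sgn_int ((2 - 1) * k) *\<^sub>R form_wedge \<omega> (gj \<eta> \<beta>)"
    using gj_derivation[OF \<eta>] by metis
  have D2: "D \<omega> \<in> \<Omega>R 2" using D0[OF \<omega>] by simp
  let ?f = "\<lambda>u x. \<omega> x [u x]" and ?g = "\<lambda>u x. \<gamma> x [u x]" and ?W = "\<lambda>l. \<Lambda> (form_wedge \<omega> (zero_form l))"
  let ?G = "\<Lambda> \<gamma>"
  note gs = form1_props(3)[OF \<gamma>]
  note z = form1_props(4)[OF \<omega>] form1_props(4)[OF \<gamma>] form2_props(5)[OF D2]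
  note hs = hat_section[OF \<eta>] note hsec = hat_sec[OF \<eta>]
  \<comment> \<open>B is isotropic, so the exchange of two entries from B costs the derivative of
    zero. This moves \<open>hat \<eta>\<close> to the front and leaves the other entry where
    \<open>T3_hat_wedge\<close> expands it.\<close>
  have skew: "T3 b' (hat \<eta> v) w x = - T3 (hat \<eta> v) b' w x"
    if "b' \<in> \<Gamma>B" "v \<in> \<Gamma>A" "w \<in> \<Gamma>A" for b' v w
  proof -
    have "T3 b' (hat \<eta> v) w + T3 (hat \<eta> v) b' w = 0"
      unfolding T3_swap12[OF \<Gamma>B_sec[OF that(1)] hsec[OF that(2)] \<Gamma>A_sec[OF that(3)]]
        pr_isotropic[OF B that(1) hs[OF that(2)]] by (rule nb_zero[OF \<Gamma>A_sec[OF that(3)]])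
    from fun_cong[OF this, of x] show ?thesis by (simp add: eq_neg_iff_add_eq_0)
  qed
  have WB: "?W l \<in> \<Gamma>B" if "l \<in> \<Gamma>L" for l by (rule lift_sec_section[OF ol_form(1)[OF \<omega> that]])
  have GB: "?G \<in> \<Gamma>B" by (rule lift_sec_section[OF \<gamma>])
  have two: "gj \<eta> \<gamma> x [v x, w x] = nb ?G (ev2 \<eta> v w) x - T3 (hat \<eta> w) ?G v x + T3 (hat \<eta> v) ?G w x"
    if "v \<in> \<Gamma>A" "w \<in> \<Gamma>A" for v w
    using F2 \<gamma> that skew[OF GB that] skew[OF GB that(2,1)] unfolding gj_on_one_forms_def by simp
  have one: "D \<omega> x [v x, w x] *\<^sub>R l x = nb (?W l) (ev2 \<eta> v w) x - T3 (hat \<eta> w) (?W l) v x +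
      T3 (hat \<eta> v) (?W l) w x + ?f v x *\<^sub>R nb (hat \<eta> w) l x - ?f w x *\<^sub>R nb (hat \<eta> v) l x"
    if l: "l \<in> \<Gamma>L" and v: "v \<in> \<Gamma>A" and w: "w \<in> \<Gamma>A" for l v w
  proof -
    note o = ol_form(1)[OF \<omega> l]
    have "gj \<eta> (form_wedge \<omega> (zero_form l)) x [v x, w x] = nb (?W l) (ev2 \<eta> v w) x - T3 (hat \<eta> w) (?W l) v x +
      T3 (hat \<eta> v) (?W l) w x"
      using F2 o v w skew[OF WB[OF l] v w] skew[OF WB[OF l] w v] unfolding gj_on_one_forms_def by simp
    moreover have "gj \<eta> (form_wedge \<omega> (zero_form l)) x [v x, w x] =
        D \<omega> x [v x, w x] *\<^sub>R l x - (?f v x *\<^sub>R nb (hat \<eta> w) l x - ?f w x *\<^sub>R nb (hat \<eta> v) l x)"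
      using fun_cong[OF fun_cong[OF D[OF \<omega> zf[OF l]], of x], of "[v x, w x]"] F1 l v w
      unfolding gj_on_sections_def
      by (simp add: form_wedge_def wedge_2 z sgn_int_def zero_form_def)
    ultimately show ?thesis by (simp add: algebra_simps)
  qed
  have lhs: "gj \<eta> (form_wedge \<omega> \<gamma>) x [a x, b x, c x] =
      D \<omega> x [a x, b x] *\<^sub>R ?g c x - D \<omega> x [a x, c x] *\<^sub>R ?g b x + D \<omega> x [b x, c x] *\<^sub>R ?g a x -
      (?f a x *\<^sub>R gj \<eta> \<gamma> x [b x, c x] - ?f b x *\<^sub>R gj \<eta> \<gamma> x [a x, c x] + ?f c x *\<^sub>R gj \<eta> \<gamma> x [a x, b x])"
    using fun_cong[OF fun_cong[OF D[OF \<omega> \<gamma>], of x], of "[a x, b x, c x]"]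
    by (simp add: form_wedge_def wedge_3 z sgn_int_def)
  have cyc: "cyc_term \<eta> (form_wedge \<omega> \<gamma>) p q r x =
      (?f q x *\<^sub>R T3 (hat \<eta> p) ?G r x + sg (hat \<eta> p) (?f q) x *\<^sub>R ?g r x - T3 (hat \<eta> p) (?W (?g q)) r x)
      - (?f p x *\<^sub>R T3 (hat \<eta> q) ?G r x + sg (hat \<eta> q) (?f p) x *\<^sub>R ?g r x - T3 (hat \<eta> q) (?W (?g p)) r x)
      - (sg (hat \<eta> p) (?f q) x *\<^sub>R ?g r x + ?f q x *\<^sub>R nb (hat \<eta> p) (?g r) x
          - (sg (hat \<eta> p) (?f r) x *\<^sub>R ?g q x + ?f r x *\<^sub>R nb (hat \<eta> p) (?g q) x))
      - (?f p x *\<^sub>R nb ?G (ev2 \<eta> q r) x - nb (?W (?g p)) (ev2 \<eta> q r) x)"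
    if p: "p \<in> \<Gamma>A" and q: "q \<in> \<Gamma>A" and r: "r \<in> \<Gamma>A" for p q r
    using skew[OF hat_section[OF wedge11_form(1)[OF \<omega> \<gamma>] p] q r]
    unfolding cyc_term_def T3_hat_wedge[OF \<omega> \<gamma> hsec[OF p] q r] T3_hat_wedge[OF \<omega> \<gamma> hsec[OF q] p r]
      nb_ev2_wedge[OF \<omega> \<gamma> hsec[OF p] q r] nb_hat_wedge[OF \<omega> \<gamma> p ev2_section[OF \<eta> q r]]
    by (simp add: T3_hat_wedge[OF \<omega> \<gamma> hsec[OF q] p r] fmult_apply)
  \<comment> \<open>The cyclic sum produces the order (c, a), the shuffles of [a, b, c] the order
    (a, c).\<close>
  have sk: "nb e (ev2 \<eta> c a) x = - nb e (ev2 \<eta> a c) x" if "e \<in> \<Gamma>" for e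
    unfolding ev2_skew[OF \<eta> u(1,3)] nb_minus[OF that ev2_section[OF \<eta> u(1,3)]] by simp
  note sk' = sk[OF \<Gamma>B_sec[OF GB]] sk[OF \<Gamma>B_sec[OF WB[OF gs[OF u(2)]]]]
  show ?thesis
    unfolding lhs polar_def
    by (simp add: one[OF gs[OF u(3)] u(1,2)] one[OF gs[OF u(2)] u(1,3)] one[OF gs[OF u(1)] u(2,3)]
        two u cyc sk' algebra_simps)
qed

section \<open>Extension to finite sums of products\<close>

lemma nb_zero1: "l \<in> \<Gamma>L \<Longrightarrow> nb 0 l = 0"
  using anchor_comb[of l 0 _ 0 0 0] by (intro ext) (simp add: nb_apply subspace_0 E.subspace_fibre)

lemma T3_zero: "e \<in> \<Gamma> \<Longrightarrow> e' \<in> \<Gamma> \<Longrightarrow> T3 0 e e' = 0" "e \<in> \<Gamma> \<Longrightarrow> e' \<in> \<Gamma> \<Longrightarrow> T3 e 0 e' = 0"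
  using T3_add(1)[OF E.section_zero E.section_zero, of e e'] T3_add(2)[OF E.section_zero E.section_zero, of e e'] by simp_all

lemma hat_zero: "X \<in> \<Gamma>A \<Longrightarrow> hat 0 X = 0"
  by (rule hat_eqI[OF L.form_zero_form])
     (simp_all add: subspace_0 subspaceB lin_on_zero[OF pairing_lin' subspace_0[OF E.subspace_fibre]] fibA)

lemma ev2_zero: "ev2 0 X Y = 0"
  by (rule ext) (simp add: ev2_def)

lemma gj_add1:
  assumes "\<eta> \<in> \<Omega> p" "\<eta>' \<in> \<Omega> p" "\<beta> \<in> \<Omega> q"
  shows "gj (\<eta> + \<eta>') \<beta> = gj \<eta> \<beta> + gj \<eta>' \<beta>"
  unfolding gj_skew[OF L.form_add[OF assms(1,2)] assms(3)] gj_skew[OF assms(1,3)] gj_skew[OF assms(2,3)]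
    lin_on_add[OF gj_lin[OF assms(3)] assms(1,2)] by (simp add: scaleR_add_right)

lemma gj_zero1: "\<beta> \<in> \<Omega> q \<Longrightarrow> gj 0 \<beta> = 0"
  using gj_skew[OF L.form_zero_form, of \<beta> q 0] lin_on_zero[OF gj_lin L.form_zero_form, of \<beta> q] by simp

lemma gj_on_low_degree_sum:
  assumes "\<And>k. k < r \<Longrightarrow> \<omega> k \<in> \<Omega>R 1" "\<And>k. k < r \<Longrightarrow> \<beta> k \<in> \<Omega> 1"
  shows "(\<Sum>k<(r::nat). form_wedge (\<omega> k) (\<beta> k)) \<in> \<Omega> 2 \<and>
    gj_on_sections (\<Sum>k<r. form_wedge (\<omega> k) (\<beta> k)) \<and> gj_on_one_forms (\<Sum>k<r. form_wedge (\<omega> k) (\<beta> k))"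
  using assms
proof (induction r)
  case 0
  have "gj_on_sections 0" unfolding gj_on_sections_def by (simp add: hat_zero nb_zero1 gj_zero1[OF zf])
  moreover have "gj_on_one_forms 0" unfolding gj_on_one_forms_def
    by (simp add: hat_zero gj_zero1 ev2_zero nb_zero T3_zero lift_sec_sec \<Gamma>A_sec)
  ultimately show ?case unfolding lessThan_0 sum.empty by (intro conjI L.form_zero_form)
next
  case (Suc r)
  let ?s = "\<Sum>k<r. form_wedge (\<omega> k) (\<beta> k)" and ?w = "form_wedge (\<omega> r) (\<beta> r)"
  have s: "?s \<in> \<Omega> 2" "gj_on_sections ?s" "gj_on_one_forms ?s" using Suc by simp_all
  have c: "\<omega> r \<in> \<Omega>R 1" "\<beta> r \<in> \<Omega> 1" using Suc.prems by simp_all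
  note w = wedge11_form(1)[OF c] gj_on_sections_wedge[OF c] gj_on_one_forms_wedge[OF c]
  have "gj_on_sections (?s + ?w)" unfolding gj_on_sections_def
  proof (intro ballI allI)
    fix l u x assume l: "l \<in> \<Gamma>L" and u: "u \<in> \<Gamma>A"
    show "gj (?s + ?w) (zero_form l) x [u x] = nb (hat (?s + ?w) u) l x"
      unfolding gj_add1[OF s(1) w(1) zf[OF l]] hat_add[OF s(1) w(1) u]
        nb_add1[OF hat_sec[OF s(1) u] hat_sec[OF w(1) u] l]
      using s(2) w(2) l u unfolding gj_on_sections_def by simp
  qed
  moreover have "gj_on_one_forms (?s + ?w)" unfolding gj_on_one_forms_def
  proof (intro ballI allI)
    fix \<gamma> u v x assume g: "\<gamma> \<in> \<Omega> 1" and u: "u \<in> \<Gamma>A" and v: "v \<in> \<Gamma>A"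
    note G = lift_sec_sec[OF g]
    show "gj (?s + ?w) \<gamma> x [u x, v x] = nb (\<Lambda> \<gamma>) (ev2 (?s + ?w) u v) x +
        T3 (\<Lambda> \<gamma>) (hat (?s + ?w) v) u x - T3 (\<Lambda> \<gamma>) (hat (?s + ?w) u) v x"
      unfolding gj_add1[OF s(1) w(1) g] hat_add[OF s(1) w(1) u] hat_add[OF s(1) w(1) v] ev2_add
        nb_add[OF G ev2_section[OF s(1) u v] ev2_section[OF w(1) u v]]
        T3_add(2)[OF hat_sec[OF s(1) u] hat_sec[OF w(1) u] G \<Gamma>A_sec[OF v]]
        T3_add(2)[OF hat_sec[OF s(1) v] hat_sec[OF w(1) v] G \<Gamma>A_sec[OF u]]
      using s(3) w(3) g u v unfolding gj_on_one_forms_def by simp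
  qed
  ultimately show ?case unfolding sum.lessThan_Suc by (intro conjI L.form_add[OF s(1) w(1)])
qed

lemma polar_add2:
  assumes h: "\<eta> \<in> \<Omega> 2" "\<eta>' \<in> \<Omega> 2" "\<eta>'' \<in> \<Omega> 2" and u: "a \<in> \<Gamma>A" "b \<in> \<Gamma>A" "c \<in> \<Gamma>A"
  shows "polar \<eta> (\<eta>' + \<eta>'') a b c = polar \<eta> \<eta>' a b c + polar \<eta> \<eta>'' a b c"
proof -
  have "cyc_term \<eta> (\<eta>' + \<eta>'') p q r = cyc_term \<eta> \<eta>' p q r + cyc_term \<eta> \<eta>'' p q r"
    if "p \<in> \<Gamma>A" "q \<in> \<Gamma>A" "r \<in> \<Gamma>A" for p q r
    unfolding cyc_term_def hat_add[OF h(2,3) that(1)] hat_add[OF h(2,3) that(2)] ev2_add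
    using that h by (intro ext) (simp add: T3_add nb_add nb_add1 hat_sec \<Gamma>A_sec ev2_section)
  then show ?thesis unfolding polar_def using u by simp
qed

lemma polar_zero2: "\<eta> \<in> \<Omega> 2 \<Longrightarrow> a \<in> \<Gamma>A \<Longrightarrow> b \<in> \<Gamma>A \<Longrightarrow> c \<in> \<Gamma>A \<Longrightarrow> polar \<eta> 0 a b c = 0"
  unfolding polar_def cyc_term_def
  by (simp add: hat_zero ev2_zero T3_zero nb_zero nb_zero1 hat_sec \<Gamma>A_sec ev2_section)

lemma gj_on_two_forms_sum:
  assumes \<eta>: "\<eta> \<in> \<Omega> 2" "gj_on_sections \<eta>" "gj_on_one_forms \<eta>"
    and u: "a \<in> \<Gamma>A" "b \<in> \<Gamma>A" "c \<in> \<Gamma>A"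
    and "\<And>k. k < r \<Longrightarrow> \<omega> k \<in> \<Omega>R 1" "\<And>k. k < r \<Longrightarrow> \<beta> k \<in> \<Omega> 1"
  shows "gj \<eta> (\<Sum>k<(r::nat). form_wedge (\<omega> k) (\<beta> k)) x [a x, b x, c x] =
    polar \<eta> (\<Sum>k<r. form_wedge (\<omega> k) (\<beta> k)) a b c x"
  using assms(7,8)
proof (induction r)
  case 0
  show ?case
    unfolding lessThan_0 sum.empty polar_zero2[OF \<eta>(1) u] lin_on_zero[OF gj_lin[OF \<eta>(1)] L.form_zero_form] by simp
next
  case (Suc r)
  let ?s = "\<Sum>k<r. form_wedge (\<omega> k) (\<beta> k)" and ?w = "form_wedge (\<omega> r) (\<beta> r)"
  have s: "?s \<in> \<Omega> 2" using gj_on_low_degree_sum[of r \<omega> \<beta>] Suc.prems by simp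
  have c: "\<omega> r \<in> \<Omega>R 1" "\<beta> r \<in> \<Omega> 1" using Suc.prems by simp_all
  note w = wedge11_form(1)[OF c]
  have 1: "gj \<eta> (?s + ?w) = gj \<eta> ?s + gj \<eta> ?w" by (rule lin_on_add[OF gj_lin[OF \<eta>(1)] s w])
  have 2: "polar \<eta> (?s + ?w) a b c = polar \<eta> ?s a b c + polar \<eta> ?w a b c"
    by (rule polar_add2[OF \<eta>(1) s w u])
  show ?case unfolding sum.lessThan_Suc 1 2
    using Suc.IH Suc.prems gj_on_two_forms_wedge[OF \<eta> c u, of x] by simp
qed

lemma zero_form_Nil: "zero_form l y [] = l y" and zero_form_Cons: "zero_form l y (v # vs) = 0"
  by (simp_all add: zero_form_def)

text \<open>The bracket is a differential operator of order one in each entry, so that it does not see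
  the factor \<open>flatten h\<close> at \<open>x\<close>.\<close>

lemma gj_flatten:
  assumes \<alpha>: "\<alpha> \<in> \<Omega> 2" and \<eta>: "\<eta> \<in> \<Omega> 2" and h: "h \<in> smooth_funs M" "h x = 1"
  shows "gj \<alpha> (\<lambda>x vs. flatten h x *\<^sub>R \<eta> x vs) x = gj \<alpha> \<eta> x"
proof -
  obtain D where D0: "\<And>k \<omega>. \<omega> \<in> \<Omega>R k \<Longrightarrow> D \<omega> \<in> \<Omega>R (k + (2 - 1))" and Dl: "\<And>k. lin_on (\<Omega>R k) D" and
    Dd: "\<And>k l \<omega> \<tau>. \<omega> \<in> \<Omega>R k \<Longrightarrow> \<tau> \<in> \<Omega>R l \<Longrightarrow>
      D (form_wedge \<omega> \<tau>) = form_wedge (D \<omega>) \<tau> + sgn_int ((2 - 1) * k) *\<^sub>R form_wedge \<omega> (D \<tau>)" and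
    DX: "\<And>k m \<omega> \<beta>. \<omega> \<in> \<Omega>R k \<Longrightarrow> \<beta> \<in> \<Omega> m \<Longrightarrow> gj \<alpha> (form_wedge \<omega> \<beta>) =
      form_wedge (D \<omega>) \<beta> + sgn_int ((2 - 1) * k) *\<^sub>R form_wedge \<omega> (gj \<alpha> \<beta>)"
    using gj_derivation[OF \<alpha>] by metis
  have D1: "D (zero_form p) \<in> \<Omega>R 1" if "p \<in> smooth_funs M" for p
    using D0[OF L.scale_form_real[OF that]] by simp
  \<comment> \<open>Zero-forms multiply like functions, so D restricts to a derivation on functions,
    with values in one-forms, and the computation of \<open>vector_field_flatten\<close> can be
    repeated for it.\<close>
  have prod: "zero_form (p * q) = form_wedge (zero_form p) (zero_form q)" for p q :: "'m \<Rightarrow> real"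
    unfolding form_wedge_zero_form by (intro ext) (simp add: zero_form_def)
  have leib: "D (zero_form (p * q)) y [v] = q y * D (zero_form p) y [v] + p y * D (zero_form q) y [v]"
    if p: "p \<in> smooth_funs M" and q: "q \<in> smooth_funs M" for p q y v
  proof -
    have "D (zero_form (p * q)) = form_wedge (D (zero_form p)) (zero_form q) +
        sgn_int ((2 - 1) * 0) *\<^sub>R form_wedge (zero_form p) (D (zero_form q))"
      unfolding prod by (rule Dd[OF L.scale_form_real[OF p] L.scale_form_real[OF q]])
    from fun_cong[OF fun_cong[OF this, of y], of "[v]"] show ?thesis
      by (simp add: form_wedge_def wedge_1 zero_form_Nil zero_form_Cons sgn_int_def)
  qed
  have c: "(\<lambda>_. t) \<in> smooth_funs M" for t by (rule smooth_fun_const[OF M])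
  have 1: "D (zero_form (\<lambda>_. 1)) y [v] = 0" for y v
    using leib[OF c c, of 1 1 y v] by (simp add: times_fun_def)
  have e: "zero_form (\<lambda>_::'m. 2::real) = 2 *\<^sub>R zero_form (\<lambda>_. 1)"
    by (intro ext) (simp add: zero_form_def)
  have "D (zero_form (\<lambda>_. 2)) = 2 *\<^sub>R D (zero_form (\<lambda>_. 1))"
    unfolding e by (rule lin_on_scale[OF Dl L.scale_form_real[OF c]])
  then have 2: "D (zero_form (\<lambda>_. 2)) y [v] = 0" for y v using 1 by simp
  have e': "zero_form ((\<lambda>_. 2) - h) = zero_form (\<lambda>_. 2) - zero_form h" by (intro ext) (simp add: zero_form_def)
  have "D (zero_form ((\<lambda>_. 2) - h)) = D (zero_form (\<lambda>_. 2)) - D (zero_form h)"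
    unfolding e' by (rule lin_on_diff[OF Dl L.scale_form_real[OF c] L.scale_form_real[OF h(1)]])
  then have 3: "D (zero_form ((\<lambda>_. 2) - h)) y [v] = - D (zero_form h) y [v]" for y v using 2 by simp
  have "D (zero_form (flatten h)) x [v] = 0" for v
    unfolding flatten_def leib[OF h(1) smooth_fun_diff[OF M c h(1)]] 3 using h(2) by simp
  moreover have "D (zero_form (flatten h)) x vs = 0" if "length vs \<noteq> 1" for vs
    by (rule form1_props(4)[OF D1[OF flatten_smooth[OF h(1)]] that])
  ultimately have z: "D (zero_form (flatten h)) x vs = 0" for vs
    by (cases "length vs = 1") (auto simp: length_Suc_conv)
  have "gj \<alpha> (form_wedge (zero_form (flatten h)) \<eta>) x vs = gj \<alpha> \<eta> x vs" for vs
  proof -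
    have "form_wedge (D (zero_form (flatten h))) \<eta> x vs = 0" by (simp add: form_wedge_def wedge_def z)
    moreover have "form_wedge (zero_form (flatten h)) (gj \<alpha> \<eta>) x vs = gj \<alpha> \<eta> x vs"
      unfolding form_wedge_zero_form using flatten_at[of h x] h(2) by simp
    ultimately show ?thesis
      using fun_cong[OF fun_cong[OF DX[OF L.scale_form_real[OF flatten_smooth[OF h(1)]] \<eta>], of x], of vs]
      by (simp add: sgn_int_def)
  qed
  then show ?thesis unfolding form_wedge_zero_form by (rule ext)
qed

text \<open>One half of \<open>gj \<eta> \<eta>\<close> on (a, b, c), as a cyclic sum in which both
  lifts occupy the first two entries of T3.\<close>

definition second_order :: "('m \<Rightarrow> 'v list \<Rightarrow> 'l) \<Rightarrow> ('m \<Rightarrow> 'v) \<Rightarrow> ('m \<Rightarrow> 'v) \<Rightarrow> ('m \<Rightarrow> 'v) \<Rightarrow> 'm \<Rightarrow> 'l" where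
  "second_order \<eta> a b c = T3 (hat \<eta> a) (hat \<eta> b) c - nb (hat \<eta> a) (ev2 \<eta> b c) +
     (T3 (hat \<eta> b) (hat \<eta> c) a - nb (hat \<eta> b) (ev2 \<eta> c a)) +
     (T3 (hat \<eta> c) (hat \<eta> a) b - nb (hat \<eta> c) (ev2 \<eta> a b))"

lemma polar_self: "polar \<eta> \<eta> a b c = 2 *\<^sub>R second_order \<eta> a b c"
  unfolding polar_def cyc_term_def second_order_def by (intro ext) (simp add: scaleR_2 algebra_simps)

lemma second_order_flatten:
  assumes \<eta>: "\<eta> \<in> \<Omega> 2" and h: "h \<in> smooth_funs M" "h x = 1" and u: "a \<in> \<Gamma>A" "b \<in> \<Gamma>A" "c \<in> \<Gamma>A"
  shows "second_order (\<lambda>x vs. flatten h x *\<^sub>R \<eta> x vs) a b c x = second_order \<eta> a b c x"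
proof -
  note fs = flatten_smooth[OF h(1)]
  have T: "T3 (fmult (flatten h) (hat \<eta> p)) (fmult (flatten h) (hat \<eta> q)) r x = T3 (hat \<eta> p) (hat \<eta> q) r x"
    if "p \<in> \<Gamma>A" "q \<in> \<Gamma>A" "r \<in> \<Gamma>A" for p q r
    unfolding T3_flatten(2)[OF hat_sec[OF \<eta> that(1)] E.section_fmult[OF fs hat_sec[OF \<eta> that(2)]] \<Gamma>A_sec[OF that(3)] h]
    by (rule T3_flatten(1)[OF hat_sec[OF \<eta> that(1)] hat_sec[OF \<eta> that(2)] \<Gamma>A_sec[OF that(3)] h])
  have N: "nb (fmult (flatten h) (hat \<eta> p)) (fmult (flatten h) (ev2 \<eta> q r)) x = nb (hat \<eta> p) (ev2 \<eta> q r) x"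
    if "p \<in> \<Gamma>A" "q \<in> \<Gamma>A" "r \<in> \<Gamma>A" for p q r
    unfolding nb_fmult1[OF hat_sec[OF \<eta> that(1)] L.section_fmult[OF fs ev2_section[OF \<eta> that(2,3)]]] fmult_apply
      nb_flatten[OF hat_sec[OF \<eta> that(1)] ev2_section[OF \<eta> that(2,3)] h]
    using flatten_at[of h x] h(2) by simp
  show ?thesis
    unfolding second_order_def ev2_fmult hat_fmult[OF fs \<eta> u(1)] hat_fmult[OF fs \<eta> u(2)] hat_fmult[OF fs \<eta> u(3)]
    by (simp add: T N u)
qed

text \<open>Inserting the partial frame in the first entry gives h \<eta>(p, q) as the sum of
  \<omega> i (p) \<eta>(s i, q). Antisymmetrising, as the wedge does, doubles this to 2 h \<eta>,
  and the factor (2 - h)/2 turns 2 h into h (2 - h), which is \<open>flatten h\<close>.\<close>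

lemma flatten_decomposition:
  assumes F: "partial_frame_at M E A r x U s \<omega> h" and \<eta>: "\<eta> \<in> \<Omega> 2"
  defines "\<beta> \<equiv> \<lambda>i y vs. ((2 - h y) / 2) *\<^sub>R contract (s i) \<eta> y vs"
  shows "(\<lambda>y vs. flatten h y *\<^sub>R \<eta> y vs) = (\<Sum>i<r. form_wedge (\<omega> i) (\<beta> i))"
    and "i < r \<Longrightarrow> \<beta> i \<in> \<Omega> 1"
proof -
  note F' = E.partial_frameD[OF F]
  have k: "(\<lambda>y. (2 - h y) / 2) \<in> smooth_funs M"
    using smooth_fun_mult[OF M smooth_fun_const[OF M, of "1/2"] smooth_fun_diff[OF M smooth_fun_const[OF M, of 2] F'(3)]]
    by (simp add: times_fun_def fun_diff_def)
  show b: "\<beta> i \<in> \<Omega> 1" if "i < r" for i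
    unfolding \<beta>_def by (rule L.fmult_form[OF k contract_form[OF \<eta> F'(5)[OF that]]])
  have rhs: "(\<Sum>i<r. form_wedge (\<omega> i) (\<beta> i)) \<in> \<Omega> 2" using gj_on_low_degree_sum[of r \<omega> \<beta>] F'(6) b by simp
  show "(\<lambda>y vs. flatten h y *\<^sub>R \<eta> y vs) = (\<Sum>i<r. form_wedge (\<omega> i) (\<beta> i))"
  proof (rule form_eqI[OF L.fmult_form[OF flatten_smooth[OF F'(3)] \<eta>] rhs])
    fix y vs assume vs: "set vs \<subseteq> A y" "int (length vs) = 2"
    obtain u v where uv: "vs = [u, v]" using vs(2) by (auto simp: numeral_2_eq_2 length_Suc_conv)
    have A: "u \<in> A y" "v \<in> A y" using vs uv by simp_all
    have ex: "h y *\<^sub>R \<eta> y [p, q] = (\<Sum>i<r. \<omega> i y [p] *\<^sub>R \<eta> y [s i y, q])" if p: "p \<in> A y" and q: "q \<in> A y" for p q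
    proof -
      have "h y *\<^sub>R \<eta> y [p, q] = \<eta> y [h y *\<^sub>R p, q]" by (rule lin_on_scale[OF form2_props(2)[OF \<eta> q] p, symmetric])
      also have "\<dots> = \<eta> y [\<Sum>i<r. \<omega> i y [p] *\<^sub>R s i y, q]" using F'(7)[OF p] by simp
      also have "\<dots> = (\<Sum>i<r. \<omega> i y [p] *\<^sub>R \<eta> y [s i y, q])"
        by (rule lin_on_sum[OF form2_props(2)[OF \<eta> q] subspaceA]) (simp_all add: \<Gamma>A_mem F'(5))
      finally show ?thesis .
    qed
    have "(\<Sum>i<r. form_wedge (\<omega> i) (\<beta> i)) y vs =
        (\<Sum>i<r. \<omega> i y [u] *\<^sub>R \<beta> i y [v] - \<omega> i y [v] *\<^sub>R \<beta> i y [u])"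
      unfolding sum_fun_apply uv by (rule sum.cong[OF refl]) (simp add: wedge11_form(2) F'(6) b A)
    also have "\<dots> = ((2 - h y) / 2) *\<^sub>R ((\<Sum>i<r. \<omega> i y [u] *\<^sub>R \<eta> y [s i y, v]) - (\<Sum>i<r. \<omega> i y [v] *\<^sub>R \<eta> y [s i y, u]))"
      by (simp add: \<beta>_def contract_apply sum_subtractf scaleR_sum_right scaleR_diff_right mult.commute)
    also have "\<dots> = ((2 - h y) / 2) *\<^sub>R (2 *\<^sub>R (h y *\<^sub>R \<eta> y [u, v]))"
      unfolding ex[OF A, symmetric] ex[OF A(2,1), symmetric] form2_skew[OF \<eta> subspaceA A]
      by (simp only: scaleR_minus_right diff_minus_eq_add scaleR_2)
    also have "\<dots> = flatten h y *\<^sub>R \<eta> y vs"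
    proof -
      have "(2 - h y) / 2 * (2 * h y) = flatten h y" by (simp add: flatten_def)
      then show ?thesis by (simp only: scaleR_scaleR uv)
    qed
    finally show "flatten h y *\<^sub>R \<eta> y vs = (\<Sum>i<r. form_wedge (\<omega> i) (\<beta> i)) y vs" by simp
  qed
qed

text \<open>\<open>gj_flatten\<close> modifies the second entry only; the symmetry
  \<open>gj_22\<close> makes it available for the first. The cut-off form is a sum of products, for
  which the bracket with itself is known, and the cutoff then disappears from the answer at
  x.\<close>

lemma gj_two_forms:
  assumes \<eta>: "\<eta> \<in> \<Omega> 2" and u: "a \<in> \<Gamma>A" "b \<in> \<Gamma>A" "c \<in> \<Gamma>A"
  shows "gj \<eta> \<eta> x [a x, b x, c x] = 2 *\<^sub>R second_order \<eta> a b c x"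
proof -
  obtain r where r: "\<forall>x. \<exists>U s \<omega> h. partial_frame_at M E A r x U s \<omega> h"
    using E.partial_frame_exists[OF subA] by (rule exE)
  obtain U s \<omega> h where F: "partial_frame_at M E A r x U s \<omega> h" using r[rule_format, of x] by (elim exE)
  note F' = E.partial_frameD[OF F]
  let ?\<beta> = "\<lambda>i y vs. ((2 - h y) / 2) *\<^sub>R contract (s i) \<eta> y vs"
  let ?\<psi> = "\<lambda>y vs. flatten h y *\<^sub>R \<eta> y vs"
  note dec = flatten_decomposition(1)[OF F \<eta>] and b = flatten_decomposition(2)[OF F \<eta>]
  note low = gj_on_low_degree_sum[of r \<omega> ?\<beta>, OF F'(6) b, folded dec]
  have low': "?\<psi> \<in> \<Omega> 2" "gj_on_sections ?\<psi>" "gj_on_one_forms ?\<psi>" using low by simp_all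
  have "gj \<eta> \<eta> x = gj \<eta> ?\<psi> x" by (rule gj_flatten[OF \<eta> \<eta> F'(3,4), symmetric])
  also have "\<dots> = gj ?\<psi> \<eta> x" unfolding gj_22[OF \<eta> low'(1)] ..
  also have "\<dots> = gj ?\<psi> ?\<psi> x" by (rule gj_flatten[OF low'(1) \<eta> F'(3,4), symmetric])
  finally have "gj \<eta> \<eta> x [a x, b x, c x] = gj ?\<psi> ?\<psi> x [a x, b x, c x]" by simp
  also have "\<dots> = polar ?\<psi> ?\<psi> a b c x"
    using gj_on_two_forms_sum[OF low' u, of r \<omega> ?\<beta> x, OF F'(6) b] unfolding dec[symmetric] by simp
  also have "\<dots> = 2 *\<^sub>R second_order \<eta> a b c x"
    unfolding polar_self using second_order_flatten[OF \<eta> F'(3,4) u] by simp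
  finally show ?thesis .
qed

end

section \<open>The cubic term\<close>

text \<open>Six explicit terms, obtained by splitting off one point at a time, turn identities
  between determinants into polynomial ones.\<close>

lemma sum_permutes_3:
  fixes F :: "nat \<Rightarrow> nat \<Rightarrow> nat \<Rightarrow> real"
  shows "(\<Sum>\<sigma> | \<sigma> permutes {..<3::nat}. of_int (sign \<sigma>) * F (\<sigma> 0) (\<sigma> 1) (\<sigma> 2)) =
    F 0 1 2 - F 0 2 1 - F 1 0 2 + F 1 2 0 + F 2 0 1 - F 2 1 0"
proof -
  have s: "{..<3::nat} = {0, 1, 2}" by auto
  have f123: "finite {1::nat, 2}" "0 \<notin> {1::nat, 2}" by auto
  have f23: "finite {2::nat}" "1 \<notin> {2::nat}" by auto
  show ?thesis
    unfolding s sum_over_permutations_insert[OF f123] sum_over_permutations_insert[OF f23] permutes_sing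
    by (simp add: sign_swap_id permutation_swap_id sign_compose sign_id swap_id_eq transpose_def)
qed

context lagrangian_pair begin

text \<open>The element of \<open>L\<^sup>*\<close> dual to l, the covector factor of the elements
  of A \<otimes> \<open>L\<^sup>*\<close> in the decomposition below.\<close>

definition coord :: "'l \<Rightarrow> 'l \<Rightarrow> real" where
  "coord l m = (SOME c. m = c *\<^sub>R l)"

lemma coord_lin:
  assumes l: "l \<noteq> 0" "\<And>m. m \<in> fibre L x \<Longrightarrow> \<exists>c. m = c *\<^sub>R l"
  shows "m \<in> fibre L x \<Longrightarrow> m = coord l m *\<^sub>R l" "lin_on (fibre L x) (coord l)"
proof -
  have c: "m = coord l m *\<^sub>R l" if "m \<in> fibre L x" for m
    unfolding coord_def by (rule someI_ex[OF l(2)[OF that]])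
  then show "m \<in> fibre L x \<Longrightarrow> m = coord l m *\<^sub>R l" .
  show "lin_on (fibre L x) (coord l)"
    unfolding lin_on_def
  proof (intro allI ballI)
    fix a b u v assume u: "u \<in> fibre L x" and v: "v \<in> fibre L x"
    have uv: "a *\<^sub>R u + b *\<^sub>R v \<in> fibre L x" using u v by (simp add: subspace_add subspace_scale L.subspace_fibre)
    have "coord l (a *\<^sub>R u + b *\<^sub>R v) *\<^sub>R l = a *\<^sub>R u + b *\<^sub>R v" by (rule c[OF uv, symmetric])
    also have "\<dots> = a *\<^sub>R (coord l u *\<^sub>R l) + b *\<^sub>R (coord l v *\<^sub>R l)" using c[OF u] c[OF v] by simp
    also have "\<dots> = (a * coord l u + b * coord l v) *\<^sub>R l" by (simp add: scaleR_left_distrib)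
    finally show "coord l (a *\<^sub>R u + b *\<^sub>R v) = a *\<^sub>R coord l u + b *\<^sub>R coord l v" using l(1) by simp
  qed
qed

abbreviation "T_B \<alpha> \<beta> \<gamma> \<equiv> T3 (\<Lambda> \<alpha>) (\<Lambda> \<beta>) (\<Lambda> \<gamma>)"

lemma upsilon_eq: "upsilon C A B \<alpha> = T_B (\<alpha> 0) (\<alpha> 1) (\<alpha> 2)"
  unfolding upsilon_def T3_def ..

lemma sub_section_combination:
  assumes "\<And>p. p < (r::nat) \<Longrightarrow> b p \<in> \<Gamma>B"
  shows "(\<Sum>p<r. fmult (\<lambda>_. c p) (b p)) \<in> \<Gamma>B"
  by (rule E.sub_section_sum[OF subB]) (simp_all add: E.sub_section_fmult[OF subB smooth_fun_const[OF M]] assms)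

lemma T3_B_fmult:
  assumes "a \<in> \<Gamma>B" "b \<in> \<Gamma>B" "e \<in> \<Gamma>B"
  shows "T3 (fmult (\<lambda>_. t) a) b e x = t *\<^sub>R T3 a b e x"
proof -
  note s = assms[THEN \<Gamma>B_sec]
  have f: "fmult (\<lambda>_. t) a \<in> \<Gamma>B" by (rule E.sub_section_fmult[OF subB smooth_fun_const[OF M] assms(1)])
  have 1: "T3 u b e = T3 b e u" if "u \<in> \<Gamma>B" for u
    unfolding T3_lagrangian_skew(2)[OF B assms(2) that assms(3)] T3_lagrangian_skew(1)[OF B that assms(2,3)] by simp
  show ?thesis unfolding 1[OF f] 1[OF assms(1)] T3_fmult3[OF s(2,3,1)] by (simp add: fmult_apply)
qed

lemma T3_B_sum1:
  assumes "\<And>p. p < (r::nat) \<Longrightarrow> s p \<in> \<Gamma>B" "b \<in> \<Gamma>B" "e \<in> \<Gamma>B"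
  shows "T3 (\<Sum>p<r. fmult (\<lambda>_. c p) (s p)) b e x = (\<Sum>p<r. c p *\<^sub>R T3 (s p) b e x)"
  using assms(1)
proof (induction r)
  case 0
  have z: "T3 0 b e = 0" using T3_add(1)[OF E.section_zero E.section_zero \<Gamma>B_sec[OF assms(2)] \<Gamma>B_sec[OF assms(3)]] by simp
  show ?case unfolding lessThan_0 sum.empty z by simp
next
  case (Suc r)
  have m: "(\<Sum>p<r. fmult (\<lambda>_. c p) (s p)) \<in> \<Gamma>B" "fmult (\<lambda>_. c r) (s r) \<in> \<Gamma>B"
    using sub_section_combination[of r s c] Suc.prems E.sub_section_fmult[OF subB smooth_fun_const[OF M], of "s r" "c r"]
    by simp_all
  have e: "T3 ((\<Sum>p<r. fmult (\<lambda>_. c p) (s p)) + fmult (\<lambda>_. c r) (s r)) b e x =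
      T3 (\<Sum>p<r. fmult (\<lambda>_. c p) (s p)) b e x + T3 (fmult (\<lambda>_. c r) (s r)) b e x"
    unfolding T3_add(1)[OF \<Gamma>B_sec[OF m(1)] \<Gamma>B_sec[OF m(2)] \<Gamma>B_sec[OF assms(2)] \<Gamma>B_sec[OF assms(3)]] by simp
  show ?case unfolding sum.lessThan_Suc e using Suc T3_B_fmult[of "s r" b e "c r" x] assms(2,3) by simp
qed

text \<open>The cyclic symmetry of T3 on B rotates each sum in turn into the first entry, where it
  is expanded.\<close>

lemma T3_B_sum:
  assumes s: "\<And>p. p < (r::nat) \<Longrightarrow> s p \<in> \<Gamma>B"
  shows "T3 (\<Sum>p<r. fmult (\<lambda>_. c p) (s p)) (\<Sum>q<r. fmult (\<lambda>_. d q) (s q)) (\<Sum>k<r. fmult (\<lambda>_. e k) (s k)) x =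
    (\<Sum>p<r. \<Sum>q<r. \<Sum>k<r. (c p * d q * e k) *\<^sub>R T3 (s p) (s q) (s k) x)"
proof -
  have cyc: "T3 u v w = T3 v w u" if "u \<in> \<Gamma>B" "v \<in> \<Gamma>B" "w \<in> \<Gamma>B" for u v w
    unfolding T3_lagrangian_skew(2)[OF B that(2,1,3)] T3_lagrangian_skew(1)[OF B that] by simp
  note m = sub_section_combination[of r s, OF s]
  have "T3 (\<Sum>p<r. fmult (\<lambda>_. c p) (s p)) (\<Sum>q<r. fmult (\<lambda>_. d q) (s q)) (\<Sum>k<r. fmult (\<lambda>_. e k) (s k)) x =
    (\<Sum>p<r. c p *\<^sub>R T3 (s p) (\<Sum>q<r. fmult (\<lambda>_. d q) (s q)) (\<Sum>k<r. fmult (\<lambda>_. e k) (s k)) x)"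
    by (rule T3_B_sum1[OF s m m])
  also have "\<dots> = (\<Sum>p<r. c p *\<^sub>R (\<Sum>q<r. d q *\<^sub>R (\<Sum>k<r. e k *\<^sub>R T3 (s p) (s q) (s k) x)))"
  proof (intro sum.cong[OF refl] arg_cong[where f = "scaleR _"])
    fix p assume p: "p \<in> {..<r}"
    then have sp: "s p \<in> \<Gamma>B" using s by simp
    have "T3 (s p) (\<Sum>q<r. fmult (\<lambda>_. d q) (s q)) (\<Sum>k<r. fmult (\<lambda>_. e k) (s k)) x =
        (\<Sum>q<r. d q *\<^sub>R T3 (s q) (\<Sum>k<r. fmult (\<lambda>_. e k) (s k)) (s p) x)"
      by (rule trans[OF fun_cong[OF cyc[OF sp m m]] T3_B_sum1[OF s m sp]])
    also have "\<dots> = (\<Sum>q<r. d q *\<^sub>R (\<Sum>k<r. e k *\<^sub>R T3 (s p) (s q) (s k) x))"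
    proof (intro sum.cong[OF refl] arg_cong[where f = "scaleR _"])
      fix q assume "q \<in> {..<r}"
      then have sq: "s q \<in> \<Gamma>B" using s by simp
      have "T3 (s q) (\<Sum>k<r. fmult (\<lambda>_. e k) (s k)) (s p) x = (\<Sum>k<r. e k *\<^sub>R T3 (s k) (s p) (s q) x)"
        by (rule trans[OF fun_cong[OF cyc[OF sq m sp]] T3_B_sum1[OF s sp sq]])
      also have "\<dots> = (\<Sum>k<r. e k *\<^sub>R T3 (s p) (s q) (s k) x)"
      proof (intro sum.cong[OF refl] arg_cong[where f = "scaleR _"])
        fix k assume "k \<in> {..<r}"
        then have "s k \<in> \<Gamma>B" using s by simp
        then show "T3 (s k) (s p) (s q) x = T3 (s p) (s q) (s k) x" by (rule fun_cong[OF cyc[OF _ sp sq]])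
      qed
      finally show "T3 (s q) (\<Sum>k<r. fmult (\<lambda>_. e k) (s k)) (s p) x = (\<Sum>k<r. e k *\<^sub>R T3 (s p) (s q) (s k) x)" .
    qed
    finally show "T3 (s p) (\<Sum>q<r. fmult (\<lambda>_. d q) (s q)) (\<Sum>k<r. fmult (\<lambda>_. e k) (s k)) x =
        (\<Sum>q<r. d q *\<^sub>R (\<Sum>k<r. e k *\<^sub>R T3 (s p) (s q) (s k) x))" .
  qed
  finally show ?thesis by (simp add: scaleR_sum_right mult.assoc)
qed

lemma section_through_line: assumes "l \<in> fibre L x" obtains m where "m \<in> \<Gamma>L" "m x = l"
proof -
  obtain m where "m \<in> sub_sections M L (fibre L)" "m x = l" by (rule L.section_through[OF L.subbundle_fibre assms])
  then show ?thesis using that[of m] L.sub_section_section by simp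
qed

text \<open>At x every one-form is a combination of the \<omega> p \<otimes> m, with coefficients
  its values on the frame. Hence \<Upsilon> at x is determined by its values on their lifts
  \<open>b p\<close>, and the frame vectors paired with \<open>coord l\<close> are the dual elements
  of A \<otimes> \<open>L\<^sup>*\<close>. The sum runs over all triples of indices instead of the
  increasing ones, so each value carries the factor 1/6.\<close>

lemma upsilon_decomposes: "\<exists>ts. decomposes M C A (upsilon C A B) x ts"
proof -
  obtain r where r: "\<forall>x. \<exists>U s \<omega> h. partial_frame_at M E A r x U s \<omega> h"
    using E.partial_frame_exists[OF subA] by (rule exE)
  obtain U s \<omega> h where F: "partial_frame_at M E A r x U s \<omega> h" using r[rule_format, of x] by (elim exE)
  note F' = E.partial_frameD[OF F]
  obtain l where l: "l \<in> fibre L x" "l \<noteq> 0" "\<And>m. m \<in> fibre L x \<Longrightarrow> \<exists>c. m = c *\<^sub>R l"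
    by (rule line_basis) (rule that)
  have co: "y = coord l y *\<^sub>R l" if "y \<in> fibre L x" for y
    by (rule coord_lin(1)[OF l(2) _ that]) (rule l(3))
  have coord: "lin_on (fibre L x) (coord l)" by (rule coord_lin(2)[OF l(2)]) (rule l(3))
  obtain m where m: "m \<in> \<Gamma>L" "m x = l" by (rule section_through_line[OF l(1)])
  define \<theta> where "\<theta> p = form_wedge (\<omega> p) (zero_form m)" for p
  have \<theta>: "\<theta> p \<in> \<Omega> 1" if "p < r" for p unfolding \<theta>_def by (rule ol_form(1)[OF F'(6)[OF that] m(1)])
  define b where "b p = \<Lambda> (\<theta> p)" for p
  have b: "b p \<in> \<Gamma>B" if "p < r" for p unfolding b_def by (rule lift_sec_section[OF \<theta>[OF that]])
  define \<Upsilon> where "\<Upsilon> p q k = T3 (b p) (b q) (b k) x" for p q k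
  define I where "I = List.product [0..<r] (List.product [0..<r] [0..<r])"
  define el where "el = (\<lambda>(p, q, k). (\<lambda>i::nat. (s (if i = 0 then p else if i = 1 then q else k) x, coord l), (1/6) *\<^sub>R \<Upsilon> p q k))"
  define ts where "ts = map el I"
  have sumI: "(\<Sum>z\<leftarrow>I. G z) = (\<Sum>p<r. \<Sum>q<r. \<Sum>k<r. G (p, q, k))" for G :: "nat \<times> nat \<times> nat \<Rightarrow> 'l"
  proof -
    have "(\<Sum>z\<leftarrow>I. G z) = (\<Sum>z\<in>set I. G z)" unfolding I_def by (rule sum_list_distinct_conv_sum_set) (simp add: distinct_product)
    also have "set I = {..<r} \<times> {..<r} \<times> {..<r}" unfolding I_def by (auto simp: atLeast0LessThan)
    finally show ?thesis by (simp add: sum.cartesian_product split_def)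
  qed
  have "decomposes M C A (upsilon C A B) x ts"
    unfolding decomposes_def
  proof (intro conjI allI impI)
    show "\<forall>(t, l)\<in>set ts. l \<in> fibre L x \<and> (\<forall>i<3. fst (t i) \<in> A x \<and> lin_on (fibre L x) (snd (t i)))"
    proof
      fix z assume "z \<in> set ts"
      then obtain p q k where z: "z = el (p, q, k)" "p < r" "q < r" "k < r" unfolding ts_def I_def by auto
      have "\<Upsilon> p q k \<in> fibre L x" unfolding \<Upsilon>_def
        by (rule L.section_mem[OF T3_section]) (simp_all add: \<Gamma>B_sec b z)
      then have "(1/6) *\<^sub>R \<Upsilon> p q k \<in> fibre L x" by (simp add: subspace_scale L.subspace_fibre)
      moreover have "s j x \<in> A x" if "j < r" for j by (rule \<Gamma>A_mem[OF F'(5)[OF that]])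
      ultimately show "case z of (t, l) \<Rightarrow> l \<in> fibre L x \<and> (\<forall>i<3. fst (t i) \<in> A x \<and> lin_on (fibre L x) (snd (t i)))"
        using z coord by (simp add: el_def)
    qed
  next
    fix \<alpha> :: "nat \<Rightarrow> 'm \<Rightarrow> 'v list \<Rightarrow> 'l" assume \<alpha>: "\<forall>i<3. \<alpha> i \<in> \<Omega> 1"
    define c where "c j p = coord l (\<alpha> j x [s p x])" for j p
    \<comment> \<open>A section of B with constant coefficients that agrees at x with the lift of
      \<open>\<alpha> j\<close>; agreement at x is enough because T3 is tensorial on B.\<close>
    define e where "e j = (\<Sum>p<r. fmult (\<lambda>_. c j p) (b p))" for j
    have eB: "e j \<in> \<Gamma>B" for j unfolding e_def by (rule sub_section_combination[OF b])
    have \<Lambda>e: "\<Lambda> (\<alpha> j) x = e j x" if j: "j < 3" for j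
    proof (rule B_eqI)
      have aj: "\<alpha> j \<in> \<Omega> 1" using \<alpha> j by simp
      show "\<Lambda> (\<alpha> j) x \<in> B x" by (rule \<Gamma>B_mem[OF lift_sec_section[OF aj]])
      show "e j x \<in> B x" by (rule \<Gamma>B_mem[OF eB])
      fix u assume u: "u \<in> A x"
      have "pairing C x (e j x) u = (\<Sum>p<r. c j p *\<^sub>R pairing C x (b p x) u)"
        unfolding e_def sum_fun_apply fmult_apply
        by (rule lin_on_sum[OF pairing_lin'[OF fibA[OF u]] E.subspace_fibre]) (simp_all add: fibB \<Gamma>B_mem b)
      also have "\<dots> = (\<Sum>p<r. \<omega> p x [u] *\<^sub>R (c j p *\<^sub>R l))"
        by (rule sum.cong[OF refl]) (simp add: b_def lift_sec_pair \<theta> u \<theta>_def ol_form[OF F'(6) m(1)] m(2) mult.commute)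
      also have "\<dots> = (\<Sum>p<r. \<omega> p x [u] *\<^sub>R \<alpha> j x [s p x])"
      proof (intro sum.cong[OF refl] arg_cong[where f = "scaleR _"])
        fix p assume "p \<in> {..<r}"
        then have "\<alpha> j x [s p x] \<in> fibre L x" by (intro form1_props(2)[OF aj] \<Gamma>A_mem F'(5)) simp
        then show "c j p *\<^sub>R l = \<alpha> j x [s p x]" unfolding c_def by (rule co[symmetric])
      qed
      also have "\<dots> = \<alpha> j x [\<Sum>p<r. \<omega> p x [u] *\<^sub>R s p x]"
        by (rule lin_on_sum[OF form1_props(1)[OF aj] subspaceA, symmetric]) (simp_all add: \<Gamma>A_mem F'(5))
      also have "\<dots> = \<alpha> j x [u]" using F'(7)[OF u] F'(4) by simp
      finally show "pairing C x (\<Lambda> (\<alpha> j) x) u = pairing C x (e j x) u" by (simp add: lift_sec_pair aj u)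
    qed
    have T: "(\<Sum>p<r. \<Sum>q<r. \<Sum>k<r. (c i p * c j q * c n k) *\<^sub>R \<Upsilon> p q k) = T3 (e i) (e j) (e n) x" for i j n
      unfolding e_def \<Upsilon>_def by (rule T3_B_sum[OF b, symmetric])
    have sk1: "T3 (e j) (e i) (e n) x = - T3 (e i) (e j) (e n) x" for i j n
      using T3_lagrangian_skew(1)[OF B eB eB eB, of j i n] by simp
    have sk2: "T3 (e i) (e n) (e j) x = - T3 (e i) (e j) (e n) x" for i j n
      using T3_lagrangian_skew(2)[OF B eB eB eB, of i n j] by simp
    have "upsilon C A B \<alpha> x = T3 (e 0) (e 1) (e 2) x"
      unfolding upsilon_eq
      by (rule T3_lagrangian_cong[OF B]) (simp_all add: lift_sec_section \<alpha> eB \<Lambda>e)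
    also have "\<dots> = (1/6) *\<^sub>R (T3 (e 0) (e 1) (e 2) x - T3 (e 0) (e 2) (e 1) x - T3 (e 1) (e 0) (e 2) x +
        T3 (e 1) (e 2) (e 0) x + T3 (e 2) (e 0) (e 1) x - T3 (e 2) (e 1) (e 0) x)"
    proof -
      have q: "T3 (e 0) (e 2) (e 1) x = - T3 (e 0) (e 1) (e 2) x" "T3 (e 1) (e 0) (e 2) x = - T3 (e 0) (e 1) (e 2) x"
        by (rule sk2, rule sk1)
      have q': "T3 (e 1) (e 2) (e 0) x = T3 (e 0) (e 1) (e 2) x" "T3 (e 2) (e 0) (e 1) x = T3 (e 0) (e 1) (e 2) x"
        using sk2[of 1 2 0] sk1[of 1 0 2] sk1[of 2 0 1] sk2[of 0 2 1] by simp_all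
      have q'': "T3 (e 2) (e 1) (e 0) x = - T3 (e 0) (e 1) (e 2) x" using sk1[of 2 1 0] q'(1) by simp
      have "v = (1/6) *\<^sub>R (v - - v - - v + v + v - - v)" for v :: 'l
        using scaleR_left_distrib[of 1 1 v] by (simp add: algebra_simps scaleR_left_distrib[symmetric])
      then show ?thesis unfolding q q' q'' .
    qed
    also have "\<dots> = (\<Sum>p<r. \<Sum>q<r. \<Sum>k<r. (c 0 p * c 1 q * c 2 k - c 0 p * c 2 q * c 1 k - c 1 p * c 0 q * c 2 k +
        c 1 p * c 2 q * c 0 k + c 2 p * c 0 q * c 1 k - c 2 p * c 1 q * c 0 k) *\<^sub>R ((1/6) *\<^sub>R \<Upsilon> p q k))"
      unfolding T[symmetric]
      by (simp only: sum_subtractf[symmetric] sum.distrib[symmetric] scaleR_sum_right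
          scaleR_left_diff_distrib[symmetric] scaleR_left_distrib[symmetric] scaleR_scaleR mult.commute[of "1/6"])
    also have "\<dots> = (\<Sum>(t, l)\<leftarrow>ts. (\<Sum>\<sigma> | \<sigma> permutes {..<3}. of_int (sign \<sigma>) *
        (\<Prod>i<3. snd (t i) (\<alpha> (\<sigma> i) x [fst (t i)]))) *\<^sub>R l)"
    proof -
      have "(\<Sum>\<sigma> | \<sigma> permutes {..<3}. of_int (sign \<sigma>) *
          (\<Prod>i<3. snd (fst (el (p, q, k)) i) (\<alpha> (\<sigma> i) x [fst (fst (el (p, q, k)) i)]))) =
          c 0 p * c 1 q * c 2 k - c 0 p * c 2 q * c 1 k - c 1 p * c 0 q * c 2 k +
          c 1 p * c 2 q * c 0 k + c 2 p * c 0 q * c 1 k - c 2 p * c 1 q * c 0 k" for p q k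
      proof -
        have "(\<Prod>i<3. snd (fst (el (p, q, k)) i) (\<alpha> (\<sigma> i) x [fst (fst (el (p, q, k)) i)])) =
            c (\<sigma> 0) p * c (\<sigma> 1) q * c (\<sigma> 2) k" for \<sigma> :: "nat \<Rightarrow> nat"
          by (simp add: el_def c_def numeral_3_eq_3 numeral_2_eq_2)
        then show ?thesis using sum_permutes_3[of "\<lambda>i j n. c i p * c j q * c n k"] by simp
      qed
      moreover have "snd (el (p, q, k)) = (1/6) *\<^sub>R \<Upsilon> p q k" for p q k by (simp add: el_def)
      ultimately show ?thesis unfolding ts_def map_map comp_def split_def sumI by simp
    qed
    finally show "upsilon C A B \<alpha> x = (\<Sum>(t, l)\<leftarrow>ts. (\<Sum>\<sigma> | \<sigma> permutes {..<3}. of_int (sign \<sigma>) *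
        (\<Prod>i<3. snd (t i) (\<alpha> (\<sigma> i) x [fst (t i)]))) *\<^sub>R l)" .
  qed
  then show ?thesis by (rule exI)
qed

lemma sharp_zero:
  assumes \<eta>: "\<eta> \<in> \<Omega> 2" and \<nu>: "lin_on (fibre L x) \<nu>" and us: "sharp (\<eta> x) (u, \<nu>) us \<noteq> 0"
  shows "length us = 1 \<and> set us \<subseteq> A x"
proof -
  have "\<nu> 0 = 0" by (rule lin_on_zero[OF \<nu> subspace_0[OF L.subspace_fibre]])
  then have "\<eta> x (u # us) \<noteq> 0" using us unfolding sharp_def by auto
  then show ?thesis using form_zero[OF \<eta>, of "u # us" x] by auto
qed

lemma sharp_wedge3_zero:
  assumes \<eta>: "\<eta> \<in> \<Omega> 2" and t: "\<And>i. i < 3 \<Longrightarrow> lin_on (fibre L x) (snd (t i))"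
    and vs: "\<not> (length vs = 3 \<and> set vs \<subseteq> A x)"
  shows "sharp_wedge3 (\<eta> x) (\<eta> x) (\<eta> x) t vs = 0"
  unfolding sharp_wedge3_def
proof (rule sum.neutral, rule ballI)
  fix \<sigma> :: "nat \<Rightarrow> nat" assume "\<sigma> \<in> {\<sigma>. \<sigma> permutes {..<3}}"
  then have p: "\<sigma> permutes {..<3}" by simp
  have s: "length us = 1 \<and> set us \<subseteq> A x" if "i < 3" "sharp (\<eta> x) (t (\<sigma> i)) us \<noteq> 0" for i us
  proof -
    have "\<sigma> i < 3" using permutes_in_image[OF p, of i] that(1) by simp
    then show ?thesis using sharp_zero[OF \<eta> t, of "\<sigma> i" "fst (t (\<sigma> i))" us] that(2) by simp
  qed
  have s0: "sharp (\<eta> x) (t (\<sigma> 0)) us \<noteq> 0 \<Longrightarrow> length us = 1 \<and> set us \<subseteq> A x"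
    and s1: "sharp (\<eta> x) (t (\<sigma> 1)) us \<noteq> 0 \<Longrightarrow> length us = 1 \<and> set us \<subseteq> A x"
    and s2: "sharp (\<eta> x) (t (\<sigma> 2)) us \<noteq> 0 \<Longrightarrow> length us = 1 \<and> set us \<subseteq> A x" for us
    by (rule s; simp)+
  have w: "length us = 1 + 1 \<and> set us \<subseteq> A x"
    if "wedge (sharp (\<eta> x) (t (\<sigma> 1))) (sharp (\<eta> x) (t (\<sigma> 2))) us \<noteq> 0" for us
  proof (rule ccontr)
    assume "\<not> (length us = 1 + 1 \<and> set us \<subseteq> A x)"
    from wedge_vanish[OF s1 s2 this] that show False by (rule notE[rotated])
  qed
  have "wedge (sharp (\<eta> x) (t (\<sigma> 0))) (wedge (sharp (\<eta> x) (t (\<sigma> 1))) (sharp (\<eta> x) (t (\<sigma> 2)))) vs = 0"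
    by (rule wedge_vanish[OF s0 w]) (use vs in simp_all)
  then show "of_int (sign \<sigma>) * wedge (sharp (\<eta> x) (t (\<sigma> 0))) (wedge (sharp (\<eta> x) (t (\<sigma> 1))) (sharp (\<eta> x) (t (\<sigma> 2)))) vs = 0"
    by simp
qed

text \<open>Let \<open>m i j\<close> be the value on \<open>X j\<close> of the covector attached to
  \<open>t i\<close>. On the left a wedge of three covectors, itself a determinant, is alternated
  once more and gives 3! times det m. On the right each contraction has its arguments in the
  opposite order, and the three signs give - det m.\<close>

lemma sharp_wedge3_eval:
  fixes X :: "nat \<Rightarrow> 'm \<Rightarrow> 'v"
  assumes \<eta>: "\<eta> \<in> \<Omega> 2" and t: "\<And>i. i < 3 \<Longrightarrow> lin_on (fibre L x) (snd (t i))" "\<And>i. i < 3 \<Longrightarrow> fst (t i) \<in> A x"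
    and X: "\<And>j. j < 3 \<Longrightarrow> X j \<in> \<Gamma>A"
  shows "sharp_wedge3 (\<eta> x) (\<eta> x) (\<eta> x) t [X 0 x, X 1 x, X 2 x] =
    - 6 * (\<Sum>\<sigma> | \<sigma> permutes {..<3}. of_int (sign \<sigma>) * (\<Prod>i<3. snd (t i) (contract (X (\<sigma> i)) \<eta> x [fst (t i)])))"
proof -
  define m where "m i j = snd (t i) (\<eta> x [fst (t i), X j x])" for i j
  have sh: "sharp (\<eta> x) (t i) [X j x] = m i j" for i j by (simp add: sharp_def m_def split_def)
  have sz: "sharp (\<eta> x) (t i) us = 0" if "i < 3" "length us \<noteq> 1" for i us
    using sharp_zero[OF \<eta> t(1)[OF that(1)], of "fst (t i)" us] that(2) by auto
  have w: "wedge (sharp (\<eta> x) (t i)) (wedge (sharp (\<eta> x) (t j)) (sharp (\<eta> x) (t k))) [X 0 x, X 1 x, X 2 x] =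
      m i 0 * (m j 1 * m k 2 - m j 2 * m k 1) - m i 1 * (m j 0 * m k 2 - m j 2 * m k 0) +
      m i 2 * (m j 0 * m k 1 - m j 1 * m k 0)" if "i < 3" "j < 3" "k < 3" for i j k
    by (simp add: wedge_3 wedge_2 wedge_1 wedge_Nil sh sz that)
  have neg: "snd (t i) (contract (X j) \<eta> x [fst (t i)]) = - m i j" if "i < 3" "j < 3" for i j
  proof -
    note Xj = \<Gamma>A_mem[OF X[OF that(2)]]
    have "contract (X j) \<eta> x [fst (t i)] = (-1) *\<^sub>R \<eta> x [fst (t i), X j x]"
      unfolding contract_apply form2_skew[OF \<eta> subspaceA t(2)[OF that(1)] Xj] by simp
    then show ?thesis
      unfolding m_def using lin_on_scale[OF t(1)[OF that(1)] form2_props(3)[OF \<eta> t(2)[OF that(1)] Xj], of "-1"] by simp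
  qed
  have "(\<Sum>\<sigma> | \<sigma> permutes {..<3}. of_int (sign \<sigma>) * (\<Prod>i<3. snd (t i) (contract (X (\<sigma> i)) \<eta> x [fst (t i)]))) =
      (\<Sum>\<sigma> | \<sigma> permutes {..<3}. of_int (sign \<sigma>) * - (m 0 (\<sigma> 0) * m 1 (\<sigma> 1) * m 2 (\<sigma> 2)))"
  proof (rule sum.cong[OF refl])
    fix \<sigma> :: "nat \<Rightarrow> nat" assume "\<sigma> \<in> {\<sigma>. \<sigma> permutes {..<3}}"
    then have p: "\<sigma> i < 3" if "i < 3" for i using permutes_in_image[of \<sigma> "{..<3}" i] that by simp
    have "(\<Prod>i<3. snd (t i) (contract (X (\<sigma> i)) \<eta> x [fst (t i)])) = (\<Prod>i<3. - m i (\<sigma> i))"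
      by (rule prod.cong[OF refl]) (simp add: neg p)
    also have "\<dots> = - (m 0 (\<sigma> 0) * m 1 (\<sigma> 1) * m 2 (\<sigma> 2))" by (simp add: numeral_3_eq_3 numeral_2_eq_2)
    finally show "of_int (sign \<sigma>) * (\<Prod>i<3. snd (t i) (contract (X (\<sigma> i)) \<eta> x [fst (t i)])) =
        of_int (sign \<sigma>) * - (m 0 (\<sigma> 0) * m 1 (\<sigma> 1) * m 2 (\<sigma> 2))" by simp
  qed
  also have "\<dots> = - (m 0 0 * m 1 1 * m 2 2) + m 0 0 * m 1 2 * m 2 1 + m 0 1 * m 1 0 * m 2 2
      - m 0 1 * m 1 2 * m 2 0 - m 0 2 * m 1 0 * m 2 1 + m 0 2 * m 1 1 * m 2 0"
    unfolding sum_permutes_3[of "\<lambda>i j k. - (m 0 i * m 1 j * m 2 k)"] by simp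
  finally have R: "(\<Sum>\<sigma> | \<sigma> permutes {..<3}. of_int (sign \<sigma>) * (\<Prod>i<3. snd (t i) (contract (X (\<sigma> i)) \<eta> x [fst (t i)]))) =
      - (m 0 0 * m 1 1 * m 2 2) + m 0 0 * m 1 2 * m 2 1 + m 0 1 * m 1 0 * m 2 2
      - m 0 1 * m 1 2 * m 2 0 - m 0 2 * m 1 0 * m 2 1 + m 0 2 * m 1 1 * m 2 0" .
  show ?thesis
    unfolding R sharp_wedge3_def
      sum_permutes_3[of "\<lambda>i j k. wedge (sharp (\<eta> x) (t i)) (wedge (sharp (\<eta> x) (t j)) (sharp (\<eta> x) (t k))) [X 0 x, X 1 x, X 2 x]"]
    by (simp add: w algebra_simps del: One_nat_def)
qed

lemma decomposesD:
  assumes "decomposes M C A (upsilon C A B) x ts" "(t, l) \<in> set ts" "i < 3"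
  shows "lin_on (fibre L x) (snd (t i))" "fst (t i) \<in> A x"
proof -
  have "\<forall>(t, l)\<in>set ts. l \<in> fibre L x \<and> (\<forall>i<3. fst (t i) \<in> A x \<and> lin_on (fibre L x) (snd (t i)))"
    using assms(1) unfolding decomposes_def by (rule conjunct1)
  from bspec[OF this assms(2)] show "lin_on (fibre L x) (snd (t i))" "fst (t i) \<in> A x" using assms(3) by simp_all
qed

text \<open>The defining property of a decomposition is tested on the one-forms
  \<open>contract (X i) \<eta>\<close>. Every decomposition therefore gives this value, in
  particular the one selected in the definition.\<close>

lemma sharp_apply_eval:
  fixes X :: "nat \<Rightarrow> 'm \<Rightarrow> 'v"
  assumes \<eta>: "\<eta> \<in> \<Omega> 2" and X: "\<And>j. j < 3 \<Longrightarrow> X j \<in> \<Gamma>A"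
  shows "sharp_apply M C A (upsilon C A B) \<eta> \<eta> \<eta> x [X 0 x, X 1 x, X 2 x] =
    - 6 *\<^sub>R T3 (hat \<eta> (X 0)) (hat \<eta> (X 1)) (hat \<eta> (X 2)) x"
proof -
  define ts where "ts = (SOME ts. decomposes M C A (upsilon C A B) x ts)"
  have d: "decomposes M C A (upsilon C A B) x ts" unfolding ts_def by (rule someI_ex[OF upsilon_decomposes])
  let ?S = "\<lambda>t. \<Sum>\<sigma> | \<sigma> permutes {..<3}. of_int (sign \<sigma>) * (\<Prod>i<3. snd (t i) (contract (X (\<sigma> i)) \<eta> x [fst (t i)]))"
  have "\<forall>i<3. contract (X i) \<eta> \<in> \<Omega> 1" using contract_form[OF \<eta> X] by simp
  then have U: "upsilon C A B (\<lambda>i. contract (X i) \<eta>) x = (\<Sum>(t, l)\<leftarrow>ts. ?S t *\<^sub>R l)"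
    using conjunct2[OF d[unfolded decomposes_def], rule_format, of "\<lambda>i. contract (X i) \<eta>"] by simp
  have "sharp_apply M C A (upsilon C A B) \<eta> \<eta> \<eta> x [X 0 x, X 1 x, X 2 x] =
      (\<Sum>(t, l)\<leftarrow>ts. sharp_wedge3 (\<eta> x) (\<eta> x) (\<eta> x) t [X 0 x, X 1 x, X 2 x] *\<^sub>R l)"
    unfolding sharp_apply_def ts_def ..
  also have "\<dots> = (\<Sum>(t, l)\<leftarrow>ts. (- 6 * ?S t) *\<^sub>R l)"
  proof (intro arg_cong[where f = sum_list] map_cong[OF refl])
    fix z assume z: "z \<in> set ts"
    obtain t l where tl: "z = (t, l)" by (cases z)
    have "sharp_wedge3 (\<eta> x) (\<eta> x) (\<eta> x) t [X 0 x, X 1 x, X 2 x] = - 6 * ?S t"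
      by (rule sharp_wedge3_eval[OF \<eta> decomposesD[OF d] X]) (use z tl in auto)
    then show "(case z of (t, l) \<Rightarrow> sharp_wedge3 (\<eta> x) (\<eta> x) (\<eta> x) t [X 0 x, X 1 x, X 2 x] *\<^sub>R l) =
        (case z of (t, l) \<Rightarrow> (- 6 * ?S t) *\<^sub>R l)" unfolding tl by simp
  qed
  also have "\<dots> = - 6 *\<^sub>R (\<Sum>(t, l)\<leftarrow>ts. ?S t *\<^sub>R l)"
  proof -
    have "(\<Sum>(t, l)\<leftarrow>xs. (c * f t) *\<^sub>R l) = c *\<^sub>R (\<Sum>(t, l)\<leftarrow>xs. f t *\<^sub>R l)"
      for c :: real and f and xs :: "((nat \<Rightarrow> 'v \<times> ('l \<Rightarrow> real)) \<times> 'l) list"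
      by (induction xs) (simp_all add: split_def scaleR_add_right)
    then show ?thesis .
  qed
  finally show ?thesis unfolding U[symmetric] upsilon_eq hat_def .
qed

lemma sharp_apply_zero:
  assumes \<eta>: "\<eta> \<in> \<Omega> 2" and vs: "\<not> (length vs = 3 \<and> set vs \<subseteq> A x)"
  shows "sharp_apply M C A (upsilon C A B) \<eta> \<eta> \<eta> x vs = 0"
proof -
  define ts where "ts = (SOME ts. decomposes M C A (upsilon C A B) x ts)"
  have d: "decomposes M C A (upsilon C A B) x ts" unfolding ts_def by (rule someI_ex[OF upsilon_decomposes])
  have z: "map (\<lambda>(t, l). sharp_wedge3 (\<eta> x) (\<eta> x) (\<eta> x) t vs *\<^sub>R l) ts = map (\<lambda>_. 0) ts"
  proof (rule map_cong[OF refl])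
    fix z assume z: "z \<in> set ts"
    obtain t l where tl: "z = (t, l)" by (cases z)
    have "sharp_wedge3 (\<eta> x) (\<eta> x) (\<eta> x) t vs = 0"
      by (rule sharp_wedge3_zero[OF \<eta> decomposesD(1)[OF d] vs]) (use z tl in auto)
    then show "(case z of (t, l) \<Rightarrow> sharp_wedge3 (\<eta> x) (\<eta> x) (\<eta> x) t vs *\<^sub>R l) = 0" unfolding tl by simp
  qed
  show ?thesis unfolding sharp_apply_def ts_def[symmetric] z by simp
qed

section \<open>The Koszul differential of a two-form\<close>

lemma koszul_3:
  "koszul C \<eta> [a, b, c] x = nb a (ev2 \<eta> b c) x - nb b (ev2 \<eta> a c) x + nb c (ev2 \<eta> a b) x -
     \<eta> x [br a b x, c x] + \<eta> x [br a c x, b x] - \<eta> x [br b c x, a x]"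
proof -
  have s: "{(i, j). i < j \<and> j < length [a, b, c]} = {(0, 1), (0, 2), (1, 2)}" by auto
  show ?thesis
    unfolding koszul_def s
    by (simp add: nths_Cons ev2_def numeral_3_eq_3 numeral_2_eq_2)
qed

text \<open>\<open>d_form\<close> checks where the entries lie but not how many there are, so the
  degree has to come out of the formula: omitting one entry, or omitting two and adding their
  bracket, leaves two arguments only if there were three.\<close>

lemma koszul_wrong_length:
  assumes \<eta>: "\<eta> \<in> \<Omega> 2" and Xs: "set Xs \<subseteq> \<Gamma>A" "length Xs \<noteq> 3"
  shows "koszul C \<eta> Xs x = 0"
proof -
  have z: "\<eta> y vs = 0" if "length vs \<noteq> 2" for y vs using form_zero[OF \<eta>, of vs y] that by auto
  have l1: "length (nths Xs (- {i})) \<noteq> 2" if "i < length Xs" for i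
  proof -
    have "{k. k < length Xs \<and> k \<in> - {i}} = {..<length Xs} - {i}" by auto
    then show ?thesis using that Xs(2) by (simp add: length_nths)
  qed
  have l2: "length (nths Xs (- {i, j})) \<noteq> 1" if "i < j" "j < length Xs" for i j
  proof -
    have "{k. k < length Xs \<and> k \<in> - {i, j}} = {..<length Xs} - {i, j}" by auto
    moreover have "card ({..<length Xs} - {i, j}) = length Xs - 2" using that by (simp add: card_Diff_subset)
    ultimately show ?thesis using that Xs(2) by (simp add: length_nths)
  qed
  have "anchor_sec C (Xs ! i) (\<lambda>y. \<eta> y (map (\<lambda>X. X y) (nths Xs (- {i})))) x = 0" if "i < length Xs" for i
  proof -
    have "Xs ! i \<in> \<Gamma>" using Xs(1) nth_mem[OF that] \<Gamma>A_sec by blast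
    moreover have "(\<lambda>y. \<eta> y (map (\<lambda>X. X y) (nths Xs (- {i})))) = 0" using l1[OF that] z by (intro ext) simp
    ultimately show ?thesis using nb_zero by simp
  qed
  moreover have "\<eta> x (br (Xs ! i) (Xs ! j) x # map (\<lambda>X. X x) (nths Xs (- {i, j}))) = 0"
    if "i < j" "j < length Xs" for i j using l2[OF that] z by simp
  ultimately show ?thesis unfolding koszul_def by (simp add: split_def)
qed

text \<open>On the left are the terms of order two as they come from the expansion of T3 on the
  graph. The exchange identities move both lifts to the first two entries; pairing a lift with a
  section of A is \<open>ev2\<close>, which accounts for the derivative terms.\<close>

lemma second_order_alt:
  assumes \<eta>: "\<eta> \<in> \<Omega> 2" and X: "a \<in> \<Gamma>A" "b \<in> \<Gamma>A" "c \<in> \<Gamma>A"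
  shows "T3 (hat \<eta> a) (hat \<eta> b) c + T3 (hat \<eta> a) b (hat \<eta> c) + T3 a (hat \<eta> b) (hat \<eta> c) =
    T3 (hat \<eta> a) (hat \<eta> b) c - nb (hat \<eta> a) (ev2 \<eta> b c) +
     (T3 (hat \<eta> b) (hat \<eta> c) a - nb (hat \<eta> b) (ev2 \<eta> c a)) +
     (T3 (hat \<eta> c) (hat \<eta> a) b - nb (hat \<eta> c) (ev2 \<eta> a b))"
proof
  fix x
  note s = X[THEN \<Gamma>A_sec] and h = hat_section[OF \<eta> X(1)] hat_section[OF \<eta> X(2)] hat_section[OF \<eta> X(3)]
  note hs = h[THEN \<Gamma>B_sec]
  have 1: "T3 (hat \<eta> a) b (hat \<eta> c) + T3 (hat \<eta> a) (hat \<eta> c) b = nb (hat \<eta> a) (ev2 \<eta> c b)"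
    using T3_swap23[OF hs(1) s(2) hs(3)] by (simp add: pr_hat'[OF \<eta> X(3,2)])
  have 2: "T3 a (hat \<eta> b) (hat \<eta> c) + T3 (hat \<eta> b) a (hat \<eta> c) = nb (hat \<eta> c) (ev2 \<eta> b a)"
    using T3_swap12[OF s(1) hs(2,3)] by (simp add: pr_hat'[OF \<eta> X(2,1)])
  have 3: "T3 (hat \<eta> b) a (hat \<eta> c) + T3 (hat \<eta> b) (hat \<eta> c) a = nb (hat \<eta> b) (ev2 \<eta> c a)"
    using T3_swap23[OF hs(2) s(1) hs(3)] by (simp add: pr_hat'[OF \<eta> X(3,1)])
  have 4: "T3 (hat \<eta> a) (hat \<eta> c) b + T3 (hat \<eta> c) (hat \<eta> a) b = 0"
    unfolding T3_swap12[OF hs(1,3) s(2)] pr_isotropic[OF B h(1,3)] by (rule nb_zero[OF s(2)])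
  have 5: "nb (hat \<eta> a) (ev2 \<eta> c b) = - nb (hat \<eta> a) (ev2 \<eta> b c)"
    unfolding ev2_skew[OF \<eta> X(2,3)] by (rule nb_minus[OF hs(1) ev2_section[OF \<eta> X(2,3)]])
  have 6: "nb (hat \<eta> c) (ev2 \<eta> b a) = - nb (hat \<eta> c) (ev2 \<eta> a b)"
    unfolding ev2_skew[OF \<eta> X(1,2)] by (rule nb_minus[OF hs(3) ev2_section[OF \<eta> X(1,2)]])
  have e1: "T3 (hat \<eta> a) b (hat \<eta> c) x = - nb (hat \<eta> a) (ev2 \<eta> b c) x - T3 (hat \<eta> a) (hat \<eta> c) b x"
    using fun_cong[OF 1[unfolded 5], of x] by (simp add: algebra_simps)
  have e2: "T3 a (hat \<eta> b) (hat \<eta> c) x = - nb (hat \<eta> c) (ev2 \<eta> a b) x - T3 (hat \<eta> b) a (hat \<eta> c) x"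
    using fun_cong[OF 2[unfolded 6], of x] by (simp add: algebra_simps)
  have e3: "T3 (hat \<eta> b) a (hat \<eta> c) x = nb (hat \<eta> b) (ev2 \<eta> c a) x - T3 (hat \<eta> b) (hat \<eta> c) a x"
    using fun_cong[OF 3, of x] by (simp add: algebra_simps)
  have e4: "T3 (hat \<eta> a) (hat \<eta> c) b x = - T3 (hat \<eta> c) (hat \<eta> a) b x"
    using fun_cong[OF 4, of x] by (simp add: eq_neg_iff_add_eq_0)
  show "(T3 (hat \<eta> a) (hat \<eta> b) c + T3 (hat \<eta> a) b (hat \<eta> c) + T3 a (hat \<eta> b) (hat \<eta> c)) x =
    (T3 (hat \<eta> a) (hat \<eta> b) c - nb (hat \<eta> a) (ev2 \<eta> b c) +
     (T3 (hat \<eta> b) (hat \<eta> c) a - nb (hat \<eta> b) (ev2 \<eta> c a)) +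
     (T3 (hat \<eta> c) (hat \<eta> a) b - nb (hat \<eta> c) (ev2 \<eta> a b))) x"
    by (simp add: e1 e2 e3 e4)
qed

text \<open>Each lift is moved to the third entry, at the cost of a derivative of
  \<open>ev2\<close>. Since A is involutive, the remaining T3 is \<eta> evaluated on a bracket in A,
  as in the Koszul formula.\<close>

lemma first_order:
  assumes inv: "dirac_jacobi M C A" and \<eta>: "\<eta> \<in> \<Omega> 2" and X: "a \<in> \<Gamma>A" "b \<in> \<Gamma>A" "c \<in> \<Gamma>A"
  shows "T3 (hat \<eta> a) b c x + T3 a (hat \<eta> b) c x + T3 a b (hat \<eta> c) x = koszul C \<eta> [a, b, c] x"
proof -
  note s = X[THEN \<Gamma>A_sec] and h = hat_section[OF \<eta> X(1)] hat_section[OF \<eta> X(2)] hat_section[OF \<eta> X(3)]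
  note hs = h[THEN \<Gamma>B_sec]
  have br: "br p q \<in> \<Gamma>A" if "p \<in> \<Gamma>A" "q \<in> \<Gamma>A" for p q
    using inv that unfolding dirac_jacobi_def by simp
  have T: "T3 p q (hat \<eta> r) x = - \<eta> x [br p q x, r x]" if "p \<in> \<Gamma>A" "q \<in> \<Gamma>A" "r \<in> \<Gamma>A" for p q r
  proof -
    have "T3 p q (hat \<eta> r) = ev2 \<eta> r (br p q)" unfolding T3_def by (rule pr_hat'[OF \<eta> that(3) br[OF that(1,2)]])
    then show ?thesis using form2_skew[OF \<eta> subspaceA \<Gamma>A_mem[OF br[OF that(1,2)]] \<Gamma>A_mem[OF that(3)], of x]
      by (simp add: ev2_def)
  qed
  have 1: "T3 a (hat \<eta> b) c x = nb a (ev2 \<eta> b c) x - T3 a c (hat \<eta> b) x"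
    using fun_cong[OF T3_swap23[OF s(1) hs(2) s(3)], of x] by (simp add: pr_hat[OF \<eta> X(2,3)] algebra_simps)
  have 2: "T3 (hat \<eta> a) b c x = nb c (ev2 \<eta> a b) x - T3 b (hat \<eta> a) c x"
    using fun_cong[OF T3_swap12[OF hs(1) s(2,3)], of x] by (simp add: pr_hat[OF \<eta> X(1,2)] algebra_simps)
  have 3: "T3 b (hat \<eta> a) c x = nb b (ev2 \<eta> a c) x - T3 b c (hat \<eta> a) x"
    using fun_cong[OF T3_swap23[OF s(2) hs(1) s(3)], of x] by (simp add: pr_hat[OF \<eta> X(1,3)] algebra_simps)
  show ?thesis unfolding koszul_3 1 2 3 T[OF X] T[OF X(1,3,2)] T[OF X(2,3,1)] by simp
qed

section \<open>Graphs\<close>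

text \<open>The fibrewise form of \<open>hat\<close>: the graph is defined vector by vector, while
  T3 takes sections.\<close>

definition hat_at :: "('m \<Rightarrow> 'v list \<Rightarrow> 'l) \<Rightarrow> 'm \<Rightarrow> 'v \<Rightarrow> 'v" where
  "hat_at \<eta> x \<xi> = lift C A B x (\<lambda>us. \<eta> x (\<xi> # us))"

lemma graph_eq: "graph C A B \<eta> x = {\<xi> + hat_at \<eta> x \<xi> | \<xi>. \<xi> \<in> A x}"
  unfolding graph_def hat_at_def ..

lemma hat_hat_at: "hat \<eta> X x = hat_at \<eta> x (X x)"
  unfolding hat_def lift_sec_def contract_def hat_at_def ..

lemma contract_dual_at:
  assumes "\<eta> \<in> \<Omega> 2" "\<xi> \<in> A x" shows "dual_at x (\<lambda>us. \<eta> x (\<xi> # us))"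
proof -
  obtain X where X: "X \<in> \<Gamma>A" "X x = \<xi>" by (rule E.section_through[OF subA assms(2)])
  show ?thesis using form1_dual_at[OF contract_form[OF assms(1) X(1)], of x] X(2) unfolding contract_def by simp
qed

lemma hat_at_props:
  assumes "\<eta> \<in> \<Omega> 2" "\<xi> \<in> A x"
  shows "hat_at \<eta> x \<xi> \<in> B x" "u \<in> A x \<Longrightarrow> pairing C x (hat_at \<eta> x \<xi>) u = \<eta> x [\<xi>, u]"
  using lift_props[OF contract_dual_at[OF assms]] unfolding hat_at_def by simp_all

lemma hat_at_lin: assumes \<eta>: "\<eta> \<in> \<Omega> 2" shows "lin_on (A x) (hat_at \<eta> x)"
  unfolding lin_on_def
proof (intro allI ballI)
  fix a b u v assume u: "u \<in> A x" and v: "v \<in> A x"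
  have uv: "a *\<^sub>R u + b *\<^sub>R v \<in> A x" using u v by (simp add: subspace_add subspace_scale subspaceA)
  note pu = hat_at_props[OF \<eta> u] and pv = hat_at_props[OF \<eta> v] and puv = hat_at_props[OF \<eta> uv]
  show "hat_at \<eta> x (a *\<^sub>R u + b *\<^sub>R v) = a *\<^sub>R hat_at \<eta> x u + b *\<^sub>R hat_at \<eta> x v"
  proof (rule B_eqI[OF puv(1)])
    show "a *\<^sub>R hat_at \<eta> x u + b *\<^sub>R hat_at \<eta> x v \<in> B x" using pu(1) pv(1) by (simp add: subspace_add subspace_scale subspaceB)
    fix w assume w: "w \<in> A x"
    show "pairing C x (hat_at \<eta> x (a *\<^sub>R u + b *\<^sub>R v)) w = pairing C x (a *\<^sub>R hat_at \<eta> x u + b *\<^sub>R hat_at \<eta> x v) w"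
      unfolding puv(2)[OF w] lin_onD[OF pairing_lin'[OF fibA[OF w]] fibB[OF pu(1)] fibB[OF pv(1)]] pu(2)[OF w] pv(2)[OF w]
      by (rule lin_onD[OF form2_props(2)[OF \<eta> w] u v])
  qed
qed

text \<open>The canonical pairing of A \<oplus> \<open>A\<^sup>\<dagger>\<close>, with B in place of
  \<open>A\<^sup>\<dagger>\<close>.\<close>

lemma graph_pairing:
  assumes b: "b \<in> B x" and a: "a \<in> A x" and z: "z \<in> A x" "w \<in> B x"
  shows "pairing C x (a + b) (z + w) = pairing C x b z + pairing C x w a"
proof -
  note f = fibA[OF a] fibB[OF b] fibA[OF z(1)] fibB[OF z(2)]
  have zw: "z + w \<in> fibre E x" using f by (simp add: subspace_add E.subspace_fibre)
  have "pairing C x (a + b) (z + w) = pairing C x a (z + w) + pairing C x b (z + w)"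
    by (rule lin_on_add[OF pairing_lin'[OF zw] f(1,2)])
  also have "pairing C x a (z + w) = pairing C x a z + pairing C x a w" by (rule lin_on_add[OF pairing_lin[OF f(1)] f(3,4)])
  also have "pairing C x b (z + w) = pairing C x b z + pairing C x b w" by (rule lin_on_add[OF pairing_lin[OF f(2)] f(3,4)])
  finally show ?thesis using isoA[OF a z(1)] isoB[OF b z(2)] pairing_sym[OF f(1,4)] by simp
qed

end

section \<open>Graphs as Lagrangian complements of B\<close>

context lagrangian_pair begin

lemma graph_mem: "\<xi> \<in> A x \<Longrightarrow> \<xi> + hat_at \<eta> x \<xi> \<in> graph C A B \<eta> x"
  unfolding graph_eq by blast

lemma graphE:
  assumes "e \<in> graph C A B \<eta> x" obtains \<xi> where "\<xi> \<in> A x" "e = \<xi> + hat_at \<eta> x \<xi>"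
  using assms unfolding graph_eq by blast

lemma graph_section:
  assumes \<eta>: "\<eta> \<in> \<Omega> 2" and X: "X \<in> \<Gamma>A"
  shows "X + hat \<eta> X \<in> sub_sections M E (graph C A B \<eta>)"
  unfolding sub_sections_iff
  by (simp add: E.section_add \<Gamma>A_sec X \<eta> hat_hat_at graph_mem \<Gamma>A_mem \<Gamma>B_sec hat_section)

lemma hat_at_sum:
  assumes \<eta>: "\<eta> \<in> \<Omega> 2" and s: "\<And>j. j < (r::nat) \<Longrightarrow> s j \<in> A x"
  shows "(\<Sum>j<r. k j *\<^sub>R (s j + hat_at \<eta> x (s j))) = (\<Sum>j<r. k j *\<^sub>R s j) + hat_at \<eta> x (\<Sum>j<r. k j *\<^sub>R s j)"
proof -
  have "hat_at \<eta> x (\<Sum>j<r. k j *\<^sub>R s j) = (\<Sum>j<r. k j *\<^sub>R hat_at \<eta> x (s j))"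
    by (rule lin_on_sum[OF hat_at_lin[OF \<eta>] subspaceA]) (simp_all add: s)
  then show ?thesis by (simp add: scaleR_add_right sum.distrib)
qed

lemma graph_subset_fibre: assumes "\<eta> \<in> \<Omega> 2" "e \<in> graph C A B \<eta> x" shows "e \<in> fibre E x"
proof -
  obtain \<xi> where x: "\<xi> \<in> A x" "e = \<xi> + hat_at \<eta> x \<xi>" by (rule graphE[OF assms(2)])
  show ?thesis unfolding x(2)
    by (rule subspace_add[OF E.subspace_fibre fibA[OF x(1)] fibB[OF hat_at_props(1)[OF assms(1) x(1)]]])
qed

text \<open>The map from \<xi> to \<xi> + \<open>hat_at \<eta> x \<xi>\<close> is linear with left
  inverse \<open>pA x\<close>, so it carries frames of A to frames of the graph.\<close>

lemma graph_subbundle: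
  assumes \<eta>: "\<eta> \<in> \<Omega> 2" shows "subbundle M E (graph C A B \<eta>)"
proof -
  obtain r where r: "\<forall>x. \<exists>U s \<omega> h. partial_frame_at M E A r x U s \<omega> h"
    using E.partial_frame_exists[OF subA] by (rule exE)
  have "\<exists>U t. open U \<and> x \<in> U \<and> (\<forall>j<r. smooth_section_on M E U (t j)) \<and>
      (\<forall>y\<in>U. basis_of r (graph C A B \<eta> y) (\<lambda>j. t j y))" for x
  proof -
    obtain U s \<omega> h where F: "partial_frame_at M E A r x U s \<omega> h" using r[rule_format, of x] by (elim exE)
    note F' = E.partial_frameD[OF F]
    define t where "t j = s j + hat \<eta> (s j)" for j
    have tj: "t j y = s j y + hat_at \<eta> y (s j y)" for j y unfolding t_def by (simp add: hat_hat_at)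
    have "smooth_section_on M E U (t j)" if "j < r" for j
    proof -
      have "t j \<in> \<Gamma>" unfolding t_def by (rule E.sub_section_section[OF graph_section[OF \<eta> F'(5)[OF that]]])
      then have "smooth_section_on M E UNIV (t j)" unfolding sections_def by simp
      then show ?thesis by (rule E.smooth_section_on_subset) simp
    qed
    moreover have "basis_of r (graph C A B \<eta> y) (\<lambda>j. t j y)" if y: "y \<in> U" for y
    proof -
      note b = F'(8)[OF y]
      have m: "s j y \<in> A y" if "j < r" for j by (rule basis_of_mem[OF b that])
      have sum: "(\<Sum>j<r. k j *\<^sub>R t j y) = (\<Sum>j<r. k j *\<^sub>R s j y) + hat_at \<eta> y (\<Sum>j<r. k j *\<^sub>R s j y)" for k
        unfolding tj by (rule hat_at_sum[OF \<eta> m])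
      have sA: "(\<Sum>j<r. k j *\<^sub>R s j y) \<in> A y" for k by (rule basis_of_combination_mem[OF b])
      show ?thesis unfolding basis_of_iff
      proof (intro conjI allI impI set_eqI iffI)
        fix e assume "e \<in> graph C A B \<eta> y"
        then obtain \<xi> where x: "\<xi> \<in> A y" "e = \<xi> + hat_at \<eta> y \<xi>" by (rule graphE)
        obtain k where "\<xi> = (\<Sum>j<r. k j *\<^sub>R s j y)" by (rule basis_of_coeffs[OF b x(1)])
        then have "e = (\<Sum>j<r. k j *\<^sub>R t j y)" unfolding sum using x(2) by simp
        then show "e \<in> range (\<lambda>c. \<Sum>j<r. c j *\<^sub>R t j y)" by (rule image_eqI[of e _ k]) simp
      next
        fix e assume "e \<in> range (\<lambda>c. \<Sum>j<r. c j *\<^sub>R t j y)"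
        then obtain k where "e = (\<Sum>j<r. k j *\<^sub>R t j y)" by (rule imageE)
        then show "e \<in> graph C A B \<eta> y" unfolding sum using graph_mem[OF sA[of k]] by simp
      next
        fix k j assume z: "(\<Sum>j<r. k j *\<^sub>R t j y) = 0" and j: "j < r"
        have "pA y ((\<Sum>j<r. k j *\<^sub>R s j y) + hat_at \<eta> y (\<Sum>j<r. k j *\<^sub>R s j y)) = (\<Sum>j<r. k j *\<^sub>R s j y)"
          by (rule pA_eq[OF sA hat_at_props(1)[OF \<eta> sA]])
        moreover have "pA y 0 = 0" using pA_eq[OF subspace_0[OF subspaceA] subspace_0[OF subspaceB], of y] by simp
        ultimately have "(\<Sum>j<r. k j *\<^sub>R s j y) = 0" using z unfolding sum by simp
        then show "k j = 0" by (rule basis_of_independent[OF b _ j])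
      qed
    qed
    ultimately show ?thesis using F'(1,2) by (intro exI[of _ U] exI[of _ t]) simp
  qed
  then show ?thesis unfolding subbundle_def using graph_subset_fibre[OF \<eta>] by (intro conjI exI[of _ r]) auto
qed

text \<open>Isotropy is the skewness of \<eta>. Conversely, if a + b is orthogonal to the graph,
  testing with the graph vectors over all u in A determines the pairings of b with A, and they are
  those of \<open>hat_at \<eta> x a\<close>.\<close>

lemma graph_almost_dirac:
  assumes \<eta>: "\<eta> \<in> \<Omega> 2" shows "almost_dirac_jacobi M C (graph C A B \<eta>)"
  unfolding almost_dirac_jacobi_def
proof (intro conjI graph_subbundle[OF \<eta>] ext set_eqI iffI)
  fix x e assume e: "e \<in> graph C A B \<eta> x"
  obtain \<xi> where x: "\<xi> \<in> A x" "e = \<xi> + hat_at \<eta> x \<xi>" by (rule graphE[OF e])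
  have "pairing C x e a = 0" if a: "a \<in> graph C A B \<eta> x" for a
  proof -
    obtain \<zeta> where z: "\<zeta> \<in> A x" "a = \<zeta> + hat_at \<eta> x \<zeta>" by (rule graphE[OF a])
    note px = hat_at_props[OF \<eta> x(1)] and pz = hat_at_props[OF \<eta> z(1)]
    show ?thesis
      unfolding x(2) z(2) graph_pairing[OF px(1) x(1) z(1) pz(1)] px(2)[OF z(1)] pz(2)[OF x(1)]
        form2_skew[OF \<eta> subspaceA x(1) z(1)] by simp
  qed
  then show "e \<in> orth C (graph C A B \<eta>) x" unfolding orth_def using graph_subset_fibre[OF \<eta> e] by simp
next
  fix x e assume "e \<in> orth C (graph C A B \<eta>) x"
  then have e: "e \<in> fibre E x" "\<And>a. a \<in> graph C A B \<eta> x \<Longrightarrow> pairing C x e a = 0" unfolding orth_def by simp_all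
  obtain a b where ab: "a \<in> A x" "b \<in> B x" "e = a + b" by (rule decompose[OF e(1)])
  note pa = hat_at_props[OF \<eta> ab(1)]
  have "b = hat_at \<eta> x a"
  proof (rule B_eqI[OF ab(2) pa(1)])
    fix u assume u: "u \<in> A x"
    note pu = hat_at_props[OF \<eta> u]
    have "pairing C x b u + pairing C x (hat_at \<eta> x u) a = 0"
      using e(2)[OF graph_mem[OF u]] unfolding ab(3) graph_pairing[OF ab(2,1) u pu(1)] .
    then show "pairing C x b u = pairing C x (hat_at \<eta> x a) u"
      unfolding pu(2)[OF ab(1)] pa(2)[OF u] form2_skew[OF \<eta> subspaceA ab(1) u] by simp
  qed
  then show "e \<in> graph C A B \<eta> x" using graph_mem[OF ab(1)] ab(3) by simp
qed

text \<open>A graph vector differs from its component in A by an element of B, so a decomposition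
  along A and B becomes one along the graph and B by shifting that element.\<close>

lemma graph_transverse:
  assumes \<eta>: "\<eta> \<in> \<Omega> 2" shows "transverse C (graph C A B \<eta>) B"
  unfolding transverse_def direct_sum_def
proof (intro allI conjI set_eqI iffI)
  fix x e assume "e \<in> fibre E x"
  then obtain a b where ab: "a \<in> A x" "b \<in> B x" "e = a + b" by (rule decompose)
  have "b - hat_at \<eta> x a \<in> B x" by (rule subspace_diff[OF subspaceB ab(2) hat_at_props(1)[OF \<eta> ab(1)]])
  moreover have "e = (a + hat_at \<eta> x a) + (b - hat_at \<eta> x a)" using ab(3) by simp
  ultimately show "e \<in> {g + b |g b. g \<in> graph C A B \<eta> x \<and> b \<in> B x}" using graph_mem[OF ab(1)] by blast
next
  fix x e assume "e \<in> {g + b |g b. g \<in> graph C A B \<eta> x \<and> b \<in> B x}"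
  then obtain g b where "g \<in> graph C A B \<eta> x" "b \<in> B x" "e = g + b" by blast
  then show "e \<in> fibre E x"
    using subspace_add[OF E.subspace_fibre graph_subset_fibre[OF \<eta>] fibB] by simp
next
  fix x e assume e: "e \<in> graph C A B \<eta> x \<inter> B x"
  then obtain \<xi> where x: "\<xi> \<in> A x" "e = \<xi> + hat_at \<eta> x \<xi>" using graphE by blast
  have "pA x e = \<xi>" unfolding x(2) by (rule pA_eq[OF x(1) hat_at_props(1)[OF \<eta> x(1)]])
  moreover have "pA x e = 0" using pA_eq[OF subspace_0[OF subspaceA], of e x] e by simp
  ultimately have "\<xi> = 0" by simp
  then show "e \<in> {0}" using x lin_on_zero[OF hat_at_lin[OF \<eta>] x(1)] by simp
next
  fix x e assume "e \<in> {0 :: 'v}"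
  then show "e \<in> graph C A B \<eta> x \<inter> B x"
    using graph_mem[OF subspace_0[OF subspaceA], of \<eta> x] lin_on_zero[OF hat_at_lin[OF \<eta>] subspace_0[OF subspaceA], of x]
      subspace_0[OF subspaceB, of x] by simp
qed

text \<open>The projection along B recovers X from the section, and it preserves smoothness.\<close>

lemma graph_section_decompose:
  assumes \<eta>: "\<eta> \<in> \<Omega> 2" and e: "e \<in> sub_sections M E (graph C A B \<eta>)"
  obtains X where "X \<in> \<Gamma>A" "e = X + hat \<eta> X"
proof (rule that)
  show "(\<lambda>x. pA x (e x)) \<in> \<Gamma>A" by (rule pA_section[OF E.sub_section_section[OF e]])
  show "e = (\<lambda>x. pA x (e x)) + hat \<eta> (\<lambda>x. pA x (e x))"
  proof
    fix x
    obtain \<xi> where x: "\<xi> \<in> A x" "e x = \<xi> + hat_at \<eta> x \<xi>" by (rule graphE[OF E.sub_section_mem[OF e]])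
    have "pA x (e x) = \<xi>" unfolding x(2) by (rule pA_eq[OF x(1) hat_at_props(1)[OF \<eta> x(1)]])
    then show "e x = ((\<lambda>x. pA x (e x)) + hat \<eta> (\<lambda>x. pA x (e x))) x" using x(2) by (simp add: hat_hat_at)
  qed
qed

lemma graph_inj:
  assumes \<eta>: "\<eta> \<in> \<Omega> 2" "\<eta>' \<in> \<Omega> 2" and g: "graph C A B \<eta> = graph C A B \<eta>'"
  shows "\<eta> = \<eta>'"
proof (rule form_eqI[OF \<eta>])
  fix x vs assume vs: "set vs \<subseteq> A x" "int (length vs) = 2"
  obtain u v where uv: "vs = [u, v]" using vs(2) by (auto simp: numeral_2_eq_2 length_Suc_conv)
  have A: "u \<in> A x" "v \<in> A x" using vs uv by simp_all
  have "u + hat_at \<eta> x u \<in> graph C A B \<eta>' x" using graph_mem[OF A(1), of \<eta>] unfolding g .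
  then obtain \<zeta> where z: "\<zeta> \<in> A x" "u + hat_at \<eta> x u = \<zeta> + hat_at \<eta>' x \<zeta>" by (rule graphE)
  note pu = hat_at_props[OF \<eta>(1) A(1)] and pz = hat_at_props[OF \<eta>(2) z(1)]
  have "u = \<zeta>" using pA_eq[OF A(1) pu(1)] pA_eq[OF z(1) pz(1)] z(2) by simp
  then have "hat_at \<eta> x u = hat_at \<eta>' x u" using z(2) by simp
  then show "\<eta> x vs = \<eta>' x vs"
    using pu(2)[OF A(2)] hat_at_props(2)[OF \<eta>(2) A] uv by simp
qed

text \<open>For u in A there is exactly one element of B that brings u into A', namely minus the
  component of u in B along A'. Pairing it with a second vector defines \<eta>; isotropy of A' is
  the skewness of \<eta>, and smoothness is that of the projection for the pair A', B.\<close>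

lemma graph_surj:
  assumes A': "almost_dirac_jacobi M C A'" and tr: "transverse C A' B"
  obtains \<eta> where "\<eta> \<in> \<Omega> 2" "graph C A B \<eta> = A'"
proof -
  interpret P: lagrangian_pair M C A' B by unfold_locales (rule A', rule B, rule tr)
  define \<beta> where "\<beta> x u = - P.pB x u" for x u
  have \<beta>: "\<beta> x u \<in> B x" "u + \<beta> x u \<in> A' x" if "u \<in> A x" for x u
    using P.proj_props[OF fibA[OF that]] subspace_neg[OF subspaceB, of "P.pB x u" x]
    by (simp_all add: \<beta>_def) (metis add_diff_cancel_right')
  define \<eta> where "\<eta> = form2 A (\<lambda>x u v. pairing C x (\<beta> x u) v)"
  have \<eta>: "\<eta> \<in> \<Omega> 2" unfolding \<eta>_def
  proof (rule form2_in_forms[OF subspaceA])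
    show "lin_on (A x) (pairing C x (\<beta> x u))" if "u \<in> A x" for x u
      using pairing_lin[OF fibB[OF \<beta>(1)[OF that]]] fibA unfolding lin_on_def by simp
    show "pairing C x (\<beta> x v) u = - pairing C x (\<beta> x u) v" if u: "u \<in> A x" and v: "v \<in> A x" for x u v
      using almost_dirac_isotropic[OF A' \<beta>(2)[OF u] \<beta>(2)[OF v]]
      unfolding graph_pairing[OF \<beta>(1)[OF u] u v \<beta>(1)[OF v]] by (simp add: eq_neg_iff_add_eq_0 add.commute)
    show "pairing C x (\<beta> x u) v \<in> fibre L x" if "u \<in> A x" "v \<in> A x" for x u v
      by (rule pairing_fibre[OF fibB[OF \<beta>(1)[OF that(1)]] fibA[OF that(2)]])
    show "(\<lambda>x. pairing C x (\<beta> x (X x)) (Y x)) \<in> \<Gamma>L" if X: "X \<in> \<Gamma>A" and Y: "Y \<in> \<Gamma>A" for X Y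
    proof -
      have "- (\<lambda>x. P.pB x (X x)) \<in> \<Gamma>"
        by (rule E.section_minus[OF \<Gamma>B_sec[OF P.pB_section[OF \<Gamma>A_sec[OF X]]]])
      from pair_sec_section[OF this \<Gamma>A_sec[OF Y]] show ?thesis
        unfolding pair_sec_def \<beta>_def by simp
    qed
  qed
  have hat: "hat_at \<eta> x u = \<beta> x u" if u: "u \<in> A x" for x u
  proof (rule B_eqI[OF hat_at_props(1)[OF \<eta> u] \<beta>(1)[OF u]])
    fix v assume v: "v \<in> A x"
    show "pairing C x (hat_at \<eta> x u) v = pairing C x (\<beta> x u) v"
      unfolding hat_at_props(2)[OF \<eta> u v] unfolding \<eta>_def by (rule form2_apply[of u A x v, OF u v])
  qed
  have "graph C A B \<eta> x = A' x" for x
  proof (intro set_eqI iffI)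
    fix e assume "e \<in> graph C A B \<eta> x"
    then obtain u where u: "u \<in> A x" "e = u + hat_at \<eta> x u" by (rule graphE)
    then show "e \<in> A' x" using hat[OF u(1)] \<beta>(2)[OF u(1)] by simp
  next
    fix e assume e: "e \<in> A' x"
    obtain a b where ab: "a \<in> A x" "b \<in> B x" "e = a + b" by (rule decompose[OF P.fibA[OF e]])
    \<comment> \<open>Since e lies in A' and a = e - b, the vector -b is the component of a in B
      along A'.\<close>
    have "P.pB x (e + - b) = - b" by (rule P.pB_eq[OF e subspace_neg[OF subspaceB ab(2)]])
    then have "\<beta> x a = b" unfolding \<beta>_def ab(3) by simp
    then show "e \<in> graph C A B \<eta> x" using graph_mem[OF ab(1), of \<eta>] hat[OF ab(1)] ab(3) by simp
  qed
  then have "graph C A B \<eta> = A'" by (rule ext)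
  with \<eta> show ?thesis by (rule that)
qed

lemma graph_dirac_iff:
  assumes \<eta>: "\<eta> \<in> \<Omega> 2"
  shows "dirac_jacobi M C (graph C A B \<eta>) \<longleftrightarrow>
    (\<forall>a\<in>\<Gamma>A. \<forall>b\<in>\<Gamma>A. \<forall>c\<in>\<Gamma>A. T3 (a + hat \<eta> a) (b + hat \<eta> b) (c + hat \<eta> c) = 0)"
  unfolding involutive_iff[OF graph_almost_dirac[OF \<eta>]]
proof (intro iffI ballI)
  fix a b c assume "\<forall>a\<in>sub_sections M E (graph C A B \<eta>). \<forall>b\<in>sub_sections M E (graph C A B \<eta>).
      \<forall>c\<in>sub_sections M E (graph C A B \<eta>). T3 a b c = 0" "a \<in> \<Gamma>A" "b \<in> \<Gamma>A" "c \<in> \<Gamma>A"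
  then show "T3 (a + hat \<eta> a) (b + hat \<eta> b) (c + hat \<eta> c) = 0" using graph_section[OF \<eta>] by simp
next
  fix a b c assume T: "\<forall>a\<in>\<Gamma>A. \<forall>b\<in>\<Gamma>A. \<forall>c\<in>\<Gamma>A. T3 (a + hat \<eta> a) (b + hat \<eta> b) (c + hat \<eta> c) = 0"
    and a: "a \<in> sub_sections M E (graph C A B \<eta>)" and b: "b \<in> sub_sections M E (graph C A B \<eta>)"
    and c: "c \<in> sub_sections M E (graph C A B \<eta>)"
  obtain X where X: "X \<in> \<Gamma>A" "a = X + hat \<eta> X" by (rule graph_section_decompose[OF \<eta> a])
  obtain Y where Y: "Y \<in> \<Gamma>A" "b = Y + hat \<eta> Y" by (rule graph_section_decompose[OF \<eta> b])
  obtain Z where Z: "Z \<in> \<Gamma>A" "c = Z + hat \<eta> Z" by (rule graph_section_decompose[OF \<eta> c])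
  show "T3 a b c = 0" unfolding X(2) Y(2) Z(2) using T X(1) Y(1) Z(1) by simp
qed

text \<open>Tensoriality holds for the sum of all orders in \<eta>, because the graph is Lagrangian
  for every two-form, involutive or not.\<close>

lemma T3_graph_cong:
  assumes \<eta>: "\<eta> \<in> \<Omega> 2" and "a \<in> \<Gamma>A" "b \<in> \<Gamma>A" "c \<in> \<Gamma>A" "a' \<in> \<Gamma>A" "b' \<in> \<Gamma>A" "c' \<in> \<Gamma>A"
    and "a x = a' x" "b x = b' x" "c x = c' x"
  shows "T3 (a + hat \<eta> a) (b + hat \<eta> b) (c + hat \<eta> c) x = T3 (a' + hat \<eta> a') (b' + hat \<eta> b') (c' + hat \<eta> c') x"
  by (rule T3_lagrangian_cong[OF graph_almost_dirac[OF \<eta>]])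
     (simp_all add: graph_section assms hat_hat_at)

lemma T3_graph_expand:
  assumes inv: "dirac_jacobi M C A" and \<eta>: "\<eta> \<in> \<Omega> 2" and X: "a \<in> \<Gamma>A" "b \<in> \<Gamma>A" "c \<in> \<Gamma>A"
  shows "T3 (a + hat \<eta> a) (b + hat \<eta> b) (c + hat \<eta> c) x = koszul C \<eta> [a, b, c] x +
    (T3 (hat \<eta> a) (hat \<eta> b) c + T3 (hat \<eta> a) b (hat \<eta> c) + T3 a (hat \<eta> b) (hat \<eta> c)) x +
    T3 (hat \<eta> a) (hat \<eta> b) (hat \<eta> c) x"
proof -
  note s = X[THEN \<Gamma>A_sec]
  note hs = hat_section[OF \<eta> X(1), THEN \<Gamma>B_sec] hat_section[OF \<eta> X(2), THEN \<Gamma>B_sec] hat_section[OF \<eta> X(3), THEN \<Gamma>B_sec]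
  have z: "T3 a b c = 0" using inv X unfolding involutive_iff[OF A] by simp
  note ts = E.section_add[OF s(2) hs(2)] E.section_add[OF s(3) hs(3)]
  show ?thesis
    unfolding first_order[OF inv \<eta> X, symmetric] T3_add(1)[OF s(1) hs(1) ts]
      T3_add(2)[OF s(2) hs(2) s(1) ts(2)] T3_add(2)[OF s(2) hs(2) hs(1) ts(2)]
      T3_add(3)[OF s(3) hs(3) s(1,2)] T3_add(3)[OF s(3) hs(3) s(1) hs(2)]
      T3_add(3)[OF s(3) hs(3) hs(1) s(2)] T3_add(3)[OF s(3) hs(3) hs(1,2)] z
    by simp
qed

end

section \<open>The Maurer--Cartan equation\<close>

context gj_pair begin

text \<open>\<open>d_form\<close> evaluates the Koszul formula on sections chosen separately at each point, so that the
  comparison with arbitrary sections needs that \<open>T3\<close> is tensorial on the graph.\<close>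

definition mc_form :: "('m \<Rightarrow> 'v list \<Rightarrow> 'l) \<Rightarrow> 'm \<Rightarrow> 'v list \<Rightarrow> 'l" where
  "mc_form \<eta> = m1 M C A \<eta> + (1/2) *\<^sub>R m2 gj 2 \<eta> \<eta> + (1/6) *\<^sub>R m3 M C A B 2 \<eta> \<eta> \<eta>"

lemma mc_form_apply:
  "mc_form \<eta> x vs = d_form M C A \<eta> x vs + (1/2) *\<^sub>R gj \<eta> \<eta> x vs -
     (1/6) *\<^sub>R sharp_apply M C A (upsilon C A B) \<eta> \<eta> \<eta> x vs"
  unfolding mc_form_def m1_def m2_def m3_def by (simp add: sgn_int_def)

text \<open>The sections belong to the conclusion because \<open>d_form\<close> selects them by
  choice at x; the other two terms are then evaluated on the same sections.\<close>

lemma mc_form_eval: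
  assumes inv: "dirac_jacobi M C A" and \<eta>: "\<eta> \<in> \<Omega> 2" and u: "u \<in> A x" "v \<in> A x" "w \<in> A x"
  obtains a b c where "a \<in> \<Gamma>A" "b \<in> \<Gamma>A" "c \<in> \<Gamma>A" "a x = u" "b x = v" "c x = w"
    "mc_form \<eta> x [u, v, w] = T3 (a + hat \<eta> a) (b + hat \<eta> b) (c + hat \<eta> c) x"
proof -
  define Xs where "Xs = (SOME Xs. set Xs \<subseteq> \<Gamma>A \<and> map (\<lambda>X. X x) Xs = [u, v, w])"
  have "set [u, v, w] \<subseteq> A x" using u by simp
  from someI_ex[OF E.sections_through_list[OF subA this]]
  have Xs: "set Xs \<subseteq> \<Gamma>A" "map (\<lambda>X. X x) Xs = [u, v, w]" unfolding Xs_def by simp_all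
  then obtain a b c where abc: "Xs = [a, b, c]" by (auto simp: map_eq_Cons_conv)
  have X: "a \<in> \<Gamma>A" "b \<in> \<Gamma>A" "c \<in> \<Gamma>A" and ev: "a x = u" "b x = v" "c x = w" using Xs abc by simp_all
  have d: "d_form M C A \<eta> x [u, v, w] = koszul C \<eta> [a, b, c] x"
    unfolding d_form_def Xs_def[symmetric] abc using u by simp
  have g: "gj \<eta> \<eta> x [u, v, w] = 2 *\<^sub>R second_order \<eta> a b c x"
    using gj_two_forms[OF \<eta> X, of x] ev by simp
  \<comment> \<open>The cubic term is stated for a family indexed by numbers.\<close>
  define Y where "Y i = (if i = 0 then a else if i = 1 then b else c)" for i :: nat
  have Y: "Y j \<in> \<Gamma>A" for j using X by (simp add: Y_def)
  from sharp_apply_eval[OF \<eta>, of Y x, OF Y]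
  have s: "sharp_apply M C A (upsilon C A B) \<eta> \<eta> \<eta> x [u, v, w] = - 6 *\<^sub>R T3 (hat \<eta> a) (hat \<eta> b) (hat \<eta> c) x"
    using ev by (simp add: Y_def)
  \<comment> \<open>The constants meet their counterparts: 1/2 the factor 2 of
    \<open>gj_two_forms\<close>, and -1/6 the factor -6 of \<open>sharp_apply_eval\<close>.\<close>
  have "mc_form \<eta> x [u, v, w] = T3 (a + hat \<eta> a) (b + hat \<eta> b) (c + hat \<eta> c) x"
    unfolding mc_form_apply d g s T3_graph_expand[OF inv \<eta> X] second_order_alt[OF \<eta> X] second_order_def by simp
  then show ?thesis using X ev by (intro that[of a b c])
qed

lemma mc_form_zero:
  assumes \<eta>: "\<eta> \<in> \<Omega> 2" and vs: "\<not> (length vs = 3 \<and> set vs \<subseteq> A x)"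
  shows "mc_form \<eta> x vs = 0"
proof -
  have "gj \<eta> \<eta> \<in> \<Omega> (2 + (2 - 1))" by (rule gj_form[OF \<eta> \<eta>])
  then have g: "gj \<eta> \<eta> x vs = 0" by (rule form_zero) (use vs in auto)
  have d: "d_form M C A \<eta> x vs = 0"
  proof (cases "set vs \<subseteq> A x")
    case True
    define Xs where "Xs = (SOME Xs. set Xs \<subseteq> \<Gamma>A \<and> map (\<lambda>X. X x) Xs = vs)"
    from someI_ex[OF E.sections_through_list[OF subA True]]
    have Xs: "set Xs \<subseteq> \<Gamma>A" "map (\<lambda>X. X x) Xs = vs" unfolding Xs_def by simp_all
    have "length Xs \<noteq> 3" using vs True Xs(2) by auto
    then have "koszul C \<eta> Xs x = 0" by (rule koszul_wrong_length[OF \<eta> Xs(1)])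
    then show ?thesis unfolding d_form_def Xs_def[symmetric] by simp
  qed (simp add: d_form_def)
  show ?thesis unfolding mc_form_apply g d sharp_apply_zero[OF \<eta> vs] by simp
qed

text \<open>From the equation to involutivity, vanishing is transferred from the sections selected
  at each point to the given ones. In the converse direction the selected sections are simply among
  those for which T3 vanishes, one point and one list at a time.\<close>

lemma maurer_cartan_iff:
  assumes inv: "dirac_jacobi M C A"
  shows "\<eta> \<in> maurer_cartan M C A B gj \<longleftrightarrow> \<eta> \<in> \<Omega> 2 \<and> dirac_jacobi M C (graph C A B \<eta>)"
proof (cases "\<eta> \<in> \<Omega> 2")
  case True
  have "mc_form \<eta> = 0 \<longleftrightarrow> (\<forall>a\<in>\<Gamma>A. \<forall>b\<in>\<Gamma>A. \<forall>c\<in>\<Gamma>A. T3 (a + hat \<eta> a) (b + hat \<eta> b) (c + hat \<eta> c) = 0)"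
  proof (intro iffI ballI)
    fix a b c assume z: "mc_form \<eta> = 0" and X: "a \<in> \<Gamma>A" "b \<in> \<Gamma>A" "c \<in> \<Gamma>A"
    show "T3 (a + hat \<eta> a) (b + hat \<eta> b) (c + hat \<eta> c) = 0"
    proof
      fix x
      obtain a' b' c' where Y: "a' \<in> \<Gamma>A" "b' \<in> \<Gamma>A" "c' \<in> \<Gamma>A" "a' x = a x" "b' x = b x" "c' x = c x"
        "mc_form \<eta> x [a x, b x, c x] = T3 (a' + hat \<eta> a') (b' + hat \<eta> b') (c' + hat \<eta> c') x"
        by (rule mc_form_eval[OF inv True \<Gamma>A_mem[OF X(1)] \<Gamma>A_mem[OF X(2)] \<Gamma>A_mem[OF X(3)]])
      have "T3 (a + hat \<eta> a) (b + hat \<eta> b) (c + hat \<eta> c) x = T3 (a' + hat \<eta> a') (b' + hat \<eta> b') (c' + hat \<eta> c') x"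
        by (rule T3_graph_cong[OF True X Y(1-3)]) (simp_all add: Y)
      then show "T3 (a + hat \<eta> a) (b + hat \<eta> b) (c + hat \<eta> c) x = 0 x" using Y(7) unfolding z by simp
    qed
  next
    assume T: "\<forall>a\<in>\<Gamma>A. \<forall>b\<in>\<Gamma>A. \<forall>c\<in>\<Gamma>A. T3 (a + hat \<eta> a) (b + hat \<eta> b) (c + hat \<eta> c) = 0"
    show "mc_form \<eta> = 0"
    proof (intro ext)
      fix x vs
      show "mc_form \<eta> x vs = 0 x vs"
      proof (cases "length vs = 3 \<and> set vs \<subseteq> A x")
        case vs: True
        then obtain u v w where e: "vs = [u, v, w]" by (auto simp: numeral_3_eq_3 length_Suc_conv)
        have m: "u \<in> A x" "v \<in> A x" "w \<in> A x" using vs e by simp_all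
        obtain a b c where Y: "a \<in> \<Gamma>A" "b \<in> \<Gamma>A" "c \<in> \<Gamma>A" "a x = u" "b x = v" "c x = w"
          "mc_form \<eta> x [u, v, w] = T3 (a + hat \<eta> a) (b + hat \<eta> b) (c + hat \<eta> c) x"
          by (rule mc_form_eval[OF inv True m])
        have "T3 (a + hat \<eta> a) (b + hat \<eta> b) (c + hat \<eta> c) = 0" using T Y(1-3) by simp
        then show ?thesis unfolding e Y(7) by simp
      next
        case False
        then show ?thesis using mc_form_zero[OF True] by simp
      qed
    qed
  qed
  then show ?thesis using True unfolding maurer_cartan_def mc_form_def[symmetric] graph_dirac_iff[OF True] by simp
next
  case False
  then show ?thesis unfolding maurer_cartan_def by simp
qed

end

theorem mainTheorem4:
  fixes M :: "('m::{t2_space,second_countable_topology}, 'e::euclidean_space) manifold"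
    and C :: "('m, 'v::real_vector, 'l::real_vector) courant_jacobi"
    and A B :: "'m \<Rightarrow> 'v set"
    and gj :: "('m \<Rightarrow> 'v list \<Rightarrow> 'l) \<Rightarrow> ('m \<Rightarrow> 'v list \<Rightarrow> 'l) \<Rightarrow> 'm \<Rightarrow> 'v list \<Rightarrow> 'l"
  assumes "smooth_manifold M"
    and "courant_jacobi_algebroid M C"
    and "dirac_jacobi M C A"
    and "almost_dirac_jacobi M C B"
    and "transverse C A B"
    and "is_gj_bracket M C A B gj"
  shows "bij_betw (graph C A B) (maurer_cartan M C A B gj)
           {A'. dirac_jacobi M C A' \<and> transverse C A' B}"
proof -
  have A: "almost_dirac_jacobi M C A" using assms(3) unfolding dirac_jacobi_def by (rule conjunct1)
  interpret gj_pair M C A B gj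
    by unfold_locales (fact assms A)+
  note mc = maurer_cartan_iff[OF assms(3)]
  show ?thesis
    unfolding bij_betw_def
  proof (intro conjI inj_onI set_eqI iffI)
    fix \<eta> \<eta>' assume "\<eta> \<in> maurer_cartan M C A B gj" "\<eta>' \<in> maurer_cartan M C A B gj"
      "graph C A B \<eta> = graph C A B \<eta>'"
    then show "\<eta> = \<eta>'" unfolding mc by (intro graph_inj) simp_all
  next
    fix A' assume "A' \<in> graph C A B ` maurer_cartan M C A B gj"
    then obtain \<eta> where "\<eta> \<in> maurer_cartan M C A B gj" "A' = graph C A B \<eta>" by blast
    then show "A' \<in> {A'. dirac_jacobi M C A' \<and> transverse C A' B}" unfolding mc by (simp add: graph_transverse)
  next
    fix A' assume "A' \<in> {A'. dirac_jacobi M C A' \<and> transverse C A' B}"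
    then have d: "dirac_jacobi M C A'" and t: "transverse C A' B" by simp_all
    have "almost_dirac_jacobi M C A'" using d unfolding dirac_jacobi_def by (rule conjunct1)
    then obtain \<eta> where e: "\<eta> \<in> \<Omega> 2" "graph C A B \<eta> = A'" using graph_surj[OF _ t] by blast
    then have "\<eta> \<in> maurer_cartan M C A B gj" unfolding mc using d by simp
    then show "A' \<in> graph C A B ` maurer_cartan M C A B gj" using e(2) by blast
  qed
qed

end
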